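(* Let $\Omega\in\mathbb R$, $\Omega\neq0$. Let $\mathbf u(\mathbf x,t)\in C^{2,1}_{\mathbf x,t}(\mathbb R^3\times(0,\infty))\cap C(\mathbb R^3\times[0,\infty))$ and $p(\mathbf x,t)\in C^1_{\mathbf x}(\mathbb R^3\times(0,\infty))$ be functions, $\mathbf L$-periodic in $\mathbf x$ ($\mathbf u$ being $\mathbb R^3$-valued and $p$ real-valued), that form a solution of $$\frac{\partial\mathbf u}{\partial t}-\Delta\mathbf u+(\mathbf u\cdot\nabla)\mathbf u+\nabla p+\Omega\,\mathbf e_3\times\mathbf u=0,\qquad {\rm div}\,\mathbf u=0$$ on $\mathbb R^3\times(0,\infty)$. Write $u(t)=\mathbf u(\cdot,t)$ and $\mathbf U(t)=\frac1{L_1L_2L_3}\int_{\mathbb T_{\mathbf L}}\mathbf u(\mathbf x,t)\,d\mathbf x$ for $t\ge0$. Then there exist $\mathcal V$-valued SS-polynomials $\mathcal Q_n(t)$, $n\in\mathbb N$, such that $$u(t)-\mathbf U(t)\sim\sum_{n=1}^\infty\mathcal Q_n(t)e^{-\mu_nt}\quad\text{in }G_{\alpha,\sigma},\ \text{ for all }\alpha,\sigma>0.$$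
   Context: Let $\mathbf L=(L_1,L_2,L_3)$ with $L_j>0$ and $\max\{L_1,L_2,L_3\}=2\pi$; $f$ on $\mathbb R^3$ is $\mathbf L$-periodic if $f(\mathbf x+L_j\mathbf e_j)=f(\mathbf x)$ for $j=1,2,3$; such functions are regarded as functions on $\mathbb T_{\mathbf L}=(\mathbb R/L_1\mathbb Z)\times(\mathbb R/L_2\mathbb Z)\times(\mathbb R/L_3\mathbb Z)$. $C^{2,1}_{\mathbf x,t}$ is the class of continuous functions $f(\mathbf x,t)$ with continuous partial derivatives $\partial f/\partial x_k$, $\partial^2f/\partial x_k\partial x_j$, $\partial f/\partial t$; $C^1_{\mathbf x}$ similarly means continuous with continuous first-order partial derivatives in $\mathbf x$. For $\mathbf k\in\mathbb Z^3$ let $\check{\mathbf k}=2\pi(k_1/L_1,k_2/L_2,k_3/L_3)$; for $\mathbf k\ne\mathbf 0$ let $X_{\mathbf k}=\{\mathbf z\in\mathbb C^3:\mathbf z\cdot\check{\mathbf k}=0\}$, where $\mathbf x\cdot\mathbf y=\mathbf x^{\rm T}\mathbf y$. $\sum'$ is the sum over $\mathbf k\in\mathbb Z^3\setminus\{\mathbf 0\}$. $\mathcal V$ is the real vector space of all $u=\sum'\widehat{\mathbf u}_{\mathbf k}e^{i\check{\mathbf k}\cdot\mathbf x}$ with $\widehat{\mathbf u}_{\mathbf k}\in X_{\mathbf k}$, $\widehat{\mathbf u}_{-\mathbf k}=\overline{\widehat{\mathbf u}_{\mathbf k}}$ and only finitely many nonzero coefficients; $H$ is its closure in $L^2(\mathbb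 T_{\mathbf L})^3$, with $L^2$ norm $|\cdot|$. For $\alpha,\sigma\ge0$, $|u|_{\alpha,\sigma}=\big|\sum'|\check{\mathbf k}|^{2\alpha}e^{\sigma|\check{\mathbf k}|}\widehat{\mathbf u}_{\mathbf k}e^{i\check{\mathbf k}\cdot\mathbf x}\big|$ and $G_{\alpha,\sigma}=\{u\in H:|u|_{\alpha,\sigma}<\infty\}$, normed by $|\cdot|_{\alpha,\sigma}$. $(\mu_n)_{n=1}^\infty$ is the strictly increasing enumeration of the set of all finite sums $\alpha_1+\dots+\alpha_n$, $n\ge1$, with each $\alpha_j\in\{|\check{\mathbf k}|^2:\mathbf k\in\mathbb Z^3\setminus\{\mathbf 0\}\}$. For a vector space $X$ over $\mathbb R$ or $\mathbb C$, an $X$-valued SS-polynomial is a function $\mathbb R\to X$ that is a finite sum of functions of the form $t^m\cos(a\cos(\omega t)+b\sin(\omega t)+ct+d)Z$ and $t^m\sin(a\cos(\omega t)+b\sin(\omega t)+ct+d)Z$, with $m\in\mathbb N\cup\{0\}$, $a,b,c,d,\omega\in\mathbb R$, $Z\in X$. For $f:[T,\infty)\to X$ (some $T\ge0$, $X$ a normed space), $f(t)\sim\sum_{n=1}^\infty f_n(t)e^{-\mu_nt}$ in $X$ means: for every $N\ge1$, $\|f(t)-\sum_{n=1}^Nf_n(t)e^{-\mu_nt}\|_X=\mathcal O(e^{-(\mu_N+\varepsilon_N)t})$ as $t\to\infty$ for some $\varepsilon_N>0$. *)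

theory Defs
  imports "HOL-Analysis.Analysis" "HOL-Library.Landau_Symbols"
begin

text \<open>Space-time functions are curried with time first, so that \<open>u t\<close> is the function
  \<open>u(., t)\<close> of the space variable.\<close>

definition periodic :: "real^3 \<Rightarrow> (real^3 \<Rightarrow> 'b) \<Rightarrow> bool" where
  "periodic L f \<longleftrightarrow> (\<forall>x j. f (x + (L $ j) *\<^sub>R axis j 1) = f x)"

text \<open>Integrals over the torus are taken over the period cell; its boundary is a null set.\<close>

definition cell :: "real^3 \<Rightarrow> (real^3) measure" where
  "cell L = lebesgue_on (cbox 0 L)"

definition average :: "real^3 \<Rightarrow> (real^3 \<Rightarrow> 'b::euclidean_space) \<Rightarrow> 'b" where
  "average L f = (1 / (L $ 1 * L $ 2 * L $ 3)) *\<^sub>R (LINT x|cell L. f x)"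

text \<open>Elements of \<open>L\<^sup>2\<close> are represented by functions instead of classes modulo null sets;
  \<open>L2\<close> and every set and norm derived from it below are invariant under changing the
  representative.\<close>

definition L2 :: "real^3 \<Rightarrow> (real^3 \<Rightarrow> 'b::euclidean_space) set" where
  "L2 L = {f. periodic L f \<and> f \<in> borel_measurable lebesgue \<and>
              integrable (cell L) (\<lambda>x. (norm (f x))\<^sup>2)}"

definition L2norm :: "real^3 \<Rightarrow> (real^3 \<Rightarrow> 'b::euclidean_space) \<Rightarrow> real" where
  "L2norm L f = sqrt (LINT x|cell L. (norm (f x))\<^sup>2)"

definition wave :: "real^3 \<Rightarrow> int^3 \<Rightarrow> real^3" where
  "wave L k = (\<chi> j. 2 * pi * of_int (k $ j) / L $ j)"

text \<open>The product of \<open>z\<close> with the wave vector is bilinear, without complex conjugation.\<close>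

definition Xspace :: "real^3 \<Rightarrow> int^3 \<Rightarrow> (complex^3) set" where
  "Xspace L k = {z. (\<Sum>j\<in>UNIV. z $ j * of_real (wave L k $ j)) = 0}"

definition trig_sum :: "real^3 \<Rightarrow> (int^3 \<Rightarrow> complex^3) \<Rightarrow> (int^3) set \<Rightarrow> real^3 \<Rightarrow> complex^3" where
  "trig_sum L c F x = (\<Sum>k\<in>F. cis (wave L k \<bullet> x) *s c k)"

definition complexify :: "real^3 \<Rightarrow> complex^3" where
  "complexify v = (\<chi> j. of_real (v $ j))"

text \<open>The reality condition on the coefficients makes the trigonometric sum real, so \<open>V\<close>
  consists of functions with values in \<open>real^3\<close>.\<close>

definition Vspace :: "real^3 \<Rightarrow> (real^3 \<Rightarrow> real^3) set" where
  "Vspace L = {u. \<exists>c. finite {k. k \<noteq> 0 \<and> c k \<noteq> 0} \<and>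
      (\<forall>k. k \<noteq> 0 \<longrightarrow> c k \<in> Xspace L k \<and> c (- k) = (\<chi> j. cnj (c k $ j))) \<and>
      (\<forall>x. complexify (u x) = trig_sum L c {k. k \<noteq> 0 \<and> c k \<noteq> 0} x)}"

definition Hspace :: "real^3 \<Rightarrow> (real^3 \<Rightarrow> real^3) set" where
  "Hspace L = {u \<in> L2 L. \<forall>e>0. \<exists>v\<in>Vspace L. L2norm L (\<lambda>x. u x - v x) < e}"

definition fourier_coeff :: "real^3 \<Rightarrow> (real^3 \<Rightarrow> real^3) \<Rightarrow> int^3 \<Rightarrow> complex^3" where
  "fourier_coeff L u k = average L (\<lambda>x. cis (- (wave L k \<bullet> x)) *s complexify (u x))"

text \<open>Unconditional convergence in \<open>L\<^sup>2\<close> of the Fourier series over the nonzero wave vectors.\<close>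

definition has_L2_sum :: "real^3 \<Rightarrow> (int^3 \<Rightarrow> complex^3) \<Rightarrow> (real^3 \<Rightarrow> complex^3) \<Rightarrow> bool" where
  "has_L2_sum L c g \<longleftrightarrow> g \<in> L2 L \<and>
     ((\<lambda>F. L2norm L (\<lambda>x. g x - trig_sum L c F x)) \<longlongrightarrow> 0) (finite_subsets_at_top (- {0}))"

definition gevrey_coeff ::
  "real^3 \<Rightarrow> real \<Rightarrow> real \<Rightarrow> (real^3 \<Rightarrow> real^3) \<Rightarrow> int^3 \<Rightarrow> complex^3" where
  "gevrey_coeff L \<alpha> \<sigma> u k =
     (norm (wave L k) powr (2 * \<alpha>) * exp (\<sigma> * norm (wave L k))) *\<^sub>R fourier_coeff L u k"

text \<open>Finiteness of the Gevrey norm means that the weighted series has a sum in \<open>L\<^sup>2\<close>; the norm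
  is then the \<open>L\<^sup>2\<close> norm of that sum, which is unique up to null sets.\<close>

definition Gspace :: "real^3 \<Rightarrow> real \<Rightarrow> real \<Rightarrow> (real^3 \<Rightarrow> real^3) set" where
  "Gspace L \<alpha> \<sigma> = {u \<in> Hspace L. \<exists>g. has_L2_sum L (gevrey_coeff L \<alpha> \<sigma> u) g}"

definition Gnorm :: "real^3 \<Rightarrow> real \<Rightarrow> real \<Rightarrow> (real^3 \<Rightarrow> real^3) \<Rightarrow> real" where
  "Gnorm L \<alpha> \<sigma> u = (THE r. \<exists>g. has_L2_sum L (gevrey_coeff L \<alpha> \<sigma> u) g \<and> r = L2norm L g)"

definition spectrum_sums :: "real^3 \<Rightarrow> real set" where
  "spectrum_sums L = {\<Sum>j=1..n. a j | n a. (n::nat) \<ge> 1 \<and>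
      (\<forall>j\<in>{1..n}. a j \<in> {(norm (wave L k))\<^sup>2 | k. k \<noteq> 0})}"

text \<open>Sequences start at index 1; the value at 0 is irrelevant.\<close>

definition strict_enumeration :: "(nat \<Rightarrow> real) \<Rightarrow> real set \<Rightarrow> bool" where
  "strict_enumeration \<mu> S \<longleftrightarrow> strict_mono_on {1..} \<mu> \<and> \<mu> ` {1..} = S"

text \<open>SS-polynomials and expansions with values in a vector space \<open>X\<close> of functions, on which
  the vector space operations are pointwise.\<close>

definition SS_polynomial :: "('a \<Rightarrow> 'b::real_vector) set \<Rightarrow> (real \<Rightarrow> 'a \<Rightarrow> 'b) \<Rightarrow> bool" where
  "SS_polynomial X Q \<longleftrightarrow>
     (\<exists>(M::nat) (m :: nat \<Rightarrow> nat) a b c d \<omega> trig Z.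
        (\<forall>i<M. trig i \<in> {cos, sin} \<and> Z i \<in> X) \<and>
        (\<forall>t x. Q t x = (\<Sum>i<M.
           (t ^ m i * trig i (a i * cos (\<omega> i * t) + b i * sin (\<omega> i * t) + c i * t + d i))
             *\<^sub>R Z i x)))"

definition asymptotic_expansion ::
  "('a \<Rightarrow> 'b::real_vector) set \<Rightarrow> (('a \<Rightarrow> 'b) \<Rightarrow> real) \<Rightarrow> (nat \<Rightarrow> real) \<Rightarrow>
     (real \<Rightarrow> 'a \<Rightarrow> 'b) \<Rightarrow> (nat \<Rightarrow> real \<Rightarrow> 'a \<Rightarrow> 'b) \<Rightarrow> bool" where
  "asymptotic_expansion X nrm \<mu> f q \<longleftrightarrow>
     (\<exists>T\<ge>0. \<forall>t\<ge>T. f t \<in> X \<and> (\<forall>n\<ge>1. q n t \<in> X)) \<and>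
     (\<forall>N\<ge>1. \<exists>\<epsilon>>0.
        (\<lambda>t. nrm (\<lambda>x. f t x - (\<Sum>n=1..N. exp (- \<mu> n * t) *\<^sub>R q n t x)))
          \<in> O[at_top](\<lambda>t. exp (- (\<mu> N + \<epsilon>) * t)))"

definition dx :: "3 \<Rightarrow> (real^3 \<Rightarrow> 'b::real_normed_vector) \<Rightarrow> real^3 \<Rightarrow> 'b" where
  "dx k f x = vector_derivative (\<lambda>s. f (x + s *\<^sub>R axis k 1)) (at 0)"

definition dt :: "(real \<Rightarrow> real^3 \<Rightarrow> 'b::real_normed_vector) \<Rightarrow> real \<Rightarrow> real^3 \<Rightarrow> 'b" where
  "dt f t x = vector_derivative (\<lambda>s. f s x) (at t)"

text \<open>\<open>C1_x\<close> and \<open>C21\<close> are the classes on all of space for times in \<open>(0, \<infinity>)\<close>; the continuity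
  required is joint continuity in time and space.\<close>

definition C1_x :: "(real \<Rightarrow> real^3 \<Rightarrow> 'b::real_normed_vector) \<Rightarrow> bool" where
  "C1_x f \<longleftrightarrow> continuous_on ({0<..} \<times> UNIV) (\<lambda>(t, x). f t x) \<and>
     (\<forall>k. (\<forall>t>0. \<forall>x. (\<lambda>s. f t (x + s *\<^sub>R axis k 1)) differentiable (at 0)) \<and>
          continuous_on ({0<..} \<times> UNIV) (\<lambda>(t, x). dx k (f t) x))"

definition C21 :: "(real \<Rightarrow> real^3 \<Rightarrow> 'b::real_normed_vector) \<Rightarrow> bool" where
  "C21 f \<longleftrightarrow> C1_x f \<and> (\<forall>k. C1_x (\<lambda>t. dx k (f t))) \<and>
     (\<forall>t>0. \<forall>x. (\<lambda>s. f s x) differentiable (at t)) \<and>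
     continuous_on ({0<..} \<times> UNIV) (\<lambda>(t, x). dt f t x)"

definition laplacian :: "(real^3 \<Rightarrow> 'b::real_normed_vector) \<Rightarrow> real^3 \<Rightarrow> 'b" where
  "laplacian f x = (\<Sum>j\<in>UNIV. dx j (dx j f) x)"

definition convection :: "(real^3 \<Rightarrow> real^3) \<Rightarrow> (real^3 \<Rightarrow> real^3) \<Rightarrow> real^3 \<Rightarrow> real^3" where
  "convection v w x = (\<Sum>j\<in>UNIV. (v x $ j) *\<^sub>R dx j w x)"

definition grad :: "(real^3 \<Rightarrow> real) \<Rightarrow> real^3 \<Rightarrow> real^3" where
  "grad p x = (\<chi> j. dx j p x)"

definition divergence :: "(real^3 \<Rightarrow> real^3) \<Rightarrow> real^3 \<Rightarrow> real" where
  "divergence v x = (\<Sum>j\<in>UNIV. dx j v x $ j)"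

definition rotating_NSE ::
  "real \<Rightarrow> (real \<Rightarrow> real^3 \<Rightarrow> real^3) \<Rightarrow> (real \<Rightarrow> real^3 \<Rightarrow> real) \<Rightarrow> bool" where
  "rotating_NSE \<Omega> u p \<longleftrightarrow> (\<forall>t>0. \<forall>x.
     dt u t x - laplacian (u t) x + convection (u t) (u t) x + grad (p t) x
       + \<Omega> *\<^sub>R cross3 (axis 3 1) (u t x) = 0 \<and>
     divergence (u t) x = 0)"

end

theory Submission
  imports Defs
begin

text \<open>The mean flow \<open>U\<close> solves \<open>U' = - \<Omega> e\<^sub>3 \<times> U\<close>, hence it rotates with frequency \<open>\<Omega>\<close>.
  Passing to the frame moving with it multiplies the Fourier coefficient of wave vector \<open>\<kappa>\<close> by
  \<open>cis \<theta>\<close> with \<open>\<theta>' = U \<bullet> \<kappa>\<close>, and \<open>\<theta>\<close> is a combination of \<open>cos (\<Omega> t)\<close>, \<open>sin (\<Omega> t)\<close> and \<open>t\<close>: this is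
  the source of the phases of SS-polynomials.  On divergence-free coefficients the projected Coriolis
  term is an infinitesimal rotation about \<open>\<kappa>\<close>, which a further rotation removes.  The new
  coefficients \<open>q\<close> solve \<open>q' = - |\<kappa>|\<^sup>2 q - N\<close>, where \<open>N\<close> is quadratic and the coefficients of \<open>N\<close>
  are trigonometric in time.

  The energy identity makes \<open>|\<nabla>u|\<close> small at some time.  From then on the flow is small in the
  critical space of Lei and Lin, in which a quadratic inequality for an exponentially weighted norm
  shows that \<open>q\<close> decays like \<open>exp (- |\<kappa>| (t - t\<^sub>0) / 2)\<close>, faster than every Gevrey weight.  Duhamel's
  formula then yields the expansion of \<open>q\<close> one exponent \<open>\<mu>\<^sub>n\<close> at a time, with finitely supported
  coefficients that are exponential polynomials, and undoing the two transformations gives the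
  SS-polynomials \<open>Q\<^sub>n\<close>.\<close>

section \<open>Exponential polynomials and linear equations\<close>

text \<open>The initial data may be large, so smallness can only come from the energy. The norm made
  small is the sum of |q k| / |k|: it is invariant under the scaling of the equations; it is bounded
  by the L2 norm of the gradient, because the sum of 1 / |k|^4 converges in dimension three; and its
  weight 1 / |k| cancels exactly the derivative lost in the nonlinearity. The phase \<theta> is
  linear in the wave vector. In an interaction m + (k - m) = k the phases of the two factors
  multiply to the phase of the result, so they drop out of the equations for q, whose coefficients
  involve only cos and sin of fixed multiples of t. Linear equations with forcing in
  \<open>exp_poly\<close> have solutions in \<open>exp_poly\<close>, which closes the recursion. The
  nested phases of SS-polynomials never enter it and return only when the transformations are
  undone. The coefficients produced by the recursion are not known to satisfy the reality condition.
  Taking real parts at the end repairs this without disturbing the expansion, because the flow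
  itself is real.\<close>

inductive_set exp_poly :: "(real \<Rightarrow> complex) set" where
  exp_poly_base: "(\<lambda>t. c * of_real t ^ m * cis (\<theta> * t)) \<in> exp_poly"
| exp_poly_add: "f \<in> exp_poly \<Longrightarrow> g \<in> exp_poly \<Longrightarrow> (\<lambda>t. f t + g t) \<in> exp_poly"

lemma exp_poly_const: "(\<lambda>t. c) \<in> exp_poly"
  using exp_poly_base[of c 0 0] by simp

lemma exp_poly_cis: "(\<lambda>t. cis (\<theta> * t)) \<in> exp_poly"
  using exp_poly_base[of 1 0 \<theta>] by simp

lemma exp_poly_cmult: "f \<in> exp_poly \<Longrightarrow> (\<lambda>t. a * f t) \<in> exp_poly"
proof (induction rule: exp_poly.induct)
  case (exp_poly_base c m \<theta>)
  show ?case using exp_poly.exp_poly_base[of "a*c" m \<theta>] by (simp add: mult.assoc)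
next
  case (exp_poly_add f g)
  then show ?case using exp_poly.exp_poly_add by (simp add: distrib_left)
qed

lemma exp_poly_mult:
  assumes "f \<in> exp_poly" "g \<in> exp_poly"
  shows "(\<lambda>t. f t * g t) \<in> exp_poly"
  using assms(1)
proof (induction rule: exp_poly.induct)
  case (exp_poly_base c m \<theta>)
  show ?case
    using assms(2)
  proof (induction rule: exp_poly.induct)
    case (exp_poly_base d n \<eta>)
    have "(\<lambda>t. c * of_real t ^ m * cis (\<theta> * t) * (d * of_real t ^ n * cis (\<eta> * t))) =
      (\<lambda>t. (c*d) * of_real t ^ (m+n) * cis ((\<theta>+\<eta>) * t))"
      by (simp add: fun_eq_iff power_add distrib_right flip: cis_mult)
    then show ?case using exp_poly.exp_poly_base[of "c*d" "m+n" "\<theta>+\<eta>"] by simp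
  next
    case (exp_poly_add f g)
    then show ?case using exp_poly.exp_poly_add by (simp add: distrib_left)
  qed
next
  case (exp_poly_add f g)
  then show ?case using exp_poly.exp_poly_add by (simp add: distrib_right)
qed

lemma exp_poly_uminus: "f \<in> exp_poly \<Longrightarrow> (\<lambda>t. - f t) \<in> exp_poly"
  using exp_poly_cmult[of f "-1"] by simp

lemma exp_poly_sum: "(\<And>a. a \<in> A \<Longrightarrow> f a \<in> exp_poly) \<Longrightarrow> (\<lambda>t. \<Sum>a\<in>A. f a t) \<in> exp_poly"
proof (induction A rule: infinite_finite_induct)
  case (insert x F)
  then show ?case using exp_poly_add[of "f x" "\<lambda>t. \<Sum>a\<in>F. f a t"] by simp
qed (auto simp: exp_poly_const)

lemma exp_poly_cos: "(\<lambda>t. of_real (cos (\<theta> * t))) \<in> exp_poly"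
proof -
  have "(\<lambda>t. of_real (cos (\<theta> * t)) :: complex) = (\<lambda>t. (1/2) * cis (\<theta> * t) + (1/2) * cis ((-\<theta>) * t))"
    by (auto simp: fun_eq_iff complex_eq_iff)
  then show ?thesis using exp_poly_add[OF exp_poly_cmult[OF exp_poly_cis[of \<theta>], of "1/2"]
      exp_poly_cmult[OF exp_poly_cis[of "-\<theta>"], of "1/2"]] by simp
qed

lemma exp_poly_sin: "(\<lambda>t. of_real (sin (\<theta> * t))) \<in> exp_poly"
proof -
  have "(\<lambda>t. of_real (sin (\<theta> * t)) :: complex) = (\<lambda>t. (-\<i>/2) * cis (\<theta> * t) + (\<i>/2) * cis ((-\<theta>) * t))"
    by (auto simp: fun_eq_iff complex_eq_iff)
  then show ?thesis using exp_poly_add[OF exp_poly_cmult[OF exp_poly_cis[of \<theta>], of "-\<i>/2"]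
      exp_poly_cmult[OF exp_poly_cis[of "-\<theta>"], of "\<i>/2"]] by simp
qed

lemma cis_linear_derivative:
  "((\<lambda>t. cis (\<theta> * t)) has_vector_derivative (\<i> * of_real \<theta> * cis (\<theta> * t))) (at t within S)"
proof -
  have "((\<lambda>z. exp (\<i> * of_real \<theta> * z)) has_field_derivative (\<i> * of_real \<theta> * exp (\<i> * of_real \<theta> * of_real t)))
      (at (of_real t))"
    by (auto intro!: derivative_eq_intros)
  from has_vector_derivative_real_field[OF this] show ?thesis
    unfolding cis_conv_exp by (simp add: mult.assoc has_vector_derivative_at_within)
qed

lemma of_real_power_derivative:
  "((\<lambda>t. of_real t ^ m :: complex) has_vector_derivative (of_nat m * of_real t ^ (m - 1))) (at t)"
proof -
  have "((\<lambda>z::complex. z ^ m) has_field_derivative (of_nat m * of_real t ^ (m - 1))) (at (of_real t))"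
    by (auto intro!: derivative_eq_intros)
  from has_vector_derivative_real_field[OF this] show ?thesis .
qed

text \<open>With z = \<beta> + i \<theta>, the ansatz -(c / z) t^m cis (\<theta> t) leaves an error
  of degree m - 1, which the induction hypothesis removes. In the resonant case z = 0 both \<beta>
  and \<theta> vanish, since they are real; the equation is then a plain integration, and the degree
  rises by one.\<close>

lemma exp_poly_solve_base:
  "\<exists>P\<in>exp_poly. \<forall>t. (P has_vector_derivative (- of_real \<beta> * P t - c * of_real t ^ m * cis (\<theta> * t))) (at t)"
proof (induction m arbitrary: c)
  case 0
  show ?case
  proof (cases "of_real \<beta> + \<i> * of_real \<theta> = 0")
    case True
    then have 1: "\<beta> = 0" "\<theta> = 0" by (auto simp: complex_eq_iff)
    have "((\<lambda>t. -c * of_real t ^ 1 * cis (0*t)) has_vector_derivative (- c)) (at t)" for t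
      by (auto intro!: derivative_eq_intros)
    then show ?thesis using 1 by (intro bexI[OF _ exp_poly_base[of "-c" 1 0]]) auto
  next
    case False
    define z where "z = of_real \<beta> + \<i> * of_real \<theta>"
    have z: "z \<noteq> 0" using False z_def by simp
    have "((\<lambda>t. -(c/z) * of_real t ^ 0 * cis (\<theta>*t)) has_vector_derivative
        (-(c/z) * (\<i> * of_real \<theta> * cis (\<theta>*t)))) (at t)" for t
      by (auto intro!: derivative_eq_intros cis_linear_derivative)
    moreover have "-(c/z) * (\<i> * of_real \<theta> * cis (\<theta>*t)) = - of_real \<beta> * (-(c/z) * of_real t ^ 0 * cis (\<theta>*t))
        - c * of_real t ^ 0 * cis (\<theta>*t)" for t
    proof -
      obtain a where a: "a = c / z" by simp
      have "c = a * (of_real \<beta> + \<i> * of_real \<theta>)" using z by (simp add: a flip: z_def)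
      then show ?thesis unfolding a[symmetric] by (simp only: algebra_simps power_0 mult_1_right)
          (simp add: algebra_simps)
    qed
    ultimately show ?thesis by (intro bexI[OF _ exp_poly_base[of "-(c/z)" 0 \<theta>]]) simp
  qed
next
  case (Suc m)
  show ?case
  proof (cases "of_real \<beta> + \<i> * of_real \<theta> = 0")
    case True
    then have 1: "\<beta> = 0" "\<theta> = 0" by (auto simp: complex_eq_iff)
    have "((\<lambda>t. -(c/(2 + of_nat m)) * of_real t ^ Suc (Suc m) * cis (0*t)) has_vector_derivative
        (- c * of_real t ^ Suc m)) (at t)" for t
    proof -
      have 2: "(2 + of_nat m :: complex) \<noteq> 0" by (metis of_nat_Suc of_nat_neq_0 add.assoc one_add_one)
      have "((\<lambda>t. -(c/(2 + of_nat m)) * of_real t ^ Suc (Suc m)) has_vector_derivative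
         (-(c/(2 + of_nat m)) * (of_nat (Suc (Suc m)) * of_real t ^ Suc m))) (at t)"
        using has_vector_derivative_mult_right[OF of_real_power_derivative[of "Suc (Suc m)" t], of
            "-(c/(2 + of_nat m))"]
        by simp
      moreover have "-(c/(2 + of_nat m)) * (of_nat (Suc (Suc m)) * of_real t ^ Suc m) = -c * of_real t ^ Suc m"
        using 2 by (simp add: field_simps)
      ultimately show ?thesis by simp
    qed
    then show ?thesis using 1 by (intro bexI[OF _ exp_poly_base[of "-(c/(2 + of_nat m))" "Suc (Suc m)" 0]]) auto
  next
    case False
    define z where "z = of_real \<beta> + \<i> * of_real \<theta>"
    have z: "z \<noteq> 0" using False z_def by simp
    obtain P where P: "P \<in> exp_poly" "\<And>t. (P has_vector_derivative
        (- of_real \<beta> * P t - (-(c/z) * of_nat (Suc m)) * of_real t ^ m * cis (\<theta> * t))) (at t)"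
      using Suc.IH[of "-(c/z) * of_nat (Suc m)"] by auto
    have d: "((\<lambda>t. -(c/z) * of_real t ^ Suc m * cis (\<theta>*t) + P t) has_vector_derivative
      ((-(c/z) * (of_nat (Suc m) * of_real t ^ m)) * cis (\<theta>*t)
          + -(c/z) * of_real t ^ Suc m * (\<i> * of_real \<theta> * cis (\<theta>*t))
       + (- of_real \<beta> * P t - (-(c/z) * of_nat (Suc m)) * of_real t ^ m * cis (\<theta> * t)))) (at t)" for t
    proof -
      note 1 = has_vector_derivative_mult[OF has_vector_derivative_mult_right[OF
          of_real_power_derivative[of "Suc m" t], of "-(c/z)"]
         cis_linear_derivative[of \<theta> t UNIV]]
      show ?thesis using has_vector_derivative_add[OF 1 P(2)[of t]] by (simp add: algebra_simps)
    qed
    have eq: "(-(c/z) * (of_nat (Suc m) * of_real t ^ m)) * cis (\<theta>*t)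
        + -(c/z) * of_real t ^ Suc m * (\<i> * of_real \<theta> * cis (\<theta>*t))
       + (- of_real \<beta> * P t - (-(c/z) * of_nat (Suc m)) * of_real t ^ m * cis (\<theta> * t))
      = - of_real \<beta> * (-(c/z) * of_real t ^ Suc m * cis (\<theta>*t) + P t)
          - c * of_real t ^ Suc m * cis (\<theta> * t)" for t
    proof -
      obtain a where a: "a = c / z" by simp
      have "c = a * (of_real \<beta> + \<i> * of_real \<theta>)" using z by (simp add: a flip: z_def)
      then show ?thesis unfolding a[symmetric] by (simp only:) (simp add: algebra_simps)
    qed
    show ?thesis
      by (rule bexI[OF _ exp_poly_add[OF exp_poly_base[of "-(c/z)" "Suc m" \<theta>] P(1)]]) (use d eq in auto)
  qed
qed

lemma exp_poly_solve:
  assumes "g \<in> exp_poly"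
  shows "\<exists>P\<in>exp_poly. \<forall>t. (P has_vector_derivative (- of_real \<beta> * P t - g t)) (at t)"
  using assms
proof (induction rule: exp_poly.induct)
  case (exp_poly_base c m \<theta>)
  then show ?case by (rule exp_poly_solve_base)
next
  case (exp_poly_add f g)
  then obtain P Q where P: "P \<in> exp_poly" "\<And>t. (P has_vector_derivative (- of_real \<beta> * P t - f t)) (at t)"
    and Q: "Q \<in> exp_poly" "\<And>t. (Q has_vector_derivative (- of_real \<beta> * Q t - g t)) (at t)" by auto
  have "((\<lambda>t. P t + Q t) has_vector_derivative (- of_real \<beta> * (P t + Q t) - (f t + g t))) (at t)" for t
    using has_vector_derivative_add[OF P(2)[of t] Q(2)[of t]] by (simp add: algebra_simps)
  then show ?case
    using exp_poly.exp_poly_add[OF P(1) Q(1)] by blast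
qed

lemma power_le_exp_growth:
  fixes \<eta> :: real assumes "\<eta> > 0"
  shows "\<exists>C\<ge>0. \<forall>t\<ge>0. t ^ m \<le> C * exp (\<eta> * t)"
proof (intro exI conjI allI impI)
  show "0 \<le> fact m / \<eta> ^ m" using assms by simp
  fix t :: real assume t: "t \<ge> 0"
  have "(\<eta> * t) ^ m / fact m \<le> exp (\<eta> * t)"
  proof -
    have "(\<Sum>i\<in>{m}. inverse (fact i) *\<^sub>R (\<eta> * t) ^ i) \<le> (\<Sum>i. inverse (fact i) *\<^sub>R (\<eta> * t) ^ i)"
      using assms t by (intro sum_le_suminf summable_exp_generic) auto
    then show ?thesis by (simp add: exp_def divide_inverse mult.commute)
  qed
  then show "t ^ m \<le> fact m / \<eta> ^ m * exp (\<eta> * t)" using assms by (simp add: field_simps power_mult_distrib)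
qed

text \<open>Polynomial growth costs an arbitrarily small exponential rate. This is the origin of the
  strict inequality between rates in \<open>Oall_exp_poly_family\<close>.\<close>

lemma exp_poly_growth:
  assumes "f \<in> exp_poly" "(\<eta>::real) > 0"
  shows "\<exists>C\<ge>0. \<forall>t\<ge>0. norm (f t) \<le> C * exp (\<eta> * t)"
  using assms(1)
proof (induction rule: exp_poly.induct)
  case (exp_poly_base c m \<theta>)
  obtain C where "C \<ge> 0" "\<And>t. t \<ge> 0 \<Longrightarrow> t ^ m \<le> C * exp (\<eta> * t)" using power_le_exp_growth[OF assms(2)] by blast
  then show ?case
    by (intro exI[of _ "norm c * C"]) (auto simp: norm_mult norm_power mult.assoc intro!: mult_left_mono)
next
  case (exp_poly_add f g)
  then obtain C D where "C \<ge> 0" "D \<ge> 0" "\<And>t. t\<ge>0 \<Longrightarrow> norm (f t) \<le> C * exp (\<eta> * t)" "\<And>t. t\<ge>0 \<Longrightarrow> norm (g t)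
      \<le> D * exp (\<eta> * t)" by blast
  then show ?case
    by (intro exI[of _ "C+D"]) (auto simp: distrib_right intro!: norm_triangle_le add_mono)
qed

lemma summable_on_product_nonneg:
  fixes f :: "'a \<Rightarrow> real" and g :: "'b \<Rightarrow> real"
  assumes f: "f summable_on A" "\<And>x. x \<in> A \<Longrightarrow> f x \<ge> 0" and g: "g summable_on B" "\<And>x. x \<in> B \<Longrightarrow> g x \<ge> 0"
  shows "(\<lambda>p. f (fst p) * g (snd p)) summable_on (A \<times> B)"
    and "(\<Sum>\<^sub>\<infinity>p\<in>A\<times>B. f (fst p) * g (snd p)) = infsum f A * infsum g B"
proof -
  show s: "(\<lambda>p. f (fst p) * g (snd p)) summable_on (A \<times> B)"
  proof (rule summable_on_SigmaI[where g = "\<lambda>x. f x * infsum g B"])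
    show "((\<lambda>y. f (fst (x,y)) * g (snd (x,y))) has_sum f x * infsum g B) B" if "x \<in> A" for x
      using has_sum_cmult_right[OF has_sum_infsum[OF g(1)], of "f x"] by simp
    show "(\<lambda>x. f x * infsum g B) summable_on A"
      using f(1) by (rule summable_on_cmult_left)
  qed (use f g in auto)
  show "(\<Sum>\<^sub>\<infinity>p\<in>A\<times>B. f (fst p) * g (snd p)) = infsum f A * infsum g B"
    using infsum_Sigma_banach[OF s] by (simp add: infsum_cmult_left' infsum_cmult_right')
qed

lemma norm_le_mult_exp_nonneg:
  assumes "norm x \<le> A * exp y" shows "A \<ge> 0"
proof (rule ccontr)
  assume "\<not> A \<ge> 0"
  then have "A * exp y < 0" by (simp add: mult_neg_pos)
  then show False using assms norm_ge_zero[of x] by linarith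
qed

section \<open>Linear equations with exponentially decaying forcing\<close>

lemma exp_conjugate_derivative:
  fixes f :: "real \<Rightarrow> 'a::real_normed_vector"
  assumes "(f has_vector_derivative (- \<beta> *\<^sub>R f t - n t)) (at t)"
  shows "((\<lambda>t. exp (\<beta> * t) *\<^sub>R f t) has_vector_derivative (- exp (\<beta> * t) *\<^sub>R n t)) (at t)"
proof -
  have e: "((\<lambda>t. exp (\<beta> * t)) has_field_derivative (\<beta> * exp (\<beta> * t))) (at t)"
    by (auto intro!: derivative_eq_intros)
  show ?thesis using has_vector_derivative_scaleR[OF e assms] by (simp add: algebra_simps)
qed

text \<open>Conjugation by \<open>exp (\<beta> * t)\<close> removes the linear term; the remaining
  derivative is bounded by A exp ((\<beta> - \<nu>) t), whose primitive appears on the right. The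
  sign of \<beta> - \<nu> is left open, so that modes faster and slower than the forcing are both
  covered; at \<beta> = \<nu> the primitive would be linear.\<close>

lemma exp_conjugate_increment:
  fixes f :: "real \<Rightarrow> 'a::real_normed_vector"
  assumes d: "\<And>t. t \<ge> T \<Longrightarrow> (f has_vector_derivative (- \<beta> *\<^sub>R f t - n t)) (at t)"
    and b: "\<And>t. t \<ge> T \<Longrightarrow> norm (n t) \<le> A * exp (- \<nu> * t)"
    and "\<beta> \<noteq> \<nu>" "T \<le> t" "t \<le> t'"
  shows "norm (exp (\<beta> * t') *\<^sub>R f t' - exp (\<beta> * t) *\<^sub>R f t)
     \<le> A / (\<beta> - \<nu>) * exp ((\<beta> - \<nu>) * t') - A / (\<beta> - \<nu>) * exp ((\<beta> - \<nu>) * t)"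
proof (cases "t = t'")
  case False
  show ?thesis
  proof (rule differentiable_bound_general[where f' = "\<lambda>t. - exp (\<beta> * t) *\<^sub>R n t"
      and \<phi>' = "\<lambda>t. A * exp ((\<beta> - \<nu>) * t)"])
    show "t < t'" using False assms by simp
    have der: "((\<lambda>t. exp (\<beta> * t) *\<^sub>R f t) has_vector_derivative (- exp (\<beta> * x) *\<^sub>R n x)) (at x)" if "x \<ge> t"
        for x
      using exp_conjugate_derivative[where f=f and n=n and t=x, OF d] that assms by auto
    then show "continuous_on {t..t'} (\<lambda>t. exp (\<beta> * t) *\<^sub>R f t)"
      by (auto intro!: continuous_at_imp_continuous_on has_vector_derivative_continuous)
    show "((\<lambda>t. exp (\<beta> * t) *\<^sub>R f t) has_vector_derivative (- exp (\<beta> * x) *\<^sub>R n x)) (at x)"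
        if "t < x" "x < t'" for x
      using that der by auto
    show "((\<lambda>x. A / (\<beta> - \<nu>) * exp ((\<beta> - \<nu>) * x)) has_vector_derivative A * exp ((\<beta> - \<nu>) * x)) (at x)" for x
      using \<open>\<beta> \<noteq> \<nu>\<close> by (auto intro!: derivative_eq_intros simp flip:
          has_real_derivative_iff_has_vector_derivative)
    show "continuous_on {t..t'} (\<lambda>x. A / (\<beta> - \<nu>) * exp ((\<beta> - \<nu>) * x))" by (intro continuous_intros)
    show "norm (- exp (\<beta> * x) *\<^sub>R n x) \<le> A * exp ((\<beta> - \<nu>) * x)" if "t < x" "x < t'" for x
    proof -
      have "exp (\<beta> * x) * norm (n x) \<le> exp (\<beta> * x) * (A * exp (- \<nu> * x))"
        using that assms by (intro mult_left_mono b) auto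
      also have "\<dots> = A * exp ((\<beta> - \<nu>) * x)" by (simp add: algebra_simps flip: exp_add)
      finally show ?thesis by simp
    qed
  qed
qed simp

text \<open>A mode that decays faster than its forcing forgets its initial value and inherits the
  rate of the forcing.\<close>

lemma linear_ode_fast:
  fixes f :: "real \<Rightarrow> 'a::real_normed_vector"
  assumes d: "\<And>t. t \<ge> T \<Longrightarrow> (f has_vector_derivative (- \<beta> *\<^sub>R f t - n t)) (at t)"
    and b: "\<And>t. t \<ge> T \<Longrightarrow> norm (n t) \<le> A * exp (- \<nu> * t)"
    and "\<nu> < \<beta>" "T \<le> t"
  shows "norm (f t) \<le> exp (- \<beta> * (t - T)) * norm (f T) + A / (\<beta> - \<nu>) * exp (- \<nu> * t)"
proof -
  have A: "A \<ge> 0" using norm_le_mult_exp_nonneg[OF b[OF order_refl]] .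
  have "norm (exp (\<beta> * t) *\<^sub>R f t - exp (\<beta> * T) *\<^sub>R f T) \<le> A / (\<beta> - \<nu>) * exp ((\<beta> - \<nu>) * t)"
    using exp_conjugate_increment[OF d b _ order_refl, of T t] assms A
        by (smt (verit) divide_nonneg_pos exp_gt_zero mult_nonneg_nonneg)
  then have "norm (exp (\<beta> * t) *\<^sub>R f t) \<le> exp (\<beta> * T) * norm (f T) + A / (\<beta> - \<nu>) * exp ((\<beta> - \<nu>) * t)"
    by (smt (verit) norm_triangle_ineq2 norm_scaleR abs_exp_cancel)
  then have "exp (- \<beta> * t) * norm (exp (\<beta> * t) *\<^sub>R f t)
      \<le> exp (- \<beta> * t) * (exp (\<beta> * T) * norm (f T) + A / (\<beta> - \<nu>) * exp ((\<beta> - \<nu>) * t))"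
    by (intro mult_left_mono) auto
  then show ?thesis by (simp add: algebra_simps flip: exp_add mult.assoc)
qed

text \<open>For a slower mode the increments of the conjugated solution are bounded by a function
  tending to 0, so it is Cauchy. Its limit is the amplitude of the free solution that the mode
  approaches.\<close>

lemma linear_ode_slow_limit:
  fixes f :: "real \<Rightarrow> 'a::banach"
  assumes d: "\<And>t. t \<ge> T \<Longrightarrow> (f has_vector_derivative (- \<beta> *\<^sub>R f t - n t)) (at t)"
    and b: "\<And>t. t \<ge> T \<Longrightarrow> norm (n t) \<le> A * exp (- \<nu> * t)"
    and "\<beta> < \<nu>"
  shows "\<exists>\<xi>. ((\<lambda>t. exp (\<beta> * t) *\<^sub>R f t) \<longlongrightarrow> \<xi>) at_top"
proof -
  define h where "h t = exp (\<beta> * t) *\<^sub>R f t" for t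
  define g where "g t = A / (\<nu> - \<beta>) * exp (- (\<nu> - \<beta>) * t)" for t
  have A: "A \<ge> 0" using norm_le_mult_exp_nonneg[OF b[OF order_refl]] .
  have inc: "norm (h t' - h t) \<le> g t" if "T \<le> t" "t \<le> t'" for t t'
  proof -
    have eq: "A / (\<beta> - \<nu>) * x - A / (\<beta> - \<nu>) * y = A / (\<nu> - \<beta>) * y - A / (\<nu> - \<beta>) * x" for x y
      using \<open>\<beta> < \<nu>\<close> by (simp add: divide_simps) (simp add: algebra_simps)
    have "norm (h t' - h t) \<le> g t - g t'"
      using exp_conjugate_increment[OF d b _ that] \<open>\<beta> < \<nu>\<close> unfolding h_def g_def eq by simp
    also have "\<dots> \<le> g t" unfolding g_def using A \<open>\<beta> < \<nu>\<close> by simp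
    finally show ?thesis .
  qed
  have g0: "(g \<longlongrightarrow> 0) at_top"
    unfolding g_def
  proof (rule tendsto_mult_right_zero)
    have "LIM t at_top. (\<nu> - \<beta>) * t :> at_top"
      using \<open>\<beta> < \<nu>\<close> by (simp add: filterlim_tendsto_pos_mult_at_top[OF tendsto_const] filterlim_ident)
    then show "((\<lambda>x. exp (- (\<nu> - \<beta>) * x)) \<longlongrightarrow> 0) at_top"
      by (intro filterlim_compose[OF exp_at_bot]) (simp add: filterlim_uminus_at_bot algebra_simps)
  qed
  have "cauchy_filter (filtermap h at_top)"
    unfolding cauchy_filter_metric_filtermap
  proof (intro allI impI)
    fix e :: real assume "e > 0"
    then have "\<forall>\<^sub>F t in at_top. g t < e / 2" using order_tendstoD(2)[OF g0, of "e/2"] by simp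
    then have "\<forall>\<^sub>F t in at_top. g t < e / 2 \<and> t \<ge> T" using eventually_ge_at_top by (rule eventually_conj)
    then obtain t where t: "g t < e / 2" "t \<ge> T" using eventually_happens[of _ "at_top :: real filter"] by auto
    show "\<exists>P. eventually P at_top \<and> (\<forall>x y. P x \<and> P y \<longrightarrow> dist (h x) (h y) < e)"
    proof (intro exI conjI allI impI)
      show "\<forall>\<^sub>F x in at_top. x \<ge> t" by (rule eventually_ge_at_top)
      fix x y assume "x \<ge> t \<and> y \<ge> t"
      then have xy: "t \<le> x" "t \<le> y" by auto
      have "norm (h x - h t) < e/2" "norm (h y - h t) < e/2"
        using inc[OF t(2) xy(1)] inc[OF t(2) xy(2)] t(1) by linarith+
      then have "norm ((h x - h t) - (h y - h t)) < e" using norm_triangle_ineq4[of "h x - h t" "h y - h t"]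
          by linarith
      then show "dist (h x) (h y) < e" by (simp add: dist_norm)
    qed
  qed
  then obtain \<xi> where "filtermap h at_top \<le> nhds \<xi>"
    using cauchy_filter_complete_converges[OF _ complete_UNIV, of "filtermap h at_top"]
        by (auto simp: filtermap_bot_iff)
  then show ?thesis unfolding filterlim_def h_def by blast
qed

text \<open>The increment bound from t to t' as t' tends to infinity: what is left after removing
  the free solution decays at the rate of the forcing.\<close>

lemma linear_ode_slow:
  fixes f :: "real \<Rightarrow> 'a::real_normed_vector"
  assumes d: "\<And>t. t \<ge> T \<Longrightarrow> (f has_vector_derivative (- \<beta> *\<^sub>R f t - n t)) (at t)"
    and b: "\<And>t. t \<ge> T \<Longrightarrow> norm (n t) \<le> A * exp (- \<nu> * t)"
    and "\<beta> < \<nu>" and lim: "((\<lambda>t. exp (\<beta> * t) *\<^sub>R f t) \<longlongrightarrow> \<xi>) at_top" and "T \<le> t"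
  shows "norm (f t - exp (- \<beta> * t) *\<^sub>R \<xi>) \<le> A / (\<nu> - \<beta>) * exp (- \<nu> * t)"
proof -
  define h where "h t = exp (\<beta> * t) *\<^sub>R f t" for t
  have A: "A \<ge> 0" using norm_le_mult_exp_nonneg[OF b[OF order_refl]] .
  have "norm (h t' - h t) \<le> A / (\<nu> - \<beta>) * exp (- (\<nu> - \<beta>) * t)" if "t \<le> t'" for t'
  proof -
    have eq: "A / (\<beta> - \<nu>) * x - A / (\<beta> - \<nu>) * y = A / (\<nu> - \<beta>) * y - A / (\<nu> - \<beta>) * x" for x y
      using \<open>\<beta> < \<nu>\<close> by (simp add: divide_simps) (simp add: algebra_simps)
    have "norm (h t' - h t) \<le> A / (\<nu> - \<beta>) * exp ((\<beta> - \<nu>) * t) - A / (\<nu> - \<beta>) * exp ((\<beta> - \<nu>) * t')"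
      using exp_conjugate_increment[OF d b _ \<open>T \<le> t\<close> that] \<open>\<beta> < \<nu>\<close> unfolding h_def eq by simp
    moreover have "A / (\<nu> - \<beta>) * exp ((\<beta> - \<nu>) * t') \<ge> 0" using A \<open>\<beta> < \<nu>\<close> by simp
    ultimately show ?thesis by (simp add: algebra_simps)
  qed
  then have ev: "\<forall>\<^sub>F t' in at_top. norm (h t' - h t) \<le> A / (\<nu> - \<beta>) * exp (- (\<nu> - \<beta>) * t)"
    by (rule eventually_mono[OF eventually_ge_at_top[of t]])
  have "((\<lambda>t'. norm (h t' - h t)) \<longlongrightarrow> norm (\<xi> - h t)) at_top"
    using lim unfolding h_def by (intro tendsto_intros)
  then have "norm (\<xi> - h t) \<le> A / (\<nu> - \<beta>) * exp (- (\<nu> - \<beta>) * t)"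
    using ev by (rule tendsto_upperbound) simp
  then have "exp (- \<beta> * t) * norm (h t - \<xi>) \<le> exp (- \<beta> * t) * (A / (\<nu> - \<beta>) * exp (- (\<nu> - \<beta>) * t))"
    by (intro mult_left_mono) (auto simp: norm_minus_commute)
  moreover have "exp (- \<beta> * t) *\<^sub>R (h t - \<xi>) = f t - exp (- \<beta> * t) *\<^sub>R \<xi>"
    unfolding h_def by (simp add: scaleR_diff_right flip: exp_add)
  then have "norm (f t - exp (- \<beta> * t) *\<^sub>R \<xi>) = exp (- \<beta> * t) * norm (h t - \<xi>)"
    by (metis abs_exp_cancel norm_scaleR)
  ultimately show ?thesis by (simp add: algebra_simps flip: exp_add)
qed

section \<open>Expansion of solutions of quadratic systems\<close>

text \<open>An index will be a pair of a wave vector and a component. \<open>K_bound\<close>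
  expresses that the nonlinearity loses one derivative, and \<open>K_zero\<close> is the triangle
  inequality for interacting wave vectors: it lets exponential weights in \<rho> pass through the
  bilinear form and keeps finite supports finite.\<close>

locale expansion_coeffs =
  fixes \<rho> :: "'i \<Rightarrow> real" and K :: "'i \<Rightarrow> 'i \<Rightarrow> 'i \<Rightarrow> real \<Rightarrow> complex" and C0 :: real
  assumes rho_ge1: "\<rho> i \<ge> 1"
    and sum_exp: "(\<lambda>i. exp (- \<rho> i)) summable_on UNIV"
    and K_exp_poly: "K i a b \<in> exp_poly"
    and K_bound: "norm (K i a b t) \<le> C0 * \<rho> i"
    and K_zero: "\<rho> i > \<rho> a + \<rho> b \<Longrightarrow> K i a b t = 0"
begin

text \<open>Decay beyond every exponential weight in \<open>\<rho>\<close> serves all Gevrey norms at once; the price is a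
  threshold for \<open>t\<close> that depends on \<open>s\<close>.\<close>

definition Oall :: "real \<Rightarrow> (real \<Rightarrow> 'i \<Rightarrow> complex) \<Rightarrow> bool" where
  "Oall \<nu> f \<longleftrightarrow> (\<forall>s. \<exists>C. \<forall>\<^sub>F t in at_top. \<forall>i. norm (f t i) \<le> C * exp (- s * \<rho> i - \<nu> * t))"

definition bil :: "real \<Rightarrow> ('i \<Rightarrow> complex) \<Rightarrow> ('i \<Rightarrow> complex) \<Rightarrow> 'i \<Rightarrow> complex" where
  "bil t x y i = (\<Sum>\<^sub>\<infinity>p. K i (fst p) (snd p) t * x (fst p) * y (snd p))"

lemma C0_nonneg: "C0 \<ge> 0"
  using K_bound[of undefined undefined undefined 0] rho_ge1[of undefined]
  by (smt (verit) norm_ge_zero mult_neg_pos)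

text \<open>Where \<open>K\<close> does not vanish, \<rho> i \<le> \<rho> a + \<rho> b, so s units
  of the weight on each input turn into s units on the output. The remaining unit makes the double
  sum converge.\<close>

lemma bil_estimate:
  assumes x: "\<And>a. norm (x a) \<le> A * exp (- (s+1) * \<rho> a)" and y: "\<And>a. norm (y a) \<le> B * exp (- (s+1) * \<rho> a)"
      and s: "s \<ge> 0"
  shows "(\<lambda>p. norm (K i (fst p) (snd p) t * x (fst p) * y (snd p))) summable_on UNIV"
    and "norm (bil t x y i) \<le> C0 * \<rho> i * A * B * exp (- s * \<rho> i) * (infsum (\<lambda>i. exp (- \<rho> i)) UNIV)\<^sup>2"
proof -
  have A: "A \<ge> 0" "B \<ge> 0"
    using norm_le_mult_exp_nonneg[OF x] norm_le_mult_exp_nonneg[OF y] by auto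
  define g where "g p = (C0 * \<rho> i * A * B * exp (- s * \<rho> i)) * (exp (- \<rho> (fst p)) * exp (- \<rho> (snd p)))" for p
  have S: "((\<lambda>p. exp (- \<rho> (fst p)) * exp (- \<rho> (snd p))) has_sum
      (infsum (\<lambda>i. exp (- \<rho> i)) UNIV * infsum (\<lambda>i. exp (- \<rho> i)) UNIV)) UNIV"
    using has_sum_infsum[OF summable_on_product_nonneg(1)[OF sum_exp _ sum_exp]]
    summable_on_product_nonneg(2)[OF sum_exp _ sum_exp] by simp
  have g: "(g has_sum (C0 * \<rho> i * A * B * exp (- s * \<rho> i) * (infsum (\<lambda>i. exp (- \<rho> i)) UNIV)\<^sup>2)) UNIV"
    unfolding g_def power2_eq_square by (rule has_sum_cmult_right[OF S])
  have le: "norm (K i (fst p) (snd p) t * x (fst p) * y (snd p)) \<le> g p" for p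
  proof (cases "\<rho> i > \<rho> (fst p) + \<rho> (snd p)")
    case True
    then show ?thesis using K_zero A C0_nonneg rho_ge1[of i] by (auto simp: g_def intro!: mult_nonneg_nonneg)
  next
    case False
    have "norm (K i (fst p) (snd p) t * x (fst p) * y (snd p))
        \<le> (C0 * \<rho> i) * (A * exp (- (s+1) * \<rho> (fst p))) * (B * exp (- (s+1) * \<rho> (snd p)))"
      unfolding norm_mult using A C0_nonneg rho_ge1[of i]
          by (intro mult_mono K_bound x y mult_nonneg_nonneg) auto
    also have "\<dots> = (C0 * \<rho> i * A * B) * exp (- s * (\<rho> (fst p) + \<rho> (snd p))) *
        (exp (- \<rho> (fst p)) * exp (- \<rho> (snd p)))"
      by (simp add: algebra_simps flip: exp_add)
    also have "\<dots> \<le> g p"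
      unfolding g_def using A C0_nonneg rho_ge1[of i] False s
          by (intro mult_mono mult_nonneg_nonneg) (auto simp: mult_left_mono)
    finally show ?thesis .
  qed
  show sm: "(\<lambda>p. norm (K i (fst p) (snd p) t * x (fst p) * y (snd p))) summable_on UNIV"
    by (rule Infinite_Sum.abs_summable_on_comparison_test'[OF has_sum_imp_summable[OF g] le])
  show "norm (bil t x y i) \<le> C0 * \<rho> i * A * B * exp (- s * \<rho> i) * (infsum (\<lambda>i. exp (- \<rho> i)) UNIV)\<^sup>2"
    unfolding bil_def by (rule norm_infsum_le[OF has_sum_infsum g le]) (rule abs_summable_summable[OF sm])
qed

lemma OallD: "Oall \<nu> f \<Longrightarrow> \<exists>C\<ge>0. \<forall>\<^sub>F t in at_top. \<forall>i. norm (f t i) \<le> C * exp (- s * \<rho> i - \<nu> * t)"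
proof -
  assume "Oall \<nu> f"
  then have "\<exists>C. \<forall>\<^sub>F t in at_top. \<forall>i. norm (f t i) \<le> C * exp (- s * \<rho> i - \<nu> * t)"
    unfolding Oall_def by (rule spec)
  then obtain C where C: "\<forall>\<^sub>F t in at_top. \<forall>i. norm (f t i) \<le> C * exp (- s * \<rho> i - \<nu> * t)" ..
  have "\<forall>\<^sub>F t in at_top. \<forall>i. norm (f t i) \<le> \<bar>C\<bar> * exp (- s * \<rho> i - \<nu> * t)"
    using C
  proof eventually_elim
    case (elim t)
    have "C * exp (- s * \<rho> i - \<nu> * t) \<le> \<bar>C\<bar> * exp (- s * \<rho> i - \<nu> * t)" for i by (intro mult_right_mono) auto
    then show ?case using elim order_trans[OF elim[rule_format]] by simp
  qed
  then have "\<bar>C\<bar> \<ge> 0 \<and> (\<forall>\<^sub>F t in at_top. \<forall>i. norm (f t i) \<le> \<bar>C\<bar> * exp (- s * \<rho> i - \<nu> * t))"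
      by (intro conjI abs_ge_zero)
  then show ?thesis by (rule exI)
qed

lemma Oall_mono: "Oall \<nu> f \<Longrightarrow> \<nu>' \<le> \<nu> \<Longrightarrow> Oall \<nu>' f"
proof -
  assume *: "Oall \<nu> f" "\<nu>' \<le> \<nu>"
  show ?thesis
    unfolding Oall_def
  proof
    fix s
    obtain C where C: "C \<ge> 0" "\<forall>\<^sub>F t in at_top. \<forall>i. norm (f t i) \<le> C * exp (- s * \<rho> i - \<nu> * t)"
        using OallD[OF *(1)] by blast
    have "\<forall>\<^sub>F t in at_top. \<forall>i. norm (f t i) \<le> C * exp (- s * \<rho> i - \<nu>' * t)"
      using C(2) eventually_ge_at_top[of 0]
    proof eventually_elim
      case (elim t)
      have "exp (- s * \<rho> i - \<nu> * t) \<le> exp (- s * \<rho> i - \<nu>' * t)" for i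
        using elim *(2) by (simp add: mult_right_mono)
      then show ?case using order_trans[OF elim(1)[rule_format] mult_left_mono[OF _ C(1)]] by blast
    qed
    then show "\<exists>C. \<forall>\<^sub>F t in at_top. \<forall>i. norm (f t i) \<le> C * exp (- s * \<rho> i - \<nu>' * t)" by blast
  qed
qed

lemma Oall_add: "Oall \<nu> f \<Longrightarrow> Oall \<nu> g \<Longrightarrow> Oall \<nu> (\<lambda>t i. f t i + g t i)"
proof -
  assume *: "Oall \<nu> f" "Oall \<nu> g"
  show ?thesis
    unfolding Oall_def
  proof
    fix s
    obtain C D where C: "\<forall>\<^sub>F t in at_top. \<forall>i. norm (f t i) \<le> C * exp (- s * \<rho> i - \<nu> * t)"
        "\<forall>\<^sub>F t in at_top. \<forall>i. norm (g t i) \<le> D * exp (- s * \<rho> i - \<nu> * t)"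
      using OallD[OF *(1), of s] OallD[OF *(2), of s] by (elim exE conjE) (rule that)
    then have "\<forall>\<^sub>F t in at_top. \<forall>i. norm (f t i + g t i) \<le> (C + D) * exp (- s * \<rho> i - \<nu> * t)"
    proof eventually_elim
      case (elim t)
      show ?case
      proof
        fix i
        show "norm (f t i + g t i) \<le> (C + D) * exp (- s * \<rho> i - \<nu> * t)"
          using norm_triangle_ineq[of "f t i" "g t i"] elim(1)[rule_format, of i] elim(2)[rule_format, of i]
          unfolding distrib_right by linarith
      qed
    qed
    then show "\<exists>C. \<forall>\<^sub>F t in at_top. \<forall>i. norm (f t i + g t i) \<le> C * exp (- s * \<rho> i - \<nu> * t)" by blast
  qed
qed

lemma Oall_uminus: "Oall \<nu> f \<Longrightarrow> Oall \<nu> (\<lambda>t i. - f t i)"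
  unfolding Oall_def by simp

lemma Oall_diff: "Oall \<nu> f \<Longrightarrow> Oall \<nu> g \<Longrightarrow> Oall \<nu> (\<lambda>t i. f t i - g t i)"
proof -
  assume "Oall \<nu> f" "Oall \<nu> g"
  then have "Oall \<nu> (\<lambda>t i. f t i + - g t i)" by (intro Oall_add Oall_uminus)
  then show ?thesis by simp
qed

lemma Oall_zero: "Oall \<nu> (\<lambda>t i. 0)"
  unfolding Oall_def by (auto intro!: exI[of _ 0])

lemma Oall_sum: "(\<And>a. a \<in> A \<Longrightarrow> Oall \<nu> (f a)) \<Longrightarrow> Oall \<nu> (\<lambda>t i. \<Sum>a\<in>A. f a t i)"
proof (induction A rule: infinite_finite_induct)
  case (insert x F)
  then have "Oall \<nu> (\<lambda>t i. f x t i + (\<Sum>a\<in>F. f a t i))" by (intro Oall_add) auto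
  then show ?case using insert by simp
qed (simp_all add: Oall_zero)

lemma Oall_cong: "(\<forall>\<^sub>F t in at_top. \<forall>i. f t i = g t i) \<Longrightarrow> Oall \<nu> f \<Longrightarrow> Oall \<nu> g"
proof -
  assume *: "\<forall>\<^sub>F t in at_top. \<forall>i. f t i = g t i" "Oall \<nu> f"
  show ?thesis unfolding Oall_def
  proof
    fix s
    obtain C where "\<forall>\<^sub>F t in at_top. \<forall>i. norm (f t i) \<le> C * exp (- s * \<rho> i - \<nu> * t)"
        using OallD[OF *(2), of s] by (elim exE conjE) (rule that)
    then have "\<forall>\<^sub>F t in at_top. \<forall>i. norm (g t i) \<le> C * exp (- s * \<rho> i - \<nu> * t)"
      using *(1) by eventually_elim simp
    then show "\<exists>C. \<forall>\<^sub>F t in at_top. \<forall>i. norm (g t i) \<le> C * exp (- s * \<rho> i - \<nu> * t)" by blast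
  qed
qed

lemma Oall_bil:
  assumes f: "Oall \<nu>1 f" and g: "Oall \<nu>2 g"
  shows "Oall (\<nu>1 + \<nu>2) (\<lambda>t. bil t (f t) (g t))"
  unfolding Oall_def
proof
  fix s :: real
  \<comment> \<open>The inputs are taken with weight s' + 1, that is |s| + 2. One extra unit makes
    the double sum converge, the other absorbs the factor \<open>\<rho> i\<close> of the lost
    derivative; the absolute value meets the sign condition of \<open>bil_estimate\<close>.\<close>
  define s' where "s' = \<bar>s\<bar> + 1"
  obtain A where A: "A \<ge> 0" "\<forall>\<^sub>F t in at_top. \<forall>i. norm (f t i) \<le> A * exp (- (s'+1) * \<rho> i - \<nu>1 * t)"
    using OallD[OF f] by blast
  obtain B where B: "B \<ge> 0" "\<forall>\<^sub>F t in at_top. \<forall>i. norm (g t i) \<le> B * exp (- (s'+1) * \<rho> i - \<nu>2 * t)"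
    using OallD[OF g] by blast
  define E where "E = (infsum (\<lambda>i. exp (- \<rho> i)) UNIV)\<^sup>2"
  have "\<forall>\<^sub>F t in at_top. \<forall>i. norm (bil t (f t) (g t) i) \<le> (C0 * A * B * E) * exp (- s * \<rho> i - (\<nu>1 + \<nu>2) * t)"
    using A(2) B(2)
  proof eventually_elim
    case (elim t)
    show ?case
    proof
      fix i
      have 1: "norm (f t a) \<le> (A * exp (- \<nu>1 * t)) * exp (- (s'+1) * \<rho> a)" for a
        using elim(1)[rule_format, of a] by (simp add: algebra_simps flip: exp_add)
      have 2: "norm (g t a) \<le> (B * exp (- \<nu>2 * t)) * exp (- (s'+1) * \<rho> a)" for a
        using elim(2)[rule_format, of a] by (simp add: algebra_simps flip: exp_add)
      have "norm (bil t (f t) (g t) i) \<le> C0 * \<rho> i * (A * exp (- \<nu>1 * t)) * (B * exp (- \<nu>2 * t)) * exp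
          (- s' * \<rho> i) * E"
        unfolding E_def by (rule bil_estimate[OF 1 2]) (simp add: s'_def)
      also have "\<dots> = (C0 * A * B * E) * (\<rho> i * exp (- \<rho> i)) * exp (- \<bar>s\<bar> * \<rho> i - (\<nu>1 + \<nu>2) * t)"
        unfolding s'_def by (simp add: algebra_simps flip: exp_add)
      also have "\<dots> \<le> (C0 * A * B * E) * 1 * exp (- s * \<rho> i - (\<nu>1 + \<nu>2) * t)"
      proof (intro mult_mono)
        have "\<rho> i \<le> exp (\<rho> i)" using exp_ge_add_one_self[of "\<rho> i"] by linarith
        then show "\<rho> i * exp (- \<rho> i) \<le> 1" by (simp add: exp_minus field_simps)
        have "s * \<rho> i \<le> \<bar>s\<bar> * \<rho> i" using rho_ge1[of i] by (intro mult_right_mono) auto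
        then show "exp (- \<bar>s\<bar> * \<rho> i - (\<nu>1 + \<nu>2) * t) \<le> exp (- s * \<rho> i - (\<nu>1 + \<nu>2) * t)" by simp
      qed (use A B C0_nonneg rho_ge1[of i] in \<open>auto simp: E_def\<close>)
      finally show "norm (bil t (f t) (g t) i) \<le> (C0 * A * B * E) * exp (- s * \<rho> i - (\<nu>1 + \<nu>2) * t)" by simp
    qed
  qed
  then show "\<exists>C. \<forall>\<^sub>F t in at_top. \<forall>i. norm (bil t (f t) (g t) i) \<le> C * exp (- s * \<rho> i - (\<nu>1 + \<nu>2) * t)" by blast
qed

text \<open>An identity for large t only: bilinearity of the infinite double sum rests on absolute
  convergence, which \<open>Oall\<close> provides beyond a threshold.\<close>

lemma bil_diff_eventually:
  assumes f: "Oall \<nu>1 f" and g: "Oall \<nu>2 g"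
  shows "\<forall>\<^sub>F t in at_top. \<forall>i. bil t (f t) (f t) i - bil t (g t) (g t) i =
    bil t (\<lambda>a. f t a - g t a) (f t) i + bil t (g t) (\<lambda>a. f t a - g t a) i"
proof -
  obtain A where A: "A \<ge> 0" "\<forall>\<^sub>F t in at_top. \<forall>i. norm (f t i) \<le> A * exp (- (0+1) * \<rho> i - \<nu>1 * t)"
    using OallD[OF f] by blast
  obtain B where B: "B \<ge> 0" "\<forall>\<^sub>F t in at_top. \<forall>i. norm (g t i) \<le> B * exp (- (0+1) * \<rho> i - \<nu>2 * t)"
    using OallD[OF g] by blast
  show ?thesis using A(2) B(2)
  proof eventually_elim
    case (elim t)
    have 1: "norm (f t a) \<le> (A * exp (- \<nu>1 * t)) * exp (- (0+1) * \<rho> a)" for a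
      using elim(1)[rule_format, of a] by (simp add: algebra_simps flip: exp_add)
    have 2: "norm (g t a) \<le> (B * exp (- \<nu>2 * t)) * exp (- (0+1) * \<rho> a)" for a
      using elim(2)[rule_format, of a] by (simp add: algebra_simps flip: exp_add)
    have 3: "norm (f t a - g t a) \<le> (A * exp (- \<nu>1 * t) + B * exp (- \<nu>2 * t)) * exp (- (0+1) * \<rho> a)" for a
      using norm_triangle_ineq4[of "f t a" "g t a"] 1[of a] 2[of a] by (simp add: distrib_right)
    show ?case
    proof
      fix i
      let ?d = "\<lambda>a. f t a - g t a"
      let ?k = "\<lambda>x y p. K i (fst p) (snd p) t * x (fst p) * y (snd p)"
      note S = abs_summable_summable[OF bil_estimate(1)[OF 1 1 order_refl], of i]
          abs_summable_summable[OF bil_estimate(1)[OF 2 2 order_refl], of i]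
        abs_summable_summable[OF bil_estimate(1)[OF 3 1 order_refl], of i]
            abs_summable_summable[OF bil_estimate(1)[OF 2 3 order_refl], of i]
      have "bil t (f t) (f t) i = infsum (\<lambda>p. ?k (g t) (g t) p + (?k ?d (f t) p + ?k (g t) ?d p)) UNIV"
        unfolding bil_def by (rule infsum_cong) (simp add: algebra_simps)
      also have "\<dots> = bil t (g t) (g t) i + (bil t ?d (f t) i + bil t (g t) ?d i)"
        unfolding bil_def by (simp only: infsum_add[OF S(2) summable_on_add[OF S(3) S(4)]]
            infsum_add[OF S(3) S(4)])
      finally show "bil t (f t) (f t) i - bil t (g t) (g t) i = bil t ?d (f t) i + bil t (g t) ?d i" by simp
    qed
  qed
qed

text \<open>Separates the dependence on i from that on t, so that the lemmas on a single linear
  equation apply with A = C exp (- s \<rho> i). \<open>T0\<close> pushes the threshold into the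
  range where the equation holds.\<close>

lemma eventually_atLeast_exp:
  assumes "Oall \<nu> f"
  shows "\<exists>C\<ge>0. \<exists>T\<ge>T0. \<forall>t\<ge>T. \<forall>i. norm (f t i) \<le> (C * exp (- s * \<rho> i)) * exp (- \<nu> * t)"
proof -
  obtain C where C: "C \<ge> 0" "\<forall>\<^sub>F t in at_top. \<forall>i. norm (f t i) \<le> C * exp (- s * \<rho> i - \<nu> * t)"
    using OallD[OF assms] by blast
  then obtain T where T: "\<And>t. t \<ge> T \<Longrightarrow> \<forall>i. norm (f t i) \<le> C * exp (- s * \<rho> i - \<nu> * t)"
    unfolding eventually_at_top_linorder by blast
  have "\<forall>t\<ge>max T T0. \<forall>i. norm (f t i) \<le> (C * exp (- s * \<rho> i)) * exp (- \<nu> * t)"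
    using T by (simp add: algebra_simps exp_diff exp_minus divide_inverse)
  then show ?thesis using C(1) by (intro exI[of _ C] conjI exI[of _ "max T T0"]) auto
qed

lemma Oall_I:
  assumes "\<And>s. \<exists>C T. \<forall>t\<ge>T. \<forall>i. norm (f t i) \<le> (C * exp (- s * \<rho> i)) * exp (- \<nu> * t)"
  shows "Oall \<nu> f"
  unfolding Oall_def
proof
  fix s
  obtain C T where T: "\<And>t. t \<ge> T \<Longrightarrow> \<forall>i. norm (f t i) \<le> (C * exp (- s * \<rho> i)) * exp (- \<nu> * t)"
    using assms[of s] by blast
  have "\<forall>\<^sub>F t in at_top. \<forall>i. norm (f t i) \<le> C * exp (- s * \<rho> i - \<nu> * t)"
    using eventually_ge_at_top[of T]
  proof eventually_elim
    case (elim t)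
    show ?case using T[OF elim] by (simp add: algebra_simps exp_diff exp_minus divide_inverse)
  qed
  then show "\<exists>C. \<forall>\<^sub>F t in at_top. \<forall>i. norm (f t i) \<le> C * exp (- s * \<rho> i - \<nu> * t)" by (rule exI)
qed

lemma exp_scaled_tendsto_0:
  assumes "\<And>t. t \<ge> T \<Longrightarrow> norm (f t) \<le> A * exp (- \<nu> * t)" and "\<beta> < \<nu>"
  shows "((\<lambda>t. exp (\<beta> * t) *\<^sub>R (f t :: complex)) \<longlongrightarrow> 0) at_top"
proof (rule Lim_null_comparison)
  show "\<forall>\<^sub>F t in at_top. norm (exp (\<beta> * t) *\<^sub>R f t) \<le> A * exp (- (\<nu> - \<beta>) * t)"
    using eventually_ge_at_top[of T]
  proof eventually_elim
    case (elim t)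
    have "exp (\<beta> * t) * norm (f t) \<le> exp (\<beta> * t) * (A * exp (- \<nu> * t))"
      using assms(1)[OF elim] by (intro mult_left_mono) auto
    then show ?case by (simp add: algebra_simps flip: exp_add)
  qed
  have "LIM t at_top. (\<nu> - \<beta>) * t :> at_top"
    using \<open>\<beta> < \<nu>\<close> by (simp add: filterlim_tendsto_pos_mult_at_top[OF tendsto_const] filterlim_ident)
  then have "((\<lambda>x. exp (- (\<nu> - \<beta>) * x)) \<longlongrightarrow> 0) at_top"
    by (intro filterlim_compose[OF exp_at_bot]) (simp add: filterlim_uminus_at_bot algebra_simps)
  then show "((\<lambda>t. A * exp (- (\<nu> - \<beta>) * t)) \<longlongrightarrow> 0) at_top" by (rule tendsto_mult_right_zero)
qed

text \<open>Extracts the term of order m from a solution whose forcing decays faster than exp (- m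
  t). If (\<rho> i)^2 < m, then by \<open>low\<close> the solution decays faster than the free
  solution, whose amplitude is therefore 0. If (\<rho> i)^2 = m, the free amplitude
  \<open>\<xi> i\<close> is the new datum. If (\<rho> i)^2 > m, the mode is faster by at least
  \<delta> and follows the forcing.\<close>

lemma remainder_step:
  assumes d: "\<And>t i. t \<ge> T0 \<Longrightarrow> ((\<lambda>t. r t i) has_vector_derivative (- (\<rho> i)\<^sup>2 *\<^sub>R r t i - n t i)) (at t)"
    and r: "Oall \<nu>0 r" and n: "Oall \<nu>1 n" and "m < \<nu>1"
    and low: "\<And>i. (\<rho> i)\<^sup>2 < m \<Longrightarrow> (\<rho> i)\<^sup>2 < \<nu>0"
    and gap: "\<delta> > 0" "\<And>i. (\<rho> i)\<^sup>2 > m \<Longrightarrow> (\<rho> i)\<^sup>2 \<ge> m + \<delta>"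
  shows "\<exists>\<xi> \<epsilon>. \<epsilon> > 0 \<and> (\<forall>i. \<xi> i \<noteq> 0 \<longrightarrow> (\<rho> i)\<^sup>2 = m) \<and> Oall (m + \<epsilon>) (\<lambda>t i. r t i - exp (- m * t) *\<^sub>R \<xi> i)"
proof -
  have lim_ex: "\<exists>z. ((\<lambda>t. exp ((\<rho> i)\<^sup>2 * t) *\<^sub>R r t i) \<longlongrightarrow> z) at_top" if "(\<rho> i)\<^sup>2 = m" for i
  proof -
    obtain C T where C: "T \<ge> T0" "\<And>t i. t\<ge>T \<Longrightarrow> norm (n t i) \<le> (C * exp (- 0 * \<rho> i)) * exp (- \<nu>1 * t)"
      using eventually_atLeast_exp[OF n, of T0 0] by blast
    show ?thesis
      by (rule linear_ode_slow_limit[where f = "\<lambda>t. r t i" and n = "\<lambda>t. n t i", OF d C(2)])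
         (use C(1) that \<open>m < \<nu>1\<close> in auto)
  qed
  define \<xi> where "\<xi> i = (if (\<rho> i)\<^sup>2 = m then SOME z. ((\<lambda>t. exp ((\<rho> i)\<^sup>2 * t) *\<^sub>R r t i) \<longlongrightarrow> z) at_top else 0)"
      for i
  have lim1: "((\<lambda>t. exp ((\<rho> i)\<^sup>2 * t) *\<^sub>R r t i) \<longlongrightarrow> \<xi> i) at_top" if "(\<rho> i)\<^sup>2 \<le> m" for i
  proof (cases "(\<rho> i)\<^sup>2 = m")
    case True
    then show ?thesis unfolding \<xi>_def using someI_ex[OF lim_ex[OF True]] by simp
  next
    case False
    obtain C T where C: "\<And>t i. t\<ge>T \<Longrightarrow> norm (r t i) \<le> (C * exp (- 0 * \<rho> i)) * exp (- \<nu>0 * t)"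
      using eventually_atLeast_exp[OF r, of T0 0] by blast
    have "((\<lambda>t. exp ((\<rho> i)\<^sup>2 * t) *\<^sub>R r t i) \<longlongrightarrow> 0) at_top"
      by (rule exp_scaled_tendsto_0[where f = "\<lambda>t. r t i", OF C]) (use low[of i] that False in auto)
    then show ?thesis using False by (simp add: \<xi>_def)
  qed
  \<comment> \<open>The halves keep m + \<epsilon> strictly below \<open>\<nu>1\<close> and at least
    \<delta> / 2 below every (\<rho> i)^2 beyond m, so that the denominators of the fast modes are
    bounded below uniformly in i.\<close>
  define \<epsilon> where "\<epsilon> = min (\<nu>1 - m) \<delta> / 2"
  have \<epsilon>: "\<epsilon> > 0" "m + \<epsilon> < \<nu>1" "\<epsilon> \<le> \<delta> / 2" using gap(1) \<open>m < \<nu>1\<close> by (auto simp: \<epsilon>_def min_def field_simps)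
  have "Oall (m + \<epsilon>) (\<lambda>t i. r t i - exp (- m * t) *\<^sub>R \<xi> i)"
  proof (rule Oall_I)
    fix s
    obtain C1 T1 where C1: "C1 \<ge> 0" "T1 \<ge> max T0 0" "\<And>t i. t\<ge>T1 \<Longrightarrow> norm (r t i)
        \<le> (C1 * exp (- s * \<rho> i)) * exp (- \<nu>0 * t)"
      using eventually_atLeast_exp[OF r, of "max T0 0" s] by blast
    obtain C2 T where C2: "C2 \<ge> 0" "T \<ge> T1" "\<And>t i. t\<ge>T \<Longrightarrow> norm (n t i) \<le> (C2 * exp (- s * \<rho> i)) * exp (- \<nu>1 * t)"
      using eventually_atLeast_exp[OF n, of T1 s] by blast
    have T: "T \<ge> 0" "T \<ge> T0" using C1 C2 by auto
    \<comment> \<open>The first summand serves the modes with (\<rho> i)^2 \<le> m, the bracket the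
      fast ones, whose value at time T contributes the exponential factor. D may depend on T and s,
      but not on i.\<close>
    define D where "D = C2 / (\<nu>1 - m) + (C1 * exp ((m + \<epsilon> - \<nu>0) * T) + C2 / (\<delta> / 2))"
    have "norm (r t i - exp (- m * t) *\<^sub>R \<xi> i) \<le> (D * exp (- s * \<rho> i)) * exp (- (m + \<epsilon>) * t)" if t: "t \<ge> T"
        for t i
    proof (cases "(\<rho> i)\<^sup>2 \<le> m")
      case True
      have e: "exp (- \<nu>1 * t) \<le> exp (- (m + \<epsilon>) * t)" using mult_right_mono[of "m + \<epsilon>" \<nu>1 t] \<epsilon> T t
          by (simp only: exp_le_cancel_iff mult_minus_left neg_le_iff_le)
      have "norm (r t i - exp (- (\<rho> i)\<^sup>2 * t) *\<^sub>R \<xi> i)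
          \<le> (C2 * exp (- s * \<rho> i)) / (\<nu>1 - (\<rho> i)\<^sup>2) * exp (- \<nu>1 * t)"
        by (rule linear_ode_slow[where f = "\<lambda>t. r t i" and n = "\<lambda>t. n t i" and T = T, OF d C2(3) _ lim1])
           (use True T t \<open>m < \<nu>1\<close> in auto)
      also have "\<dots> \<le> (C2 * exp (- s * \<rho> i)) / (\<nu>1 - m) * exp (- (m + \<epsilon>) * t)"
        using True \<open>m < \<nu>1\<close> C2(1) by (intro mult_mono e divide_left_mono mult_pos_pos) auto
      also have "\<dots> = C2 / (\<nu>1 - m) * (exp (- s * \<rho> i) * exp (- (m + \<epsilon>) * t))" by simp
      also have "\<dots> \<le> D * (exp (- s * \<rho> i) * exp (- (m + \<epsilon>) * t))"
        unfolding D_def using C1 C2 gap by (intro mult_right_mono) auto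
      also have "exp (- (\<rho> i)\<^sup>2 * t) *\<^sub>R \<xi> i = exp (- m * t) *\<^sub>R \<xi> i"
        by (simp add: \<xi>_def)
      finally show ?thesis by (simp add: mult.assoc)
    next
      case False
      then have \<xi>0: "\<xi> i = 0" by (simp add: \<xi>_def)
      have b: "m + \<delta> \<le> (\<rho> i)\<^sup>2" using gap False by simp
      have n': "norm (n t i) \<le> (C2 * exp (- s * \<rho> i)) * exp (- (m + \<epsilon>) * t)" if "t \<ge> T" for t
      proof -
        have "exp (- \<nu>1 * t) \<le> exp (- (m + \<epsilon>) * t)" using mult_right_mono[of "m + \<epsilon>" \<nu>1 t] \<epsilon> T that
            by (simp only: exp_le_cancel_iff mult_minus_left neg_le_iff_le)
        then show ?thesis using order_trans[OF C2(3)[OF that] mult_left_mono] C2(1) by simp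
      qed
      have "norm (r t i) \<le> exp (- (\<rho> i)\<^sup>2 * (t - T)) * norm (r T i)
          + (C2 * exp (- s * \<rho> i)) / ((\<rho> i)\<^sup>2 - (m + \<epsilon>)) * exp (- (m + \<epsilon>) * t)"
        by (rule linear_ode_fast[where f = "\<lambda>t. r t i" and n = "\<lambda>t. n t i" and T = T, OF d n'])
           (use T t \<epsilon> gap b in auto)
      also have "\<dots> \<le> exp (- (m + \<epsilon>) * (t - T)) * ((C1 * exp (- s * \<rho> i)) * exp (- \<nu>0 * T))
          + (C2 * exp (- s * \<rho> i)) / (\<delta> / 2) * exp (- (m + \<epsilon>) * t)"
      proof (intro add_mono mult_mono C1(3) divide_left_mono mult_pos_pos)
        have "(m + \<epsilon>) * (t - T) \<le> (\<rho> i)\<^sup>2 * (t - T)" using b \<epsilon> gap(1) t by (intro mult_right_mono) auto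
        then show "exp (- (\<rho> i)\<^sup>2 * (t - T)) \<le> exp (- (m + \<epsilon>) * (t - T))"
            by (simp only: exp_le_cancel_iff mult_minus_left neg_le_iff_le)
      qed (use b \<epsilon> gap C2 C1 in auto)
      also have "\<dots> = (C1 * exp ((m + \<epsilon> - \<nu>0) * T) + C2 / (\<delta> / 2)) * (exp (- s * \<rho> i) * exp (- (m + \<epsilon>) * t))"
        by (simp add: algebra_simps flip: exp_add)
      also have "\<dots> \<le> D * (exp (- s * \<rho> i) * exp (- (m + \<epsilon>) * t))"
        unfolding D_def using C2 \<open>m < \<nu>1\<close> by (intro mult_right_mono) auto
      finally show ?thesis by (simp add: \<xi>0 mult.assoc)
    qed
    then show "\<exists>C T. \<forall>t\<ge>T. \<forall>i. norm (r t i - exp (- m * t) *\<^sub>R \<xi> i)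
        \<le> (C * exp (- s * \<rho> i)) * exp (- (m + \<epsilon>) * t)"
      by (intro exI[of _ D] exI[of _ T]) simp
  qed
  then show ?thesis using \<epsilon>(1) by (intro exI[of _ \<xi>] exI[of _ \<epsilon>]) (auto simp: \<xi>_def)
qed

text \<open>Each index with \<rho> i \<le> R contributes at least exp (- R) to the convergent sum of
  \<open>sum_exp\<close>, so their number is bounded.\<close>

lemma finite_rho_le: "finite {i. \<rho> i \<le> R}"
proof (rule ccontr)
  assume inf: "infinite {i. \<rho> i \<le> R}"
  define E where "E = infsum (\<lambda>i. exp (- \<rho> i)) UNIV"
  obtain N :: nat where N: "real N * exp (- R) > E"
    using reals_Archimedean3[of "exp (- R)"] by auto
  obtain F where F: "finite F" "card F = N" "F \<subseteq> {i. \<rho> i \<le> R}"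
    using infinite_arbitrarily_large[OF inf] by blast
  have "real N * exp (- R) = (\<Sum>i\<in>F. exp (- R))" using F by simp
  also have "\<dots> \<le> (\<Sum>i\<in>F. exp (- \<rho> i))" using F by (intro sum_mono) auto
  also have "\<dots> \<le> E" unfolding E_def using F by (intro finite_sum_le_infsum sum_exp) auto
  finally show False using N by simp
qed

definition exp_poly_family :: "(real \<Rightarrow> 'i \<Rightarrow> complex) \<Rightarrow> bool" where
  "exp_poly_family Q \<longleftrightarrow> (\<forall>i. (\<lambda>t. Q t i) \<in> exp_poly) \<and> finite {i. \<exists>t. Q t i \<noteq> 0}"

lemma bil_finite:
  assumes "finite F" "\<And>a. a \<notin> F \<Longrightarrow> x a = 0" "\<And>a. a \<notin> F \<Longrightarrow> y a = 0"
  shows "bil t x y i = (\<Sum>a\<in>F. \<Sum>b\<in>F. K i a b t * x a * y b)"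
proof -
  have "bil t x y i = infsum (\<lambda>p. K i (fst p) (snd p) t * x (fst p) * y (snd p)) (F \<times> F)"
    unfolding bil_def
  proof (rule infsum_cong_neutral)
    fix p assume "p \<in> UNIV - F \<times> F"
    then have "fst p \<notin> F \<or> snd p \<notin> F" by (auto simp: mem_Times_iff)
    then show "K i (fst p) (snd p) t * x (fst p) * y (snd p) = 0" using assms(2,3) by auto
  qed auto
  also have "\<dots> = (\<Sum>a\<in>F. \<Sum>b\<in>F. K i a b t * x a * y b)"
    using assms(1) by (simp add: sum.cartesian_product case_prod_unfold)
  finally show ?thesis .
qed

text \<open>By \<open>K_zero\<close> the output lives where \<rho> i is at most twice a bound for
  \<rho> on the inputs, and this set is finite by \<open>finite_rho_le\<close>.\<close>

lemma exp_poly_family_bil: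
  assumes P: "exp_poly_family P" and Q: "exp_poly_family Q"
  shows "exp_poly_family (\<lambda>t. bil t (P t) (Q t))"
proof -
  define F where "F = {i. \<exists>t. P t i \<noteq> 0} \<union> {i. \<exists>t. Q t i \<noteq> 0}"
  have F: "finite F" "\<And>t a. a \<notin> F \<Longrightarrow> P t a = 0" "\<And>t a. a \<notin> F \<Longrightarrow> Q t a = 0"
    using P Q by (auto simp: F_def exp_poly_family_def)
  have eq: "bil t (P t) (Q t) i = (\<Sum>a\<in>F. \<Sum>b\<in>F. K i a b t * P t a * Q t b)" for t i
    by (rule bil_finite) (use F in auto)
  \<comment> \<open>A crude upper bound for \<rho> on F that makes sense for empty F as
    well.\<close>
  define R where "R = (\<Sum>a\<in>F. \<rho> a)"
  have R: "\<rho> a \<le> R" if "a \<in> F" for a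
    unfolding R_def using that F(1) rho_ge1 by (intro member_le_sum) (auto intro: order_trans[OF zero_le_one])
  have "{i. \<exists>t. bil t (P t) (Q t) i \<noteq> 0} \<subseteq> {i. \<rho> i \<le> R + R}"
  proof safe
    fix i t assume nz: "bil t (P t) (Q t) i \<noteq> 0"
    show "\<rho> i \<le> R + R"
    proof (rule ccontr)
      assume "\<not> \<rho> i \<le> R + R"
      then have "K i a b t = 0" if "a \<in> F" "b \<in> F" for a b using R[OF that(1)] R[OF that(2)]
          by (intro K_zero) simp
      then show False using nz unfolding eq by simp
    qed
  qed
  then have "finite {i. \<exists>t. bil t (P t) (Q t) i \<noteq> 0}" using finite_rho_le finite_subset by blast
  moreover have "(\<lambda>t. bil t (P t) (Q t) i) \<in> exp_poly" for i
    unfolding eq using P Q by (intro exp_poly_sum exp_poly_mult K_exp_poly) (auto simp: exp_poly_family_def)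
  ultimately show ?thesis by (simp add: exp_poly_family_def)
qed

lemma exp_poly_family_sum:
  assumes "\<And>a. a \<in> A \<Longrightarrow> exp_poly_family (Q a)"
  shows "exp_poly_family (\<lambda>t i. \<Sum>a\<in>A. Q a t i)"
proof (cases "finite A")
  case True
  have "{i. \<exists>t. (\<Sum>a\<in>A. Q a t i) \<noteq> 0} \<subseteq> (\<Union>a\<in>A. {i. \<exists>t. Q a t i \<noteq> 0})"
    by (auto dest: sum.not_neutral_contains_not_neutral)
  moreover have "finite (\<Union>a\<in>A. {i. \<exists>t. Q a t i \<noteq> 0})" using True assms by (auto simp: exp_poly_family_def)
  ultimately have "finite {i. \<exists>t. (\<Sum>a\<in>A. Q a t i) \<noteq> 0}" by (rule finite_subset)
  then show ?thesis using assms by (auto simp: exp_poly_family_def intro: exp_poly_sum)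
qed (simp add: exp_poly_family_def exp_poly_const)

text \<open>The gap between \<nu> and m pays for the polynomial growth. On a finite support the
  weight exp (- s \<rho> i) is bounded below, so a constant restores it for every s.\<close>

lemma Oall_exp_poly_family:
  assumes Q: "exp_poly_family Q" and "\<nu> < m"
  shows "Oall \<nu> (\<lambda>t i. exp (- m * t) *\<^sub>R Q t i)"
proof (rule Oall_I)
  fix s
  define F where "F = {i. \<exists>t. Q t i \<noteq> 0}"
  have F: "finite F" "\<And>t a. a \<notin> F \<Longrightarrow> Q t a = 0"
    using Q by (auto simp: F_def exp_poly_family_def)
  have "\<exists>C\<ge>0. \<forall>t\<ge>0. norm (Q t i) \<le> C * exp ((m - \<nu>) * t)" for i
    using Q \<open>\<nu> < m\<close> by (intro exp_poly_growth) (auto simp: exp_poly_family_def)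
  then obtain C where C: "\<And>i. C i \<ge> 0" "\<And>i t. t \<ge> 0 \<Longrightarrow> norm (Q t i) \<le> C i * exp ((m - \<nu>) * t)" by metis
  define D where "D = (\<Sum>i\<in>F. C i * exp (s * \<rho> i))"
  have "norm (exp (- m * t) *\<^sub>R Q t i) \<le> (D * exp (- s * \<rho> i)) * exp (- \<nu> * t)" if "t \<ge> 0" for t i
  proof (cases "i \<in> F")
    case True
    have "norm (exp (- m * t) *\<^sub>R Q t i) \<le> exp (- m * t) * (C i * exp ((m - \<nu>) * t))"
      using C(2)[OF that, of i] by (simp add: mult_left_mono)
    also have "\<dots> = (C i * exp (s * \<rho> i)) * (exp (- s * \<rho> i) * exp (- \<nu> * t))"
      by (simp add: algebra_simps flip: exp_add)
    also have "\<dots> \<le> D * (exp (- s * \<rho> i) * exp (- \<nu> * t))"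
      unfolding D_def using True F(1) C(1) by (intro mult_right_mono member_le_sum) auto
    finally show ?thesis by (simp add: mult.assoc)
  next
    case False
    have "D \<ge> 0" unfolding D_def using C(1) by (intro sum_nonneg) auto
    then show ?thesis using F(2)[OF False] by simp
  qed
  then show "\<exists>C T. \<forall>t\<ge>T. \<forall>i. norm (exp (- m * t) *\<^sub>R Q t i) \<le> (C * exp (- s * \<rho> i)) * exp (- \<nu> * t)" by blast
qed

lemma bil_sum_sum:
  assumes A: "finite A" and P: "\<And>m. m \<in> A \<Longrightarrow> exp_poly_family (P m)"
  shows "bil t (\<lambda>i. \<Sum>m\<in>A. c m *\<^sub>R P m t i) (\<lambda>i. \<Sum>m\<in>A. c m *\<^sub>R P m t i) i
    = (\<Sum>p\<in>A \<times> A. (c (fst p) * c (snd p)) *\<^sub>R bil t (P (fst p) t) (P (snd p) t) i)"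
proof -
  define F where "F = (\<Union>m\<in>A. {i. \<exists>t. P m t i \<noteq> 0})"
  have F: "finite F" using A P by (auto simp: F_def exp_poly_family_def)
  have z: "P m t a = 0" if "m \<in> A" "a \<notin> F" for m a using that by (auto simp: F_def)
  have b: "bil t (P m t) (P j t) i = (\<Sum>a\<in>F. \<Sum>b\<in>F. K i a b t * P m t a * P j t b)" if "m \<in> A" "j \<in> A" for m j
    by (rule bil_finite) (use F z that in auto)
  have "bil t (\<lambda>i. \<Sum>m\<in>A. c m *\<^sub>R P m t i) (\<lambda>i. \<Sum>m\<in>A. c m *\<^sub>R P m t i) i
     = (\<Sum>a\<in>F. \<Sum>b\<in>F. K i a b t * (\<Sum>m\<in>A. c m *\<^sub>R P m t a) * (\<Sum>m\<in>A. c m *\<^sub>R P m t b))"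
    by (rule bil_finite) (use F z in auto)
  also have "\<dots> = (\<Sum>a\<in>F. \<Sum>b\<in>F. \<Sum>p\<in>A\<times>A. (c (fst p) * c (snd p)) *\<^sub>R (K i a b t * P (fst p) t a * P (snd p) t b))"
  proof (intro sum.cong refl)
    fix a b
    have "K i a b t * (\<Sum>m\<in>A. c m *\<^sub>R P m t a) * (\<Sum>m\<in>A. c m *\<^sub>R P m t b)
      = K i a b t * (\<Sum>m\<in>A. \<Sum>j\<in>A. (c m *\<^sub>R P m t a) * (c j *\<^sub>R P j t b))"
      by (simp only: mult.assoc sum_product)
    also have "\<dots> = (\<Sum>p\<in>A\<times>A. (c (fst p) * c (snd p)) *\<^sub>R (K i a b t * P (fst p) t a * P (snd p) t b))"
      by (simp add: sum.cartesian_product case_prod_unfold sum_distrib_left scaleR_conv_of_real algebra_simps)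
    finally show "K i a b t * (\<Sum>m\<in>A. c m *\<^sub>R P m t a) * (\<Sum>m\<in>A. c m *\<^sub>R P m t b)
        = (\<Sum>p\<in>A\<times>A. (c (fst p) * c (snd p)) *\<^sub>R (K i a b t * P (fst p) t a * P (snd p) t b))" .
  qed
  also have "\<dots> = (\<Sum>p\<in>A\<times>A. \<Sum>a\<in>F. \<Sum>b\<in>F. (c (fst p) * c (snd p)) *\<^sub>R (K i a b t * P (fst p) t a * P (snd p) t b))"
    by (subst sum.swap[of _ "A\<times>A"])+ (simp add: sum.swap[of _ "A\<times>A"])
  also have "\<dots> = (\<Sum>p\<in>A \<times> A. (c (fst p) * c (snd p)) *\<^sub>R bil t (P (fst p) t) (P (snd p) t) i)"
    by (intro sum.cong refl) (auto simp: b scaleR_sum_right)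
  finally show ?thesis .
qed

end

section \<open>Recursive construction of the expansion\<close>

locale expansion_system = expansion_coeffs \<rho> K C0
  for \<rho> :: "'i \<Rightarrow> real" and K :: "'i \<Rightarrow> 'i \<Rightarrow> 'i \<Rightarrow> real \<Rightarrow> complex" and C0 :: real +
  fixes q :: "real \<Rightarrow> 'i \<Rightarrow> complex" and T0 \<delta>0 :: real and \<mu> :: "nat \<Rightarrow> real"
  assumes q_der: "t \<ge> T0 \<Longrightarrow>
      ((\<lambda>t. q t i) has_vector_derivative (- (\<rho> i)\<^sup>2 *\<^sub>R q t i - bil t (q t) (q t) i)) (at t)"
    and q_decay: "Oall \<delta>0 q" "\<delta>0 > 0"
    and mu_mono: "strict_mono_on {1..} \<mu>"
    and mu_rho: "(\<rho> i)\<^sup>2 \<in> \<mu> ` {1..}"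
    and mu_add: "x \<in> \<mu> ` {1..} \<Longrightarrow> y \<in> \<mu> ` {1..} \<Longrightarrow> x + y \<in> \<mu> ` {1..}"
    and mu_1: "\<mu> 1 = 1"
begin

lemma mu_less_iff: "a \<ge> 1 \<Longrightarrow> b \<ge> 1 \<Longrightarrow> \<mu> a < \<mu> b \<longleftrightarrow> a < b"
  using strict_mono_onD[OF mu_mono, of a b] strict_mono_onD[OF mu_mono, of b a]
  by (cases a b rule: linorder_cases) auto

lemma mu_le_iff: "a \<ge> 1 \<Longrightarrow> b \<ge> 1 \<Longrightarrow> \<mu> a \<le> \<mu> b \<longleftrightarrow> a \<le> b"
  using mu_less_iff[of b a] by (simp flip: not_less)

lemma mu_ge1: "n \<ge> 1 \<Longrightarrow> \<mu> n \<ge> 1"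
  using mu_le_iff[of 1 n] mu_1 by simp

text \<open>\<mu> n + \<mu> 1 is again an exponent and exceeds \<mu> n. Since \<mu> 1 = 1, a
  remainder beyond order \<mu> n, multiplied by a factor of rate sufficiently close to 1, is beyond
  order \<mu> (n + 1).\<close>

lemma mu_Suc_le: "n \<ge> 1 \<Longrightarrow> \<mu> (Suc n) \<le> \<mu> n + 1"
proof -
  assume n: "n \<ge> 1"
  then obtain m where m: "m \<ge> 1" "\<mu> n + 1 = \<mu> m" using mu_add[of "\<mu> n" "\<mu> 1"] mu_1 by auto
  then have "\<mu> n < \<mu> m" by simp
  then have "Suc n \<le> m" using mu_less_iff n m by simp
  then show ?thesis using mu_le_iff[of "Suc n" m] m n by simp
qed

text \<open>Bootstrap: the quadratic term decays at twice the rate of q, and the linear part permits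
  every rate below 1, as each (\<rho> i)^2 is at least 1. Raising the rate by 3/2 instead of 2 keeps
  the inequality \<nu> < 2 \<open>\<nu>0\<close> strict.\<close>

lemma q_Oall:
  assumes "\<nu> < 1" shows "Oall \<nu> q"
proof -
  have step: "Oall \<nu> q" if "Oall \<nu>0 q" "\<nu> < 1" "\<nu> < 2 * \<nu>0" for \<nu> \<nu>0
  proof -
    have "Oall (2 * \<nu>0) (\<lambda>t. bil t (q t) (q t))" using Oall_bil[OF that(1) that(1)] by simp
    then have n: "Oall ((\<nu> + min 1 (2 * \<nu>0)) / 2) (\<lambda>t. bil t (q t) (q t))"
      by (rule Oall_mono) (use that in auto)
    \<comment> \<open>No (\<rho> i)^2 equals \<nu> < 1, so the amplitudes \<xi> vanish and
      \<open>remainder_step\<close> merely improves the rate of q.\<close>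
    have "\<exists>\<xi> \<epsilon>. \<epsilon> > 0 \<and> (\<forall>i. \<xi> i \<noteq> 0 \<longrightarrow> (\<rho> i)\<^sup>2 = \<nu>) \<and> Oall (\<nu> + \<epsilon>) (\<lambda>t i. q t i - exp (- \<nu> * t) *\<^sub>R \<xi> i)"
    proof (rule remainder_step[OF q_der that(1) n, where m = \<nu> and \<delta> = "1 - \<nu>"])
      have r1: "(\<rho> i)\<^sup>2 \<ge> 1" for i using rho_ge1[of i] by simp
      show "(\<rho> i)\<^sup>2 < \<nu>0" if "(\<rho> i)\<^sup>2 < \<nu>" for i using r1[of i] that \<open>\<nu> < 1\<close> by linarith
      show "\<nu> + (1 - \<nu>) \<le> (\<rho> i)\<^sup>2" for i using r1[of i] by linarith
    qed (use that in auto)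
    then obtain \<xi> \<epsilon> where x: "\<epsilon> > 0" "\<And>i. \<xi> i \<noteq> 0 \<Longrightarrow> (\<rho> i)\<^sup>2 = \<nu>"
        "Oall (\<nu> + \<epsilon>) (\<lambda>t i. q t i - exp (- \<nu> * t) *\<^sub>R \<xi> i)"
      by blast
    have "\<xi> i = 0" for i
    proof (rule ccontr)
      assume "\<xi> i \<noteq> 0"
      then have "(\<rho> i)\<^sup>2 = \<nu>" by (rule x(2))
      moreover have "(\<rho> i)\<^sup>2 \<ge> 1" using rho_ge1[of i] by simp
      ultimately show False using that by simp
    qed
    then have "Oall (\<nu> + \<epsilon>) q" using x(3) by simp
    then show ?thesis by (rule Oall_mono) (use x in simp)
  qed
  have it: "Oall (min \<nu> (\<delta>0 * (3/2) ^ n)) q" for n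
  proof (induction n)
    case 0
    show ?case using q_decay by (auto intro: Oall_mono)
  next
    case (Suc n)
    show ?case
    proof (cases "\<nu> \<le> \<delta>0 * (3/2) ^ n")
      case True
      then have "Oall \<nu> q" using Suc by (simp add: min_def)
      then show ?thesis by (rule Oall_mono) simp
    next
      case False
      then have 1: "Oall (\<delta>0 * (3/2) ^ n) q" using Suc by (simp add: min_def)
      have 2: "\<delta>0 * (3/2) ^ n > 0" using q_decay(2) by simp
      show ?thesis by (rule step[OF 1]) (use assms 2 in \<open>auto simp: min_def\<close>)
    qed
  qed
  obtain n where "(3/2::real) ^ n > \<nu> / \<delta>0" using real_arch_pow[of "3/2" "\<nu> / \<delta>0"] by auto
  then have "\<nu> < \<delta>0 * (3/2) ^ n" using q_decay(2) by (simp add: field_simps)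
  then show ?thesis using it[of n] by (simp add: min_def)
qed

text \<open>The coefficient of exp (- \<mu> n t) in the bilinear form of the formal series with
  itself. Positivity of \<mu> confines both factors to indices below n, which makes the system for
  the \<open>Q n\<close> triangular.\<close>

definition force :: "(nat \<Rightarrow> real \<Rightarrow> 'i \<Rightarrow> complex) \<Rightarrow> nat \<Rightarrow> real \<Rightarrow> 'i \<Rightarrow> complex" where
  "force Q n t i = (\<Sum>p\<in>{p \<in> {1..<n} \<times> {1..<n}. \<mu> (fst p) + \<mu> (snd p) = \<mu> n}. bil t (Q (fst p) t) (Q (snd p) t)
      i)"

definition remainder :: "nat \<Rightarrow> (nat \<Rightarrow> real \<Rightarrow> 'i \<Rightarrow> complex) \<Rightarrow> real \<Rightarrow> 'i \<Rightarrow> complex" where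
  "remainder N Q t i = q t i - (\<Sum>n=1..N. exp (- \<mu> n * t) *\<^sub>R Q n t i)"

text \<open>The condition \<open>\<mu> (Suc N) < \<nu> + 1\<close> makes the interactions of the remainder with \<open>q\<close>, whose decay rate
  is any number below 1, negligible at order \<open>\<mu> (Suc N)\<close>.  At \<open>N = 0\<close> there is no \<open>\<mu> N\<close> to compare with.\<close>

definition good :: "nat \<Rightarrow> (nat \<Rightarrow> real \<Rightarrow> 'i \<Rightarrow> complex) \<Rightarrow> bool" where
  "good N Q \<longleftrightarrow>
    (\<forall>n\<in>{1..N}. exp_poly_family (Q n) \<and> (\<forall>t i. ((\<lambda>t. Q n t i) has_vector_derivative
        (- ((\<rho> i)\<^sup>2 - \<mu> n) *\<^sub>R Q n t i - force Q n t i)) (at t))) \<and>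
    (\<exists>\<nu>. Oall \<nu> (remainder N Q) \<and> \<mu> (Suc N) < \<nu> + 1 \<and> (\<forall>i. (\<rho> i)\<^sup>2 < \<mu> (Suc N) \<longrightarrow> (\<rho> i)\<^sup>2 < \<nu>)
        \<and> (N \<ge> 1 \<longrightarrow> \<mu> N < \<nu>))"

lemma force_cong: "(\<And>m. m < n \<Longrightarrow> Q m = Q' m) \<Longrightarrow> force Q n = force Q' n"
  unfolding force_def by (intro ext sum.cong) auto

lemma remainder_cong: "(\<And>m. m \<in> {1..N} \<Longrightarrow> Q m = Q' m) \<Longrightarrow> remainder N Q = remainder N Q'"
  unfolding remainder_def by (intro ext arg_cong2[where f = minus] sum.cong) auto

lemma good_0: "good 0 Q"
  unfolding good_def
\<comment> \<open>Any rate strictly between 0 and 1 would do: \<open>q_Oall\<close> asks for less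
  than 1, and \<mu> 1 = 1 < \<nu> + 1 for more than 0.\<close>
proof (intro conjI exI[of _ "1/2"])
  show "Oall (1/2) (remainder 0 Q)" using q_Oall[of "1/2"] by (simp add: remainder_def[abs_def])
  show "\<forall>i. (\<rho> i)\<^sup>2 < \<mu> (Suc 0) \<longrightarrow> (\<rho> i)\<^sup>2 < 1 / 2"
  proof (intro allI impI)
    fix i assume "(\<rho> i)\<^sup>2 < \<mu> (Suc 0)"
    moreover have "(\<rho> i)\<^sup>2 \<ge> 1" using rho_ge1[of i] by simp
    ultimately show "(\<rho> i)\<^sup>2 < 1 / 2" using mu_1 by simp
  qed
qed (use mu_1 in auto)

text \<open>Pairs are grouped by the index of \<mu> a + \<mu> b among the exponents. Every pair
  reaching \<mu> n with n \<le> Suc N has both indices at most N, so the forces up to order Suc N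
  are complete; all other pairs lie beyond.\<close>

lemma interactions_split:
  assumes Q: "\<And>n. n \<in> {1..N} \<Longrightarrow> exp_poly_family (Q n)"
  shows "bil t (\<lambda>i. \<Sum>n=1..N. exp (- \<mu> n * t) *\<^sub>R Q n t i) (\<lambda>i. \<Sum>n=1..N. exp (- \<mu> n * t) *\<^sub>R Q n t i) i
    = (\<Sum>n=1..Suc N. exp (- \<mu> n * t) *\<^sub>R force Q n t i)
    + (\<Sum>p\<in>{p \<in> {1..N} \<times> {1..N}. \<mu> (Suc N) < \<mu> (fst p) + \<mu> (snd p)}.
         exp (- (\<mu> (fst p) + \<mu> (snd p)) * t) *\<^sub>R bil t (Q (fst p) t) (Q (snd p) t) i)"
proof -
  define A where "A = {1..N} \<times> {1..N}"
  define h where "h p = exp (- (\<mu> (fst p) + \<mu> (snd p)) * t) *\<^sub>R bil t (Q (fst p) t) (Q (snd p) t) i" for p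
  define B where "B = {p \<in> A. \<mu> (fst p) + \<mu> (snd p) \<le> \<mu> (Suc N)}"
  have "\<exists>k\<ge>1. \<mu> (fst p) + \<mu> (snd p) = \<mu> k" if "p \<in> A" for p
    using mu_add[of "\<mu> (fst p)" "\<mu> (snd p)"] that by (auto simp: A_def)
  then obtain k where k: "\<And>p. p \<in> A \<Longrightarrow> k p \<ge> 1 \<and> \<mu> (fst p) + \<mu> (snd p) = \<mu> (k p)" by metis
  have fin: "finite A" by (simp add: A_def)
  have "bil t (\<lambda>i. \<Sum>n=1..N. exp (- \<mu> n * t) *\<^sub>R Q n t i) (\<lambda>i. \<Sum>n=1..N. exp (- \<mu> n * t) *\<^sub>R Q n t i) i
    = sum h A"
    unfolding A_def h_def by (subst bil_sum_sum)
        (auto simp: Q algebra_simps simp flip: exp_add intro!: sum.cong)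
  also have "\<dots> = sum h B + sum h (A - B)"
    using fin by (subst sum.subset_diff[of B A]) (auto simp: B_def)
  also have "sum h B = (\<Sum>n\<in>{1..Suc N}. \<Sum>p\<in>{p \<in> B. k p = n}. h p)"
  proof (rule sum.group[symmetric])
    show "k ` B \<subseteq> {1..Suc N}" using k mu_le_iff[of _ "Suc N"] by (fastforce simp: B_def)
  qed (use fin in \<open>auto simp: B_def\<close>)
  also have "\<dots> = (\<Sum>n=1..Suc N. exp (- \<mu> n * t) *\<^sub>R force Q n t i)"
  proof (rule sum.cong[OF refl])
    fix n assume n: "n \<in> {1..Suc N}"
    have eq: "{p \<in> B. k p = n} = {p \<in> {1..<n} \<times> {1..<n}. \<mu> (fst p) + \<mu> (snd p) = \<mu> n}"
    proof (intro equalityI subsetI)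
      fix p assume p: "p \<in> {p \<in> B. k p = n}"
      then have pA: "p \<in> A" "k p = n" by (auto simp: B_def)
      then have 1: "fst p \<ge> 1" "snd p \<ge> 1" "\<mu> (fst p) + \<mu> (snd p) = \<mu> n" using k[of p] by (auto simp: A_def)
      then have "\<mu> (fst p) < \<mu> n" "\<mu> (snd p) < \<mu> n" using mu_ge1[of "fst p"] mu_ge1[of "snd p"] by linarith+
      then have "fst p < n" "snd p < n" using mu_less_iff 1 n by auto
      then show "p \<in> {p \<in> {1..<n} \<times> {1..<n}. \<mu> (fst p) + \<mu> (snd p) = \<mu> n}" using 1 by (auto simp: mem_Times_iff)
    next
      fix p assume p: "p \<in> {p \<in> {1..<n} \<times> {1..<n}. \<mu> (fst p) + \<mu> (snd p) = \<mu> n}"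
      then have pA: "p \<in> A" using n by (auto simp: A_def mem_Times_iff)
      have "\<mu> (k p) = \<mu> n" using k[OF pA] p by auto
      then have "k p = n" using k[OF pA] n mu_less_iff[of "k p" n] mu_less_iff[of n "k p"]
          by (cases "k p" n rule: linorder_cases) auto
      moreover have "\<mu> n \<le> \<mu> (Suc N)" using n mu_le_iff by auto
      ultimately show "p \<in> {p \<in> B. k p = n}" using pA p by (auto simp: B_def)
    qed
    show "(\<Sum>p\<in>{p \<in> B. k p = n}. h p) = exp (- \<mu> n * t) *\<^sub>R force Q n t i"
      unfolding eq force_def scaleR_sum_right by (rule sum.cong) (auto simp: h_def)
  qed
  also have "A - B = {p \<in> {1..N} \<times> {1..N}. \<mu> (Suc N) < \<mu> (fst p) + \<mu> (snd p)}"
    by (auto simp: A_def B_def)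
  finally show ?thesis by (simp add: h_def)
qed

text \<open>\<open>P0\<close> answers the forcing of order m. For modes with (\<rho> i)^2 = m the
  equation for the coefficient leaves a constant free; \<open>remainder_step\<close> reads these
  constants \<xi> off from the solution, and the new coefficient is \<open>P0\<close> plus
  \<xi>.\<close>

lemma good_step:
  assumes "good N Q"
  shows "\<exists>P. good (Suc N) (Q(Suc N := P))"
proof -
  define m where "m = \<mu> (Suc N)"
  define m2 where "m2 = \<mu> (Suc (Suc N))"
  have m: "m < m2" "m \<ge> 1" "m2 \<le> m + 1" unfolding m_def m2_def
      using mu_less_iff[of "Suc N" "Suc (Suc N)"] mu_ge1[of "Suc N"] mu_Suc_le[of "Suc N"] by auto
  obtain \<nu> where \<nu>: "Oall \<nu> (remainder N Q)" "m < \<nu> + 1" "\<And>i. (\<rho> i)\<^sup>2 < m \<Longrightarrow> (\<rho> i)\<^sup>2 < \<nu>" "N \<ge> 1 \<Longrightarrow> \<mu> N < \<nu>"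
    using assms unfolding good_def m_def by blast
  have Q: "\<And>n. n \<in> {1..N} \<Longrightarrow> exp_poly_family (Q n)"
    and Qd: "\<And>n t i. n \<in> {1..N} \<Longrightarrow> ((\<lambda>t. Q n t i) has_vector_derivative
        (- ((\<rho> i)\<^sup>2 - \<mu> n) *\<^sub>R Q n t i - force Q n t i)) (at t)"
    using assms unfolding good_def by blast+
  define S where "S t i = (\<Sum>n=1..N. exp (- \<mu> n * t) *\<^sub>R Q n t i)" for t i
  \<comment> \<open>Half of the slack in m < \<nu> + 1: factors of rate 1 - \<eta> still carry the
    remainder beyond order m.\<close>
  define \<eta> where "\<eta> = (\<nu> + 1 - m) / 2"
  have \<eta>: "\<eta> > 0" "\<nu> + (1 - \<eta>) > m" using \<nu>(2) by (auto simp: \<eta>_def field_simps)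
  have qO: "Oall (1 - \<eta>) q" using \<eta> by (intro q_Oall) simp
  have SO: "Oall (1 - \<eta>) S" unfolding S_def
  proof (intro Oall_sum Oall_exp_poly_family Q)
    fix n assume "n \<in> {1..N}"
    then show "1 - \<eta> < \<mu> n" using mu_ge1[of n] \<eta> by simp
  qed
  have fsF: "exp_poly_family (force Q (Suc N))"
    unfolding force_def[abs_def] by (intro exp_poly_family_sum exp_poly_family_bil Q) auto
  define g where "g t i = force Q (Suc N) t i" for t i
  \<comment> \<open>The zero solution is singled out wherever the force vanishes; arbitrary choices
    at infinitely many i could destroy the finite support.\<close>
  have "\<exists>P. P \<in> exp_poly \<and> ((\<forall>t. g t i = 0) \<longrightarrow> P = (\<lambda>t. 0))
      \<and> (\<forall>t. (P has_vector_derivative (- ((\<rho> i)\<^sup>2 - m) *\<^sub>R P t - g t i)) (at t))" for i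
  proof (cases "\<forall>t. g t i = 0")
    case True
    then show ?thesis by (intro exI[of _ "\<lambda>t. 0"]) (auto simp: exp_poly_const)
  next
    case False
    have "(\<lambda>t. g t i) \<in> exp_poly" using fsF by (auto simp: exp_poly_family_def g_def)
    from exp_poly_solve[OF this, of "(\<rho> i)\<^sup>2 - m"] show ?thesis using False by (auto simp: scaleR_conv_of_real)
  qed
  then obtain P0 where P0: "\<And>i. P0 i \<in> exp_poly" "\<And>i. (\<forall>t. g t i = 0) \<Longrightarrow> P0 i = (\<lambda>t. 0)"
    "\<And>i t. (P0 i has_vector_derivative (- ((\<rho> i)\<^sup>2 - m) *\<^sub>R P0 i t - g t i)) (at t)"
    by metis
  have fsP0: "exp_poly_family (\<lambda>t i. P0 i t)"
  proof -
    have "{i. \<exists>t. P0 i t \<noteq> 0} \<subseteq> {i. \<exists>t. g t i \<noteq> 0}"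
    proof safe
      fix i t assume nz: "P0 i t \<noteq> 0"
      show "\<exists>t. g t i \<noteq> 0"
      proof (rule ccontr)
        assume "\<not> (\<exists>t. g t i \<noteq> 0)"
        then have "P0 i = (\<lambda>t. 0)" by (intro P0(2)) simp
        then show False using nz by simp
      qed
    qed
    moreover have "finite {i. \<exists>t. g t i \<noteq> 0}" using fsF by (simp add: exp_poly_family_def g_def)
    ultimately show ?thesis using P0(1) by (auto simp: exp_poly_family_def dest: finite_subset)
  qed
  define r where "r t i = remainder N Q t i - exp (- m * t) *\<^sub>R P0 i t" for t i
  define nn where "nn t i = bil t (q t) (q t) i - (\<Sum>n=1..Suc N. exp (- \<mu> n * t) *\<^sub>R force Q n t i)" for t i
  have expd: "((\<lambda>t. exp (- \<beta> * t) *\<^sub>R f t) has_vector_derivative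
      (- (\<rho> i)\<^sup>2 *\<^sub>R (exp (- \<beta> * t) *\<^sub>R f t) - exp (- \<beta> * t) *\<^sub>R h)) (at t)"
    if "(f has_vector_derivative (- ((\<rho> i)\<^sup>2 - \<beta>) *\<^sub>R f t - h)) (at t)" for f :: "real \<Rightarrow> complex" and \<beta> t h i
  proof -
    have e: "((\<lambda>t. exp (- \<beta> * t)) has_field_derivative (- \<beta> * exp (- \<beta> * t))) (at t)"
      by (auto intro!: derivative_eq_intros)
    show ?thesis by (rule has_vector_derivative_eq_rhs[OF has_vector_derivative_scaleR[OF e that]])
        (simp add: algebra_simps)
  qed
  have rd: "((\<lambda>t. r t i) has_vector_derivative (- (\<rho> i)\<^sup>2 *\<^sub>R r t i - nn t i)) (at t)" if "t \<ge> T0" for t i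
  proof -
    have 1: "((\<lambda>t. \<Sum>n=1..N. exp (- \<mu> n * t) *\<^sub>R Q n t i) has_vector_derivative
      (\<Sum>n=1..N. - (\<rho> i)\<^sup>2 *\<^sub>R (exp (- \<mu> n * t) *\<^sub>R Q n t i) - exp (- \<mu> n * t) *\<^sub>R force Q n t i)) (at t)"
      by (intro has_vector_derivative_sum expd Qd) auto
    have 2: "((\<lambda>t. exp (- m * t) *\<^sub>R P0 i t) has_vector_derivative (- (\<rho> i)\<^sup>2 *\<^sub>R (exp (- m * t) *\<^sub>R P0 i t)
        - exp (- m * t) *\<^sub>R g t i)) (at t)"
      by (intro expd P0)
    have 3: "(\<Sum>n=1..N. - (\<rho> i)\<^sup>2 *\<^sub>R (exp (- \<mu> n * t) *\<^sub>R Q n t i) - exp (- \<mu> n * t) *\<^sub>R force Q n t i)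
      = - (\<rho> i)\<^sup>2 *\<^sub>R (\<Sum>n=1..N. exp (- \<mu> n * t) *\<^sub>R Q n t i) - (\<Sum>n=1..N. exp (- \<mu> n * t) *\<^sub>R force Q n t i)"
      by (simp only: sum_subtractf scaleR_sum_right)
    have 4: "nn t i = bil t (q t) (q t) i - ((\<Sum>n=1..N. exp (- \<mu> n * t) *\<^sub>R force Q n t i)
        + exp (- m * t) *\<^sub>R g t i)"
      by (simp add: nn_def g_def m_def)
    show ?thesis
      unfolding r_def remainder_def
      by (rule has_vector_derivative_eq_rhs[OF has_vector_derivative_diff[OF
          has_vector_derivative_diff[OF q_der[OF that] 1] 2]])
         (simp only: 3 4, simp add: algebra_simps)
  qed
  \<comment> \<open>Subtracting exp (- m t) \<open>P0\<close> may lower the rate. The midpoint stays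
    above every (\<rho> i)^2 < m, since these are exponents of index at most N; for N = 0 there are
    none, and any number below m serves.\<close>
  define \<nu>' where "\<nu>' = (if N = 0 then m - 1 else (\<mu> N + m) / 2)"
  have muN: "\<mu> N < m" if "N \<ge> 1" unfolding m_def using mu_less_iff[of N "Suc N"] that by simp
  have \<nu>'m: "\<nu>' < m" using muN by (auto simp: \<nu>'_def)
  have rho_mu: "(\<rho> i)\<^sup>2 = \<mu> j \<Longrightarrow> j \<ge> 1 \<Longrightarrow> (\<rho> i)\<^sup>2 < \<mu> (Suc k) \<Longrightarrow> j \<le> k" for i j k
    using mu_less_iff[of j "Suc k"] by simp
  have low': "(\<rho> i)\<^sup>2 < \<nu>'" if lt: "(\<rho> i)\<^sup>2 < m" for i
  proof -
    obtain j where j: "j \<ge> 1" "(\<rho> i)\<^sup>2 = \<mu> j" using mu_rho[of i] by auto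
    then have jN: "j \<le> N" using rho_mu lt unfolding m_def by blast
    then have "\<mu> j \<le> \<mu> N" using mu_le_iff[of j N] j by simp
    then show ?thesis using j jN muN by (simp add: \<nu>'_def)
  qed
  have rO: "Oall (min \<nu> \<nu>') r"
    unfolding r_def[abs_def]
    by (intro Oall_diff Oall_mono[OF \<nu>(1)] Oall_mono[OF Oall_exp_poly_family[OF fsP0 \<nu>'m]]) auto
  \<comment> \<open>The two bounds serve the two sources of error: products with the remainder, from
    q q - S S = (q - S) q + S (q - S), and products of known terms, whose exponents beyond m are at
    least \<open>m2\<close>.\<close>
  define \<nu>1 where "\<nu>1 = min (\<nu> + (1 - \<eta>)) ((m + m2) / 2)"
  have \<nu>1: "m < \<nu>1" using \<eta> m by (auto simp: \<nu>1_def)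
  have nnO: "Oall \<nu>1 nn"
  proof -
    have rem: "remainder N Q = (\<lambda>t i. q t i - S t i)" by (intro ext) (simp add: remainder_def S_def)
    have \<nu>1_le: "\<nu>1 \<le> \<nu> + (1 - \<eta>)" "\<nu>1 \<le> (1 - \<eta>) + \<nu>" by (auto simp: \<nu>1_def)
    define R2 where "R2 t i = (\<Sum>p\<in>{p \<in> {1..N} \<times> {1..N}. \<mu> (Suc N) < \<mu> (fst p) + \<mu> (snd p)}.
         exp (- (\<mu> (fst p) + \<mu> (snd p)) * t) *\<^sub>R bil t (Q (fst p) t) (Q (snd p) t) i)" for t i
    have a: "Oall \<nu>1 (\<lambda>t. bil t (\<lambda>i. q t i - S t i) (q t))"
      using Oall_mono[OF Oall_bil[OF \<nu>(1) qO] \<nu>1_le(1)] unfolding rem .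
    have b: "Oall \<nu>1 (\<lambda>t. bil t (S t) (\<lambda>i. q t i - S t i))"
      using Oall_mono[OF Oall_bil[OF SO \<nu>(1)] \<nu>1_le(2)] unfolding rem .
    have c: "Oall \<nu>1 R2"
      unfolding R2_def
    proof (intro Oall_sum Oall_exp_poly_family exp_poly_family_bil Q)
      fix p assume p: "p \<in> {p \<in> {1..N} \<times> {1..N}. \<mu> (Suc N) < \<mu> (fst p) + \<mu> (snd p)}"
      then have "\<mu> (fst p) + \<mu> (snd p) \<in> \<mu> ` {1..}" by (intro mu_add) auto
      then obtain k where k: "k \<ge> 1" "\<mu> (fst p) + \<mu> (snd p) = \<mu> k" by auto
      then have "Suc N < k" using p mu_less_iff[of "Suc N" k] by auto
      then have "m2 \<le> \<mu> k" unfolding m2_def using mu_le_iff[of "Suc (Suc N)" k] by auto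
      then have "(m + m2) / 2 < \<mu> k" using m(1) by (simp add: field_simps)
      moreover have "\<nu>1 \<le> (m + m2) / 2" unfolding \<nu>1_def by (rule min.cobounded2)
      ultimately show "\<nu>1 < \<mu> (fst p) + \<mu> (snd p)" using k(2) by simp
      show "fst p \<in> {1..N}" "snd p \<in> {1..N}" using p by auto
    qed
    show ?thesis
    proof (rule Oall_cong[OF _ Oall_add[OF Oall_add[OF a b] c]])
      show "\<forall>\<^sub>F t in at_top. \<forall>i. bil t (\<lambda>i. q t i - S t i) (q t) i + bil t (S t) (\<lambda>i. q t i - S t i) i
          + R2 t i = nn t i"
        using bil_diff_eventually[OF qO SO]
      proof eventually_elim
        case (elim t)
        show ?case
        proof
          fix i
          have "bil t (S t) (S t) i = (\<Sum>n=1..Suc N. exp (- \<mu> n * t) *\<^sub>R force Q n t i) + R2 t i"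
            using interactions_split[where N=N and Q=Q and t=t and i=i, OF Q] unfolding S_def R2_def by simp
          then show "bil t (\<lambda>i. q t i - S t i) (q t) i + bil t (S t) (\<lambda>i. q t i - S t i) i + R2 t i = nn t i"
            using elim[rule_format, of i] unfolding nn_def by (simp add: algebra_simps)
        qed
      qed
    qed
  qed
  have "\<exists>\<xi> \<epsilon>. \<epsilon> > 0 \<and> (\<forall>i. \<xi> i \<noteq> 0 \<longrightarrow> (\<rho> i)\<^sup>2 = m) \<and> Oall (m + \<epsilon>) (\<lambda>t i. r t i - exp (- m * t) *\<^sub>R \<xi> i)"
  proof (rule remainder_step[OF rd rO nnO \<nu>1, where \<delta> = "m2 - m"])
    show "(\<rho> i)\<^sup>2 < min \<nu> \<nu>'" if "(\<rho> i)\<^sup>2 < m" for i using \<nu>(3) low' that by simp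
    show "m + (m2 - m) \<le> (\<rho> i)\<^sup>2" if "(\<rho> i)\<^sup>2 > m" for i
    proof -
      obtain j where j: "j \<ge> 1" "(\<rho> i)\<^sup>2 = \<mu> j" using mu_rho[of i] by auto
      then have "Suc N < j" using that mu_less_iff[of "Suc N" j] by (simp add: m_def)
      then show ?thesis using j mu_le_iff[of "Suc (Suc N)" j] by (simp add: m2_def)
    qed
  qed (use m in auto)
  then obtain \<xi> \<epsilon> where \<xi>: "\<epsilon> > 0" "\<And>i. \<xi> i \<noteq> 0 \<Longrightarrow> (\<rho> i)\<^sup>2 = m"
      "Oall (m + \<epsilon>) (\<lambda>t i. r t i - exp (- m * t) *\<^sub>R \<xi> i)"
    by blast
  define P where "P t i = P0 i t + \<xi> i" for t i
  define Q' where "Q' = Q(Suc N := P)"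
  have Q'Q: "Q' n = Q n" if "n \<noteq> Suc N" for n using that by (simp add: Q'_def)
  have force': "force Q' n = force Q n" if "n \<le> Suc N" for n
    by (rule force_cong) (use that in \<open>auto simp: Q'_def\<close>)
  have fsP: "exp_poly_family P"
  proof -
    \<comment> \<open>As \<rho> i \<ge> 1, the equation (\<rho> i)^2 = m implies \<rho> i \<le> m,
      so \<xi> has finite support too.\<close>
    have "{i. \<exists>t. P t i \<noteq> 0} \<subseteq> {i. \<exists>t. P0 i t \<noteq> 0} \<union> {i. \<rho> i \<le> m}"
    proof safe
      fix i t assume nz: "P t i \<noteq> 0" and le: "\<not> \<rho> i \<le> m"
      have "\<rho> i * 1 \<le> \<rho> i * \<rho> i" using rho_ge1[of i] by (intro mult_left_mono) auto
      then have "(\<rho> i)\<^sup>2 \<noteq> m" using le by (auto simp: power2_eq_square)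
      then have "\<xi> i = 0" using \<xi>(2) by blast
      then show "\<exists>t. P0 i t \<noteq> 0" using nz by (auto simp: P_def)
    qed
    moreover have "finite ({i. \<exists>t. P0 i t \<noteq> 0} \<union> {i. \<rho> i \<le> m})" using fsP0 finite_rho_le
        by (simp add: exp_poly_family_def)
    ultimately have "finite {i. \<exists>t. P t i \<noteq> 0}" by (rule finite_subset)
    then show ?thesis unfolding exp_poly_family_def P_def by (auto intro: exp_poly_add P0 exp_poly_const)
  qed
  have Pd: "((\<lambda>t. P t i) has_vector_derivative (- ((\<rho> i)\<^sup>2 - m) *\<^sub>R P t i - force Q (Suc N) t i)) (at t)"
      for t i
  proof -
    have "((\<lambda>t. P t i) has_vector_derivative (- ((\<rho> i)\<^sup>2 - m) *\<^sub>R P0 i t - g t i)) (at t)"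
      unfolding P_def using has_vector_derivative_add[OF P0(3)[of i t] has_vector_derivative_const[of "\<xi> i"]]
          by simp
    moreover have "((\<rho> i)\<^sup>2 - m) *\<^sub>R \<xi> i = 0" using \<xi>(2)[of i] by auto
    then have "- ((\<rho> i)\<^sup>2 - m) *\<^sub>R P0 i t - g t i = - ((\<rho> i)\<^sup>2 - m) *\<^sub>R P t i - force Q (Suc N) t i"
      by (auto simp: P_def g_def scaleR_add_right)
    ultimately show ?thesis by simp
  qed
  have "good (Suc N) Q'"
    unfolding good_def
  proof (intro conjI ballI allI exI[of _ "m + \<epsilon>"] impI)
    fix n assume n: "n \<in> {1..Suc N}"
    show "exp_poly_family (Q' n)" using n Q fsP by (cases "n = Suc N") (auto simp: Q'_def)
    show "((\<lambda>t. Q' n t i) has_vector_derivative (- ((\<rho> i)\<^sup>2 - \<mu> n) *\<^sub>R Q' n t i - force Q' n t i)) (at t)"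
        for t i
    proof (cases "n = Suc N")
      case True
      then show ?thesis using Pd[of i t] force'[of n] by (simp add: Q'_def m_def)
    next
      case False
      then show ?thesis using Qd[of n i t] n force'[of n] by (simp add: Q'Q)
    qed
  next
    have "remainder (Suc N) Q' t i = r t i - exp (- m * t) *\<^sub>R \<xi> i" for t i
    proof -
      have "(\<Sum>n=1..N. exp (- \<mu> n * t) *\<^sub>R Q' n t i) = (\<Sum>n=1..N. exp (- \<mu> n * t) *\<^sub>R Q n t i)"
        by (intro sum.cong refl) (simp add: Q'Q)
      then show ?thesis
        by (simp add: remainder_def r_def Q'_def P_def m_def algebra_simps)
    qed
    then have "remainder (Suc N) Q' = (\<lambda>t i. r t i - exp (- m * t) *\<^sub>R \<xi> i)" by (intro ext)
    then show "Oall (m + \<epsilon>) (remainder (Suc N) Q')" using \<xi>(3) by simp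
    show "\<mu> (Suc (Suc N)) < m + \<epsilon> + 1" using m \<xi> by (simp add: m2_def)
    show "\<mu> (Suc N) < m + \<epsilon>" using \<xi> by (simp add: m_def)
    fix i assume "(\<rho> i)\<^sup>2 < \<mu> (Suc (Suc N))"
    moreover obtain j where j: "j \<ge> 1" "(\<rho> i)\<^sup>2 = \<mu> j" using mu_rho[of i] by auto
    ultimately have "j \<le> Suc N" using rho_mu by blast
    then have "\<mu> j \<le> m" unfolding m_def using mu_le_iff j by simp
    then show "(\<rho> i)\<^sup>2 < m + \<epsilon>" using j \<xi> by simp
  qed
  then show ?thesis unfolding Q'_def by (rule exI[of _ P])
qed

text \<open>A later stage changes only its newest coefficient, so the diagonal \<open>Qs n n\<close>
  agrees with stage N at every index up to N.\<close>

theorem expansion: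
  "\<exists>Q. (\<forall>n\<ge>1. exp_poly_family (Q n)) \<and>
     (\<forall>N\<ge>1. \<exists>\<epsilon>>0. Oall (\<mu> N + \<epsilon>) (\<lambda>t i. q t i - (\<Sum>n=1..N. exp (- \<mu> n * t) *\<^sub>R Q n t i)))"
proof -
  have "\<exists>Qs. \<forall>N. good N (Qs N) \<and> (\<exists>P. Qs (Suc N) = (Qs N)(Suc N := P))"
  proof (rule dependent_nat_choice)
    show "\<exists>Q. good 0 Q" using good_0 by blast
    show "\<exists>Q'. good (Suc N) Q' \<and> (\<exists>P. Q' = Q(Suc N := P))" if gN: "good N Q" for Q N
    proof -
      obtain P where "good (Suc N) (Q(Suc N := P))" using good_step[OF gN] ..
      then show ?thesis by (intro exI[of _ "Q(Suc N := P)"] conjI exI[of _ P] refl)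
    qed
  qed
  then obtain Qs where g: "\<And>N. good N (Qs N)" and st: "\<And>N. \<exists>P. Qs (Suc N) = (Qs N)(Suc N := P)" by blast
  have stable: "Qs (n + k) n = Qs n n" for n k
  proof (induction k)
    case (Suc k)
    obtain P where "Qs (Suc (n + k)) = (Qs (n + k))(Suc (n + k) := P)" using st[of "n + k"] ..
    then show ?case using Suc by simp
  qed simp
  have st2: "Qs N n = Qs n n" if "n \<le> N" for n N
    using stable[of n "N - n"] that by simp
  show ?thesis
  proof (intro exI[of _ "\<lambda>n. Qs n n"] conjI allI impI)
    fix n :: nat assume "n \<ge> 1"
    then show "exp_poly_family (Qs n n)" using g[of n] by (simp add: good_def)
  next
    fix N :: nat assume N: "N \<ge> 1"
    obtain \<nu> where \<nu>: "Oall \<nu> (remainder N (Qs N))" "\<mu> N < \<nu>"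
      using g[of N] N unfolding good_def by blast
    have "remainder N (Qs N) = remainder N (\<lambda>n. Qs n n)" by (rule remainder_cong) (rule st2, simp)
    then have "Oall (\<mu> N + (\<nu> - \<mu> N)) (\<lambda>t i. q t i - (\<Sum>n=1..N. exp (- \<mu> n * t) *\<^sub>R Qs n n t i))"
      using \<nu>(1) by (simp add: remainder_def[abs_def])
    then show "\<exists>\<epsilon>>0. Oall (\<mu> N + \<epsilon>) (\<lambda>t i. q t i - (\<Sum>n=1..N. exp (- \<mu> n * t) *\<^sub>R Qs n n t i))"
      using \<nu>(2) by (intro exI[of _ "\<nu> - \<mu> N"]) simp
  qed
qed

end

section \<open>Analytic decay of small solutions\<close>

text \<open>Made for bounds obtained from Cauchy-Schwarz, where one factor is the square root of a
  sum of g: the tails of g then control the tails of a uniformly in t.\<close>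

lemma uniform_limit_of_tail:
  fixes a :: "'k \<Rightarrow> 's \<Rightarrow> real" and g :: "'k \<Rightarrow> real"
  assumes a: "\<And>k t. t \<in> S \<Longrightarrow> a k t \<ge> 0" and g: "g summable_on UNIV" "\<And>k. g k \<ge> 0" and M: "M \<ge> 0"
    and le: "\<And>F t. finite F \<Longrightarrow> t \<in> S \<Longrightarrow> (\<Sum>k\<in>F. a k t) \<le> M * sqrt (sum g F)"
  shows "t \<in> S \<Longrightarrow> (\<lambda>k. a k t) summable_on UNIV"
    and "uniform_limit S (\<lambda>F t. \<Sum>k\<in>F. a k t) (\<lambda>t. \<Sum>\<^sub>\<infinity>k. a k t) (finite_subsets_at_top UNIV)"
proof -
  have s: "(\<lambda>k. a k t) summable_on UNIV" if t: "t \<in> S" for t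
  proof (rule nonneg_bdd_above_summable_on)
    show "bdd_above (sum (\<lambda>k. a k t) ` {F. F \<subseteq> UNIV \<and> finite F})"
    proof (rule bdd_aboveI2)
      fix F :: "'k set" assume "F \<in> {F. F \<subseteq> UNIV \<and> finite F}"
      then have F: "finite F" by simp
      have "sum (\<lambda>k. a k t) F \<le> M * sqrt (sum g F)" by (rule le[OF F t])
      also have "\<dots> \<le> M * sqrt (infsum g UNIV)"
        using F g by (intro mult_left_mono M) (auto intro!: finite_sum_le_infsum)
      finally show "sum (\<lambda>k. a k t) F \<le> M * sqrt (infsum g UNIV)" .
    qed
  qed (use a t in auto)
  then show "t \<in> S \<Longrightarrow> (\<lambda>k. a k t) summable_on UNIV" .
  show "uniform_limit S (\<lambda>F t. \<Sum>k\<in>F. a k t) (\<lambda>t. \<Sum>\<^sub>\<infinity>k. a k t) (finite_subsets_at_top UNIV)"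
  proof (rule uniform_limitI)
    fix e :: real assume e: "e > 0"
    \<comment> \<open>Makes M times the square root of d at most e / 2; the summand 1 excludes a
      zero denominator.\<close>
    define d where "d = (e / (2 * (M + 1)))\<^sup>2"
    have d: "d > 0" using e M by (auto simp: d_def)
    obtain F0 where F0: "finite F0" "dist (sum g F0) (infsum g UNIV) \<le> d"
      using infsum_finite_approximation[OF g(1) d] by blast
    have tail: "sum g F \<le> d" if "finite F" "F \<inter> F0 = {}" for F
    proof -
      have "sum g F + sum g F0 = sum g (F \<union> F0)" using that F0(1) by (simp add: sum.union_disjoint)
      also have "\<dots> \<le> infsum g UNIV" using that F0(1) g by (intro finite_sum_le_infsum) auto
      finally show ?thesis using F0(2) by (simp add: dist_real_def)
    qed
    have "dist (\<Sum>k\<in>F. a k t) (\<Sum>\<^sub>\<infinity>k. a k t) < e" if F: "finite F" "F0 \<subseteq> F" and t: "t \<in> S" for F t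
    proof -
      have 1: "(\<Sum>\<^sub>\<infinity>k. a k t) = (\<Sum>k\<in>F. a k t) + infsum (\<lambda>k. a k t) (- F)"
        using infsum_Un_disjoint[of "\<lambda>k. a k t" F "- F"] F(1) summable_on_subset_banach[OF s[OF t], of "-F"]
            by (simp add: Compl_partition)
      have 2: "infsum (\<lambda>k. a k t) (- F) \<le> M * sqrt d"
      proof (rule infsum_le_finite_sums)
        show "(\<lambda>k. a k t) summable_on - F" using summable_on_subset_banach[OF s[OF t], of "-F"] by simp
        fix G assume G: "finite G" "G \<subseteq> - F"
        have "sum (\<lambda>k. a k t) G \<le> M * sqrt (sum g G)" by (rule le[OF G(1) t])
        also have "\<dots> \<le> M * sqrt d" using tail[OF G(1)] G F by (intro mult_left_mono M real_sqrt_le_mono) auto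
        finally show "sum (\<lambda>k. a k t) G \<le> M * sqrt d" .
      qed
      have 3: "infsum (\<lambda>k. a k t) (- F) \<ge> 0" using a t by (intro infsum_nonneg) auto
      have "M * sqrt d = M * (e / (2 * (M + 1)))" using e M by (simp add: d_def)
      also have "\<dots> \<le> e / 2" using M e by (simp add: field_simps)
      also have "\<dots> < e" using e by simp
      finally show ?thesis using 1 2 3 by (simp add: dist_real_def)
    qed
    then show "\<forall>\<^sub>F F in finite_subsets_at_top UNIV. \<forall>t\<in>S. dist (\<Sum>k\<in>F. a k t) (\<Sum>\<^sub>\<infinity>k. a k t) < e"
      unfolding eventually_finite_subsets_at_top using F0(1) by (intro exI[of _ F0]) auto
  qed
qed

lemma summable_infsum_finite_sum:
  fixes f :: "'k \<Rightarrow> 'm \<Rightarrow> 'b::{topological_comm_monoid_add, t2_space}"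
  assumes "\<And>k. k \<in> F \<Longrightarrow> f k summable_on A"
  shows "(\<lambda>m. \<Sum>k\<in>F. f k m) summable_on A \<and> infsum (\<lambda>m. \<Sum>k\<in>F. f k m) A = (\<Sum>k\<in>F. infsum (f k) A)"
  using assms
  by (induction F rule: infinite_finite_induct) (auto simp: summable_on_add infsum_add)

text \<open>The norm of q need not be differentiable where q vanishes. Its Duhamel majorant h is,
  and h' = - (b - \<gamma>) h plus the weighted norm of n; integrating this over {t0..T} yields the
  pointwise bound and the dissipation integral at once.\<close>

lemma weighted_duhamel:
  fixes q n :: "real \<Rightarrow> 'a::euclidean_space"
  assumes d: "\<And>t. t \<ge> t0 \<Longrightarrow> (q has_vector_derivative (- b *\<^sub>R q t - n t)) (at t)"
    and n: "continuous_on {t0..} n"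
    and b: "b - \<gamma> \<ge> \<beta>" "\<beta> > 0" and T: "T \<ge> t0"
  shows "exp (\<gamma> * (T - t0)) * norm (q T) + \<beta> * integral {t0..T} (\<lambda>t. exp (\<gamma> * (t - t0)) * norm (q t))
     \<le> norm (q t0) + integral {t0..T} (\<lambda>t. exp (\<gamma> * (t - t0)) * norm (n t))"
proof (cases "T = t0")
  case False
  then have T: "t0 < T" using T by simp
  define w where "w t = exp (b * (t - t0)) * norm (n t)" for t
  define G where "G t = integral {t0..t} w" for t
  define h where "h t = exp (- (b - \<gamma>) * (t - t0)) * (norm (q t0) + G t)" for t
  have nT: "continuous_on {t0..T} n" using n by (rule continuous_on_subset) auto
  have qc: "continuous_on {t0..T} q"
    using d by (intro continuous_at_imp_continuous_on ballI has_vector_derivative_continuous) auto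
  have wc: "continuous_on {t0..T} w" unfolding w_def by (intro continuous_intros nT)
  have Gd: "(G has_real_derivative w t) (at t within {t0..T})" if "t \<in> {t0..T}" for t
    unfolding G_def using integral_has_real_derivative[OF wc that] .
  have Gc: "continuous_on {t0..T} G" using Gd by (intro DERIV_continuous_on)
  have Gd': "(G has_real_derivative w t) (at t)" if "t0 < t" "t < T" for t
    using Gd[of t] that by (simp add: at_within_Icc_at)
  have qh: "exp (b * (t - t0)) * norm (q t) \<le> norm (q t0) + G t" if t: "t \<in> {t0..T}" for t
  proof (cases "t = t0")
    case False
    have e: "((\<lambda>t. exp (b * (t - t0)) *\<^sub>R q t) has_vector_derivative (- exp (b * (s - t0)) *\<^sub>R n s)) (at s)"
        if "s \<ge> t0" for s
    proof -
      have "((\<lambda>t. exp (b * (t - t0))) has_field_derivative (b * exp (b * (s - t0)))) (at s)"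
        by (auto intro!: derivative_eq_intros)
      from has_vector_derivative_scaleR[OF this d[OF that]] show ?thesis by (simp add: algebra_simps)
    qed
    have "norm (exp (b * (t - t0)) *\<^sub>R q t - exp (b * (t0 - t0)) *\<^sub>R q t0) \<le> G t - G t0"
    proof (rule differentiable_bound_general[where f' = "\<lambda>s. - exp (b * (s - t0)) *\<^sub>R n s" and \<phi>' = w])
      show "t0 < t" using t False by auto
      show "continuous_on {t0..t} (\<lambda>t. exp (b * (t - t0)) *\<^sub>R q t)"
        by (intro continuous_intros continuous_on_subset[OF qc]) (use t in auto)
      show "continuous_on {t0..t} G" by (rule continuous_on_subset[OF Gc]) (use t in auto)
      show "(G has_vector_derivative w x) (at x)" if "t0 < x" "x < t" for x
        using Gd'[of x] that t by (simp flip: has_real_derivative_iff_has_vector_derivative)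
    qed (use e in \<open>auto simp: w_def\<close>)
    moreover have "G t0 = 0" by (simp add: G_def)
    ultimately have "norm (exp (b * (t - t0)) *\<^sub>R q t - q t0) \<le> G t" by simp
    then have "norm (exp (b * (t - t0)) *\<^sub>R q t) \<le> norm (q t0) + G t"
      using norm_triangle_sub[of "exp (b * (t - t0)) *\<^sub>R q t" "q t0"] by linarith
    then show ?thesis by simp
  qed (simp add: G_def)
  have G0: "G t \<ge> 0" if "t \<in> {t0..T}" for t unfolding G_def w_def
    by (intro integral_nonneg integrable_continuous_interval continuous_intros continuous_on_subset[OF nT])
        (use that in auto)
  have qh': "exp (\<gamma> * (t - t0)) * norm (q t) \<le> h t" if t: "t \<in> {t0..T}" for t
  proof -
    have "exp (- (b - \<gamma>) * (t - t0)) * (exp (b * (t - t0)) * norm (q t)) \<le> h t"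
      unfolding h_def by (intro mult_left_mono qh t) auto
    moreover have "exp (- (b - \<gamma>) * (t - t0)) * exp (b * (t - t0)) = exp (\<gamma> * (t - t0))"
      by (simp add: algebra_simps flip: exp_add)
    ultimately show ?thesis by (simp only: mult.assoc[symmetric])
  qed
  have hc: "continuous_on {t0..T} h" unfolding h_def by (intro continuous_intros Gc)
  have hd: "(h has_vector_derivative (- (b - \<gamma>) * h t + exp (\<gamma> * (t - t0)) * norm (n t)))
      (at t within {t0..T})" if t: "t \<in> {t0..T}" for t
  proof -
    have eq: "- (b - \<gamma>) * h t + exp (\<gamma> * (t - t0)) * norm (n t) =
        exp (- (b - \<gamma>) * (t - t0)) * w t + - (b - \<gamma>) * exp (- (b - \<gamma>) * (t - t0)) * (norm (q t0) + G t)"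
      by (simp add: h_def w_def algebra_simps flip: exp_add mult.assoc)
    have e: "((\<lambda>t. exp (- (b - \<gamma>) * (t - t0))) has_real_derivative (- (b - \<gamma>) * exp (- (b - \<gamma>) * (t - t0))))
        (at t within {t0..T})"
      by (rule derivative_eq_intros refl | simp)+
    have g: "((\<lambda>t. norm (q t0) + G t) has_real_derivative w t) (at t within {t0..T})"
      using DERIV_add[OF DERIV_const Gd[OF t], of "norm (q t0)"] by simp
    show ?thesis unfolding eq has_real_derivative_iff_has_vector_derivative[symmetric]
      unfolding h_def using DERIV_mult[OF e g] by (simp add: algebra_simps)
  qed
  have hi: "h integrable_on {t0..T}" by (intro integrable_continuous_interval hc)
  have ni: "(\<lambda>t. exp (\<gamma> * (t - t0)) * norm (n t)) integrable_on {t0..T}"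
    by (intro integrable_continuous_interval continuous_intros nT)
  have qi: "(\<lambda>t. exp (\<gamma> * (t - t0)) * norm (q t)) integrable_on {t0..T}"
    by (intro integrable_continuous_interval continuous_intros qc)
  have "((\<lambda>t. - (b - \<gamma>) * h t + exp (\<gamma> * (t - t0)) * norm (n t)) has_integral (h T - h t0)) {t0..T}"
    using fundamental_theorem_of_calculus[OF less_imp_le[OF T] hd] by simp
  moreover have "((\<lambda>t. - (b - \<gamma>) * h t + exp (\<gamma> * (t - t0)) * norm (n t)) has_integral
      (- (b - \<gamma>) * integral {t0..T} h + integral {t0..T} (\<lambda>t. exp (\<gamma> * (t - t0)) * norm (n t)))) {t0..T}"
    by (intro has_integral_add has_integral_mult_right integrable_integral hi ni)
  ultimately have eq: "h T - h t0 = - (b - \<gamma>) * integral {t0..T} h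
      + integral {t0..T} (\<lambda>t. exp (\<gamma> * (t - t0)) * norm (n t))"
    by (rule has_integral_unique)
  have h0: "h t0 = norm (q t0)" by (simp add: h_def G_def)
  have "\<beta> * integral {t0..T} (\<lambda>t. exp (\<gamma> * (t - t0)) * norm (q t)) \<le> (b - \<gamma>) * integral {t0..T} h"
    using b by (intro mult_mono integral_le qi hi qh' integral_nonneg) auto
  then show ?thesis using eq h0 qh'[of T] T by (simp add: algebra_simps)
qed simp

text \<open>Interpolates the plain sum between the norm that is kept small and the one that is
  controlled only after integration in time.\<close>

lemma cauchy_schwarz_weighted_sum:
  fixes a \<rho> :: "'k \<Rightarrow> real"
  assumes "\<And>k. k \<in> F \<Longrightarrow> a k \<ge> 0" "\<And>k. k \<in> F \<Longrightarrow> \<rho> k > 0"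
  shows "(\<Sum>k\<in>F. a k)\<^sup>2 \<le> (\<Sum>k\<in>F. a k / \<rho> k) * (\<Sum>k\<in>F. \<rho> k * a k)"
proof -
  have "(\<Sum>k\<in>F. a k) = (\<Sum>k\<in>F. sqrt (a k / \<rho> k) * sqrt (\<rho> k * a k))"
  proof (rule sum.cong[OF refl])
    fix k assume k: "k \<in> F"
    have "sqrt (a k / \<rho> k) * sqrt (\<rho> k * a k) = sqrt ((a k)\<^sup>2)"
      using assms(2)[OF k] by (simp add: power2_eq_square flip: real_sqrt_mult)
    then show "a k = sqrt (a k / \<rho> k) * sqrt (\<rho> k * a k)" using assms(1)[OF k] by simp
  qed
  then have "(\<Sum>k\<in>F. a k)\<^sup>2 \<le> (\<Sum>k\<in>F. (sqrt (a k / \<rho> k))\<^sup>2) * (\<Sum>k\<in>F. (sqrt (\<rho> k * a k))\<^sup>2)"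
    using Cauchy_Schwarz_ineq_sum by metis
  also have "\<dots> = (\<Sum>k\<in>F. a k / \<rho> k) * (\<Sum>k\<in>F. \<rho> k * a k)"
    using assms by (intro arg_cong2[where f = "(*)"] sum.cong refl) (auto simp: less_imp_le)
  finally show ?thesis .
qed

text \<open>Smallness is required of the critical norm at time \<open>t0\<close>, the sum of norm (q
  k) / \<rho> k. \<open>loc_bound\<close> is purely qualitative: it gives convergence and continuity
  of the sums, and its constant does not appear in the final estimate.\<close>

locale small_data =
  fixes \<rho> :: "'k::ab_group_add \<Rightarrow> real" and q n :: "real \<Rightarrow> 'k \<Rightarrow> 'v::euclidean_space" and c t0 y0 :: real
  assumes rho_ge1: "\<rho> k \<ge> 1" and rho_add: "\<rho> k \<le> \<rho> m + \<rho> (k - m)"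
    and rho_sum: "(\<lambda>k. 1 / (\<rho> k) ^ 4) summable_on UNIV"
    and der: "t \<ge> t0 \<Longrightarrow> ((\<lambda>t. q t k) has_vector_derivative (- (\<rho> k)\<^sup>2 *\<^sub>R q t k - n t k)) (at t)"
    and n_cont: "continuous_on {t0..} (\<lambda>t. n t k)"
    and n_bound: "t \<ge> t0 \<Longrightarrow> norm (n t k) \<le> c * \<rho> k * (\<Sum>\<^sub>\<infinity>m. norm (q t m) * norm (q t (k - m)))"
    and loc_bound: "\<exists>C. \<forall>t\<in>{t0..T}. \<forall>F. finite F \<longrightarrow> (\<Sum>k\<in>F. (\<rho> k)^4 * (norm (q t k))\<^sup>2) \<le> C"
    and c_pos: "c > 0"
    and small: "finite F \<Longrightarrow> (\<Sum>k\<in>F. norm (q t0 k) / \<rho> k) \<le> y0" "16 * c * y0 \<le> 1"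
begin

text \<open>Truncating the weight at \<open>R\<close> keeps all sums finite; the bounds obtained are uniform in \<open>R\<close>.\<close>

context
  fixes R :: real
  assumes R: "R \<ge> 0"
begin

definition a :: "'k \<Rightarrow> real \<Rightarrow> real" where
  "a k t = exp (min (\<rho> k) R / 2 * (t - t0)) * norm (q t k)"

definition X :: "real \<Rightarrow> real" where "X t = (\<Sum>\<^sub>\<infinity>k. a k t)"

text \<open>\<open>Z\<close> bounds the weighted norm, is continuous, starts at \<open>y0\<close> and satisfies \<open>Z \<le> y0 + 2 c Z\<^sup>2\<close>: it can
  never cross the gap between the roots of this inequality.\<close>

definition Z :: "real \<Rightarrow> real" where "Z T = y0 + c * integral {t0..T} (\<lambda>t. (X t)\<^sup>2)"

lemma a_nonneg: "a k t \<ge> 0" by (simp add: a_def)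

lemma a_cont: "continuous_on {t0..T} (a k)"
proof -
  have "continuous_on {t0..T} (\<lambda>t. q t k)"
    using der by (intro continuous_at_imp_continuous_on ballI has_vector_derivative_continuous) auto
  then show ?thesis unfolding a_def by (intro continuous_intros)
qed

text \<open>On {t0..T} the truncated weight is at most exp (R / 2 (T - t0)), so
  \<open>loc_bound\<close> and the summability of 1 / \<rho>^4 control the tails through
  Cauchy-Schwarz.\<close>

lemma X_props:
  shows "t \<ge> t0 \<Longrightarrow> (\<lambda>k. a k t) summable_on UNIV"
    and "uniform_limit {t0..T} (\<lambda>F t. \<Sum>k\<in>F. a k t) X (finite_subsets_at_top UNIV)"
proof -
  have *: "(\<forall>t\<in>{t0..T}. (\<lambda>k. a k t) summable_on UNIV)
      \<and> uniform_limit {t0..T} (\<lambda>F t. \<Sum>k\<in>F. a k t) X (finite_subsets_at_top UNIV)" for T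
  proof (cases "T \<ge> t0")
    case True
    obtain C where C: "\<And>t F. t \<in> {t0..T} \<Longrightarrow> finite F \<Longrightarrow> (\<Sum>k\<in>F. (\<rho> k)^4 * (norm (q t k))\<^sup>2) \<le> C"
      using loc_bound[of T] by blast
    have C0: "C \<ge> 0" using C[of t0 "{}"] True by simp
    define M where "M = exp (R / 2 * (T - t0)) * sqrt C"
    have M: "M \<ge> 0" using C0 by (simp add: M_def)
    have le: "(\<Sum>k\<in>F. a k t) \<le> M * sqrt (\<Sum>k\<in>F. 1 / (\<rho> k) ^ 4)" if F: "finite F" and t: "t \<in> {t0..T}" for F t
    proof -
      have rp: "\<rho> k > 0" for k using rho_ge1[of k] by linarith
      have cs: "(\<Sum>k\<in>F. norm (q t k))\<^sup>2 \<le> C * (\<Sum>k\<in>F. 1 / (\<rho> k) ^ 4)"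
      proof -
        have "(\<Sum>k\<in>F. norm (q t k)) = (\<Sum>k\<in>F. ((\<rho> k)\<^sup>2 * norm (q t k)) * (1 / (\<rho> k)\<^sup>2))"
          by (intro sum.cong refl) (use rp in \<open>simp add: less_imp_neq[THEN not_sym]\<close>)
        then have "(\<Sum>k\<in>F. norm (q t k))\<^sup>2 \<le> (\<Sum>k\<in>F. ((\<rho> k)\<^sup>2 * norm (q t k))\<^sup>2) * (\<Sum>k\<in>F. (1 / (\<rho> k)\<^sup>2)\<^sup>2)"
          using Cauchy_Schwarz_ineq_sum by metis
        also have "\<dots> = (\<Sum>k\<in>F. (\<rho> k)^4 * (norm (q t k))\<^sup>2) * (\<Sum>k\<in>F. 1 / (\<rho> k) ^ 4)"
          by (simp add: power_mult_distrib power_divide flip: power_mult)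
        also have "\<dots> \<le> C * (\<Sum>k\<in>F. 1 / (\<rho> k) ^ 4)"
          by (intro mult_right_mono C t F sum_nonneg) auto
        finally show ?thesis .
      qed
      have "(\<Sum>k\<in>F. a k t) \<le> (\<Sum>k\<in>F. exp (R / 2 * (T - t0)) * norm (q t k))"
        unfolding a_def
      proof (intro sum_mono mult_right_mono)
        fix k
        have "min (\<rho> k) R / 2 * (t - t0) \<le> R / 2 * (T - t0)"
          using t R by (intro mult_mono) auto
        then show "exp (min (\<rho> k) R / 2 * (t - t0)) \<le> exp (R / 2 * (T - t0))" by simp
      qed auto
      also have "\<dots> = exp (R / 2 * (T - t0)) * (\<Sum>k\<in>F. norm (q t k))" by (simp add: sum_distrib_left)
      also have "\<dots> \<le> exp (R / 2 * (T - t0)) * sqrt (C * (\<Sum>k\<in>F. 1 / (\<rho> k) ^ 4))"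
        using cs by (intro mult_left_mono real_le_rsqrt) auto
      finally show ?thesis by (simp add: M_def real_sqrt_mult)
    qed
    show ?thesis
      using uniform_limit_of_tail[where S = "{t0..T}" and a = a, OF a_nonneg rho_sum _ M le]
      unfolding X_def[abs_def] by auto
  qed simp
  show "t \<ge> t0 \<Longrightarrow> (\<lambda>k. a k t) summable_on UNIV" using *[of t] by auto
  show "uniform_limit {t0..T} (\<lambda>F t. \<Sum>k\<in>F. a k t) X (finite_subsets_at_top UNIV)" using * by blast
qed

lemma X_cont: "continuous_on {t0..T} X"
  by (rule uniform_limit_theorem[OF _ X_props(2)]) (auto intro!: always_eventually continuous_on_sum a_cont)

lemma sum_a_le_X: "t \<ge> t0 \<Longrightarrow> finite F \<Longrightarrow> (\<Sum>k\<in>F. a k t) \<le> X t"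
  unfolding X_def by (intro finite_sum_le_infsum X_props) (auto simp: a_nonneg)

lemma X2_integrable: "(\<lambda>t. (X t)\<^sup>2) integrable_on {t0..T}"
  by (intro integrable_continuous_interval continuous_intros X_cont)

text \<open>Dividing by \<rho> k cancels the derivative lost in \<open>n_bound\<close>, so the
  nonlinearity is estimated by X alone.\<close>

lemma convolution_bound:
  assumes t: "t \<ge> t0" and F: "finite F"
  shows "(\<Sum>k\<in>F. (exp (min (\<rho> k) R / 2 * (t - t0)) * norm (n t k)) / \<rho> k) \<le> c * (X t)\<^sup>2"
proof -
  have rp: "\<rho> k > 0" for k using rho_ge1[of k] by linarith
  have single: "a k t \<le> X t" for k using sum_a_le_X[OF t, of "{k}"] by simp
  have S: "(\<lambda>m. a m t * a (k - m) t) summable_on UNIV" for k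
  proof (rule summable_on_comparison_test)
    show "(\<lambda>m. a m t * X t) summable_on UNIV" by (intro summable_on_cmult_left X_props t)
  qed (auto intro!: mult_left_mono single a_nonneg mult_nonneg_nonneg)
  have e: "exp (min (\<rho> k) R / 2 * (t - t0)) * (norm (q t m) * norm (q t (k - m))) \<le> a m t * a (k - m) t" for k m
  proof -
    \<comment> \<open>Truncation at R \<ge> 0 preserves the subadditivity of \<rho>, so the weight
      of the output is at most the product of the weights of the inputs.\<close>
    have "min (\<rho> k) R \<le> min (\<rho> m) R + min (\<rho> (k - m)) R"
      using rho_add[of k m] R rho_ge1[of m] rho_ge1[of "k - m"] by (auto simp: min_def)
    then have "min (\<rho> k) R / 2 * (t - t0) \<le> (min (\<rho> m) R / 2 + min (\<rho> (k - m)) R / 2) * (t - t0)"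
      using t by (intro mult_right_mono) auto
    then have "exp (min (\<rho> k) R / 2 * (t - t0))
        \<le> exp (min (\<rho> m) R / 2 * (t - t0)) * exp (min (\<rho> (k - m)) R / 2 * (t - t0))"
      by (simp add: distrib_right flip: exp_add)
    then have "exp (min (\<rho> k) R / 2 * (t - t0)) * (norm (q t m) * norm (q t (k - m)))
      \<le> (exp (min (\<rho> m) R / 2 * (t - t0)) * exp (min (\<rho> (k - m)) R / 2 * (t - t0))) *
          (norm (q t m) * norm (q t (k - m)))"
      by (intro mult_right_mono) auto
    then show ?thesis by (simp add: a_def mult_ac)
  qed
  have S2: "(\<lambda>m. exp (min (\<rho> k) R / 2 * (t - t0)) * (norm (q t m) * norm (q t (k - m)))) summable_on UNIV" for k
    by (rule summable_on_comparison_test[OF S e]) simp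
  have 1: "(exp (min (\<rho> k) R / 2 * (t - t0)) * norm (n t k)) / \<rho> k \<le> c * (\<Sum>\<^sub>\<infinity>m. a m t * a (k - m) t)" for k
  proof -
    have "exp (min (\<rho> k) R / 2 * (t - t0)) * norm (n t k)
      \<le> exp (min (\<rho> k) R / 2 * (t - t0)) * (c * \<rho> k * (\<Sum>\<^sub>\<infinity>m. norm (q t m) * norm (q t (k - m))))"
      by (intro mult_left_mono n_bound t) auto
    also have "\<dots> = c * \<rho> k * (\<Sum>\<^sub>\<infinity>m. exp (min (\<rho> k) R / 2 * (t - t0)) * (norm (q t m) * norm (q t (k - m))))"
      by (simp add: infsum_cmult_right')
    also have "\<dots> \<le> c * \<rho> k * (\<Sum>\<^sub>\<infinity>m. a m t * a (k - m) t)"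
      using c_pos rp[of k] by (intro mult_left_mono infsum_mono S S2 e) auto
    finally show ?thesis using rp[of k] by (simp add: field_simps)
  qed
  have "(\<Sum>k\<in>F. (exp (min (\<rho> k) R / 2 * (t - t0)) * norm (n t k)) / \<rho> k)
      \<le> (\<Sum>k\<in>F. c * (\<Sum>\<^sub>\<infinity>m. a m t * a (k - m) t))"
    by (intro sum_mono 1)
  also have "\<dots> = c * (\<Sum>\<^sub>\<infinity>m. \<Sum>k\<in>F. a m t * a (k - m) t)"
    using summable_infsum_finite_sum[of F "\<lambda>k m. a m t * a (k - m) t" UNIV] S by (simp add: sum_distrib_left)
  also have "\<dots> \<le> c * (\<Sum>\<^sub>\<infinity>m. a m t * X t)"
  proof (intro mult_left_mono infsum_mono)
    show "(\<lambda>m. \<Sum>k\<in>F. a m t * a (k - m) t) summable_on UNIV"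
        using summable_infsum_finite_sum[of F "\<lambda>k m. a m t * a (k - m) t" UNIV] S by blast
    show "(\<lambda>m. a m t * X t) summable_on UNIV" by (intro summable_on_cmult_left X_props t)
    fix m
    have "(\<Sum>k\<in>F. a (k - m) t) = (\<Sum>k\<in>(\<lambda>k. k - m) ` F. a k t)"
      by (subst sum.reindex) (auto simp: inj_on_def)
    also have "\<dots> \<le> X t" using F by (intro sum_a_le_X t) auto
    finally show "(\<Sum>k\<in>F. a m t * a (k - m) t) \<le> a m t * X t"
      by (simp add: mult_left_mono a_nonneg flip: sum_distrib_left)
  qed (use c_pos in auto)
  also have "\<dots> = c * (X t)\<^sup>2" by (simp add: infsum_cmult_left' X_def power2_eq_square)
  finally show ?thesis .
qed

text \<open>Duhamel's estimate for each mode, divided by \<rho> k and summed. As \<rho> k \<ge> 1,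
  the weight uses up at most half of the damping (\<rho> k)^2; the other half is the integral on the
  left.\<close>

lemma energy_bound:
  assumes T: "T \<ge> t0" and F: "finite F"
  shows "(\<Sum>k\<in>F. a k T / \<rho> k) + integral {t0..T} (\<lambda>t. \<Sum>k\<in>F. \<rho> k * a k t) / 2 \<le> Z T"
proof -
  have rp: "\<rho> k > 0" for k using rho_ge1[of k] by linarith
  have nT: "continuous_on {t0..T} (\<lambda>t. n t k)" for k using n_cont by (rule continuous_on_subset) auto
  let ?e = "\<lambda>k t. exp (min (\<rho> k) R / 2 * (t - t0)) * norm (n t k)"
  have ei: "?e k integrable_on {t0..T}" for k by (intro integrable_continuous_interval continuous_intros nT)
  have ai: "a k integrable_on {t0..T}" for k by (intro integrable_continuous_interval a_cont)
  have 1: "a k T / \<rho> k + integral {t0..T} (\<lambda>t. \<rho> k * a k t) / 2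
      \<le> norm (q t0 k) / \<rho> k + integral {t0..T} (\<lambda>t. ?e k t / \<rho> k)" for k
  proof -
    have "min (\<rho> k) R / 2 \<le> (\<rho> k)\<^sup>2 / 2"
    proof -
      have "\<rho> k * 1 \<le> \<rho> k * \<rho> k" using rho_ge1[of k] by (intro mult_left_mono) auto
      then show ?thesis by (simp add: power2_eq_square)
    qed
    then have "a k T + (\<rho> k)\<^sup>2 / 2 * integral {t0..T} (a k) \<le> norm (q t0 k) + integral {t0..T} (?e k)"
      unfolding a_def[abs_def]
      by (intro weighted_duhamel[where q = "\<lambda>t. q t k" and n = "\<lambda>t. n t k", OF der n_cont _ _ T])
          (use rp[of k] in auto)
    then have "(a k T + (\<rho> k)\<^sup>2 / 2 * integral {t0..T} (a k)) / \<rho> k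
        \<le> (norm (q t0 k) + integral {t0..T} (?e k)) / \<rho> k"
      using rp[of k] by (intro divide_right_mono) auto
    then show ?thesis
      using rp[of k] by (simp add: add_divide_distrib power2_eq_square)
  qed
  have "(\<Sum>k\<in>F. a k T / \<rho> k) + integral {t0..T} (\<lambda>t. \<Sum>k\<in>F. \<rho> k * a k t) / 2
     = (\<Sum>k\<in>F. a k T / \<rho> k + integral {t0..T} (\<lambda>t. \<rho> k * a k t) / 2)"
    using F ai by (subst integral_sum) (auto simp: sum.distrib sum_divide_distrib intro!:
        integrable_on_mult_right)
  also have "\<dots> \<le> (\<Sum>k\<in>F. norm (q t0 k) / \<rho> k + integral {t0..T} (\<lambda>t. ?e k t / \<rho> k))"
    by (intro sum_mono 1)
  also have "\<dots> = (\<Sum>k\<in>F. norm (q t0 k) / \<rho> k) + integral {t0..T} (\<lambda>t. \<Sum>k\<in>F. ?e k t / \<rho> k)"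
    using F ei by (subst integral_sum) (auto simp: sum.distrib intro!: integrable_on_divide)
  also have "\<dots> \<le> y0 + integral {t0..T} (\<lambda>t. c * (X t)\<^sup>2)"
    using F X2_integrable ei
    by (intro add_mono small integral_le convolution_bound integrable_sum integrable_on_divide
        integrable_on_mult_right) auto
  also have "\<dots> = Z T" by (simp add: Z_def)
  finally show ?thesis .
qed

lemma Z_mono: "t0 \<le> t \<Longrightarrow> t \<le> T \<Longrightarrow> Z t \<le> Z T"
  unfolding Z_def using c_pos
  by (intro add_left_mono mult_left_mono integral_subset_le X2_integrable) auto

text \<open>By interpolation X^2 is at most the critical norm times the sum weighted by \<rho>.
  \<open>energy_bound\<close> bounds the first by Z T and the time integral of the second by 2 Z
  T.\<close>

lemma Z_quadratic:
  assumes T: "T \<ge> t0" shows "Z T \<le> y0 + 2 * c * (Z T)\<^sup>2"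
proof -
  have rp: "\<rho> k > 0" for k using rho_ge1[of k] by linarith
  have Z0: "Z T \<ge> 0" using energy_bound[OF T, of "{}"] by simp
  have fin: "integral {t0..T} (\<lambda>t. (\<Sum>k\<in>F. a k t)\<^sup>2) \<le> 2 * (Z T)\<^sup>2" if F: "finite F" for F
  proof -
    have bi: "(\<lambda>t. \<Sum>k\<in>F. \<rho> k * a k t) integrable_on {t0..T}"
      by (intro integrable_continuous_interval continuous_intros a_cont)
    have "integral {t0..T} (\<lambda>t. (\<Sum>k\<in>F. a k t)\<^sup>2) \<le> integral {t0..T} (\<lambda>t. Z T * (\<Sum>k\<in>F. \<rho> k * a k t))"
    proof (rule integral_le)
      fix t assume t: "t \<in> {t0..T}"
      have i0: "integral {t0..t} (\<lambda>t. \<Sum>k\<in>F. \<rho> k * a k t) \<ge> 0"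
        by (intro integral_nonneg integrable_continuous_interval continuous_intros a_cont sum_nonneg
            mult_nonneg_nonneg a_nonneg)
           (use rp in \<open>auto simp: less_imp_le\<close>)
      have "(\<Sum>k\<in>F. a k t)\<^sup>2 \<le> (\<Sum>k\<in>F. a k t / \<rho> k) * (\<Sum>k\<in>F. \<rho> k * a k t)"
        by (rule cauchy_schwarz_weighted_sum) (auto simp: a_nonneg rp)
      also have "\<dots> \<le> Z T * (\<Sum>k\<in>F. \<rho> k * a k t)"
      proof (rule mult_right_mono)
        have "(\<Sum>k\<in>F. a k t / \<rho> k) \<le> Z t" using energy_bound[of t F] F t i0 by auto
        also have "\<dots> \<le> Z T" using t by (intro Z_mono) auto
        finally show "(\<Sum>k\<in>F. a k t / \<rho> k) \<le> Z T" .
        show "0 \<le> (\<Sum>k\<in>F. \<rho> k * a k t)" by (intro sum_nonneg mult_nonneg_nonneg a_nonneg)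
            (use rp in \<open>auto simp: less_imp_le\<close>)
      qed
      finally show "(\<Sum>k\<in>F. a k t)\<^sup>2 \<le> Z T * (\<Sum>k\<in>F. \<rho> k * a k t)" .
    qed (auto intro!: integrable_continuous_interval continuous_intros a_cont)
    also have "\<dots> = Z T * integral {t0..T} (\<lambda>t. \<Sum>k\<in>F. \<rho> k * a k t)" by simp
    also have "\<dots> \<le> Z T * (2 * Z T)"
    proof (intro mult_left_mono Z0)
      have "(\<Sum>k\<in>F. a k T / \<rho> k) \<ge> 0" by (intro sum_nonneg divide_nonneg_pos a_nonneg rp)
      then show "integral {t0..T} (\<lambda>t. \<Sum>k\<in>F. \<rho> k * a k t) \<le> 2 * Z T" using energy_bound[OF T F] by simp
    qed
    finally show ?thesis by (simp add: power2_eq_square)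
  qed
  have bX: "bounded (X ` {t0..T})" by (intro compact_imp_bounded compact_continuous_image X_cont compact_Icc)
  \<comment> \<open>The sum weighted by \<rho> has been used over finite sets only; uniform
    convergence of the partial sums transfers the bound to the integral of X^2.\<close>
  have "uniform_limit {t0..T} (\<lambda>F t. (\<Sum>k\<in>F. a k t) * (\<Sum>k\<in>F. a k t)) (\<lambda>t. X t * X t)
      (finite_subsets_at_top UNIV)"
    by (intro uniform_lim_mult X_props bX)
  then obtain I J where IJ: "\<And>F. ((\<lambda>t. (\<Sum>k\<in>F. a k t) * (\<Sum>k\<in>F. a k t)) has_integral I F) {t0..T}"
     "((\<lambda>t. X t * X t) has_integral J) {t0..T}" "(I \<longlongrightarrow> J) (finite_subsets_at_top UNIV)"
    by (rule uniform_limit_integral) (auto intro!: continuous_intros a_cont)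
  have "J \<le> 2 * (Z T)\<^sup>2"
  proof (rule tendsto_upperbound[OF IJ(3)])
    show "\<forall>\<^sub>F F in finite_subsets_at_top UNIV. I F \<le> 2 * (Z T)\<^sup>2"
      by (rule eventually_finite_subsets_at_top_weakI)
          (use fin integral_unique[OF IJ(1)] in \<open>auto simp: power2_eq_square\<close>)
  qed simp
  moreover have "J = integral {t0..T} (\<lambda>t. (X t)\<^sup>2)" using integral_unique[OF IJ(2)]
      by (simp add: power2_eq_square)
  ultimately show ?thesis using c_pos by (simp add: Z_def mult.assoc[symmetric])
qed

lemma Z_bound:
  assumes T: "T \<ge> t0" shows "Z T \<le> 1 / (8 * c)"
proof (rule ccontr)
  assume "\<not> Z T \<le> 1 / (8 * c)"
  then have 1: "1 / (8 * c) \<le> Z T" by simp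
  have "Z t0 = y0" by (simp add: Z_def)
  also have "y0 \<le> 1 / (8 * c)" using small(2) c_pos by (simp add: field_simps)
  finally have 2: "Z t0 \<le> 1 / (8 * c)" .
  have "continuous_on {t0..T} Z" unfolding Z_def
    by (intro continuous_intros indefinite_integral_continuous_1 X2_integrable)
  then obtain t where t: "t0 \<le> t" "t \<le> T" "Z t = 1 / (8 * c)"
    using IVT'[of Z t0 "1 / (8 * c)" T, OF 2 1 T] by auto
  \<comment> \<open>At the value 1 / (8 c) the quadratic inequality would read 4 / (32 c) \<le> 2 /
    (32 c) + 1 / (32 c).\<close>
  have "1 / (8 * c) \<le> y0 + 2 * c * (1 / (8 * c))\<^sup>2" using Z_quadratic[OF t(1)] t(3) by simp
  also have "2 * c * (1 / (8 * c))\<^sup>2 = 1 / (32 * c)" using c_pos by (simp add: power2_eq_square field_simps)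
  also have "y0 \<le> 1 / (16 * c)" using small(2) c_pos by (simp add: field_simps)
  finally show False using c_pos by (simp add: field_simps)
qed

end

text \<open>Truncating at R = \<rho> k leaves the weight of the mode k untouched, and the bound on Z
  does not depend on R.\<close>

theorem analytic_decay:
  assumes t: "t \<ge> t0"
  shows "norm (q t k) \<le> \<rho> k / (8 * c) * exp (- (\<rho> k) / 2 * (t - t0))"
proof -
  have rp: "\<rho> k > 0" using rho_ge1[of k] by linarith
  then have R: "\<rho> k \<ge> 0" by simp
  have i0: "integral {t0..t} (\<lambda>t. \<Sum>k\<in>{k'}. \<rho> k * a R' k t) \<ge> 0" if "R' \<ge> 0" for k' R'
    by (intro integral_nonneg integrable_continuous_interval continuous_intros a_cont[OF that] sum_nonneg
        mult_nonneg_nonneg a_nonneg)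
       (use rho_ge1 in \<open>auto intro: order_trans[OF zero_le_one] simp: a_nonneg that\<close>)
  have "a (\<rho> k) k t / \<rho> k \<le> Z (\<rho> k) t"
    using energy_bound[OF R t, of "{k}"] i0[OF R, of k] by simp
  also have "\<dots> \<le> 1 / (8 * c)" by (rule Z_bound[OF R t])
  finally have "exp (\<rho> k / 2 * (t - t0)) * norm (q t k) \<le> \<rho> k / (8 * c)"
    using rp by (simp add: a_def[OF R] field_simps)
  then have "exp (- (\<rho> k) / 2 * (t - t0)) * (exp (\<rho> k / 2 * (t - t0)) * norm (q t k))
      \<le> exp (- (\<rho> k) / 2 * (t - t0)) * (\<rho> k / (8 * c))"
    by (intro mult_left_mono) auto
  moreover have "exp (- (\<rho> k) / 2 * (t - t0)) * exp (\<rho> k / 2 * (t - t0)) = 1" by (simp flip: exp_add)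
  ultimately show ?thesis
    by (metis mult.assoc mult.commute mult_1)
qed

end

section \<open>Fourier series on the torus\<close>

lemma continuous_integrable_cbox:
  fixes f :: "'a::euclidean_space \<Rightarrow> 'b::banach"
  shows "continuous_on UNIV f \<Longrightarrow> f integrable_on cbox a b"
  by (rule integrable_continuous) (rule continuous_on_subset, auto)

definition pder :: "3 \<Rightarrow> (real^3 \<Rightarrow> 'b::real_normed_vector) \<Rightarrow> (real^3 \<Rightarrow> 'b) \<Rightarrow> bool" where
  "pder j f f' \<longleftrightarrow> (\<forall>x. ((\<lambda>s. f (x + s *\<^sub>R axis j 1)) has_vector_derivative f' x) (at 0))"

lemma pder_shift:
  assumes "pder j f f'"
  shows "((\<lambda>s. f (x + s *\<^sub>R axis j 1)) has_vector_derivative f' (x + s *\<^sub>R axis j 1)) (at s)"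
proof -
  have g: "((\<lambda>r. f ((x + s *\<^sub>R axis j 1) + r *\<^sub>R axis j 1)) has_vector_derivative f' (x + s *\<^sub>R axis j 1))
      (at (s - s))"
    using assms by (simp add: pder_def)
  have "((\<lambda>r. r - s) has_vector_derivative 1) (at s)"
    by (auto intro!: derivative_eq_intros)
  from vector_diff_chain_at[OF this g] show ?thesis
    by (simp add: o_def algebra_simps)
qed

lemma pder_mult:
  fixes f g :: "real^3 \<Rightarrow> 'b::real_normed_algebra"
  assumes "pder j f f'" "pder j g g'"
  shows "pder j (\<lambda>x. f x * g x) (\<lambda>x. f x * g' x + f' x * g x)"
  unfolding pder_def
proof
  fix x
  show "((\<lambda>s. f (x + s *\<^sub>R axis j 1) * g (x + s *\<^sub>R axis j 1)) has_vector_derivative f x * g' x + f' x * g x)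
      (at 0)"
    using has_vector_derivative_mult[of "\<lambda>s. f (x + s *\<^sub>R axis j 1)" "f' x" 0 UNIV
        "\<lambda>s. g (x + s *\<^sub>R axis j 1)" "g' x"]
      assms unfolding pder_def by simp
qed

lemma pder_bounded_linear:
  "bounded_linear h \<Longrightarrow> pder j f f' \<Longrightarrow> pder j (\<lambda>x. h (f x)) (\<lambda>x. h (f' x))"
  unfolding pder_def by (auto intro: bounded_linear.has_vector_derivative)

locale torus =
  fixes L :: "real^3"
  assumes L_pos: "\<And>j. L $ j > 0"
begin

definition vol :: real where "vol = L $ 1 * L $ 2 * L $ 3"

text \<open>Based on the gauge integral; it agrees with \<open>average\<close> on continuous
  functions by \<open>average_eq_mean\<close>.\<close>

definition mean :: "(real^3 \<Rightarrow> 'b::euclidean_space) \<Rightarrow> 'b" where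
  "mean f = (1 / vol) *\<^sub>R integral (cbox 0 L) f"

lemma vol_pos: "vol > 0" using L_pos by (simp add: vol_def)

lemma content_cell: "measure lborel (cbox 0 L) = vol"
proof -
  have "0 \<le> L $ i" for i using L_pos[of i] by simp
  then have "cbox 0 L \<noteq> {}" by (simp add: interval_ne_empty_cart)
  have "measure lborel (cbox 0 L) = (\<Prod>i\<in>UNIV. L $ i)" using \<open>cbox 0 L \<noteq> {}\<close> by (simp add: content_cbox_cart)
  also have "\<dots> = vol"
    unfolding UNIV_3 vol_def by simp
  finally show ?thesis .
qed

lemma average_eq_mean:
  assumes "continuous_on UNIV f" shows "average L f = mean f"
proof -
  have "integrable (lebesgue_on (cbox 0 L)) f"
    by (rule continuous_imp_integrable, rule continuous_on_subset[OF assms subset_UNIV])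
  then show ?thesis unfolding average_def mean_def cell_def vol_def
    by (simp add: lebesgue_integral_eq_integral)
qed

lemma mean_add: "continuous_on UNIV f \<Longrightarrow> continuous_on UNIV g \<Longrightarrow> mean (\<lambda>x. f x + g x) = mean f + mean g"
  unfolding mean_def by (simp add: integral_add continuous_integrable_cbox scaleR_add_right)

lemma mean_diff: "continuous_on UNIV f \<Longrightarrow> continuous_on UNIV g \<Longrightarrow> mean (\<lambda>x. f x - g x) = mean f - mean g"
  unfolding mean_def by (simp add: integral_diff continuous_integrable_cbox scaleR_diff_right)

lemma mean_sum: "finite A \<Longrightarrow> (\<And>a. a \<in> A \<Longrightarrow> continuous_on UNIV (f a)) \<Longrightarrow> mean (\<lambda>x. \<Sum>a\<in>A. f a x)
    = (\<Sum>a\<in>A. mean (f a))"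
  unfolding mean_def by (simp add: integral_sum continuous_integrable_cbox scaleR_sum_right)

lemma mean_linear: "bounded_linear h \<Longrightarrow> continuous_on UNIV f \<Longrightarrow> mean (\<lambda>x. h (f x)) = h (mean f)"
  unfolding mean_def
  using integral_linear[of f "cbox 0 L" h] continuous_integrable_cbox[of f 0 L]
  by (simp add: o_def linear_scale bounded_linear.linear)

lemma mean_cmult: "continuous_on UNIV f \<Longrightarrow> mean (\<lambda>x. c * f x) = c * mean f"
    for f :: "real^3 \<Rightarrow> 'b::{real_normed_algebra,euclidean_space}"
  using mean_linear[OF bounded_linear_mult_right[of c], of f] by simp

lemma mean_const: "mean (\<lambda>x. c) = c"
  unfolding mean_def by (simp add: content_cell vol_pos less_imp_neq[OF vol_pos, symmetric])

lemma mean_mono: "continuous_on UNIV f \<Longrightarrow> continuous_on UNIV g \<Longrightarrow> (\<And>x. x \<in> cbox 0 L \<Longrightarrow> f x \<le> g x) \<Longrightarrow> mean f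
    \<le> mean (g :: _ \<Rightarrow> real)"
  unfolding mean_def using vol_pos
  by (simp add: divide_right_mono integral_le continuous_integrable_cbox)

lemma mean_nonneg: "continuous_on UNIV f \<Longrightarrow> (\<And>x. x \<in> cbox 0 L \<Longrightarrow> 0 \<le> f x) \<Longrightarrow> 0 \<le> mean (f :: _ \<Rightarrow> real)"
  using mean_mono[of "\<lambda>x. 0" f] mean_const[of "0::real"] by simp

lemma mean_cong: "(\<And>x. x \<in> cbox 0 L \<Longrightarrow> f x = g x) \<Longrightarrow> mean f = mean g"
  unfolding mean_def using integral_cong[of "cbox 0 L" f g] by simp

text \<open>The cell lengthened by s in direction j is cut once at x_j = s and once at x_j = L_j.
  The first cut yields a slab and the translated cell, the second the cell and the same slab moved
  by a period.\<close>

lemma integral_translate: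
  fixes f :: "real^3 \<Rightarrow> 'b::euclidean_space"
  assumes f: "continuous_on UNIV f" "periodic L f" and s: "0 \<le> s" "s \<le> L $ j"
  shows "integral (cbox 0 L) (\<lambda>x. f (x + s *\<^sub>R axis j 1)) = integral (cbox 0 L) f"
proof -
  define e where "e = (axis j 1 :: real^3)"
  have ek: "e \<in> Basis" by (simp add: e_def axis_in_Basis_iff)
  have ex: "x \<bullet> e = x $ j" for x by (simp add: e_def inner_axis)
  define Ls where "Ls = (\<chi> i. if i = j then s else L $ i)"
  have comp: "e $ i = (if i = j then 1 else 0)" for i
    by (simp add: e_def axis_def)
  have L0: "0 \<le> L $ i" for i using L_pos[of i] by simp
  have 1: "cbox 0 (L + s *\<^sub>R e) \<inter> {x. x \<bullet> e \<le> s} = cbox 0 Ls"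
    using s L0 by (auto simp: mem_box_cart comp Ls_def ex set_eq_iff split: if_splits; smt (verit))
  have 2: "cbox 0 (L + s *\<^sub>R e) \<inter> {x. x \<bullet> e \<ge> s} = cbox (0 + s *\<^sub>R e) (L + s *\<^sub>R e)"
    using s L0 by (auto simp: mem_box_cart comp ex set_eq_iff split: if_splits; smt (verit))
  have 3: "cbox 0 (L + s *\<^sub>R e) \<inter> {x. x \<bullet> e \<le> L $ j} = cbox 0 L"
    using s L0 by (auto simp: mem_box_cart comp ex set_eq_iff split: if_splits; smt (verit))
  have 4: "cbox 0 (L + s *\<^sub>R e) \<inter> {x. x \<bullet> e \<ge> L $ j} = cbox (0 + (L $ j) *\<^sub>R e) (Ls + (L $ j) *\<^sub>R e)"
    using s L0 by (auto simp: mem_box_cart comp ex Ls_def set_eq_iff split: if_splits; smt (verit))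
  have fi: "f integrable_on cbox 0 (L + s *\<^sub>R e)" by (rule continuous_integrable_cbox[OF f(1)])
  have per: "f \<circ> (+) ((L $ j) *\<^sub>R e) = f"
    using f(2) by (auto simp: periodic_def e_def fun_eq_iff add.commute)
  have "integral (cbox (0 + (L $ j) *\<^sub>R e) (Ls + (L $ j) *\<^sub>R e)) f = integral (cbox 0 Ls) f"
    using integral_shift_cbox_plus[of 0 Ls f "(L $ j) *\<^sub>R e"] unfolding per by simp
  then have "integral (cbox (0 + s *\<^sub>R e) (L + s *\<^sub>R e)) f = integral (cbox 0 L) f"
    using integral_split[OF fi ek, of s] integral_split[OF fi ek, of "L $ j"] unfolding 1 2 3 4 by simp
  then show ?thesis
    using integral_shift_cbox_plus[of 0 L f "s *\<^sub>R e"] by (simp add: o_def e_def add.commute)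
qed

text \<open>Integrals of translates are constant, and differentiating them gives the integral of f'.
  The derivative at 0 is one-sided because \<open>integral_translate\<close> covers 0 \<le> s \<le>
  L_j. Applied to products, this is integration by parts without boundary terms.\<close>

lemma integral_pder_zero:
  fixes f :: "real^3 \<Rightarrow> 'b::euclidean_space"
  assumes f: "continuous_on UNIV f" "periodic L f" and f': "continuous_on UNIV f'" and d: "pder j f f'"
  shows "mean f' = 0"
proof -
  define U where "U = {0..L $ j}"
  define e where "e = (axis j 1 :: real^3)"
  have 1: "((\<lambda>s. integral (cbox 0 L) (\<lambda>x. f (x + s *\<^sub>R e))) has_vector_derivative
      integral (cbox 0 L) (\<lambda>x. f' (x + 0 *\<^sub>R e))) (at 0 within U)"
  proof (rule leibniz_rule_vector_derivative)
    show "((\<lambda>s. f (x + s *\<^sub>R e)) has_vector_derivative f' (x + s *\<^sub>R e)) (at s within U)" for s x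
      unfolding e_def by (rule has_vector_derivative_at_within[OF pder_shift[OF d]])
    show "(\<lambda>x. f (x + s *\<^sub>R e)) integrable_on cbox 0 L" for s
      by (intro continuous_integrable_cbox continuous_on_compose2[OF f(1)] continuous_intros) auto
    show "continuous_on (U \<times> cbox 0 L) (\<lambda>(s, x). f' (x + s *\<^sub>R e))"
      unfolding case_prod_unfold by (intro continuous_on_compose2[OF f'] continuous_intros) auto
  qed (use L_pos[of j] in \<open>auto simp: U_def\<close>)
  have 2: "((\<lambda>s. integral (cbox 0 L) (\<lambda>x. f (x + s *\<^sub>R e))) has_vector_derivative 0) (at 0 within U)"
  proof (rule has_vector_derivative_transform)
    show "((\<lambda>s. integral (cbox 0 L) f) has_vector_derivative 0) (at 0 within U)" by simp
    show "integral (cbox 0 L) (\<lambda>x. f (x + s *\<^sub>R e)) = integral (cbox 0 L) f" if "s \<in> U" for s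
      using integral_translate[OF f] that by (simp add: U_def e_def)
  qed (use L_pos[of j] in \<open>simp add: U_def\<close>)
  have "at 0 within U \<noteq> bot"
    using L_pos[of j] unfolding U_def by (simp add: trivial_limit_within)
  from vector_derivative_unique_within[OF this 1 2] show ?thesis by (simp add: mean_def)
qed

definition ee :: "int^3 \<Rightarrow> real^3 \<Rightarrow> complex" where "ee k x = cis (wave L k \<bullet> x)"

definition fc :: "(real^3 \<Rightarrow> complex) \<Rightarrow> int^3 \<Rightarrow> complex" where
  "fc f k = mean (\<lambda>x. ee (- k) x * f x)"

lemma wave_add: "wave L (k + m) = wave L k + wave L m"
  by (simp add: wave_def vec_eq_iff distrib_left add_divide_distrib distrib_right)

lemma wave_minus: "wave L (- k) = - wave L k"
  by (simp add: wave_def vec_eq_iff)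

lemma wave_diff: "wave L (k - m) = wave L k - wave L m"
  using wave_add[of k "- m"] wave_minus[of m] by simp

lemma wave_0: "wave L 0 = 0"
  by (simp add: wave_def vec_eq_iff)

lemma wave_eq_0_iff: "wave L k = 0 \<longleftrightarrow> k = 0"
  using L_pos by (auto simp: wave_def vec_eq_iff) (metis less_irrefl)

lemma ee_cont: "continuous_on S (ee k)"
  unfolding ee_def by (intro continuous_intros continuous_on_cis)

lemma ee_mult: "ee k x * ee m x = ee (k + m) x"
  by (simp add: ee_def wave_add inner_add_left cis_mult)

lemma ee_0: "ee 0 x = 1" by (simp add: ee_def wave_0)

lemma cnj_ee: "cnj (ee k x) = ee (- k) x"
  by (simp add: ee_def wave_minus cis_cnj)

lemma norm_ee [simp]: "norm (ee k x) = 1" by (simp add: ee_def)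

lemma ee_periodic: "periodic L (ee k)"
proof -
  have "ee k (x + L $ j *\<^sub>R axis j 1) = ee k x" for x j
  proof -
    have "wave L k \<bullet> (x + L $ j *\<^sub>R axis j 1) = wave L k \<bullet> x + 2 * pi * of_int (k $ j)"
      using L_pos[of j] by (simp add: inner_add_right inner_axis wave_def)
    then show ?thesis by (simp add: ee_def cis_multiple_2pi flip: cis_mult)
  qed
  then show ?thesis by (simp add: periodic_def)
qed

lemma pder_ee: "pder j (ee k) (\<lambda>x. \<i> * of_real (wave L k $ j) * ee k x)"
  unfolding pder_def
proof
  fix x
  have "((\<lambda>s. cis (wave L k \<bullet> x + wave L k $ j * s)) has_vector_derivative wave L k $ j *\<^sub>R
      (\<i> * cis (wave L k \<bullet> x + wave L k $ j * 0))) (at 0)"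
    unfolding has_vector_derivative_def
    by (rule has_derivative_eq_rhs, (rule derivative_intros)+) (auto simp: fun_eq_iff)
  moreover have "wave L k \<bullet> (x + s *\<^sub>R axis j 1) = wave L k \<bullet> x + wave L k $ j * s" for s
    by (simp add: inner_add_right inner_axis)
  ultimately show "((\<lambda>s. ee k (x + s *\<^sub>R axis j 1)) has_vector_derivative \<i> * complex_of_real (wave L k $ j) *
      ee k x) (at 0)"
    unfolding ee_def by (simp add: scaleR_conv_of_real mult_ac)
qed

lemma periodic_mult: "periodic L f \<Longrightarrow> periodic L g \<Longrightarrow> periodic L (\<lambda>x. f x * g x)"
  by (simp add: periodic_def)

text \<open>For k \<noteq> 0 some partial derivative of \<open>ee k\<close> is a nonzero multiple of
  \<open>ee k\<close>, and derivatives have mean 0.\<close>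

lemma mean_ee: "mean (ee k) = (if k = 0 then 1 else 0)"
proof (cases "k = 0")
  case True
  then show ?thesis using mean_const[of "1::complex"] by (simp add: ee_0[abs_def])
next
  case False
  then obtain j where j: "wave L k $ j \<noteq> 0" using wave_eq_0_iff[of k] by (auto simp: vec_eq_iff)
  have "mean (\<lambda>x. \<i> * of_real (wave L k $ j) * ee k x) = 0"
    by (intro integral_pder_zero[OF ee_cont ee_periodic _ pder_ee] continuous_intros ee_cont)
  then show ?thesis using False j by (simp add: mean_cmult ee_cont)
qed

lemma fc_ee: "fc (ee m) k = (if m = k then 1 else 0)"
  by (simp add: fc_def ee_mult mean_ee eq_neg_iff_add_eq_0 add.commute)

lemma fc_add: "continuous_on UNIV f \<Longrightarrow> continuous_on UNIV g \<Longrightarrow> fc (\<lambda>x. f x + g x) k = fc f k + fc g k"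
  unfolding fc_def by (simp add: distrib_left mean_add continuous_on_mult ee_cont)

lemma fc_diff: "continuous_on UNIV f \<Longrightarrow> continuous_on UNIV g \<Longrightarrow> fc (\<lambda>x. f x - g x) k = fc f k - fc g k"
  unfolding fc_def by (simp add: right_diff_distrib mean_diff continuous_on_mult ee_cont)

lemma fc_cmult: "continuous_on UNIV f \<Longrightarrow> fc (\<lambda>x. c * f x) k = c * fc f k"
  unfolding fc_def by (simp add: mult.left_commute[of _ c] mean_cmult continuous_on_mult ee_cont)

lemma fc_sum: "finite A \<Longrightarrow> (\<And>a. a \<in> A \<Longrightarrow> continuous_on UNIV (f a)) \<Longrightarrow> fc (\<lambda>x. \<Sum>a\<in>A. f a x) k = (\<Sum>a\<in>A. fc (f a) k)"
  unfolding fc_def by (simp add: sum_distrib_left mean_sum continuous_on_mult ee_cont)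

lemma fc_pder:
  assumes f: "continuous_on UNIV f" "periodic L f" and f': "continuous_on UNIV f'" and d: "pder j f f'"
  shows "fc f' k = \<i> * of_real (wave L k $ j) * fc f k"
proof -
  have "mean (\<lambda>x. ee (- k) x * f' x + (\<i> * of_real (wave L (- k) $ j) * ee (- k) x) * f x) = 0"
    by (intro integral_pder_zero[OF _ _ _ pder_mult[OF pder_ee d]] periodic_mult ee_periodic f
        continuous_intros ee_cont f')
  then have "mean (\<lambda>x. ee (- k) x * f' x) + mean (\<lambda>x. (\<i> * of_real (wave L (- k) $ j)) * (ee (- k) x * f x))
      = 0"
    by (subst (asm) mean_add) (auto intro!: continuous_intros ee_cont f f' simp: mult.assoc)
  then show ?thesis
    by (subst (asm) mean_cmult) (auto intro!: continuous_intros ee_cont f simp: fc_def wave_minus)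
qed

lemma fc_uminus_real:
  assumes "continuous_on UNIV f"
  shows "fc (\<lambda>x. of_real (f x)) (- k) = cnj (fc (\<lambda>x. of_real (f x)) k)"
proof -
  have "cnj (fc (\<lambda>x. of_real (f x)) k) = mean (\<lambda>x. cnj (ee (- k) x * of_real (f x)))"
    unfolding fc_def by (rule mean_linear[symmetric, OF bounded_linear_cnj])
        (intro continuous_intros ee_cont assms)
  then show ?thesis by (simp add: fc_def cnj_ee)
qed

text \<open>Removing one Fourier mode lowers the mean square by exactly the square of its
  coefficient. Done one mode at a time, this gives Bessel's inequality.\<close>

lemma mean_norm_sq_diff:
  assumes g: "continuous_on UNIV g"
  shows "mean (\<lambda>x. (norm (g x - fc g k * ee k x))\<^sup>2) = mean (\<lambda>x. (norm (g x))\<^sup>2) - (norm (fc g k))\<^sup>2"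
proof -
  let ?c = "fc g k"
  have eq: "(norm (g x - ?c * ee k x))\<^sup>2 = (norm (g x))\<^sup>2 - 2 * Re (cnj ?c * (ee (- k) x * g x))
      + (norm ?c)\<^sup>2" for x
  proof -
    have "complex_of_real ((norm (g x - ?c * ee k x))\<^sup>2) = (g x - ?c * ee k x) * cnj (g x - ?c * ee k x)"
      by (simp only: complex_norm_square)
    also have "\<dots> = g x * cnj (g x) - (cnj ?c * (ee (- k) x * g x) + cnj (cnj ?c * (ee (- k) x * g x)))
        + ?c * cnj ?c * (ee k x * ee (- k) x)"
      by (simp add: algebra_simps cnj_ee)
    also have "\<dots> = complex_of_real ((norm (g x))\<^sup>2 - 2 * Re (cnj ?c * (ee (- k) x * g x)) + (norm ?c)\<^sup>2)"
      unfolding ee_mult by (simp only: complex_norm_square[symmetric] complex_add_cnj) (simp add: ee_0)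
    finally show ?thesis by (simp only: of_real_eq_iff)
  qed
  have "mean (\<lambda>x. (norm (g x - ?c * ee k x))\<^sup>2) = mean (\<lambda>x. (norm (g x))\<^sup>2)
      - mean (\<lambda>x. 2 * Re (cnj ?c * (ee (- k) x * g x))) + mean (\<lambda>x. (norm ?c)\<^sup>2)"
    unfolding eq by (subst mean_add mean_diff; (intro continuous_intros g ee_cont)?)+ (rule refl)
  also have "mean (\<lambda>x. 2 * Re (cnj ?c * (ee (- k) x * g x))) = 2 * Re (mean (\<lambda>x. cnj ?c * (ee (- k) x * g x)))"
  proof -
    have "mean (\<lambda>x. 2 * Re (cnj ?c * (ee (- k) x * g x))) = 2 * mean (\<lambda>x. Re (cnj ?c * (ee (- k) x * g x)))"
      by (rule mean_cmult) (intro continuous_intros g ee_cont)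
    also have "mean (\<lambda>x. Re (cnj ?c * (ee (- k) x * g x))) = Re (mean (\<lambda>x. cnj ?c * (ee (- k) x * g x)))"
      by (rule mean_linear[OF bounded_linear_Re]) (intro continuous_intros g ee_cont)
    finally show ?thesis .
  qed
  also have "mean (\<lambda>x. cnj ?c * (ee (- k) x * g x)) = cnj ?c * ?c"
    by (subst mean_cmult) (auto intro!: continuous_intros g ee_cont simp: fc_def)
  also have "Re (cnj ?c * ?c) = (norm ?c)\<^sup>2" by (simp add: cmod_power2) (simp add: power2_eq_square)
  finally show ?thesis by (simp add: mean_const)
qed

lemma mean_norm_sq_partial_sum:
  assumes f: "continuous_on UNIV f" and F: "finite F"
  shows "mean (\<lambda>x. (norm (f x - (\<Sum>k\<in>F. fc f k * ee k x)))\<^sup>2) = mean (\<lambda>x. (norm (f x))\<^sup>2)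
      - (\<Sum>k\<in>F. (norm (fc f k))\<^sup>2)"
  using F
proof (induction F rule: finite_induct)
  case (insert k F)
  define g where "g x = f x - (\<Sum>k\<in>F. fc f k * ee k x)" for x
  have gc: "continuous_on UNIV g" unfolding g_def by (intro continuous_intros f ee_cont)
  have "fc g k = fc f k - (\<Sum>m\<in>F. fc f m * fc (ee m) k)"
    unfolding g_def using insert.hyps
    by (subst fc_diff) (simp_all add: fc_sum fc_cmult ee_cont continuous_on_mult continuous_on_sum f)
  also have "\<dots> = fc f k" using insert.hyps by (auto simp: fc_ee intro!: sum.neutral)
  finally have gk: "fc g k = fc f k" .
  have "mean (\<lambda>x. (norm (f x - (\<Sum>k\<in>insert k F. fc f k * ee k x)))\<^sup>2)
      = mean (\<lambda>x. (norm (g x - fc g k * ee k x))\<^sup>2)"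
    using insert.hyps by (simp add: g_def gk algebra_simps)
  also have "\<dots> = mean (\<lambda>x. (norm (g x))\<^sup>2) - (norm (fc f k))\<^sup>2"
    using mean_norm_sq_diff[OF gc, of k] by (simp only: gk)
  finally show ?case using insert by (simp add: g_def)
qed simp

lemma bessel:
  assumes f: "continuous_on UNIV f" and F: "finite F"
  shows "(\<Sum>k\<in>F. (norm (fc f k))\<^sup>2) \<le> mean (\<lambda>x. (norm (f x))\<^sup>2)"
  using mean_norm_sq_partial_sum[OF assms] mean_nonneg[of "\<lambda>x. (norm (f x - (\<Sum>k\<in>F. fc f k * ee k x)))\<^sup>2"]
  by (simp add: continuous_intros f ee_cont)

end

section \<open>Summability over the lattice of wave vectors\<close>

lemma summable_on_int_powr:
  "(\<lambda>n::int. (1 + (of_int n)\<^sup>2) powr (- (2/3)) :: real) summable_on UNIV"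
proof -
  let ?f = "\<lambda>n::int. (1 + (of_int n)\<^sup>2) powr (- (2/3)) :: real"
  have nat: "(\<lambda>n::nat. ?f (int n)) summable_on UNIV"
  proof -
    have "summable (\<lambda>n::nat. real n powr (-4/3))" by (simp add: summable_real_powr_iff)
    then have "summable (\<lambda>n::nat. ?f (int n))"
    proof (rule summable_comparison_test_ev[rotated])
      show "\<forall>\<^sub>F n in sequentially. norm (?f (int n)) \<le> real n powr (-4/3)"
        using eventually_gt_at_top[of 0]
      proof eventually_elim
        case (elim n)
        have "?f (int n) \<le> ((real n)\<^sup>2) powr (- (2/3))"
          using elim by (intro powr_mono2') auto
        also have "\<dots> = real n powr (-4/3)"
          using elim by (simp add: powr_powr flip: powr_numeral)
        finally show ?case by simp
      qed
    qed
    then show ?thesis by (intro norm_summable_imp_summable_on) simp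
  qed
  have nat': "(\<lambda>n::nat. ?f (- int n)) summable_on UNIV" using nat by simp
  have 1: "?f summable_on range int"
    by (subst summable_on_reindex) (use nat in \<open>auto simp: o_def\<close>)
  have 2: "?f summable_on range (\<lambda>n. - int n)"
    by (subst summable_on_reindex) (use nat' in \<open>auto simp: o_def inj_on_def\<close>)
  have "?f summable_on (range (\<lambda>n. - int n) - range int)"
    by (rule summable_on_subset_banach[OF 2]) auto
  then have "?f summable_on (range int \<union> (range (\<lambda>n. - int n) - range int))"
    by (intro summable_on_Un_disjoint 1) auto
  moreover have "range int \<union> (range (\<lambda>n. - int n) - range int) = UNIV"
  proof (intro equalityI subsetI UNIV_I)
    fix n :: int
    show "n \<in> range int \<union> (range (\<lambda>n. - int n) - range int)"
    proof (cases "n \<ge> 0")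
      case True
      then have "n = int (nat n)" by simp
      then show ?thesis by blast
    next
      case False
      then have "n = - int (nat (- n))" by simp
      then show ?thesis by blast
    qed
  qed
  ultimately show ?thesis by simp
qed

context torus
begin

text \<open>The lower bound 1 gives the zero wave vector a positive weight; by \<open>rho_eq\<close>
  it changes no other value once nonzero wave vectors have length at least 1.\<close>

definition rho :: "int^3 \<Rightarrow> real" where "rho k = max 1 (norm (wave L k))"

lemma rho_ge1: "rho k \<ge> 1" by (simp add: rho_def)

lemma rho_minus: "rho (- k) = rho k" by (simp add: rho_def wave_minus)

lemma rho_add: "rho k \<le> rho m + rho (k - m)"
  using norm_triangle_ineq[of "wave L m" "wave L (k - m)"] by (auto simp: rho_def wave_diff)

text \<open>The square of rho dominates c (1 + k_j^2) for each of the three components. Multiplying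
  the three bounds and raising to the power -2/3 gives rho^(-4) on one side and, on the other, a
  product of one-dimensional terms of order |n|^(-4/3), each of which is summable.\<close>

lemma rho_summable: "(\<lambda>k. 1 / (rho k) ^ 4) summable_on UNIV"
proof -
  \<comment> \<open>Half of the smallest constant, because 1 and k_j^2 are dominated by the same
    square of rho and the two bounds are added.\<close>
  define c where "c = min 1 (Min (range (\<lambda>j. (2 * pi / L $ j)\<^sup>2))) / 2"
  have cpos: "c > 0"
    using L_pos by (auto simp: c_def less_imp_neq[THEN not_sym])
  have c1: "2 * c \<le> 1" "2 * c \<le> (2 * pi / L $ j)\<^sup>2" for j
  proof -
    show "2 * c \<le> 1" by (simp add: c_def)
    have "Min (range (\<lambda>j. (2 * pi / L $ j)\<^sup>2)) \<le> (2 * pi / L $ j)\<^sup>2" by (intro Min_le) auto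
    then show "2 * c \<le> (2 * pi / L $ j)\<^sup>2" unfolding c_def by linarith
  qed
  define g :: "int \<Rightarrow> real" where "g n = (1 + (of_int n)\<^sup>2) powr (- (2/3))" for n
  have g0: "g n \<ge> 0" for n by (simp add: g_def)
  have gs: "g summable_on UNIV" unfolding g_def by (rule summable_on_int_powr)
  have comp: "c * (1 + (of_int (k $ j))\<^sup>2) \<le> (rho k)\<^sup>2" for k j
  proof -
    have "\<bar>wave L k $ j\<bar> \<le> rho k" using component_le_norm_cart[of "wave L k" j] by (simp add: rho_def)
    then have "(wave L k $ j)\<^sup>2 \<le> (rho k)\<^sup>2" by
        (metis abs_le_square_iff abs_of_nonneg order_trans rho_ge1 zero_le_one)
    moreover have "(wave L k $ j)\<^sup>2 = (2 * pi / L $ j)\<^sup>2 * (of_int (k $ j))\<^sup>2"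
      by (simp add: wave_def power_mult_distrib power_divide)
    moreover have "2 * c * (of_int (k $ j))\<^sup>2 \<le> (2 * pi / L $ j)\<^sup>2 * (of_int (k $ j))\<^sup>2"
      by (intro mult_right_mono c1) auto
    moreover have "1 \<le> (rho k)\<^sup>2" using rho_ge1[of k] by simp
    moreover have "2 * c \<le> 1" by (rule c1)
    ultimately show ?thesis by (simp add: distrib_left)
  qed
  have le: "1 / (rho k) ^ 4 \<le> c powr (-2) * (g (k $ 1) * (g (k $ 2) * g (k $ 3)))" for k
  proof -
    have p: "1 + (of_int n)\<^sup>2 > (0::real)" for n :: int by (simp add: add_pos_nonneg)
    have r: "rho k > 0" using rho_ge1[of k] by linarith
    have "(c * (1 + (of_int (k $ 1))\<^sup>2)) * ((c * (1 + (of_int (k $ 2))\<^sup>2)) * (c * (1 + (of_int (k $ 3))\<^sup>2)))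
        \<le> (rho k)\<^sup>2 * ((rho k)\<^sup>2 * (rho k)\<^sup>2)"
      using cpos by (intro mult_mono comp mult_nonneg_nonneg) (auto simp: add_nonneg_nonneg)
    then have "((rho k)\<^sup>2 * ((rho k)\<^sup>2 * (rho k)\<^sup>2)) powr (-2/3)
        \<le> ((c * (1 + (of_int (k $ 1))\<^sup>2)) * ((c * (1 + (of_int (k $ 2))\<^sup>2)) * (c * (1 + (of_int (k $ 3))\<^sup>2))))
        powr (-2/3)"
      using cpos p by (intro powr_mono2') (auto intro!: mult_pos_pos)
    also have "\<dots> = (c powr (-2/3) * c powr (-2/3) * c powr (-2/3)) * (g (k $ 1) * (g (k $ 2) * g (k $ 3)))"
      using cpos p by (simp add: powr_mult g_def less_imp_le)
    also have "c powr (-2/3) * c powr (-2/3) * c powr (-2/3) = c powr (-2)"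
      by (simp flip: powr_add)
    also have "((rho k)\<^sup>2 * ((rho k)\<^sup>2 * (rho k)\<^sup>2)) powr (-2/3) = 1 / (rho k) ^ 4"
    proof -
      have "(rho k)\<^sup>2 * ((rho k)\<^sup>2 * (rho k)\<^sup>2) = rho k powr 6"
        using powr_numeral[of "rho k" "num.Bit0 (num.Bit1 num.One)"] r by (simp flip: power_add)
      then have "((rho k)\<^sup>2 * ((rho k)\<^sup>2 * (rho k)\<^sup>2)) powr (-2/3) = rho k powr (6 * (-2/3))"
        by (simp only: powr_powr)
      also have "6 * (-2/3) = (- 4 :: real)" by simp
      also have "rho k powr (- 4) = 1 / rho k powr 4" by (rule powr_minus_divide)
      also have "rho k powr 4 = rho k ^ 4" using powr_numeral[of "rho k" "num.Bit0 (num.Bit0 num.One)"] r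
          by simp
      finally show ?thesis .
    qed
    finally show ?thesis .
  qed
  have "(\<lambda>k::int^3. g (k $ 1) * (g (k $ 2) * g (k $ 3))) summable_on UNIV"
  proof -
    define h where "h k = (k $ 1, k $ 2, k $ 3)" for k :: "int^3"
    have inj: "inj h" by (auto simp: inj_def h_def vec_eq_iff forall_3)
    define G where "G p = g (fst p) * (g (fst (snd p)) * g (snd (snd p)))" for p :: "int \<times> int \<times> int"
    have "(\<lambda>p::int\<times>int. g (fst p) * g (snd p)) summable_on UNIV \<times> UNIV"
      by (rule summable_on_product_nonneg(1)) (auto simp: gs g0)
    then have "(\<lambda>p. g (fst p) * (\<lambda>p::int\<times>int. g (fst p) * g (snd p)) (snd p)) summable_on UNIV \<times> UNIV"
      by (intro summable_on_product_nonneg(1)) (auto simp: gs g0)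
    then have "G summable_on UNIV" by (simp add: G_def[abs_def])
    then have "G summable_on range h" by (rule summable_on_subset_banach) simp
    then show ?thesis by (subst (asm) summable_on_reindex[OF inj]) (simp add: o_def G_def h_def)
  qed
  then have "(\<lambda>k. c powr (-2) * (g (k $ 1) * (g (k $ 2) * g (k $ 3)))) summable_on (UNIV :: (int^3) set)"
    by (rule summable_on_cmult_right)
  then show ?thesis
    by (rule summable_on_comparison_test[OF _ le]) (simp add: rho_def)
qed

section \<open>Density of trigonometric polynomials\<close>

inductive_set trig_poly :: "(real^3 \<Rightarrow> complex) set" where
  trig_poly_base: "(\<lambda>x. c * ee k x) \<in> trig_poly"
| trig_poly_add: "f \<in> trig_poly \<Longrightarrow> g \<in> trig_poly \<Longrightarrow> (\<lambda>x. f x + g x) \<in> trig_poly"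

lemma trig_poly_cont: "f \<in> trig_poly \<Longrightarrow> continuous_on UNIV f"
  by (induction rule: trig_poly.induct) (intro continuous_intros ee_cont; assumption)+

lemma trig_poly_const: "(\<lambda>x. c) \<in> trig_poly"
  using trig_poly_base[of c 0] by (simp add: ee_0)

lemma trig_poly_mult:
  assumes "f \<in> trig_poly" "g \<in> trig_poly" shows "(\<lambda>x. f x * g x) \<in> trig_poly"
  using assms(1)
proof (induction rule: trig_poly.induct)
  case (trig_poly_base c k)
  show ?case using assms(2)
  proof (induction rule: trig_poly.induct)
    case (trig_poly_base d m)
    have "(\<lambda>x. c * ee k x * (d * ee m x)) = (\<lambda>x. (c * d) * ee (k + m) x)"
      by (auto simp: fun_eq_iff simp flip: ee_mult)
    then show ?case using trig_poly.trig_poly_base[of "c * d" "k + m"] by simp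
  next
    case (trig_poly_add f g)
    then show ?case using trig_poly.trig_poly_add by (simp add: distrib_left)
  qed
next
  case (trig_poly_add f g)
  then show ?case using trig_poly.trig_poly_add by (simp add: distrib_right)
qed

lemma trig_poly_sum: "(\<And>a. a \<in> A \<Longrightarrow> f a \<in> trig_poly) \<Longrightarrow> (\<lambda>x. \<Sum>a\<in>A. f a x) \<in> trig_poly"
proof (induction A rule: infinite_finite_induct)
  case (insert x F)
  then show ?case using trig_poly_add[of "f x" "\<lambda>y. \<Sum>a\<in>F. f a y"] by simp
qed (auto simp: trig_poly_const)

text \<open>Embeds the torus into a compact subset of \<open>complex^3\<close>, where the Stone-Weierstrass theorem applies.\<close>

definition torus_map :: "real^3 \<Rightarrow> complex^3" where
  "torus_map x = (\<chi> j. cis (2 * pi * x $ j / L $ j))"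

lemma torus_map_ee: "torus_map x $ j = ee (axis j 1) x"
proof -
  have "wave L (axis j 1) = axis j (2 * pi / L $ j)"
    by (simp add: wave_def vec_eq_iff axis_def)
  then show ?thesis by (simp add: torus_map_def ee_def inner_axis' mult.commute)
qed

text \<open>A real-linear functional of \<open>torus_map x\<close> combines real and imaginary parts
  of its coordinates, that is, the waves \<open>ee (axis j 1)\<close> and their conjugates. It is
  the base case for polynomials in these coordinates.\<close>

lemma trig_poly_linear:
  assumes h: "bounded_linear h"
  shows "(\<lambda>x. complex_of_real (h (torus_map x))) \<in> trig_poly"
proof -
  have z: "z = (\<Sum>j\<in>UNIV. Re (z $ j) *\<^sub>R axis j 1 + Im (z $ j) *\<^sub>R axis j \<i>)" for z :: "complex^3"
    by (simp add: vec_eq_iff axis_def if_distrib[of "\<lambda>x. _ *\<^sub>R x"] sum.distrib sum.delta complex_eq_iff cong: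
        if_cong)
  have "h (torus_map x) = (\<Sum>j\<in>UNIV. Re (torus_map x $ j) * h (axis j 1)
      + Im (torus_map x $ j) * h (axis j \<i>))" for x
    by (subst z[of "torus_map x"])
       (simp add: linear_sum[OF bounded_linear.linear[OF h]] linear_add[OF bounded_linear.linear[OF h]]
           linear_scale[OF bounded_linear.linear[OF h]])
  moreover have "complex_of_real (Re (torus_map x $ j) * h (axis j 1) + Im (torus_map x $ j) * h (axis j \<i>))
     = ((of_real (h (axis j 1)) - \<i> * of_real (h (axis j \<i>))) / 2) * ee (axis j 1) x
         + ((of_real (h (axis j 1)) + \<i> * of_real (h (axis j \<i>))) / 2) * ee (- axis j 1) x" for x j
    unfolding torus_map_ee by (simp add: complex_eq_iff algebra_simps flip: cnj_ee) (simp add: field_simps)?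
  ultimately have "(\<lambda>x. complex_of_real (h (torus_map x)))
      = (\<lambda>x. \<Sum>j\<in>UNIV. ((of_real (h (axis j 1)) - \<i> * of_real (h (axis j \<i>))) / 2) * ee (axis j 1) x
      + ((of_real (h (axis j 1)) + \<i> * of_real (h (axis j \<i>))) / 2) * ee (- axis j 1) x)"
    by (simp only: of_real_sum)
  moreover have "\<dots> \<in> trig_poly" by (intro trig_poly_sum trig_poly_add trig_poly_base)
  ultimately show ?thesis by simp
qed

lemma trig_poly_real_polynomial:
  "real_polynomial_function p \<Longrightarrow> (\<lambda>x. complex_of_real (p (torus_map x))) \<in> trig_poly"
  by (induction p rule: real_polynomial_function.induct)
      (auto simp: trig_poly_const trig_poly_linear trig_poly_add trig_poly_mult)

lemma periodic_int:
  assumes "periodic L f"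
  shows "f (x + (of_int n * L $ j) *\<^sub>R axis j 1) = f x"
proof (induction n rule: int_induct[where k = 0])
  case (step1 i)
  have "x + (of_int (i + 1) * L $ j) *\<^sub>R axis j 1 = (x + (of_int i * L $ j) *\<^sub>R axis j 1)
      + (L $ j) *\<^sub>R axis j 1"
    by (simp add: algebra_simps)
  then show ?case using step1 assms[unfolded periodic_def, rule_format, of
      "x + (of_int i * L $ j) *\<^sub>R axis j 1" j] by (simp only:)
next
  case (step2 i)
  have "x + (of_int i * L $ j) *\<^sub>R axis j 1 = (x + (of_int (i - 1) * L $ j) *\<^sub>R axis j 1)
      + (L $ j) *\<^sub>R axis j 1"
    by (simp add: algebra_simps)
  then show ?case using step2 assms by (metis periodic_def)
qed simp

text \<open>The fibres of \<open>torus_map\<close> are the classes modulo the period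
  lattice.\<close>

lemma torus_map_eqD:
  assumes f: "periodic L f" and eq: "torus_map x = torus_map y"
  shows "f x = f y"
proof -
  have "\<exists>n::int. x $ j = y $ j + of_int n * L $ j" for j
  proof -
    have "cis (2 * pi * x $ j / L $ j) = cis (2 * pi * y $ j / L $ j)"
      using arg_cong[OF eq, of "\<lambda>z. z $ j"] by (simp add: torus_map_def)
    then obtain n :: int where "2 * pi * x $ j / L $ j = 2 * pi * y $ j / L $ j + 2 * pi * of_int n"
      using sin_cos_eq_iff[of "2 * pi * x $ j / L $ j" "2 * pi * y $ j / L $ j"] by (auto simp: complex_eq_iff)
    then have "2 * pi * (x $ j / L $ j) = 2 * pi * (y $ j / L $ j + of_int n)" by (simp add: distrib_left)
    then have "x $ j / L $ j = y $ j / L $ j + of_int n" by (simp only: mult_cancel_left) simp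
    then show ?thesis using L_pos[of j] by (intro exI[of _ n]) (simp add: field_simps)
  qed
  then obtain n where n: "\<And>j. x $ j = y $ j + of_int (n j) * L $ j" by metis
  have "x = ((y + (of_int (n 1) * L $ 1) *\<^sub>R axis 1 1) + (of_int (n 2) * L $ 2) *\<^sub>R axis 2 1)
      + (of_int (n 3) * L $ 3) *\<^sub>R axis 3 1"
    using n by (simp add: vec_eq_iff forall_3 axis_def)
  then show ?thesis by (simp only: periodic_int[OF f])
qed

lemma torus_map_cont: "continuous_on S torus_map"
  unfolding torus_map_def using L_pos by (intro continuous_on_vec_lambda continuous_on_cis continuous_intros)
      (metis less_irrefl)

text \<open>f factors through \<open>torus_map\<close> as F, and F is continuous on the image S
  because preimages of closed sets under F are images of compact sets. Stone-Weierstrass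
  approximates F by a polynomial, which pulls back to a trigonometric polynomial.\<close>

lemma trig_poly_dense:
  assumes f: "continuous_on UNIV f" "periodic L f" and e: "e > 0"
  shows "\<exists>g\<in>trig_poly. \<forall>x\<in>cbox 0 L. norm (f x - g x) < e"
proof -
  define S where "S = torus_map ` cbox 0 L"
  define F where "F y = f (SOME x. x \<in> cbox 0 L \<and> torus_map x = y)" for y
  have F: "F (torus_map x) = f x" if "x \<in> cbox 0 L" for x
  proof -
    have "\<exists>x'. x' \<in> cbox 0 L \<and> torus_map x' = torus_map x" using that by blast
    from someI_ex[OF this] show ?thesis unfolding F_def by (intro torus_map_eqD[OF f(2)]) simp
  qed
  have S: "compact S" unfolding S_def by (intro compact_continuous_image torus_map_cont compact_cbox)
  have Fc: "continuous_on S F"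
    unfolding continuous_on_closed_vimage[OF compact_imp_closed[OF S]]
  proof (intro allI impI)
    fix B :: "complex set" assume B: "closed B"
    have "F -` B \<inter> S = torus_map ` (cbox 0 L \<inter> f -` B)"
      using F by (force simp: S_def)
    moreover have "closed (f -` B)" using continuous_closed_vimage[OF B, of f] f(1)
        by (simp add: continuous_on_eq_continuous_at)
    then have "compact (cbox 0 L \<inter> f -` B)" by (intro compact_Int_closed compact_cbox)
    then have "compact (torus_map ` (cbox 0 L \<inter> f -` B))" by (intro compact_continuous_image torus_map_cont)
    ultimately show "closed (F -` B \<inter> S)" by (simp add: compact_imp_closed)
  qed
  obtain p where p: "polynomial_function p" "\<And>y. y \<in> S \<Longrightarrow> norm (F y - p y) < e"
    using Stone_Weierstrass_polynomial_function[OF S Fc e] by blast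
  have re: "real_polynomial_function (\<lambda>y. Re (p y))" "real_polynomial_function (\<lambda>y. Im (p y))"
    using p(1) bounded_linear_Re bounded_linear_Im unfolding polynomial_function_def o_def by blast+
  have "(\<lambda>x. complex_of_real (Re (p (torus_map x))) + \<i> * complex_of_real (Im (p (torus_map x)))) \<in> trig_poly"
    by (intro trig_poly_add trig_poly_mult trig_poly_const trig_poly_real_polynomial[OF re(1)]
        trig_poly_real_polynomial[OF re(2)])
  then have "(\<lambda>x. p (torus_map x)) \<in> trig_poly" by (simp flip: complex_eq)
  moreover have "norm (f x - p (torus_map x)) < e" if "x \<in> cbox 0 L" for x
    using p(2)[of "torus_map x"] F[OF that] that by (simp add: S_def)
  ultimately show ?thesis by (intro bexI[of _ "\<lambda>x. p (torus_map x)"]) auto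
qed

section \<open>Uniqueness and absolutely convergent Fourier series\<close>

lemma fc_zero_orthogonal:
  assumes f: "continuous_on UNIV f" "\<And>k. fc f k = 0" and g: "g \<in> trig_poly"
  shows "mean (\<lambda>x. f x * cnj (g x)) = 0"
  using g
proof (induction rule: trig_poly.induct)
  case (trig_poly_base c k)
  have "mean (\<lambda>x. f x * cnj (c * ee k x)) = mean (\<lambda>x. cnj c * (ee (- k) x * f x))"
    by (simp add: cnj_ee mult_ac)
  also have "\<dots> = cnj c * fc f k"
    unfolding fc_def by (rule mean_cmult) (intro continuous_intros ee_cont f)
  finally show ?case using f by simp
next
  case (trig_poly_add g h)
  then show ?case
    by (simp add: distrib_left mean_add continuous_intros f trig_poly_cont)
qed

text \<open>f is orthogonal to every trigonometric polynomial g, so the mean of |f|^2 is the mean of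
  the real part of f times the conjugate of f - g, at most e times the mean of |f|. A continuous
  function of mean square 0 vanishes on the cell.\<close>

lemma fc_unique:
  assumes f: "continuous_on UNIV f" "periodic L f" "\<And>k. fc f k = 0" and x: "x \<in> cbox 0 L"
  shows "f x = 0"
proof -
  define M where "M = mean (\<lambda>x. (norm (f x))\<^sup>2)"
  define A where "A = mean (\<lambda>x. norm (f x))"
  have A: "A \<ge> 0" unfolding A_def by (intro mean_nonneg continuous_intros f) auto
  have le: "M \<le> e * A" if e: "e > 0" for e
  proof -
    obtain g where g: "g \<in> trig_poly" "\<And>x. x \<in> cbox 0 L \<Longrightarrow> norm (f x - g x) < e"
        using trig_poly_dense[OF f(1,2) e] by blast
    have gc: "continuous_on UNIV g" by (rule trig_poly_cont[OF g(1)])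
    have "M = mean (\<lambda>x. Re (f x * cnj (f x - g x)) + Re (f x * cnj (g x)))"
      unfolding M_def by (rule mean_cong) (simp add: cmod_power2 algebra_simps, simp add: power2_eq_square)
    also have "\<dots> = mean (\<lambda>x. Re (f x * cnj (f x - g x))) + Re (mean (\<lambda>x. f x * cnj (g x)))"
      by (subst mean_add; (intro continuous_intros f gc)?)
          (subst mean_linear[OF bounded_linear_Re]; (intro continuous_intros f gc)?; simp)
    also have "mean (\<lambda>x. f x * cnj (g x)) = 0" by (rule fc_zero_orthogonal[OF f(1,3) g(1)])
    also have "mean (\<lambda>x. Re (f x * cnj (f x - g x))) \<le> mean (\<lambda>x. e * norm (f x))"
    proof (rule mean_mono)
      fix x assume "x \<in> cbox 0 L"
      then have "norm (f x - g x) \<le> e" using g(2) by (simp add: less_imp_le)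
      have "Re (f x * cnj (f x - g x)) \<le> norm (f x * cnj (f x - g x))" by (rule complex_Re_le_cmod)
      also have "\<dots> = norm (f x) * norm (f x - g x)" by (simp only: norm_mult complex_mod_cnj)
      also have "\<dots> \<le> norm (f x) * e" by (intro mult_left_mono \<open>norm (f x - g x) \<le> e\<close>) auto
      finally show "Re (f x * cnj (f x - g x)) \<le> e * norm (f x)" by (simp add: mult.commute)
    qed (intro continuous_intros f gc)+
    also have "mean (\<lambda>x. e * norm (f x)) = e * A" unfolding A_def
        by (rule mean_cmult) (intro continuous_intros f)
    finally show ?thesis by simp
  qed
  have "M \<le> 0"
  proof (rule field_le_epsilon)
    fix d :: real assume d: "d > 0"
    have "M \<le> (d / (A + 1)) * A" using A d by (intro le) auto
    also have "\<dots> \<le> d" using A d by (simp add: field_simps)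
    finally show "M \<le> 0 + d" by simp
  qed
  moreover have "M \<ge> 0" unfolding M_def by (intro mean_nonneg continuous_intros f) auto
  ultimately have "integral (cbox 0 L) (\<lambda>x. (norm (f x))\<^sup>2) = 0"
    using vol_pos by (simp add: M_def mean_def)
  moreover have "box 0 L \<noteq> {}" using L_pos by (simp add: interval_ne_empty_cart)
  ultimately have "\<forall>x\<in>cbox 0 L. (norm (f x))\<^sup>2 = 0"
    by (subst (asm) integral_cbox_eq_0_iff) (auto intro!: continuous_intros continuous_on_subset[OF f(1)])
  then show ?thesis using x by simp
qed

text \<open>Termwise integration, justified by the M-test. Only the factor g is expanded: in the
  application h is a spatial derivative of the velocity, of which only continuity is used.\<close>

lemma fc_mult_series:
  assumes a: "(\<lambda>k. norm (a k)) summable_on UNIV" and h: "continuous_on UNIV h"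
    and g: "\<And>x. x \<in> cbox 0 L \<Longrightarrow> g x = (\<Sum>\<^sub>\<infinity>k. a k * ee k x)"
  shows "((\<lambda>k. a k * fc h (m - k)) has_sum fc (\<lambda>x. g x * h x) m) UNIV"
proof -
  have "bounded (h ` cbox 0 L)"
    by (intro compact_imp_bounded compact_continuous_image continuous_on_subset[OF h] compact_cbox) auto
  then obtain B where B: "\<And>x. x \<in> cbox 0 L \<Longrightarrow> norm (h x) \<le> B" by (auto simp: bounded_iff)
  define t where "t k x = ee (- m) x * (a k * ee k x) * h x" for k x
  have tc: "continuous_on UNIV (t k)" for k unfolding t_def by (intro continuous_intros ee_cont h)
  have "uniform_limit (cbox 0 L) (\<lambda>F x. \<Sum>k\<in>F. t k x) (\<lambda>x. \<Sum>\<^sub>\<infinity>k. t k x) (finite_subsets_at_top UNIV)"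
  proof (rule Weierstrass_m_test_general)
    show "(\<lambda>k. norm (a k) * B) summable_on UNIV" by (rule summable_on_cmult_left[OF a])
    show "norm (t k x) \<le> norm (a k) * B" if "x \<in> cbox 0 L" for k x
      using B[OF that] by (simp add: t_def norm_mult mult_left_mono)
  qed
  then obtain I J where IJ: "\<And>F. ((\<lambda>x. \<Sum>k\<in>F. t k x) has_integral I F) (cbox 0 L)"
      "((\<lambda>x. \<Sum>\<^sub>\<infinity>k. t k x) has_integral J) (cbox 0 L)" "(I \<longlongrightarrow> J) (finite_subsets_at_top UNIV)"
    by (rule uniform_limit_integral_cbox) (auto intro!: continuous_on_sum continuous_on_subset[OF tc])
  have "(1 / vol) *\<^sub>R J = fc (\<lambda>x. g x * h x) m"
  proof -
    have "(1 / vol) *\<^sub>R J = mean (\<lambda>x. \<Sum>\<^sub>\<infinity>k. t k x)"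
      unfolding mean_def integral_unique[OF IJ(2)] ..
    also have "\<dots> = fc (\<lambda>x. g x * h x) m" unfolding fc_def
    proof (rule mean_cong)
      fix x assume x: "x \<in> cbox 0 L"
      show "(\<Sum>\<^sub>\<infinity>k. t k x) = ee (- m) x * (g x * h x)"
        unfolding t_def g[OF x] by (simp add: infsum_cmult_left' infsum_cmult_right')
    qed
    finally show ?thesis .
  qed
  moreover have "(1 / vol) *\<^sub>R I F = (\<Sum>k\<in>F. a k * fc h (m - k))" if F: "finite F" for F
  proof -
    have "(1 / vol) *\<^sub>R I F = mean (\<lambda>x. \<Sum>k\<in>F. t k x)" unfolding mean_def integral_unique[OF IJ(1)] ..
    also have "\<dots> = (\<Sum>k\<in>F. mean (t k))" by (rule mean_sum[OF F tc])
    also have "\<dots> = (\<Sum>k\<in>F. a k * fc h (m - k))"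
    proof (rule sum.cong[OF refl])
      fix k
      have "t k = (\<lambda>x. a k * (ee (- (m - k)) x * h x))"
      proof
        fix x
        have "ee (- (m - k)) x = ee (- m) x * ee k x" by (simp add: ee_mult)
        then show "t k x = a k * (ee (- (m - k)) x * h x)" by (simp add: t_def mult_ac)
      qed
      then have "mean (t k) = mean (\<lambda>x. a k * (ee (- (m - k)) x * h x))" by simp
      also have "\<dots> = a k * fc h (m - k)" unfolding fc_def
          by (rule mean_cmult) (intro continuous_intros ee_cont h)
      finally show "mean (t k) = a k * fc h (m - k)" .
    qed
    finally show ?thesis .
  qed
  moreover have "((\<lambda>F. (1 / vol) *\<^sub>R I F) \<longlongrightarrow> (1 / vol) *\<^sub>R J) (finite_subsets_at_top UNIV)"
    by (intro tendsto_intros IJ)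
  ultimately have "((\<lambda>F. (1 / vol) *\<^sub>R I F) \<longlongrightarrow> fc (\<lambda>x. g x * h x) m) (finite_subsets_at_top UNIV)" by simp
  then show ?thesis unfolding has_sum_def
    by (rule Lim_transform_eventually) (rule eventually_finite_subsets_at_top_weakI, simp add:
        \<open>\<And>F. finite F \<Longrightarrow> (1 / vol) *\<^sub>R I F = (\<Sum>k\<in>F. a k * fc h (m - k))\<close>)
qed

lemma ee_series_cont:
  assumes a: "(\<lambda>k. norm (a k)) summable_on UNIV"
  shows "continuous_on UNIV (\<lambda>x. \<Sum>\<^sub>\<infinity>k. a k * ee k x)"
proof (rule uniform_limit_theorem)
  show "uniform_limit UNIV (\<lambda>F x. \<Sum>k\<in>F. a k * ee k x) (\<lambda>x. \<Sum>\<^sub>\<infinity>k. a k * ee k x) (finite_subsets_at_top UNIV)"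
    by (rule Weierstrass_m_test_general[OF _ a]) (simp add: norm_mult)
  show "\<forall>\<^sub>F F in finite_subsets_at_top UNIV. continuous_on UNIV (\<lambda>x. \<Sum>k\<in>F. a k * ee k x)"
    by (intro always_eventually allI continuous_intros ee_cont)
qed simp

lemma fc_ee_series:
  assumes a: "(\<lambda>k. norm (a k)) summable_on UNIV"
  shows "fc (\<lambda>x. \<Sum>\<^sub>\<infinity>k. a k * ee k x) m = a m"
proof -
  have one: "fc (\<lambda>x. 1) (m - k) = (if k = m then 1 else 0)" for k
    using fc_ee[of 0 "m - k"] by (simp add: ee_0[abs_def])
  have "((\<lambda>k. a k * fc (\<lambda>x. 1) (m - k)) has_sum fc (\<lambda>x. (\<Sum>\<^sub>\<infinity>k. a k * ee k x) * 1) m) UNIV"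
    by (rule fc_mult_series[OF a]) auto
  moreover have "((\<lambda>k. a k * fc (\<lambda>x. 1) (m - k)) has_sum a m) UNIV"
  proof -
    have "((\<lambda>k. a k * fc (\<lambda>x. 1) (m - k)) has_sum a m) {m}"
      by (rule has_sum_finiteI) (use one[of m] in simp_all)
    then show ?thesis by (subst (asm) has_sum_cong_neutral[of UNIV "{m}" "\<lambda>k. a k * fc (\<lambda>x. 1) (m - k)"])
        (auto simp: one)
  qed
  ultimately have "fc (\<lambda>x. (\<Sum>\<^sub>\<infinity>k. a k * ee k x) * 1) m = a m" by (rule has_sum_unique)
  then show ?thesis by simp
qed

lemma ee_series_periodic: "periodic L (\<lambda>x. \<Sum>\<^sub>\<infinity>k. a k * ee k x)"
  using ee_periodic unfolding periodic_def by simp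

text \<open>The series is a continuous periodic function with the same coefficients as f, so
  \<open>fc_unique\<close> identifies the two.\<close>

lemma fourier_series:
  assumes f: "continuous_on UNIV f" "periodic L f" and s: "(\<lambda>k. norm (fc f k)) summable_on UNIV"
      and x: "x \<in> cbox 0 L"
  shows "f x = (\<Sum>\<^sub>\<infinity>k. fc f k * ee k x)"
proof -
  define g where "g x = (\<Sum>\<^sub>\<infinity>k. fc f k * ee k x)" for x
  have g: "continuous_on UNIV g" "periodic L g" "\<And>k. fc g k = fc f k"
    unfolding g_def using ee_series_cont[OF s] ee_series_periodic fc_ee_series[OF s] by auto
  have "f x - g x = 0"
  proof (rule fc_unique[OF _ _ _ x])
    show "continuous_on UNIV (\<lambda>x. f x - g x)" by (intro continuous_intros f g)
    show "periodic L (\<lambda>x. f x - g x)" using f g by (simp add: periodic_def)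
    show "fc (\<lambda>x. f x - g x) k = 0" for k by (simp add: fc_diff f g)
  qed
  then show ?thesis by (simp add: g_def)
qed

end

section \<open>Energy estimates for the rotating flow\<close>

lemma pder_dx:
  assumes "\<And>x. (\<lambda>s. f (x + s *\<^sub>R axis k 1)) differentiable (at 0)"
  shows "pder k f (dx k f)"
  unfolding pder_def dx_def using assms by (simp add: vector_derivative_works)

lemma periodic_dx: "periodic L f \<Longrightarrow> periodic L (dx k f)"
proof -
  assume f: "periodic L f"
  have "f (x + L $ j *\<^sub>R axis j 1 + s *\<^sub>R axis k 1) = f (x + s *\<^sub>R axis k 1)" for x j s
    using f[unfolded periodic_def, rule_format, of "x + s *\<^sub>R axis k 1" j] by (simp add: algebra_simps)
  then show ?thesis unfolding periodic_def dx_def by simp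
qed

lemma pder_inner:
  assumes "pder j f f'" "pder j g g'"
  shows "pder j (\<lambda>x. f x \<bullet> g x) (\<lambda>x. f x \<bullet> g' x + f' x \<bullet> g x)"
  unfolding pder_def
proof
  fix x
  show "((\<lambda>s. f (x + s *\<^sub>R axis j 1) \<bullet> g (x + s *\<^sub>R axis j 1)) has_vector_derivative f x \<bullet> g' x + f' x \<bullet> g x)
      (at 0)"
    using bounded_bilinear.has_vector_derivative[OF bounded_bilinear_inner, of "\<lambda>s. f (x + s *\<^sub>R axis j 1)"
        "f' x" 0 UNIV "\<lambda>s. g (x + s *\<^sub>R axis j 1)" "g' x"]
      assms unfolding pder_def by simp
qed

lemma continuous_on_slice:
  assumes "continuous_on ({0<..} \<times> UNIV) (\<lambda>(t, x). f t x)" "t > (0::real)"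
  shows "continuous_on UNIV (f t)"
proof -
  have "continuous_on UNIV (\<lambda>x. (case (t, x) of (t, x) \<Rightarrow> f t x))"
    by (rule continuous_on_compose2[OF assms(1),
        where f = "\<lambda>x. (t, x)"]) (use assms(2) in \<open>auto intro!: continuous_intros\<close>)
  then show ?thesis by simp
qed

lemma bounded_linear_of_real_nth: "bounded_linear (\<lambda>v::real^3. complex_of_real (v $ j))"
  by (intro bounded_linear_compose[OF bounded_linear_of_real bounded_linear_vec_nth])

context torus
begin

lemma fourier_coeff_nth:
  assumes "continuous_on UNIV h"
  shows "fourier_coeff L h k $ j = fc (\<lambda>x. of_real (h x $ j)) k"
proof -
  have c: "continuous_on UNIV (\<lambda>x. cis (- (wave L k \<bullet> x)) *s complexify (h x))"
    unfolding complexify_def vector_scalar_mult_def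
    by (intro continuous_on_vec_lambda continuous_intros continuous_on_cis assms) (simp add: assms)?
  have "fourier_coeff L h k $ j = mean (\<lambda>x. cis (- (wave L k \<bullet> x)) *s complexify (h x)) $ j"
    unfolding fourier_coeff_def average_eq_mean[OF c] ..
  also have "\<dots> = mean (\<lambda>x. (cis (- (wave L k \<bullet> x)) *s complexify (h x)) $ j)"
    by (rule mean_linear[OF bounded_linear_vec_nth c, symmetric])
  also have "\<dots> = fc (\<lambda>x. of_real (h x $ j)) k"
    by (simp add: fc_def ee_def wave_minus complexify_def)
  finally show ?thesis .
qed

lemma mean_has_derivative:
  fixes f :: "real \<Rightarrow> real^3 \<Rightarrow> 'b::euclidean_space"
  assumes f: "continuous_on ({0<..} \<times> UNIV) (\<lambda>(t, x). f t x)"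
      and f': "continuous_on ({0<..} \<times> UNIV) (\<lambda>(t, x). f' t x)"
    and d: "\<And>t x. t > 0 \<Longrightarrow> ((\<lambda>s. f s x) has_vector_derivative f' t x) (at t)" and t: "t > 0"
  shows "((\<lambda>t. mean (f t)) has_vector_derivative mean (f' t)) (at t)"
proof -
  have "((\<lambda>t. integral (cbox 0 L) (f t)) has_vector_derivative integral (cbox 0 L) (f' t)) (at t within {0<..})"
  proof (rule leibniz_rule_vector_derivative)
    show "((\<lambda>t. f t x) has_vector_derivative f' s x) (at s within {0<..})" if "s \<in> {0<..}" for s x
      using d[of s x] that by (auto intro: has_vector_derivative_at_within)
    show "f s integrable_on cbox 0 L" if "s \<in> {0<..}" for s
      by (rule continuous_integrable_cbox, rule continuous_on_slice[OF f]) (use that in auto)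
    show "continuous_on ({0<..} \<times> cbox 0 L) (\<lambda>(x, t). f' x t)"
      by (rule continuous_on_subset[OF f']) auto
  qed (use t in auto)
  moreover have "at t within {0<..} = at t" by (rule at_within_open) (use t in auto)
  ultimately have "((\<lambda>t. integral (cbox 0 L) (f t)) has_vector_derivative integral (cbox 0 L) (f' t)) (at t)"
    by (simp only:)
  from bounded_linear.has_vector_derivative[OF bounded_linear_scaleR_right this]
  show ?thesis unfolding mean_def .
qed

end

locale rotating_flow = torus L for L :: "real^3" +
  fixes \<Omega> :: real and u :: "real \<Rightarrow> real^3 \<Rightarrow> real^3" and p :: "real \<Rightarrow> real^3 \<Rightarrow> real"
  assumes u_C21: "C21 u" and p_C1: "C1_x p"
    and u_periodic: "t > 0 \<Longrightarrow> periodic L (u t)" and p_periodic: "t > 0 \<Longrightarrow> periodic L (p t)"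
    and nse: "rotating_NSE \<Omega> u p"
begin

lemma joint_cont:
  "continuous_on ({0<..} \<times> UNIV) (\<lambda>(t, x). u t x)"
  "continuous_on ({0<..} \<times> UNIV) (\<lambda>(t, x). dx k (u t) x)"
  "continuous_on ({0<..} \<times> UNIV) (\<lambda>(t, x). dx j (dx k (u t)) x)"
  "continuous_on ({0<..} \<times> UNIV) (\<lambda>(t, x). dt u t x)"
  "continuous_on ({0<..} \<times> UNIV) (\<lambda>(t, x). p t x)"
  "continuous_on ({0<..} \<times> UNIV) (\<lambda>(t, x). dx k (p t) x)"
  using u_C21 p_C1 unfolding C21_def C1_x_def by blast+

lemma cont:
  assumes "t > 0"
  shows "continuous_on UNIV (u t)" "continuous_on UNIV (dx k (u t))" "continuous_on UNIV (dx j (dx k (u t)))"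
    "continuous_on UNIV (dt u t)" "continuous_on UNIV (p t)" "continuous_on UNIV (dx k (p t))"
  using joint_cont[THEN continuous_on_slice, OF assms] by blast+

lemma pders:
  assumes "t > 0"
  shows "pder k (u t) (dx k (u t))" "pder j (dx k (u t)) (dx j (dx k (u t)))" "pder k (p t) (dx k (p t))"
  using u_C21 p_C1 assms unfolding C21_def C1_x_def by (intro pder_dx; blast)+

lemma dt_derivative:
  assumes "t > 0" shows "((\<lambda>s. u s x) has_vector_derivative dt u t x) (at t)"
  using u_C21 assms unfolding C21_def dt_def by (simp add: vector_derivative_works)

lemma eq_dt:
  assumes "t > 0"
  shows "dt u t x = laplacian (u t) x - convection (u t) (u t) x - grad (p t) x
      - \<Omega> *\<^sub>R cross3 (axis 3 1) (u t x)"
proof -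
  have "dt u t x - laplacian (u t) x + convection (u t) (u t) x + grad (p t) x
      + \<Omega> *\<^sub>R cross3 (axis 3 1) (u t x) = 0"
    using nse assms unfolding rotating_NSE_def by blast
  then show ?thesis by (simp add: algebra_simps eq_neg_iff_add_eq_0) (simp add: add_eq_0_iff algebra_simps)?
qed

lemma div_zero:
  assumes "t > 0" shows "(\<Sum>j\<in>UNIV. dx j (u t) x $ j) = 0"
  using nse assms unfolding rotating_NSE_def divergence_def by blast

definition v :: "real \<Rightarrow> int^3 \<Rightarrow> complex^3" where
  "v t k = (\<chi> j. fc (\<lambda>x. of_real (u t x $ j)) k)"

lemma v_nth: "v t k $ j = fc (\<lambda>x. of_real (u t x $ j)) k"
  by (simp add: v_def)

lemma continuous_of_real_nth: "continuous_on UNIV f \<Longrightarrow> continuous_on UNIV (\<lambda>x. complex_of_real (f x $ j))"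
  by (intro continuous_intros)

lemma periodic_of_real_nth: "periodic L f \<Longrightarrow> periodic L (\<lambda>x. complex_of_real (f x $ j))"
  by (simp add: periodic_def)

lemma fc_dx:
  assumes t: "t > 0"
  shows "fc (\<lambda>x. of_real (dx l (u t) x $ j)) k = \<i> * of_real (wave L k $ l) * v t k $ j"
  unfolding v_nth
  by (rule fc_pder[OF _ _ _ pder_bounded_linear[OF bounded_linear_of_real_nth]])
     (intro continuous_of_real_nth periodic_of_real_nth cont pders u_periodic t)+

lemma fc_dxdx:
  assumes t: "t > 0"
  shows "fc (\<lambda>x. of_real (dx l (dx l (u t)) x $ j)) k = - of_real ((wave L k $ l)\<^sup>2) * v t k $ j"
proof -
  have "fc (\<lambda>x. of_real (dx l (dx l (u t)) x $ j)) k
      = \<i> * of_real (wave L k $ l) * fc (\<lambda>x. of_real (dx l (u t) x $ j)) k"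
    by (rule fc_pder[OF _ _ _ pder_bounded_linear[OF bounded_linear_of_real_nth]])
       (intro continuous_of_real_nth periodic_of_real_nth periodic_dx cont pders u_periodic t)+
  then show ?thesis using t by (simp add: fc_dx power2_eq_square algebra_simps)
qed

lemma norm_wave_sq: "(norm (wave L k))\<^sup>2 = (\<Sum>l\<in>UNIV. (wave L k $ l)\<^sup>2)"
  by (simp add: norm_vec_def L2_set_def sum_nonneg)

lemma laplacian_cont: "t > 0 \<Longrightarrow> continuous_on UNIV (laplacian (u t))"
  unfolding laplacian_def by (intro continuous_intros cont)

lemma fc_laplacian:
  assumes t: "t > 0"
  shows "fc (\<lambda>x. of_real (laplacian (u t) x $ j)) k = - of_real ((norm (wave L k))\<^sup>2) * v t k $ j"
proof -
  have "fc (\<lambda>x. of_real (laplacian (u t) x $ j)) k = fc (\<lambda>x. \<Sum>l\<in>UNIV. of_real (dx l (dx l (u t)) x $ j)) k"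
    by (simp add: laplacian_def sum_component)
  also have "\<dots> = (\<Sum>l\<in>UNIV. fc (\<lambda>x. of_real (dx l (dx l (u t)) x $ j)) k)"
    by (rule fc_sum) (auto intro!: continuous_intros cont t)
  also have "\<dots> = - of_real ((norm (wave L k))\<^sup>2) * v t k $ j"
    using t by (simp add: fc_dxdx norm_wave_sq sum_distrib_right sum_negf)
  finally show ?thesis .
qed

lemma v_divergence_free:
  assumes t: "t > 0"
  shows "(\<Sum>l\<in>UNIV. v t k $ l * of_real (wave L k $ l)) = 0"
proof -
  have "\<i> * (\<Sum>l\<in>UNIV. v t k $ l * of_real (wave L k $ l)) = (\<Sum>l\<in>UNIV. fc (\<lambda>x. of_real (dx l (u t) x $ l)) k)"
    using t by (simp add: fc_dx sum_distrib_left algebra_simps)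
  also have "\<dots> = fc (\<lambda>x. \<Sum>l\<in>UNIV. of_real (dx l (u t) x $ l)) k"
    by (rule fc_sum[symmetric]) (auto intro!: continuous_intros cont t)
  also have "\<dots> = fc (\<lambda>x. of_real (\<Sum>l\<in>UNIV. dx l (u t) x $ l)) k" by simp
  also have "\<dots> = 0" using t by (simp add: div_zero fc_def mean_const)
  finally show ?thesis by simp
qed

lemma sum_norm_nth_sq: "(norm (z::complex^3))\<^sup>2 = (\<Sum>j\<in>UNIV. (norm (z $ j))\<^sup>2)"
  by (simp add: norm_vec_def L2_set_def sum_nonneg)

lemma sum_norm_nth_sq_real: "(norm (z::real^3))\<^sup>2 = (\<Sum>j\<in>UNIV. (norm (z $ j))\<^sup>2)"
  by (simp add: norm_vec_def L2_set_def sum_nonneg)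

lemma bessel_vec:
  assumes f: "continuous_on UNIV (f :: real^3 \<Rightarrow> real^3)" and F: "finite F"
  shows "(\<Sum>k\<in>F. \<Sum>j\<in>UNIV. (norm (fc (\<lambda>x. of_real (f x $ j)) k))\<^sup>2) \<le> mean (\<lambda>x. (norm (f x))\<^sup>2)"
proof -
  have "(\<Sum>k\<in>F. \<Sum>j\<in>UNIV. (norm (fc (\<lambda>x. of_real (f x $ j)) k))\<^sup>2)
      = (\<Sum>j\<in>UNIV. \<Sum>k\<in>F. (norm (fc (\<lambda>x. of_real (f x $ j)) k))\<^sup>2)"
    by (rule sum.swap)
  also have "\<dots> \<le> (\<Sum>j\<in>UNIV. mean (\<lambda>x. (norm (complex_of_real (f x $ j)))\<^sup>2))"
    by (intro sum_mono bessel F continuous_of_real_nth f)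
  also have "\<dots> = mean (\<lambda>x. \<Sum>j\<in>UNIV. (norm (complex_of_real (f x $ j)))\<^sup>2)"
    by (rule mean_sum[symmetric]) (auto intro!: continuous_intros f)
  also have "\<dots> = mean (\<lambda>x. (norm (f x))\<^sup>2)" unfolding sum_norm_nth_sq_real by simp
  finally show ?thesis .
qed

text \<open>The dissipation: by \<open>energy_derivative\<close> the mean of |u|^2 decreases at the
  rate 2 D.\<close>

definition D :: "real \<Rightarrow> real" where "D t = mean (\<lambda>x. \<Sum>l\<in>UNIV. (norm (dx l (u t) x))\<^sup>2)"

lemma bessel_grad:
  assumes t: "t > 0" and F: "finite F"
  shows "(\<Sum>k\<in>F. (norm (wave L k))\<^sup>2 * (norm (v t k))\<^sup>2) \<le> D t"
proof -
  have "(\<Sum>k\<in>F. (norm (wave L k))\<^sup>2 * (norm (v t k))\<^sup>2)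
      = (\<Sum>k\<in>F. \<Sum>l\<in>UNIV. \<Sum>j\<in>UNIV. (norm (fc (\<lambda>x. of_real (dx l (u t) x $ j)) k))\<^sup>2)"
    unfolding norm_wave_sq sum_norm_nth_sq[of "v t _"] sum_product fc_dx[OF t]
        by (simp add: norm_mult power_mult_distrib)
  also have "\<dots> = (\<Sum>l\<in>UNIV. \<Sum>k\<in>F. \<Sum>j\<in>UNIV. (norm (fc (\<lambda>x. of_real (dx l (u t) x $ j)) k))\<^sup>2)"
    by (rule sum.swap)
  also have "\<dots> \<le> (\<Sum>l\<in>UNIV. mean (\<lambda>x. (norm (dx l (u t) x))\<^sup>2))"
    by (intro sum_mono bessel_vec F cont t)
  also have "\<dots> = D t" unfolding D_def by (rule mean_sum[symmetric]) (auto intro!: continuous_intros cont t)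
  finally show ?thesis .
qed

text \<open>Control of two derivatives is what makes the coefficients absolutely summable:
  Cauchy-Schwarz pairs the weight rho^4 with the summable rho^(-4).\<close>

lemma bessel_laplacian:
  assumes t: "t > 0" and F: "finite F"
  shows "(\<Sum>k\<in>F. (rho k)^4 * (norm (v t k))\<^sup>2) \<le> mean (\<lambda>x. (norm (u t x))\<^sup>2)
      + mean (\<lambda>x. (norm (laplacian (u t) x))\<^sup>2)"
proof -
  have r: "(rho k)^4 \<le> 1 + ((norm (wave L k))\<^sup>2)\<^sup>2" for k
    by (auto simp: rho_def max_def simp flip: power_mult)
  have "(\<Sum>k\<in>F. (rho k)^4 * (norm (v t k))\<^sup>2) \<le> (\<Sum>k\<in>F. (1 + ((norm (wave L k))\<^sup>2)\<^sup>2) * (norm (v t k))\<^sup>2)"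
    by (intro sum_mono mult_right_mono r) auto
  also have "\<dots> = (\<Sum>k\<in>F. (norm (v t k))\<^sup>2) + (\<Sum>k\<in>F. ((norm (wave L k))\<^sup>2)\<^sup>2 * (norm (v t k))\<^sup>2)"
    by (simp add: distrib_right sum.distrib)
  also have "(\<Sum>k\<in>F. (norm (v t k))\<^sup>2) = (\<Sum>k\<in>F. \<Sum>j\<in>UNIV. (norm (fc (\<lambda>x. of_real (u t x $ j)) k))\<^sup>2)"
    unfolding sum_norm_nth_sq v_nth ..
  also have "\<dots> \<le> mean (\<lambda>x. (norm (u t x))\<^sup>2)" by (rule bessel_vec[OF cont(1)[OF t] F])
  also have "(\<Sum>k\<in>F. ((norm (wave L k))\<^sup>2)\<^sup>2 * (norm (v t k))\<^sup>2)
      = (\<Sum>k\<in>F. \<Sum>j\<in>UNIV. (norm (fc (\<lambda>x. of_real (laplacian (u t) x $ j)) k))\<^sup>2)"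
    unfolding sum_norm_nth_sq[of "v t _"] fc_laplacian[OF t]
        by (simp add: norm_mult power_mult_distrib sum_distrib_left norm_power)
  also have "\<dots> \<le> mean (\<lambda>x. (norm (laplacian (u t) x))\<^sup>2)" by (rule bessel_vec[OF laplacian_cont[OF t] F])
  finally show ?thesis by simp
qed

lemma joint_bounded:
  fixes f :: "real \<Rightarrow> real^3 \<Rightarrow> 'b::real_normed_vector"
  assumes f: "continuous_on ({0<..} \<times> UNIV) (\<lambda>(t, x). f t x)" and a: "a > 0"
  shows "\<exists>C. \<forall>t\<in>{a..b}. \<forall>x\<in>cbox 0 L. norm (f t x) \<le> C"
proof -
  have "compact ((\<lambda>(t, x). f t x) ` ({a..b} \<times> cbox 0 L))"
    by (intro compact_continuous_image continuous_on_subset[OF f] compact_Times compact_Icc compact_cbox)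
        (use a in auto)
  then have "bounded ((\<lambda>(t, x). f t x) ` ({a..b} \<times> cbox 0 L))" by (rule compact_imp_bounded)
  then obtain C where "\<forall>y\<in>(\<lambda>(t, x). f t x) ` ({a..b} \<times> cbox 0 L). norm y \<le> C" unfolding bounded_iff by blast
  then show ?thesis by (intro exI[of _ C]) auto
qed

text \<open>Joint continuity makes the Bessel bound uniform on compact intervals of positive times.
  It supplies \<open>loc_bound\<close> of \<open>small_data\<close>.\<close>

lemma local_bound:
  assumes a: "a > 0"
  shows "\<exists>C. \<forall>t\<in>{a..b}. \<forall>F. finite F \<longrightarrow> (\<Sum>k\<in>F. (rho k)^4 * (norm (v t k))\<^sup>2) \<le> C"
proof -
  obtain C1 where C1: "\<And>t x. t \<in> {a..b} \<Longrightarrow> x \<in> cbox 0 L \<Longrightarrow> norm (u t x) \<le> C1"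
    using joint_bounded[OF joint_cont(1) a, of b] by blast
  have lc: "continuous_on ({0<..} \<times> UNIV) (\<lambda>(t, x). laplacian (u t) x)"
    unfolding laplacian_def case_prod_unfold using joint_cont(3)
        by (intro continuous_on_sum) (simp add: case_prod_unfold)
  obtain C2 where C2: "\<And>t x. t \<in> {a..b} \<Longrightarrow> x \<in> cbox 0 L \<Longrightarrow> norm (laplacian (u t) x) \<le> C2"
    using joint_bounded[OF lc a, of b] by blast
  show ?thesis
  proof (intro exI[of _ "C1\<^sup>2 + C2\<^sup>2"] ballI allI impI)
    fix t and F :: "(int^3) set" assume t: "t \<in> {a..b}" and F: "finite F"
    then have t0: "t > 0" using a by auto
    have "mean (\<lambda>x. (norm (u t x))\<^sup>2) \<le> mean (\<lambda>x. C1\<^sup>2)"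
      using C1[OF t] by (intro mean_mono continuous_intros cont t0 power_mono) auto
    moreover have "mean (\<lambda>x. (norm (laplacian (u t) x))\<^sup>2) \<le> mean (\<lambda>x. C2\<^sup>2)"
      using C2[OF t] by (intro mean_mono continuous_intros laplacian_cont t0 power_mono) auto
    ultimately show "(\<Sum>k\<in>F. (rho k)^4 * (norm (v t k))\<^sup>2) \<le> C1\<^sup>2 + C2\<^sup>2"
      using bessel_laplacian[OF t0 F] by (simp add: mean_const)
  qed
qed

text \<open>Convection and pressure drop out as divergences, the Coriolis term is pointwise
  orthogonal to u, and the Laplacian is integrated by parts.\<close>

lemma energy_derivative:
  assumes t: "t > 0"
  shows "((\<lambda>t. mean (\<lambda>x. u t x \<bullet> u t x)) has_vector_derivative - 2 * D t) (at t)"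
proof -
  note c = cont[OF t] and pd = pders[OF t] and per = u_periodic[OF t] p_periodic[OF t]
  have perd: "periodic L (dx k (u t))" for k by (rule periodic_dx[OF per(1)])
  have 1: "((\<lambda>t. mean (\<lambda>x. u t x \<bullet> u t x)) has_vector_derivative mean
      (\<lambda>x. u t x \<bullet> dt u t x + dt u t x \<bullet> u t x)) (at t)"
  proof (rule mean_has_derivative[OF _ _ _ t])
    show "continuous_on ({0<..} \<times> UNIV) (\<lambda>(t, x). u t x \<bullet> u t x)"
      using joint_cont(1) unfolding case_prod_unfold by (intro continuous_intros)
    show "continuous_on ({0<..} \<times> UNIV) (\<lambda>(t, x). u t x \<bullet> dt u t x + dt u t x \<bullet> u t x)"
      using joint_cont(1,4) unfolding case_prod_unfold by (intro continuous_intros)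
    show "((\<lambda>s. u s x \<bullet> u s x) has_vector_derivative u t x \<bullet> dt u t x + dt u t x \<bullet> u t x) (at t)" if "t > 0"
        for t x
      by (rule bounded_bilinear.has_vector_derivative[OF bounded_bilinear_inner dt_derivative[OF that]
          dt_derivative[OF that]])
  qed
  have lap: "mean (\<lambda>x. u t x \<bullet> dx j (dx j (u t)) x) = - mean (\<lambda>x. (norm (dx j (u t) x))\<^sup>2)" for j
  proof -
    have "mean (\<lambda>x. u t x \<bullet> dx j (dx j (u t)) x + dx j (u t) x \<bullet> dx j (u t) x) = 0"
      by (rule integral_pder_zero[OF _ _ _ pder_inner[OF pd(1) pd(2)]])
         (use per perd in \<open>auto intro!: continuous_intros c simp: periodic_def\<close>)
    then show ?thesis by (simp add: mean_add continuous_intros c power2_norm_eq_inner)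
  qed
  have conv: "mean (\<lambda>x. u t x \<bullet> convection (u t) (u t) x) = 0"
  proof -
    \<comment> \<open>The integrand is the j-th derivative of u_j |u|^2; since div u = 0, the sum
      over j is twice the inner product of u with the convection term.\<close>
    have 1: "mean (\<lambda>x. u t x $ j * (u t x \<bullet> dx j (u t) x + dx j (u t) x \<bullet> u t x)
        + dx j (u t) x $ j * (u t x \<bullet> u t x)) = 0" for j
      by (rule integral_pder_zero[OF _ _ _ pder_mult[OF pder_bounded_linear[OF bounded_linear_vec_nth pd(1)]
          pder_inner[OF pd(1) pd(1)]]])
         (use per perd in \<open>auto intro!: continuous_intros c simp: periodic_def\<close>)
    have "0 = (\<Sum>j\<in>UNIV. mean (\<lambda>x. u t x $ j * (u t x \<bullet> dx j (u t) x + dx j (u t) x \<bullet> u t x)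
        + dx j (u t) x $ j * (u t x \<bullet> u t x)))"
      by (simp add: 1)
    also have "\<dots> = mean (\<lambda>x. \<Sum>j\<in>UNIV. u t x $ j * (u t x \<bullet> dx j (u t) x + dx j (u t) x \<bullet> u t x)
        + dx j (u t) x $ j * (u t x \<bullet> u t x))"
      by (rule mean_sum[symmetric]) (auto intro!: continuous_intros c)
    also have "\<dots> = mean (\<lambda>x. 2 * (u t x \<bullet> convection (u t) (u t) x))"
    proof (rule mean_cong)
      fix x
      have "(\<Sum>j\<in>UNIV. dx j (u t) x $ j * (u t x \<bullet> u t x)) = 0"
        using div_zero[OF t, of x] by (simp flip: sum_distrib_right)
      then show "(\<Sum>j\<in>UNIV. u t x $ j * (u t x \<bullet> dx j (u t) x + dx j (u t) x \<bullet> u t x)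
          + dx j (u t) x $ j * (u t x \<bullet> u t x)) = 2 * (u t x \<bullet> convection (u t) (u t) x)"
        unfolding sum.distrib by (simp add: convection_def inner_sum_right inner_commute sum_distrib_left
            algebra_simps)
    qed
    also have "\<dots> = 2 * mean (\<lambda>x. u t x \<bullet> convection (u t) (u t) x)"
      unfolding convection_def by (rule mean_cmult) (intro continuous_intros c)
    finally show ?thesis by simp
  qed
  have pres: "mean (\<lambda>x. u t x \<bullet> grad (p t) x) = 0"
  proof -
    have 1: "mean (\<lambda>x. u t x $ j * dx j (p t) x + dx j (u t) x $ j * p t x) = 0" for j
      by (rule integral_pder_zero[OF _ _ _ pder_mult[OF pder_bounded_linear[OF bounded_linear_vec_nth pd(1)]
          pd(3)]])
         (use per perd in \<open>auto intro!: continuous_intros c simp: periodic_def\<close>)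
    have "0 = (\<Sum>j\<in>UNIV. mean (\<lambda>x. u t x $ j * dx j (p t) x + dx j (u t) x $ j * p t x))"
      by (simp add: 1)
    also have "\<dots> = mean (\<lambda>x. \<Sum>j\<in>UNIV. u t x $ j * dx j (p t) x + dx j (u t) x $ j * p t x)"
      by (rule mean_sum[symmetric]) (auto intro!: continuous_intros c)
    also have "\<dots> = mean (\<lambda>x. u t x \<bullet> grad (p t) x)"
    proof (rule mean_cong)
      fix x
      have "(\<Sum>j\<in>UNIV. dx j (u t) x $ j * p t x) = 0"
        using div_zero[OF t, of x] by (simp flip: sum_distrib_right)
      then show "(\<Sum>j\<in>UNIV. u t x $ j * dx j (p t) x + dx j (u t) x $ j * p t x) = u t x \<bullet> grad (p t) x"
        unfolding sum.distrib by (simp add: grad_def inner_vec_def)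
    qed
    finally show ?thesis by simp
  qed
  have gc: "continuous_on UNIV (grad (p t))" unfolding grad_def by (intro continuous_on_vec_lambda c)
  have cc: "continuous_on UNIV (convection (u t) (u t))" unfolding convection_def by (intro continuous_intros c)
  have orth: "u t x \<bullet> cross3 (axis 3 1) (u t x) = 0" for x by (simp add: dot_cross_self)
  have "mean (\<lambda>x. u t x \<bullet> dt u t x + dt u t x \<bullet> u t x)
     = mean (\<lambda>x. 2 * ((\<Sum>j\<in>UNIV. u t x \<bullet> dx j (dx j (u t)) x) - u t x \<bullet> convection (u t) (u t) x
         - u t x \<bullet> grad (p t) x))"
    by (rule mean_cong) (simp add: eq_dt[OF t] inner_commute[of _ "u t _"] inner_diff_right orth laplacian_def
        inner_sum_right)
  also have "\<dots> = 2 * mean (\<lambda>x. (\<Sum>j\<in>UNIV. u t x \<bullet> dx j (dx j (u t)) x) - u t x \<bullet> convection (u t) (u t) x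
      - u t x \<bullet> grad (p t) x)"
    by (rule mean_cmult) (intro continuous_intros c gc cc)
  also have "mean (\<lambda>x. (\<Sum>j\<in>UNIV. u t x \<bullet> dx j (dx j (u t)) x) - u t x \<bullet> convection (u t) (u t) x
      - u t x \<bullet> grad (p t) x)
     = mean (\<lambda>x. \<Sum>j\<in>UNIV. u t x \<bullet> dx j (dx j (u t)) x) - mean (\<lambda>x. u t x \<bullet> convection (u t) (u t) x)
         - mean (\<lambda>x. u t x \<bullet> grad (p t) x)"
  proof -
    have *: "continuous_on UNIV (\<lambda>x. \<Sum>j\<in>UNIV. u t x \<bullet> dx j (dx j (u t)) x)"
        "continuous_on UNIV (\<lambda>x. u t x \<bullet> convection (u t) (u t) x)"
      "continuous_on UNIV (\<lambda>x. u t x \<bullet> grad (p t) x)"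
      by (intro continuous_intros c gc cc)+
    show ?thesis unfolding mean_diff[OF continuous_on_diff[OF *(1,2)] *(3)] mean_diff[OF *(1,2)] ..
  qed
  also have "mean (\<lambda>x. \<Sum>j\<in>UNIV. u t x \<bullet> dx j (dx j (u t)) x)
      = (\<Sum>j\<in>UNIV. mean (\<lambda>x. u t x \<bullet> dx j (dx j (u t)) x))"
    by (rule mean_sum) (auto intro!: continuous_intros c)
  also have "\<dots> = - D t"
    unfolding lap D_def sum_negf by (subst mean_sum) (auto intro!: continuous_intros c)
  finally show ?thesis using 1 conv pres by simp
qed

text \<open>The energy is nonnegative, so its dissipation cannot stay above e for ever.\<close>

lemma small_gradient:
  assumes "e > 0" "t1 > 0"
  shows "\<exists>t\<ge>t1. D t < e"
proof (rule ccontr)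
  assume "\<not> (\<exists>t\<ge>t1. D t < e)"
  then have ge: "D t \<ge> e" if "t \<ge> t1" for t using that by (auto simp: not_less)
  define E where "E t = mean (\<lambda>x. u t x \<bullet> u t x)" for t
  have dE: "(E has_real_derivative - 2 * D t) (at t)" if "t \<ge> t1" for t
    using energy_derivative[of t] that assms unfolding E_def[abs_def]
        by (simp add: has_real_derivative_iff_has_vector_derivative)
  have E0: "E t \<ge> 0" if "t \<ge> t1" for t
    unfolding E_def by (intro mean_nonneg continuous_intros cont) (use that assms in auto)
  \<comment> \<open>By this time a dissipation of at least e would have consumed 2 (E t1 + e), more
    than the energy available at \<open>t1\<close>.\<close>
  define T where "T = t1 + E t1 / e + 1"
  have T: "T > t1" using E0[of t1] assms by (simp add: T_def add_nonneg_pos)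
  obtain z where z: "t1 < z" "z < T" "E T - E t1 = (T - t1) * (- 2 * D z)"
    using MVT2[OF T, of E "\<lambda>t. - 2 * D t"] dE by auto
  have "(T - t1) * e \<le> (T - t1) * D z" using z ge[of z] T by (intro mult_left_mono) auto
  moreover have "(T - t1) * e = E t1 + e" using assms by (simp add: T_def field_simps)
  ultimately have "E T \<le> E t1 - 2 * (E t1 + e)" using z(3) by (simp add: algebra_simps)
  then show False using E0[of T] E0[of t1] T assms by simp
qed

end

section \<open>Rotations and the Leray projection\<close>

lemma has_vector_derivative_vec:
  fixes f :: "real \<Rightarrow> 'b::real_normed_vector^'n"
  assumes "\<And>j. ((\<lambda>t. f t $ j) has_vector_derivative f' $ j) F"
  shows "(f has_vector_derivative f') F"
proof -
  have bl: "bounded_linear (axis j :: 'b \<Rightarrow> 'b^'n)" for j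
  proof (rule bounded_linear_intro[where K = 1])
    show "norm (axis j x :: 'b^'n) \<le> norm x * 1" for x
      by (simp add: norm_vec_def L2_set_def axis_def if_distrib[of norm] if_distrib[of "\<lambda>x. x\<^sup>2"] cong: if_cong)
  qed (auto simp: vec_eq_iff axis_def)
  have eq: "z = (\<Sum>j\<in>UNIV. axis j (z $ j))" for z :: "'b^'n"
    by (simp add: vec_eq_iff axis_def sum.delta)
  have "((\<lambda>t. \<Sum>j\<in>UNIV. axis j (f t $ j)) has_vector_derivative (\<Sum>j\<in>UNIV. axis j (f' $ j))) F"
    by (intro has_vector_derivative_sum bounded_linear.has_vector_derivative[OF bl] assms)
  then show ?thesis unfolding eq[symmetric] .
qed

definition cdot :: "complex^3 \<Rightarrow> real^3 \<Rightarrow> complex" where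
  "cdot z n = (\<Sum>j\<in>UNIV. z $ j * of_real (n $ j))"

definition ccross :: "real^3 \<Rightarrow> complex^3 \<Rightarrow> complex^3" where
  "ccross n z = vector [of_real (n $ 2) * z $ 3 - of_real (n $ 3) * z $ 2,
      of_real (n $ 3) * z $ 1 - of_real (n $ 1) * z $ 3,
      of_real (n $ 1) * z $ 2 - of_real (n $ 2) * z $ 1]"

text \<open>Rodrigues' formula for a unit axis n, without the term along n: a rotation on vectors
  orthogonal to n, and linear on all vectors.\<close>

definition rot :: "real^3 \<Rightarrow> real \<Rightarrow> complex^3 \<Rightarrow> complex^3" where
  "rot n \<phi> z = cos \<phi> *\<^sub>R z + sin \<phi> *\<^sub>R ccross n z"

text \<open>For a unit vector n this is the orthogonal projection that removes the component along
  n, the symbol of the Leray projection at wave vectors of direction n.\<close>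

definition leray :: "real^3 \<Rightarrow> complex^3 \<Rightarrow> complex^3" where
  "leray n z = (\<chi> j. z $ j - cdot z n * of_real (n $ j))"

lemma ccross_nth:
  "ccross n z $ 1 = of_real (n $ 2) * z $ 3 - of_real (n $ 3) * z $ 2"
  "ccross n z $ 2 = of_real (n $ 3) * z $ 1 - of_real (n $ 1) * z $ 3"
  "ccross n z $ 3 = of_real (n $ 1) * z $ 2 - of_real (n $ 2) * z $ 1"
  by (simp_all add: ccross_def vector_3)

lemmas vec3_simps = cdot_def leray_def ccross_nth sum_3 vec_eq_iff forall_3

lemma scaleR_complex: "r *\<^sub>R (c::complex) = of_real r * c"
  by (rule scaleR_conv_of_real)

lemma cdot_linear: "linear (\<lambda>z. cdot z n)"
  by (rule linearI) (simp_all add: vec3_simps algebra_simps scaleR_complex)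

lemma ccross_linear: "linear (ccross n)"
  by (rule linearI) (simp_all add: vec3_simps algebra_simps scaleR_complex)

lemma leray_linear: "linear (leray n)"
  by (rule linearI) (simp_all add: vec3_simps algebra_simps scaleR_complex)

lemma rot_linear: "linear (rot n \<phi>)"
  unfolding rot_def using ccross_linear[of n]
  by (intro linearI) (simp_all add: linear_add linear_scale algebra_simps)

lemma cdot_scale: "cdot (c *s z) n = c * cdot z n"
  by (simp add: vec3_simps algebra_simps)

lemma ccross_scale: "ccross n (c *s z) = c *s ccross n z"
  by (simp add: vec3_simps algebra_simps)

lemma leray_scale: "leray n (c *s z) = c *s leray n z"
  by (simp add: vec3_simps algebra_simps)

lemma rot_scale: "rot n \<phi> (c *s z) = c *s rot n \<phi> z"
  unfolding rot_def ccross_scale by (simp add: vec_eq_iff scaleR_complex algebra_simps)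

lemma unit_sum:
  assumes "norm (n::real^3) = 1"
  shows "complex_of_real (n $ 1) * of_real (n $ 1) + of_real (n $ 2) * of_real (n $ 2)
      + of_real (n $ 3) * of_real (n $ 3) = 1"
proof -
  have "(n $ 1)\<^sup>2 + (n $ 2)\<^sup>2 + (n $ 3)\<^sup>2 = 1"
    using assms by (simp add: norm_vec_def L2_set_def sum_3)
  from arg_cong[OF this, of complex_of_real] show ?thesis by (simp add: power2_eq_square)
qed

lemma leray_id: "cdot z n = 0 \<Longrightarrow> leray n z = z"
  by (simp add: leray_def vec_eq_iff)

lemma cdot_leray: assumes "norm n = 1" shows "cdot (leray n z) n = 0"
proof -
  have "cdot (leray n z) n = cdot z n - cdot z n * (complex_of_real (n $ 1) * of_real (n $ 1)
      + of_real (n $ 2) * of_real (n $ 2) + of_real (n $ 3) * of_real (n $ 3))"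
    by (simp add: leray_def cdot_def sum_3 algebra_simps)
  then show ?thesis by (simp add: unit_sum[OF assms])
qed

text \<open>On the orthogonal complement of n, the cross product with n is a quarter turn.\<close>

lemma ccross_ccross:
  assumes "norm n = 1" "cdot z n = 0" shows "ccross n (ccross n z) = - z"
proof -
  have d: "z $ 1 * of_real (n $ 1) + z $ 2 * of_real (n $ 2) + z $ 3 * of_real (n $ 3) = 0"
    using assms(2) by (simp add: cdot_def sum_3)
  note u = unit_sum[OF assms(1)]
  show ?thesis unfolding vec_eq_iff forall_3 ccross_nth vector_uminus_component
    using u d by (intro conjI; algebra)
qed

text \<open>Split the third unit vector into its parts along n and orthogonal to n. The cross
  product of the orthogonal part with z is parallel to n, hence removed by the projection.\<close>

lemma leray_coriolis:
  assumes "norm n = 1" "cdot z n = 0" shows "leray n (ccross (axis 3 1) z) = (n $ 3) *\<^sub>R ccross n z"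
proof -
  have d: "z $ 1 * of_real (n $ 1) + z $ 2 * of_real (n $ 2) + z $ 3 * of_real (n $ 3) = 0"
    using assms(2) by (simp add: cdot_def sum_3)
  note u = unit_sum[OF assms(1)]
  define n1 n2 n3 where n_def: "n1 = complex_of_real (n $ 1)" "n2 = complex_of_real (n $ 2)" "n3
      = complex_of_real (n $ 3)"
  note u' = u[folded n_def] and d' = d[folded n_def]
  have j: "ccross (axis 3 1) z $ 1 = - z $ 2" "ccross (axis 3 1) z $ 2 = z $ 1" "ccross (axis 3 1) z $ 3 = 0"
    by (simp_all add: ccross_nth axis_def)
  have 1: "- z $ 2 - (- z $ 2 * n1 + z $ 1 * n2 + 0 * n3) * n1 = n3 * (n2 * z $ 3 - n3 * z $ 2)" using u' d'
      by algebra
  have 2: "z $ 1 - (- z $ 2 * n1 + z $ 1 * n2 + 0 * n3) * n2 = n3 * (n3 * z $ 1 - n1 * z $ 3)" using u' d'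
      by algebra
  have 3: "0 - (- z $ 2 * n1 + z $ 1 * n2 + 0 * n3) * n3 = n3 * (n1 * z $ 2 - n2 * z $ 1)"
      by (simp add: algebra_simps)
  show ?thesis unfolding vec_eq_iff forall_3 leray_def cdot_def sum_3 vec_lambda_beta j
      vector_scaleR_component scaleR_complex
    unfolding ccross_nth n_def[symmetric] using 1 2 3 by blast
qed

lemma leray_gradient: assumes "norm n = 1" shows "leray n (\<chi> j. c * of_real (r * n $ j)) = 0"
proof -
  have "cdot (\<chi> j. c * of_real (r * n $ j)) n = c * of_real r"
    using unit_sum[OF assms] by (simp add: cdot_def sum_3) algebra
  then show ?thesis by (simp add: leray_def vec_eq_iff)
qed

lemma rot_inverse:
  assumes "norm n = 1" "cdot z n = 0" shows "rot n (- \<phi>) (rot n \<phi> z) = z"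
proof -
  have "rot n (- \<phi>) (rot n \<phi> z) = cos \<phi> *\<^sub>R (cos \<phi> *\<^sub>R z + sin \<phi> *\<^sub>R ccross n z)
      - sin \<phi> *\<^sub>R (cos \<phi> *\<^sub>R ccross n z - sin \<phi> *\<^sub>R z)"
    using ccross_linear[of n] ccross_ccross[OF assms] by (simp add: rot_def linear_add linear_scale)
  also have "\<dots> = (cos \<phi> * cos \<phi> + sin \<phi> * sin \<phi>) *\<^sub>R z"
    by (simp only: scaleR_add_left scaleR_add_right scaleR_diff_right scaleR_scaleR
        mult.commute[of "sin \<phi>" "cos \<phi>"]) simp
  also have "cos \<phi> * cos \<phi> + sin \<phi> * sin \<phi> = 1"
    using sin_cos_squared_add[of \<phi>] by (simp only: power2_eq_square add.commute)
  finally show ?thesis by simp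
qed

text \<open>The numerical constants in this and the following bounds are crude. Smallness is
  obtained by waiting long enough, so their size does not matter.\<close>

lemma norm_cdot_le: "norm (cdot z n) \<le> 3 * (norm z * norm n)"
proof -
  have "norm (cdot z n) \<le> (\<Sum>j\<in>UNIV. norm (z $ j) * norm (n $ j))"
    unfolding cdot_def by (rule order_trans[OF norm_sum]) (simp add: norm_mult)
  also have "\<dots> \<le> (\<Sum>j\<in>(UNIV::3 set). norm z * norm n)"
    by (intro sum_mono mult_mono component_le_norm_cart Finite_Cartesian_Product.norm_nth_le) auto
  finally show ?thesis by simp
qed

lemma norm_le_sum_nth: "norm (z::complex^3) \<le> norm (z $ 1) + norm (z $ 2) + norm (z $ 3)"
  using L2_set_le_sum[of UNIV "\<lambda>j. norm (z $ j)"] by (simp add: norm_vec_def sum_3)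

lemma norm_ccross_le: "norm (ccross n z) \<le> 6 * (norm n * norm z)"
proof -
  have m: "norm (complex_of_real (n $ i) * z $ j) \<le> norm n * norm z" for i j
    unfolding norm_mult using component_le_norm_cart[of n i] Finite_Cartesian_Product.norm_nth_le[of z j]
        by (intro mult_mono) auto
  have "norm (complex_of_real (n $ i) * z $ j - of_real (n $ i') * z $ j') \<le> 2 * (norm n * norm z)"
      for i j i' j'
    using norm_triangle_ineq4[of "complex_of_real (n $ i) * z $ j" "of_real (n $ i') * z $ j'"] m[of i j]
        m[of i' j'] by linarith
  then have "norm (ccross n z $ 1) + norm (ccross n z $ 2) + norm (ccross n z $ 3)
      \<le> 2 * (norm n * norm z) + 2 * (norm n * norm z) + 2 * (norm n * norm z)"
    unfolding ccross_nth by (intro add_mono)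
  then show ?thesis using norm_le_sum_nth[of "ccross n z"] by linarith
qed

lemma norm_rot_le: assumes "norm n \<le> 1" shows "norm (rot n \<phi> z) \<le> 7 * norm z"
proof -
  have "norm (rot n \<phi> z) \<le> \<bar>cos \<phi>\<bar> * norm z + \<bar>sin \<phi>\<bar> * norm (ccross n z)"
    unfolding rot_def by (rule order_trans[OF norm_triangle_ineq]) simp
  also have "\<dots> \<le> 1 * norm z + 1 * (6 * (1 * norm z))"
    using assms by (intro add_mono mult_mono order_trans[OF norm_ccross_le]) (auto intro: mult_right_mono)
  finally show ?thesis by simp
qed

lemma norm_leray_le: assumes "norm n \<le> 1" shows "norm (leray n z) \<le> 12 * norm z"
proof -
  have "norm (leray n z $ j) \<le> 4 * norm z" for j
  proof -
    have "norm (cdot z n) \<le> 3 * (norm z * 1)"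
      using norm_cdot_le[of z n] mult_left_mono[OF assms, of "norm z"] by simp
    then have "norm (cdot z n * of_real (n $ j)) \<le> (3 * norm z) * 1"
      unfolding norm_mult using component_le_norm_cart[of n j] assms by (intro mult_mono) auto
    then show ?thesis
      using norm_triangle_ineq4[of "z $ j" "cdot z n * of_real (n $ j)"]
          Finite_Cartesian_Product.norm_nth_le[of z j] by (simp add: leray_def)
  qed
  from this[of 1] this[of 2] this[of 3] show ?thesis
    using norm_le_sum_nth[of "leray n z"] norm_ge_zero[of z] by linarith
qed

section \<open>Fourier form of the equations and the mean flow\<close>

context rotating_flow
begin

lemma v_summable:
  assumes t: "t > 0" shows "(\<lambda>k. norm (v t k)) summable_on UNIV"
proof -
  obtain C where C: "\<And>F. finite F \<Longrightarrow> (\<Sum>k\<in>F. (rho k)^4 * (norm (v t k))\<^sup>2) \<le> C"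
    using local_bound[OF t, of t] by auto
  have rp: "rho k > 0" for k using rho_ge1[of k] by linarith
  have C0: "C \<ge> 0" using C[of "{}"] by simp
  show ?thesis
  proof (rule uniform_limit_of_tail(1)[where S = "{t}" and a = "\<lambda>k t. norm (v t k)"
      and M = "sqrt C", OF _ rho_summable])
    fix F :: "(int^3) set" and s assume F: "finite F" and s: "s \<in> {t}"
    have "(\<Sum>k\<in>F. norm (v t k)) = (\<Sum>k\<in>F. ((rho k)\<^sup>2 * norm (v t k)) * (1 / (rho k)\<^sup>2))"
      by (intro sum.cong refl) (use rp in \<open>simp add: less_imp_neq[THEN not_sym]\<close>)
    then have "(\<Sum>k\<in>F. norm (v t k))\<^sup>2 \<le> (\<Sum>k\<in>F. ((rho k)\<^sup>2 * norm (v t k))\<^sup>2) * (\<Sum>k\<in>F. (1 / (rho k)\<^sup>2)\<^sup>2)"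
      using Cauchy_Schwarz_ineq_sum[of "\<lambda>k. (rho k)\<^sup>2 * norm (v t k)" "\<lambda>k. 1 / (rho k)\<^sup>2" F] by simp
    also have "\<dots> = (\<Sum>k\<in>F. (rho k)^4 * (norm (v t k))\<^sup>2) * (\<Sum>k\<in>F. 1 / (rho k) ^ 4)"
      by (simp add: power_mult_distrib power_divide flip: power_mult)
    also have "\<dots> \<le> C * (\<Sum>k\<in>F. 1 / (rho k) ^ 4)"
      by (intro mult_right_mono C F sum_nonneg) auto
    finally have "(\<Sum>k\<in>F. norm (v t k)) \<le> sqrt (C * (\<Sum>k\<in>F. 1 / (rho k) ^ 4))" by (rule real_le_rsqrt)
    then show "(\<Sum>k\<in>F. norm (v s k)) \<le> sqrt C * sqrt (\<Sum>k\<in>F. 1 / (rho k) ^ 4)"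
      using s by (simp add: real_sqrt_mult)
  qed (use C0 in auto)
qed

lemma v_nth_summable:
  assumes t: "t > 0" shows "(\<lambda>k. norm (v t k $ j)) summable_on UNIV"
  by (rule Infinite_Sum.abs_summable_on_comparison_test'[OF v_summable[OF t]])
      (rule Finite_Cartesian_Product.norm_nth_le)

lemma u_series:
  assumes t: "t > 0" and x: "x \<in> cbox 0 L"
  shows "complex_of_real (u t x $ j) = (\<Sum>\<^sub>\<infinity>k. v t k $ j * ee k x)"
  unfolding v_nth
  by (rule fourier_series[OF continuous_of_real_nth[OF cont(1)[OF t]]
      periodic_of_real_nth[OF u_periodic[OF t]] v_nth_summable[OF t, unfolded v_nth] x])

lemma fc_joint_continuous:
  assumes f: "continuous_on ({0<..} \<times> UNIV) (\<lambda>(t, x). f t x)"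
  shows "continuous_on {0<..} (\<lambda>t. fc (\<lambda>x. complex_of_real (f t x $ j)) k)"
proof -
  have f': "continuous_on ({0<..} \<times> UNIV) (\<lambda>z. f (fst z) (snd z))" using f by (simp add: case_prod_unfold)
  have "continuous_on {0<..} (\<lambda>t. integral (cbox 0 L) (\<lambda>x. ee (- k) x * complex_of_real (f t x $ j)))"
  proof (rule integral_continuous_on_param)
    show "continuous_on ({0<..} \<times> cbox 0 L) (\<lambda>(t, x). ee (- k) x * complex_of_real (f t x $ j))"
      unfolding case_prod_unfold
      by (intro continuous_intros continuous_on_compose2[OF ee_cont[of UNIV "- k"]]
          continuous_on_subset[OF f']) auto
  qed
  then show ?thesis unfolding fc_def mean_def by (intro continuous_intros)
qed

lemma v_derivative:
  assumes t: "t > 0"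
  shows "((\<lambda>t. v t k $ j) has_vector_derivative fc (\<lambda>x. of_real (dt u t x $ j)) k) (at t)"
  unfolding v_nth fc_def
proof (rule mean_has_derivative[OF _ _ _ t])
  have ec: "continuous_on ({0<..} \<times> UNIV) (\<lambda>z::real \<times> (real^3). ee (- k) (snd z))"
    by (intro continuous_on_compose2[OF ee_cont[of UNIV "- k"]] continuous_intros) auto
  show "continuous_on ({0<..} \<times> UNIV) (\<lambda>(t, x). ee (- k) x * complex_of_real (u t x $ j))"
    using joint_cont(1) unfolding case_prod_unfold by (intro continuous_intros ec)
  show "continuous_on ({0<..} \<times> UNIV) (\<lambda>(t, x). ee (- k) x * complex_of_real (dt u t x $ j))"
    using joint_cont(4) unfolding case_prod_unfold by (intro continuous_intros ec)
  show "((\<lambda>s. ee (- k) x * complex_of_real (u s x $ j)) has_vector_derivative ee (- k) x * complex_of_real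
      (dt u t x $ j)) (at t)" if "t > 0" for t x
    using bounded_linear.has_vector_derivative[OF
        bounded_linear_compose[OF bounded_linear_mult_right bounded_linear_of_real_nth]
        dt_derivative[OF that]] by simp
qed

definition conv :: "real \<Rightarrow> int^3 \<Rightarrow> complex^3" where
  "conv t k = (\<chi> j. fc (\<lambda>x. of_real (convection (u t) (u t) x $ j)) k)"

lemma convection_cont: "t > 0 \<Longrightarrow> continuous_on UNIV (convection (u t) (u t))"
  unfolding convection_def by (intro continuous_intros cont)

lemma v_cdot: "t > 0 \<Longrightarrow> cdot (v t k) (wave L k) = 0"
  unfolding cdot_def by (rule v_divergence_free)

text \<open>The derivative falls on the factor of wave vector k - m, but \<open>v t m\<close> is
  orthogonal to the wave vector of m, so k - m may be replaced by k. The lost derivative is then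
  measured at the output k alone.\<close>

lemma conv_has_sum:
  assumes t: "t > 0"
  shows "((\<lambda>m. (\<i> * cdot (v t m) (wave L k)) * v t (k - m) $ j) has_sum conv t k $ j) UNIV"
proof -
  have 1: "((\<lambda>m. v t m $ l * fc (\<lambda>x. of_real (dx l (u t) x $ j)) (k - m)) has_sum
      fc (\<lambda>x. of_real (u t x $ l) * of_real (dx l (u t) x $ j)) k) UNIV" for l
    by (rule fc_mult_series[OF v_nth_summable[OF t] continuous_of_real_nth[OF cont(2)[OF t]] u_series[OF t]])
  have "((\<lambda>m. \<Sum>l\<in>UNIV. v t m $ l * fc (\<lambda>x. of_real (dx l (u t) x $ j)) (k - m)) has_sum
      (\<Sum>l\<in>UNIV. fc (\<lambda>x. of_real (u t x $ l) * of_real (dx l (u t) x $ j)) k)) UNIV"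
    unfolding sum_3 by (intro has_sum_add 1)
  moreover have "(\<Sum>l\<in>UNIV. fc (\<lambda>x. of_real (u t x $ l) * of_real (dx l (u t) x $ j)) k) = conv t k $ j"
  proof -
    have "(\<Sum>l\<in>UNIV. fc (\<lambda>x. of_real (u t x $ l) * of_real (dx l (u t) x $ j)) k)
        = fc (\<lambda>x. \<Sum>l\<in>UNIV. of_real (u t x $ l) * of_real (dx l (u t) x $ j)) k"
      by (rule fc_sum[symmetric]) (auto intro!: continuous_intros cont t)
    also have "\<dots> = conv t k $ j" by (simp add: conv_def convection_def)
    finally show ?thesis .
  qed
  moreover have "(\<Sum>l\<in>UNIV. v t m $ l * fc (\<lambda>x. of_real (dx l (u t) x $ j)) (k - m))
      = (\<i> * cdot (v t m) (wave L k)) * v t (k - m) $ j" for m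
  proof -
    have "(\<Sum>l\<in>UNIV. v t m $ l * fc (\<lambda>x. of_real (dx l (u t) x $ j)) (k - m))
        = \<i> * (cdot (v t m) (wave L k) - cdot (v t m) (wave L m)) * v t (k - m) $ j"
      unfolding fc_dx[OF t] wave_diff cdot_def sum_3 by (simp add: algebra_simps)
    then show ?thesis using v_cdot[OF t] by simp
  qed
  ultimately show ?thesis by simp
qed

lemma fc_cross:
  assumes f: "continuous_on UNIV f"
  shows "fc (\<lambda>x. of_real (cross3 (axis 3 1) (f x) $ j)) k
      = ccross (axis 3 1) (\<chi> j. fc (\<lambda>x. of_real (f x $ j)) k) $ j"
proof -
  have c: "cross3 (axis 3 1) y $ 1 = - y $ 2" "cross3 (axis 3 1) y $ 2 = y $ 1" "cross3 (axis 3 1) y $ 3 = 0"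
      for y :: "real^3"
    by (simp_all add: cross3_def axis_def vector_3)
  have m: "fc (\<lambda>x. - complex_of_real (f x $ 2)) k = - fc (\<lambda>x. complex_of_real (f x $ 2)) k"
    using fc_cmult[OF continuous_of_real_nth[OF f], of "-1" 2 k] by simp
  have z: "fc (\<lambda>x. 0) k = 0" by (simp add: fc_def mean_const)
  have "\<forall>j. fc (\<lambda>x. of_real (cross3 (axis 3 1) (f x) $ j)) k
      = ccross (axis 3 1) (\<chi> j. fc (\<lambda>x. of_real (f x $ j)) k) $ j"
    unfolding forall_3 c ccross_nth by (simp add: axis_def m z)
  then show ?thesis by blast
qed

definition pc :: "real \<Rightarrow> int^3 \<Rightarrow> complex" where "pc t k = fc (\<lambda>x. of_real (p t x)) k"

lemma v_ode_nth:
  assumes t: "t > 0"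
  shows "fc (\<lambda>x. of_real (dt u t x $ j)) k =
    - of_real ((norm (wave L k))\<^sup>2) * v t k $ j - conv t k $ j - \<i> * of_real (wave L k $ j) * pc t k
    - of_real \<Omega> * ccross (axis 3 1) (v t k) $ j"
proof -
  have gj: "fc (\<lambda>x. of_real (grad (p t) x $ j)) k = \<i> * of_real (wave L k $ j) * pc t k"
    unfolding grad_def pc_def vec_lambda_beta
    by (rule fc_pder[OF _ _ _ pder_bounded_linear[OF bounded_linear_of_real pders(3)[OF t]]])
       (use p_periodic[OF t] in \<open>auto intro!: continuous_intros cont t simp: periodic_def\<close>)
  have gc: "continuous_on UNIV (grad (p t))" unfolding grad_def by (intro continuous_on_vec_lambda cont t)
  have crc: "continuous_on UNIV (\<lambda>x. cross3 (axis 3 1) (u t x))"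
    by (intro continuous_on_cross continuous_intros cont t)
  have "fc (\<lambda>x. of_real (dt u t x $ j)) k = fc
      (\<lambda>x. of_real (laplacian (u t) x $ j) - of_real (convection (u t) (u t) x $ j)
      - of_real (grad (p t) x $ j) - of_real \<Omega> * of_real (cross3 (axis 3 1) (u t x) $ j)) k"
    by (simp add: eq_dt[OF t])
  also have "\<dots> = fc (\<lambda>x. of_real (laplacian (u t) x $ j)) k - fc (\<lambda>x. of_real (convection (u t) (u t) x $ j)) k
      - fc (\<lambda>x. of_real (grad (p t) x $ j)) k - of_real \<Omega> * fc (\<lambda>x. of_real (cross3 (axis 3 1) (u t x) $ j)) k"
  proof -
    note cc = continuous_of_real_nth[OF laplacian_cont[OF t], of j]
        continuous_of_real_nth[OF convection_cont[OF t], of j]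
      continuous_of_real_nth[OF gc, of j] continuous_of_real_nth[OF crc, of j]
    note c2 = continuous_on_diff[OF cc(1,2)] and c5
        = continuous_on_mult[OF continuous_on_const cc(4), of "of_real \<Omega>"]
    note c3 = continuous_on_diff[OF c2 cc(3)]
    show ?thesis unfolding fc_diff[OF c3 c5] fc_diff[OF c2 cc(3)] fc_diff[OF cc(1,2)] fc_cmult[OF cc(4)] ..
  qed
  also have "\<dots> = - of_real ((norm (wave L k))\<^sup>2) * v t k $ j - conv t k $ j
      - \<i> * of_real (wave L k $ j) * pc t k
    - of_real \<Omega> * ccross (axis 3 1) (v t k) $ j"
    unfolding fc_laplacian[OF t] gj fc_cross[OF cont(1)[OF t]] by (simp add: conv_def v_def)
  finally show ?thesis .
qed

definition U :: "real \<Rightarrow> 3 \<Rightarrow> real" where "U t j = mean (\<lambda>x. u t x $ j)"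

lemma v_0: "t > 0 \<Longrightarrow> v t 0 $ j = of_real (U t j)"
  unfolding v_nth fc_def U_def by (simp add: ee_0 mean_linear[OF bounded_linear_of_real] cont continuous_intros)

text \<open>In the form of \<open>conv_has_sum\<close> every term carries the output wave vector as
  a factor, which is 0 here: convection does not move the mean.\<close>

lemma conv_0: "t > 0 \<Longrightarrow> conv t 0 $ j = 0"
  using has_sum_unique[OF conv_has_sum[of t 0 j] has_sum_0[of UNIV]] by (simp add: wave_0 cdot_def)

text \<open>The equation of the coefficient at 0, where viscosity, pressure and convection vanish
  and only the Coriolis term is left.\<close>

lemma U_derivative:
  assumes t: "t > 0"
  shows "((\<lambda>t. U t 1) has_real_derivative \<Omega> * U t 2) (at t)"
    "((\<lambda>t. U t 2) has_real_derivative - \<Omega> * U t 1) (at t)"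
    "((\<lambda>t. U t 3) has_real_derivative 0) (at t)"
proof -
  have "((\<lambda>s. Re (v s 0 $ j)) has_vector_derivative Re (- of_real \<Omega> * ccross (axis 3 1) (v t 0) $ j)) (at t)"
      for j
    using bounded_linear.has_vector_derivative[OF bounded_linear_Re v_derivative[OF t, of 0 j]]
    unfolding v_ode_nth[OF t] using t by (simp add: wave_0 conv_0)
  then have d: "((\<lambda>s. U s j) has_vector_derivative Re (- of_real \<Omega> * ccross (axis 3 1) (v t 0) $ j)) (at t)"
      for j
    by (rule has_vector_derivative_transform_within_open[of _ _ _ "{0<..}"]) (use t in \<open>auto simp: v_0\<close>)
  show "((\<lambda>t. U t 1) has_real_derivative \<Omega> * U t 2) (at t)"
    "((\<lambda>t. U t 2) has_real_derivative - \<Omega> * U t 1) (at t)"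
    "((\<lambda>t. U t 3) has_real_derivative 0) (at t)"
    unfolding has_real_derivative_iff_has_vector_derivative
    using d[of 1] d[of 2] d[of 3] t by (simp_all add: ccross_nth axis_def v_0)
qed

text \<open>Amplitudes of the mean flow, read off at time 1 because nothing is assumed about derivatives at time 0.\<close>

definition mA where "mA = U 1 1 * cos \<Omega> - U 1 2 * sin \<Omega>"
definition mB where "mB = U 1 1 * sin \<Omega> + U 1 2 * cos \<Omega>"
definition mC where "mC = U 1 3"

lemma U_explicit:
  assumes t: "t > 0"
  shows "U t 1 = mA * cos (\<Omega> * t) + mB * sin (\<Omega> * t)" "U t 2 = - mA * sin (\<Omega> * t) + mB * cos (\<Omega> * t)" "U t 3
      = mC"
proof -
  have const: "f t = f 1" if "\<And>s. s > 0 \<Longrightarrow> (f has_real_derivative 0) (at s)" for f :: "real \<Rightarrow> real"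
  proof -
    have "\<exists>c. \<forall>x\<in>{0<..}. f x = c"
      by (rule has_field_derivative_zero_constant) (use that in \<open>auto intro: has_field_derivative_at_within\<close>)
    then show ?thesis using t by auto
  qed
  have c: "((\<lambda>s. cos (\<Omega> * s)) has_real_derivative - \<Omega> * sin (\<Omega> * s)) (at s)"
    and sn: "((\<lambda>s. sin (\<Omega> * s)) has_real_derivative \<Omega> * cos (\<Omega> * s)) (at s)" for s
    by (auto intro!: derivative_eq_intros)
  \<comment> \<open>Seen from a frame that turns with the mean flow, its horizontal components are
    constant; this conserved combination and the next one are these components.\<close>
  have 1: "U t 1 * cos (\<Omega> * t) - U t 2 * sin (\<Omega> * t) = mA"
  proof -
    have "((\<lambda>s. U s 1 * cos (\<Omega> * s) - U s 2 * sin (\<Omega> * s)) has_real_derivative 0) (at s)" if "s > 0" for s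
      using DERIV_diff[OF DERIV_mult[OF U_derivative(1)[OF that] c]
          DERIV_mult[OF U_derivative(2)[OF that] sn]] by (simp add: algebra_simps)
    from const[OF this] show ?thesis by (simp add: mA_def)
  qed
  have 2: "U t 1 * sin (\<Omega> * t) + U t 2 * cos (\<Omega> * t) = mB"
  proof -
    have "((\<lambda>s. U s 1 * sin (\<Omega> * s) + U s 2 * cos (\<Omega> * s)) has_real_derivative 0) (at s)" if "s > 0" for s
      using DERIV_add[OF DERIV_mult[OF U_derivative(1)[OF that] sn] DERIV_mult[OF U_derivative(2)[OF that] c]]
          by (simp add: algebra_simps)
    from const[OF this] show ?thesis by (simp add: mB_def)
  qed
  have sc: "sin (\<Omega> * t) * sin (\<Omega> * t) + cos (\<Omega> * t) * cos (\<Omega> * t) = 1"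
    using sin_cos_squared_add[of "\<Omega> * t"] by (simp only: power2_eq_square)
  show "U t 1 = mA * cos (\<Omega> * t) + mB * sin (\<Omega> * t)" "U t 2 = - mA * sin (\<Omega> * t) + mB * cos (\<Omega> * t)"
    unfolding 1[symmetric] 2[symmetric] using sc by algebra+
  show "U t 3 = mC" using const[of "\<lambda>t. U t 3"] U_derivative(3) by (simp add: mC_def)
qed

text \<open>A primitive of \<open>U \<bullet> wave L k\<close>; it needs \<open>\<Omega> \<noteq> 0\<close>, as the divisions by \<open>\<Omega>\<close> would otherwise give 0.\<close>

definition \<theta> :: "int^3 \<Rightarrow> real \<Rightarrow> real" where
  "\<theta> k t = ((wave L k $ 2 * mA - wave L k $ 1 * mB) / \<Omega>) * cos (\<Omega> * t)
      + ((wave L k $ 1 * mA + wave L k $ 2 * mB) / \<Omega>) * sin (\<Omega> * t) + (wave L k $ 3 * mC) * t"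

text \<open>The phases of two interacting modes multiply to the phase of the mode they feed, and so
  factor out of the convolution.\<close>

lemma \<theta>_add: "\<theta> k t = \<theta> m t + \<theta> (k - m) t"
  unfolding \<theta>_def wave_diff by (simp add: algebra_simps diff_divide_distrib add_divide_distrib)

lemma \<theta>_derivative:
  assumes "\<Omega> \<noteq> 0" "t > 0"
  shows "(\<theta> k has_real_derivative (\<Sum>j\<in>UNIV. U t j * wave L k $ j)) (at t)"
proof -
  have "(\<Sum>j\<in>UNIV. U t j * wave L k $ j) = ((wave L k $ 2 * mA - wave L k $ 1 * mB) / \<Omega>) * (- \<Omega> * sin (\<Omega> * t))
      + ((wave L k $ 1 * mA + wave L k $ 2 * mB) / \<Omega>) * (\<Omega> * cos (\<Omega> * t)) + (wave L k $ 3 * mC) * 1"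
    unfolding sum_3 U_explicit[OF assms(2)] using assms(1) by (simp add: field_simps)
  moreover have "((\<lambda>t. ((wave L k $ 2 * mA - wave L k $ 1 * mB) / \<Omega>) * cos (\<Omega> * t)
      + ((wave L k $ 1 * mA + wave L k $ 2 * mB) / \<Omega>) * sin (\<Omega> * t) + (wave L k $ 3 * mC) * t)
     has_real_derivative ((wave L k $ 2 * mA - wave L k $ 1 * mB) / \<Omega>) * (- \<Omega> * sin (\<Omega> * t))
         + ((wave L k $ 1 * mA + wave L k $ 2 * mB) / \<Omega>) * (\<Omega> * cos (\<Omega> * t)) + (wave L k $ 3 * mC) * 1) (at t)"
    by (intro DERIV_add DERIV_cmult DERIV_ident) (auto intro!: derivative_eq_intros)
  ultimately show ?thesis by (simp only: \<theta>_def[abs_def])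
qed

end

section \<open>The transformed Fourier coefficients\<close>

lemma has_sum_vec3:
  fixes b :: "'m \<Rightarrow> complex^3"
  assumes "\<And>j. ((\<lambda>m. b m $ j) has_sum S $ j) A"
  shows "(b has_sum S) A"
proof -
  have bl: "bounded_linear (axis j :: complex \<Rightarrow> complex^3)" for j
    by (intro linear_conv_bounded_linear[THEN iffD1] linearI) (auto simp: vec_eq_iff axis_def)
  have eq: "z = axis 1 (z $ 1) + axis 2 (z $ 2) + axis 3 (z $ 3)" for z :: "complex^3"
    by (simp add: vec_eq_iff axis_def forall_3)
  have "((\<lambda>m. axis j (b m $ j)) has_sum (axis j (S $ j) :: complex^3)) A" for j :: 3
    using has_sum_bounded_linear[OF bl assms] by (simp add: o_def)
  then have "((\<lambda>m. (axis 1 (b m $ 1) :: complex^3) + axis 2 (b m $ 2) + axis 3 (b m $ 3)) has_sum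
      (axis 1 (S $ 1) + axis 2 (S $ 2) + axis 3 (S $ 3))) A"
    by (intro has_sum_add)
  then show ?thesis unfolding eq[symmetric] .
qed

lemma vec_expand_smult: "z = (\<Sum>a\<in>UNIV. (z $ a) *s axis a 1)" for z :: "complex^3"
  by (simp add: vec_eq_iff axis_def sum_component if_distrib[of "\<lambda>x. _ * x"] cong: if_cong)

lemma norm_smult_vec: "norm (c *s z) = norm c * norm z" for z :: "complex^3"
  by (simp add: norm_vec_def L2_set_def norm_mult power_mult_distrib real_sqrt_mult flip: sum_distrib_left)

lemma exp_poly_rot:
  assumes "\<And>j. (\<lambda>t. z t $ j) \<in> exp_poly"
  shows "(\<lambda>t. rot n (c * t) (z t) $ j) \<in> exp_poly"
proof -
  have cr: "(\<lambda>t. ccross n (z t) $ j) \<in> exp_poly" for j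
  proof -
    have d: "(\<lambda>t. a * z t $ i - b * z t $ l) \<in> exp_poly" for a b i l
      using exp_poly_add[OF exp_poly_cmult[OF assms[of i], of a] exp_poly_cmult[OF assms[of l], of "- b"]]
          by simp
    have "\<forall>j. (\<lambda>t. ccross n (z t) $ j) \<in> exp_poly" unfolding forall_3 ccross_nth by (intro conjI d)
    then show ?thesis by blast
  qed
  have "(\<lambda>t. of_real (cos (c * t)) * z t $ j + of_real (sin (c * t)) * ccross n (z t) $ j) \<in> exp_poly"
    by (intro exp_poly_add exp_poly_mult exp_poly_cos exp_poly_sin assms cr)
  then show ?thesis by (simp add: rot_def scaleR_complex)
qed

lemma exp_poly_cdot: "(\<And>j. (\<lambda>t. z t $ j) \<in> exp_poly) \<Longrightarrow> (\<lambda>t. cdot (z t) n) \<in> exp_poly"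
  unfolding cdot_def by (intro exp_poly_sum exp_poly_mult exp_poly_const)

lemma exp_poly_leray:
  assumes "\<And>j. (\<lambda>t. z t $ j) \<in> exp_poly" shows "(\<lambda>t. leray n (z t) $ j) \<in> exp_poly"
proof -
  have "(\<lambda>t. z t $ j + - (cdot (z t) n * of_real (n $ j))) \<in> exp_poly"
    by (intro exp_poly_add exp_poly_uminus exp_poly_mult exp_poly_const exp_poly_cdot assms)
  then show ?thesis by (simp add: leray_def)
qed

locale rotating_expansion = rotating_flow +
  assumes Omega_nz: "\<Omega> \<noteq> 0" and wave_ge1: "k \<noteq> 0 \<Longrightarrow> norm (wave L k) \<ge> 1"
begin

text \<open>At k = 0 the convention 1 / 0 = 0 makes it 0, so \<open>norm_dir_le\<close> covers all
  k.\<close>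

definition dir :: "int^3 \<Rightarrow> real^3" where "dir k = (1 / norm (wave L k)) *\<^sub>R wave L k"
text \<open>The dispersion relation of inertial waves.\<close>

definition om :: "int^3 \<Rightarrow> real" where "om k = \<Omega> * dir k $ 3"
definition w :: "real \<Rightarrow> int^3 \<Rightarrow> complex^3" where
  "w t k = (if k = 0 then 0 else cis (\<theta> k t) *s v t k)"
definition q :: "real \<Rightarrow> int^3 \<Rightarrow> complex^3" where "q t k = rot (dir k) (om k * t) (w t k)"
text \<open>The convection convolution formed with w instead of v: the interactions with the mean
  flow are left out because w vanishes at 0.\<close>

definition Bw :: "real \<Rightarrow> int^3 \<Rightarrow> complex^3" where
  "Bw t k = (\<chi> j. \<Sum>\<^sub>\<infinity>m. (\<i> * cdot (w t m) (wave L k)) * w t (k - m) $ j)"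
definition N :: "real \<Rightarrow> int^3 \<Rightarrow> complex^3" where
  "N t k = rot (dir k) (om k * t) (leray (dir k) (Bw t k))"

lemma rho_eq: "k \<noteq> 0 \<Longrightarrow> rho k = norm (wave L k)"
  using wave_ge1[of k] by (simp add: rho_def max_def)

lemma norm_wave_le_rho: "norm (wave L k) \<le> rho k" by (simp add: rho_def)

lemma norm_dir: "k \<noteq> 0 \<Longrightarrow> norm (dir k) = 1"
  using wave_eq_0_iff[of k] by (simp add: dir_def)

lemma norm_dir_le: "norm (dir k) \<le> 1"
  by (cases "wave L k = 0") (simp_all add: dir_def)

lemma wave_dir: "wave L k = norm (wave L k) *\<^sub>R dir k"
  by (cases "wave L k = 0") (simp_all add: dir_def)

lemma cdot_dir: "cdot z (dir k) = of_real (1 / norm (wave L k)) * cdot z (wave L k)"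
  by (simp add: cdot_def dir_def sum_distrib_left algebra_simps)

lemma w_cdot_wave: "t > 0 \<Longrightarrow> cdot (w t k) (wave L k) = 0"
  by (simp add: w_def cdot_scale v_cdot) (simp add: cdot_def)

lemma w_cdot: "t > 0 \<Longrightarrow> cdot (w t k) (dir k) = 0"
  by (simp add: cdot_dir w_cdot_wave)

lemma w_0: "w t 0 = 0" by (simp add: w_def)

lemma norm_w_le: "norm (w t k) \<le> norm (v t k)"
  by (simp add: w_def norm_smult_vec)

text \<open>Among the terms of \<open>conv t k\<close>, the one with m = 0 is transport by the mean
  flow and is subtracted by g; the one with m = k vanishes by orthogonality; in all others
  \<open>\<theta>_add\<close> factors out the phase.\<close>

lemma w_conv:
  assumes t: "t > 0" and k: "k \<noteq> 0"
  shows "((\<lambda>m. (\<i> * cdot (w t m) (wave L k)) * w t (k - m) $ j) has_sum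
    cis (\<theta> k t) * (conv t k $ j - \<i> * cdot (v t 0) (wave L k) * v t k $ j)) UNIV"
proof -
  define f where "f m = cis (\<theta> k t) * ((\<i> * cdot (v t m) (wave L k)) * v t (k - m) $ j)" for m
  define c where "c = cis (\<theta> k t) * (\<i> * cdot (v t 0) (wave L k) * v t k $ j)"
  define g where "g m = (if m = 0 then - c else 0)" for m :: "int^3"
  have f: "(f has_sum cis (\<theta> k t) * conv t k $ j) UNIV"
    unfolding f_def by (rule has_sum_cmult_right[OF conv_has_sum[OF t]])
  have "(g has_sum - c) {0}" by (rule has_sum_finiteI) (simp_all add: g_def)
  then have g: "(g has_sum - c) UNIV" by (subst (asm) has_sum_cong_neutral[of UNIV "{0}" g g])
      (auto simp: g_def)
  have eq: "f m + g m = (\<i> * cdot (w t m) (wave L k)) * w t (k - m) $ j" for m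
  proof -
    consider "m = 0" | "m = k" "m \<noteq> 0" | "m \<noteq> 0" "k - m \<noteq> 0" by auto
    then show ?thesis
    proof cases
      case 1
      then show ?thesis by (simp add: f_def g_def c_def w_0 cdot_def)
    next
      case 2
      then show ?thesis by (simp add: f_def g_def w_0 v_cdot[OF t])
    next
      case 3
      then show ?thesis
        by (simp add: f_def g_def w_def cdot_scale \<theta>_add[of k t m] mult_ac flip: cis_mult)
    qed
  qed
  show ?thesis using has_sum_add[OF f g] unfolding eq c_def by (simp add: right_diff_distrib)
qed

lemma Bw_nth:
  assumes t: "t > 0" and k: "k \<noteq> 0"
  shows "Bw t k $ j = cis (\<theta> k t) * (conv t k $ j - \<i> * cdot (v t 0) (wave L k) * v t k $ j)"
  using infsumI[OF w_conv[OF t k]] by (simp add: Bw_def)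

lemma Bw_0: "Bw t 0 = 0"
  by (simp add: Bw_def vec_eq_iff wave_0 cdot_def)

lemma w_has_sum:
  assumes t: "t > 0"
  shows "((\<lambda>m. (\<i> * cdot (w t m) (wave L k)) *s w t (k - m)) has_sum Bw t k) UNIV"
proof (cases "k = 0")
  case True
  then show ?thesis by (simp add: Bw_0 wave_0 cdot_def)
next
  case False
  show ?thesis by (rule has_sum_vec3) (simp add: Bw_nth[OF t False] w_conv[OF t False])
qed

text \<open>Differentiating the phase produces i (U . k) w, which cancels the transport by the mean
  flow contained in \<open>conv\<close>.\<close>

lemma w_derivative:
  assumes t: "t > 0" and k: "k \<noteq> 0"
  shows "((\<lambda>t. w t k) has_vector_derivative
    (- (norm (wave L k))\<^sup>2 *\<^sub>R w t k - Bw t k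
        - (\<chi> j. (\<i> * cis (\<theta> k t) * pc t k) * of_real (norm (wave L k) * dir k $ j))
        - \<Omega> *\<^sub>R ccross (axis 3 1) (w t k))) (at t)"
proof (rule has_vector_derivative_vec)
  fix j
  have th: "((\<lambda>t. cis (\<theta> k t)) has_vector_derivative (\<Sum>j\<in>UNIV. U t j * wave L k $ j) *\<^sub>R (\<i> * cis (\<theta> k t)))
      (at t)"
    using has_derivative_cis[OF \<theta>_derivative[OF Omega_nz t, of k, unfolded has_field_derivative_def]]
    by (simp add: has_vector_derivative_def mult.commute)
  have c0: "cdot (v t 0) (wave L k) = of_real (\<Sum>j\<in>UNIV. U t j * wave L k $ j)"
    by (simp add: cdot_def v_0[OF t])
  have wj: "wave L k $ j = norm (wave L k) * dir k $ j"
    using arg_cong[OF wave_dir[of k], of "\<lambda>x. x $ j"] by simp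
  have cc: "ccross (axis 3 1) (w t k) $ j = cis (\<theta> k t) * ccross (axis 3 1) (v t k) $ j"
    using k by (simp add: w_def ccross_scale)
  have "((\<lambda>t. cis (\<theta> k t) * v t k $ j) has_vector_derivative
     (cis (\<theta> k t) * fc (\<lambda>x. of_real (dt u t x $ j)) k + (\<Sum>j\<in>UNIV. U t j * wave L k $ j) *\<^sub>R (\<i> * cis (\<theta> k t))
         * v t k $ j)) (at t)"
    by (rule has_vector_derivative_mult[OF th v_derivative[OF t]])
  moreover have "cis (\<theta> k t) * fc (\<lambda>x. of_real (dt u t x $ j)) k
      + (\<Sum>j\<in>UNIV. U t j * wave L k $ j) *\<^sub>R (\<i> * cis (\<theta> k t)) * v t k $ j
    = (- (norm (wave L k))\<^sup>2 *\<^sub>R w t k - Bw t k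
        - (\<chi> j. (\<i> * cis (\<theta> k t) * pc t k) * of_real (norm (wave L k) * dir k $ j))
        - \<Omega> *\<^sub>R ccross (axis 3 1) (w t k)) $ j"
    unfolding v_ode_nth[OF t] vector_minus_component vector_scaleR_component Bw_nth[OF t k] c0 cc
        vec_lambda_beta wj[symmetric]
    using k by (simp add: w_def scaleR_complex algebra_simps)
  ultimately show "((\<lambda>t. w t k $ j) has_vector_derivative (- (norm (wave L k))\<^sup>2 *\<^sub>R w t k - Bw t k
      - (\<chi> j. (\<i> * cis (\<theta> k t) * pc t k) * of_real (norm (wave L k) * dir k $ j))
      - \<Omega> *\<^sub>R ccross (axis 3 1) (w t k)) $ j) (at t)"
    using k by (simp add: w_def)
qed

text \<open>w stays orthogonal to the wave vector, hence so does its derivative, and the projection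
  leaves the right-hand side as a whole unchanged. Term by term it removes the pressure and
  simplifies the Coriolis term.\<close>

lemma w_derivative_leray:
  assumes t: "t > 0" and k: "k \<noteq> 0"
  shows "((\<lambda>t. w t k) has_vector_derivative
    (- (norm (wave L k))\<^sup>2 *\<^sub>R w t k - leray (dir k) (Bw t k) - om k *\<^sub>R ccross (dir k) (w t k))) (at t)"
proof -
  note n1 = norm_dir[OF k]
  define G where "G = (\<chi> j. (\<i> * cis (\<theta> k t) * pc t k) * complex_of_real (norm (wave L k) * dir k $ j))"
  define w' where "w' = - (norm (wave L k))\<^sup>2 *\<^sub>R w t k - Bw t k - G - \<Omega> *\<^sub>R ccross (axis 3 1) (w t k)"
  have d: "((\<lambda>t. w t k) has_vector_derivative w') (at t)"
    using w_derivative[OF t k] unfolding w'_def G_def .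
  have bl: "bounded_linear (\<lambda>z. cdot z (dir k))"
    using cdot_linear[of "dir k"] by (simp add: linear_conv_bounded_linear)
  have "((\<lambda>t. cdot (w t k) (dir k)) has_vector_derivative cdot w' (dir k)) (at t)"
    by (rule bounded_linear.has_vector_derivative[OF bl d])
  moreover have "((\<lambda>t. cdot (w t k) (dir k)) has_vector_derivative 0) (at t)"
    by (rule has_vector_derivative_transform_within_open[of "\<lambda>t. 0" _ _ "{0<..}"])
        (use t in \<open>auto simp: w_cdot\<close>)
  ultimately have "cdot w' (dir k) = 0" by (rule vector_derivative_unique_at)
  then have "w' = leray (dir k) w'" by (simp add: leray_id)
  also have "\<dots> = - (norm (wave L k))\<^sup>2 *\<^sub>R leray (dir k) (w t k) - leray (dir k) (Bw t k) - leray (dir k) G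
      - \<Omega> *\<^sub>R leray (dir k) (ccross (axis 3 1) (w t k))"
    unfolding w'_def by (simp only: linear_diff[OF leray_linear] linear_scale[OF leray_linear])
  also have "\<dots> = - (norm (wave L k))\<^sup>2 *\<^sub>R w t k - leray (dir k) (Bw t k) - om k *\<^sub>R ccross (dir k) (w t k)"
    unfolding G_def leray_gradient[OF n1] leray_id[OF w_cdot[OF t]] leray_coriolis[OF n1 w_cdot[OF t]]
        by (simp add: om_def)
  finally show ?thesis using d by simp
qed

lemma q_0: "q t 0 = 0"
  using linear_0[OF rot_linear] by (simp add: q_def w_0)

lemma N_0: "N t 0 = 0"
  using linear_0[OF rot_linear] linear_0[OF leray_linear] by (simp add: N_def Bw_0)

text \<open>The rotation turns at the rate of the projected Coriolis term;
  \<open>ccross_ccross\<close> makes the two contributions cancel.\<close>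

lemma q_derivative:
  assumes t: "t > 0"
  shows "((\<lambda>t. q t k) has_vector_derivative (- (rho k)\<^sup>2 *\<^sub>R q t k - N t k)) (at t)"
proof (cases "k = 0")
  case True
  then show ?thesis by (simp add: q_0 N_0)
next
  case False
  note n1 = norm_dir[OF False]
  let ?n = "dir k" and ?w = "w t k" and ?c = "cos (om k * t)" and ?s = "sin (om k * t)"
      and ?B = "leray (dir k) (Bw t k)"
  let ?w' = "- (norm (wave L k))\<^sup>2 *\<^sub>R ?w - ?B - om k *\<^sub>R ccross ?n ?w"
  have bl: "bounded_linear (ccross ?n)"
    using ccross_linear[of ?n] by (simp add: linear_conv_bounded_linear)
  have dw: "((\<lambda>t. w t k) has_vector_derivative ?w') (at t)" by (rule w_derivative_leray[OF t False])
  have dc: "((\<lambda>t. cos (om k * t)) has_field_derivative (- om k * ?s)) (at t)"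
      by (auto intro!: derivative_eq_intros)
  have ds: "((\<lambda>t. sin (om k * t)) has_field_derivative (om k * ?c)) (at t)"
      by (auto intro!: derivative_eq_intros)
  have "((\<lambda>t. q t k) has_vector_derivative ((?c *\<^sub>R ?w' + (- om k * ?s) *\<^sub>R ?w)
      + (?s *\<^sub>R ccross ?n ?w' + (om k * ?c) *\<^sub>R ccross ?n ?w))) (at t)"
    unfolding q_def rot_def
    by (intro has_vector_derivative_add has_vector_derivative_scaleR dc ds dw
        bounded_linear.has_vector_derivative[OF bl])
  moreover have "(?c *\<^sub>R ?w' + (- om k * ?s) *\<^sub>R ?w) + (?s *\<^sub>R ccross ?n ?w' + (om k * ?c) *\<^sub>R ccross ?n ?w)
      = - (rho k)\<^sup>2 *\<^sub>R q t k - N t k"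
    unfolding linear_diff[OF ccross_linear] linear_scale[OF ccross_linear] ccross_ccross[OF n1 w_cdot[OF t]]
        q_def N_def rot_def rho_eq[OF False]
    by (simp add: algebra_simps)
  ultimately show ?thesis by simp
qed

lemma w_eq_rot_q: "t > 0 \<Longrightarrow> w t k = rot (dir k) (- om k * t) (q t k)"
proof -
  assume t: "t > 0"
  show ?thesis
  proof (cases "k = 0")
    case True
    then show ?thesis using linear_0[OF rot_linear] by (simp add: w_0 q_0)
  next
    case False
    then show ?thesis using rot_inverse[OF norm_dir[OF False] w_cdot[OF t], of "om k * t"] by (simp add: q_def)
  qed
qed

lemma norm_q_le_w: "norm (q t k) \<le> 7 * norm (w t k)"
  unfolding q_def by (rule norm_rot_le[OF norm_dir_le])

lemma norm_q_le: "norm (q t k) \<le> 7 * norm (v t k)"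
  using norm_q_le_w[of t k] norm_w_le[of t k] by linarith

lemma norm_w_le_q: "t > 0 \<Longrightarrow> norm (w t k) \<le> 7 * norm (q t k)"
  using norm_rot_le[OF norm_dir_le, of k "- om k * t" "q t k"] w_eq_rot_q[of t k] by simp

lemma q_conv_summable:
  assumes t: "t > 0" shows "(\<lambda>m. norm (q t m) * norm (q t (k - m))) summable_on UNIV"
proof -
  define V where "V = infsum (\<lambda>k. norm (v t k)) UNIV"
  have V: "norm (v t m) \<le> V" for m
    using finite_sum_le_infsum[OF v_summable[OF t], of "{m}"] by (simp add: V_def)
  show ?thesis
  proof (rule summable_on_comparison_test)
    show "(\<lambda>m. norm (v t m) * (49 * V)) summable_on UNIV" by (rule summable_on_cmult_left[OF v_summable[OF t]])
    have "norm (q t m) * norm (q t (k - m)) \<le> (7 * norm (v t m)) * (7 * V)" for m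
      by (intro mult_mono norm_q_le order_trans[OF norm_q_le] mult_left_mono V) auto
    then show "norm (q t m) * norm (q t (k - m)) \<le> norm (v t m) * (49 * V)" for m by (simp add: mult_ac)
  qed auto
qed

text \<open>The factors are 7 for the outer rotation, 12 for the projection, 3 for
  \<open>cdot\<close>, and 49 for replacing both factors w by q.\<close>

definition cN :: real where "cN = 7 * 12 * 3 * 49"

lemma N_bound:
  assumes t: "t > 0"
  shows "norm (N t k) \<le> cN * rho k * (\<Sum>\<^sub>\<infinity>m. norm (q t m) * norm (q t (k - m)))"
proof -
  have "norm (Bw t k) \<le> 3 * 49 * rho k * (\<Sum>\<^sub>\<infinity>m. norm (q t m) * norm (q t (k - m)))"
  proof (rule norm_infsum_le[OF w_has_sum[OF t]])
    show "((\<lambda>m. 3 * 49 * rho k * (norm (q t m) * norm (q t (k - m)))) has_sum 3 * 49 * rho k *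
        (\<Sum>\<^sub>\<infinity>m. norm (q t m) * norm (q t (k - m)))) UNIV"
      by (intro has_sum_cmult_right has_sum_infsum q_conv_summable t)
    fix m
    have "norm ((\<i> * cdot (w t m) (wave L k)) *s w t (k - m))
        = norm (cdot (w t m) (wave L k)) * norm (w t (k - m))"
      by (simp add: norm_smult_vec norm_mult)
    also have "\<dots> \<le> (3 * ((7 * norm (q t m)) * rho k)) * (7 * norm (q t (k - m)))"
      using rho_ge1[of k]
      by (intro mult_mono order_trans[OF norm_cdot_le] norm_w_le_q t norm_wave_le_rho mult_nonneg_nonneg) auto
    finally show "norm ((\<i> * cdot (w t m) (wave L k)) *s w t (k - m))
        \<le> 3 * 49 * rho k * (norm (q t m) * norm (q t (k - m)))" by (simp add: mult_ac)
  qed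
  moreover have "norm (N t k) \<le> 7 * (12 * norm (Bw t k))"
    unfolding N_def by (rule order_trans[OF norm_rot_le[OF norm_dir_le]])
        (intro mult_left_mono norm_leray_le norm_dir_le, simp)
  ultimately show ?thesis by (simp add: cN_def)
qed

text \<open>For positive times \<open>Bw_nth\<close> expresses \<open>Bw\<close> by Fourier
  coefficients of jointly continuous fields; continuity is read off from this formula instead of the
  defining series.\<close>

lemma N_continuous:
  assumes t0: "t0 > 0" shows "continuous_on {t0..} (\<lambda>t. N t k)"
proof (cases "k = 0")
  case True
  then show ?thesis by (simp add: N_0)
next
  case False
  have cj: "continuous_on ({0<..} \<times> UNIV) (\<lambda>(t, x). convection (u t) (u t) x)"
    unfolding convection_def case_prod_unfold using joint_cont(1,2)
        by (intro continuous_intros) (simp_all add: case_prod_unfold)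
  have sub: "{t0..} \<subseteq> {0<..}" using t0 by auto
  have c1: "continuous_on {t0..} (\<lambda>t. conv t k $ j)" for j
    unfolding conv_def vec_lambda_beta by (rule continuous_on_subset[OF fc_joint_continuous[OF cj] sub])
  have c2: "continuous_on {t0..} (\<lambda>t. v t k $ j)" for j k
    unfolding v_nth by (rule continuous_on_subset[OF fc_joint_continuous[OF joint_cont(1)] sub])
  have c3: "continuous_on {t0..} (\<lambda>t. cis (\<theta> k t))"
    unfolding \<theta>_def by (intro continuous_on_cis continuous_intros)
  have c4: "continuous_on {t0..} (\<lambda>t. \<chi> j. cis (\<theta> k t) *
      (conv t k $ j - \<i> * cdot (v t 0) (wave L k) * v t k $ j))"
    unfolding cdot_def by (intro continuous_on_vec_lambda continuous_intros c1 c2 c3)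
  have B: "Bw t k = (\<chi> j. cis (\<theta> k t) * (conv t k $ j - \<i> * cdot (v t 0) (wave L k) * v t k $ j))"
      if "t \<in> {t0..}" for t
    using that t0 by (simp add: vec_eq_iff Bw_nth[OF _ False])
  have c5: "continuous_on {t0..} (\<lambda>t. Bw t k)"
    using c4 by (rule continuous_on_eq) (simp add: B)
  have lc: "continuous_on {t0..} (\<lambda>t. f (g t))" if "linear f" "continuous_on {t0..} g"
      for f g :: "_ \<Rightarrow> complex^3"
    using linear_continuous_on_compose[OF that(2,1)] .
  show ?thesis unfolding N_def rot_def
    by (intro continuous_intros lc[OF ccross_linear] lc[OF leray_linear] c5)
qed

text \<open>Both inputs are rotated back from q to w, combined, projected and rotated forward. The
  phases have already cancelled, so time enters only through cos and sin of multiples of t.\<close>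

definition K :: "(int^3) \<times> 3 \<Rightarrow> (int^3) \<times> 3 \<Rightarrow> (int^3) \<times> 3 \<Rightarrow> real \<Rightarrow> complex" where
  "K i a b t = (if fst a + fst b = fst i \<and> fst i \<noteq> 0 then
     \<i> * cdot (rot (dir (fst a)) (- om (fst a) * t) (axis (snd a) 1)) (wave L (fst i)) *
     rot (dir (fst i)) (om (fst i) * t) (leray (dir (fst i))
         (rot (dir (fst b)) (- om (fst b) * t) (axis (snd b) 1))) $ snd i
   else 0)"

lemma K_exp_poly: "K i a b \<in> exp_poly"
proof (cases "fst a + fst b = fst i \<and> fst i \<noteq> 0")
  case True
  then have "K i a b = (\<lambda>t. \<i> * cdot (rot (dir (fst a)) (- om (fst a) * t) (axis (snd a) 1)) (wave L (fst i)) *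
     rot (dir (fst i)) (om (fst i) * t) (leray (dir (fst i))
         (rot (dir (fst b)) (- om (fst b) * t) (axis (snd b) 1))) $ snd i)"
    by (simp add: K_def fun_eq_iff)
  also have "\<dots> \<in> exp_poly"
    by (intro exp_poly_mult exp_poly_const exp_poly_cdot exp_poly_rot exp_poly_leray)
  finally show ?thesis .
next
  case False
  then have "K i a b = (\<lambda>t. 0)" by (simp only: K_def fun_eq_iff if_False) simp
  then show ?thesis by (simp add: exp_poly_const)
qed

lemma norm_axis_complex: "norm (axis a 1 :: complex^3) = 1"
  by (simp add: norm_vec_def L2_set_def axis_def if_distrib[of norm] if_distrib[of "\<lambda>x. x\<^sup>2"] cong: if_cong)

text \<open>21 = 3 * 7 bounds \<open>cdot\<close> of a rotated unit vector; the other factors are 7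
  for the outer rotation, 12 for the projection and 7 for the rotation of the second input.\<close>

lemma K_bound: "norm (K i a b t) \<le> (21 * 7 * 12 * 7) * rho (fst i)"
proof (cases "fst a + fst b = fst i \<and> fst i \<noteq> 0")
  case True
  have 1: "norm (cdot (rot (dir (fst a)) (- om (fst a) * t) (axis (snd a) 1)) (wave L (fst i)))
      \<le> 21 * rho (fst i)"
  proof -
    have "norm (rot (dir (fst a)) (- om (fst a) * t) (axis (snd a) 1)) \<le> 7"
      using norm_rot_le[OF norm_dir_le, of "fst a" "- om (fst a) * t" "axis (snd a) 1"]
          by (simp add: norm_axis_complex)
    then have "norm (cdot (rot (dir (fst a)) (- om (fst a) * t) (axis (snd a) 1)) (wave L (fst i)))
        \<le> 3 * (7 * rho (fst i))"
      by (intro order_trans[OF norm_cdot_le] mult_left_mono mult_mono norm_wave_le_rho) auto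
    then show ?thesis by simp
  qed
  have 2: "norm (rot (dir (fst i)) (om (fst i) * t)
      (leray (dir (fst i)) (rot (dir (fst b)) (- om (fst b) * t) (axis (snd b) 1))) $ snd i) \<le> 7 * (12 * 7)"
  proof -
    have "norm (rot (dir (fst b)) (- om (fst b) * t) (axis (snd b) 1)) \<le> 7"
      using norm_rot_le[OF norm_dir_le, of "fst b" "- om (fst b) * t" "axis (snd b) 1"]
          by (simp add: norm_axis_complex)
    then have "norm (leray (dir (fst i)) (rot (dir (fst b)) (- om (fst b) * t) (axis (snd b) 1))) \<le> 12 * 7"
      by (intro order_trans[OF norm_leray_le[OF norm_dir_le]]) simp
    then show ?thesis
      by (intro order_trans[OF Finite_Cartesian_Product.norm_nth_le]
          order_trans[OF norm_rot_le[OF norm_dir_le]]) simp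
  qed
  have "norm (K i a b t) \<le> (21 * rho (fst i)) * (7 * (12 * 7))"
    unfolding K_def if_P[OF True] norm_mult norm_ii mult_1_left
    by (intro mult_mono 1 2) (use rho_ge1[of "fst i"] in auto)
  then show ?thesis by simp
next
  case False
  then have "K i a b t = 0" by (simp only: K_def if_False)
  then show ?thesis using rho_ge1[of "fst i"] by simp
qed

lemma K_zero:
  assumes "rho (fst i) > rho (fst a) + rho (fst b)" shows "K i a b t = 0"
proof -
  have "fst i - fst a \<noteq> fst b" using rho_add[of "fst i" "fst a"] assms by auto
  then have "fst a + fst b \<noteq> fst i" by (metis add_diff_cancel_left')
  then show ?thesis by (simp add: K_def)
qed

text \<open>Expanding both inputs in components gives a sum over triples (m, a, b). The map \<phi>
  sends these to the pairs of indices whose wave vectors add up to k; outside its range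
  \<open>K\<close> vanishes.\<close>

lemma N_K:
  assumes t: "t > 0"
  shows "N t k $ j = (\<Sum>\<^sub>\<infinity>p. K (k, j) (fst p) (snd p) t * q t (fst (fst p)) $ snd (fst p) * q t
      (fst (snd p)) $ snd (snd p))"
proof (cases "k = 0")
  case True
  then show ?thesis by (simp add: N_0 K_def)
next
  case False
  define h where "h z = rot (dir k) (om k * t) (leray (dir k) z) $ j" for z
  have hl: "linear h"
    unfolding h_def using linear_compose[OF linear_compose[OF leray_linear rot_linear]
        bounded_linear.linear[OF bounded_linear_vec_nth]] by (simp add: o_def)
  have hb: "bounded_linear h" using hl by (simp add: linear_conv_bounded_linear)
  have hs: "h (c *s z) = c * h z" for c z by (simp add: h_def leray_scale rot_scale)
  define T where "T p = K (k, j) (fst p, fst (snd p)) (k - fst p, snd (snd p)) t * q t (fst p) $ fst (snd p) *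
      q t (k - fst p) $ snd (snd p)" for p :: "(int^3) \<times> (3 \<times> 3)"
  have exp_rot: "rot n \<phi> z = (\<Sum>a\<in>UNIV. (z $ a) *s rot n \<phi> (axis a 1))" for n \<phi> z
    by (subst vec_expand_smult[of z]) (simp add: linear_sum[OF rot_linear] rot_scale)
  have 1: "h ((\<i> * cdot (w t m) (wave L k)) *s w t (k - m)) = (\<Sum>ab\<in>UNIV. T (m, ab))" for m
  proof -
    have c: "cdot (w t m) (wave L k) = (\<Sum>a\<in>UNIV. q t m $ a * cdot (rot (dir m) (- om m * t) (axis a 1))
        (wave L k))"
      unfolding w_eq_rot_q[OF t, of m] by (subst exp_rot) (simp add: linear_sum[OF cdot_linear] cdot_scale)
    have hw: "h (w t (k - m)) = (\<Sum>b\<in>UNIV. q t (k - m) $ b * h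
        (rot (dir (k - m)) (- om (k - m) * t) (axis b 1)))"
      unfolding w_eq_rot_q[OF t, of "k - m"] by (subst exp_rot) (simp add: linear_sum[OF hl] hs)
    have "h ((\<i> * cdot (w t m) (wave L k)) *s w t (k - m))
        = \<i> * ((\<Sum>a\<in>UNIV. q t m $ a * cdot (rot (dir m) (- om m * t) (axis a 1)) (wave L k)) *
        (\<Sum>b\<in>UNIV. q t (k - m) $ b * h (rot (dir (k - m)) (- om (k - m) * t) (axis b 1))))"
      unfolding hs c hw by simp
    also have "\<dots> = (\<Sum>a\<in>UNIV. \<Sum>b\<in>UNIV. \<i> * ((q t m $ a * cdot (rot (dir m) (- om m * t) (axis a 1)) (wave L k))
        * (q t (k - m) $ b * h (rot (dir (k - m)) (- om (k - m) * t) (axis b 1)))))"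
      by (subst sum_product) (simp only: sum_distrib_left)
    also have "\<dots> = (\<Sum>a\<in>UNIV. \<Sum>b\<in>UNIV. T (m, (a, b)))"
      using False by (intro sum.cong refl) (simp add: T_def K_def h_def mult_ac)
    also have "\<dots> = (\<Sum>ab\<in>UNIV \<times> UNIV. T (m, ab))" by (simp add: sum.cartesian_product case_prod_unfold)
    finally show ?thesis by simp
  qed
  have s1: "((\<lambda>m. \<Sum>ab\<in>UNIV. T (m, ab)) has_sum N t k $ j) UNIV"
    using has_sum_bounded_linear[OF hb w_has_sum[OF t, of k]] unfolding o_def 1 by (simp add: h_def N_def)
  have Tn: "norm (T p) \<le> ((21 * 7 * 12 * 7) * rho k) * (norm (q t (fst p)) * norm (q t (k - fst p)))" for p
  proof -
    have "norm (T p) \<le> ((21 * 7 * 12 * 7) * rho k) * norm (q t (fst p)) * norm (q t (k - fst p))"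
      unfolding T_def norm_mult using K_bound[of "(k, j)"] rho_ge1[of k]
      by (intro mult_mono Finite_Cartesian_Product.norm_nth_le mult_nonneg_nonneg) auto
    then show ?thesis by (simp add: mult.assoc)
  qed
  have Ts: "T summable_on (UNIV \<times> UNIV)"
  proof (rule abs_summable_summable, rule Infinite_Sum.abs_summable_on_comparison_test'[OF _ Tn])
    show "(\<lambda>p. (21 * 7 * 12 * 7) * rho k * (norm (q t (fst p)) * norm (q t (k - fst p)))) summable_on
        (UNIV \<times> (UNIV :: (3\<times>3) set))"
    \<comment> \<open>9 is the number of pairs of components.\<close>
    proof (rule summable_on_SigmaI[where g = "\<lambda>m. 9 *
        ((21 * 7 * 12 * 7) * rho k * (norm (q t m) * norm (q t (k - m))))"])
      show "((\<lambda>y. 21 * 7 * 12 * 7 * rho k * (norm (q t (fst (x, y))) * norm (q t (k - fst (x, y))))) has_sum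
          9 * (21 * 7 * 12 * 7 * rho k * (norm (q t x) * norm (q t (k - x))))) (UNIV :: (3\<times>3) set)" for x
        by (rule has_sum_finiteI) simp_all
      show "(\<lambda>m. 9 * (21 * 7 * 12 * 7 * rho k * (norm (q t m) * norm (q t (k - m))))) summable_on UNIV"
        by (intro summable_on_cmult_right q_conv_summable t)
    qed (use rho_ge1[of k] in auto)
  qed
  have s2: "(T has_sum N t k $ j) (UNIV \<times> UNIV)"
    by (rule has_sum_SigmaI[OF _ s1 Ts]) simp
  define \<phi> where "\<phi> p = ((fst p, fst (snd p)), (k - fst p, snd (snd p)))" for p :: "(int^3) \<times> (3 \<times> 3)"
  have inj: "inj \<phi>" by (auto simp: inj_def \<phi>_def)
  define F where "F p = K (k, j) (fst p) (snd p) t * q t (fst (fst p)) $ snd (fst p) * q t (fst (snd p)) $ snd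
      (snd p)" for p
  have FT: "F \<circ> \<phi> = T" by (auto simp: F_def \<phi>_def T_def fun_eq_iff)
  have "(F has_sum N t k $ j) (range \<phi>)"
    using s2 unfolding has_sum_reindex[OF inj] FT by simp
  moreover have "F p = 0" if "p \<notin> range \<phi>" for p
  proof -
    have "fst (fst p) + fst (snd p) \<noteq> k"
    proof
      assume "fst (fst p) + fst (snd p) = k"
      then have "p = \<phi> (fst (fst p), (snd (fst p), snd (snd p)))" by (auto simp: \<phi>_def prod_eq_iff)
      then show False using that by blast
    qed
    then show ?thesis by (simp add: F_def K_def)
  qed
  ultimately have "(F has_sum N t k $ j) UNIV"
    by (subst (asm) has_sum_cong_neutral[of UNIV "range \<phi>" F F]) auto
  then show ?thesis using infsumI unfolding F_def by fastforce
qed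

end

section \<open>Membership in Gevrey spaces\<close>

context torus
begin

text \<open>Comparison with \<open>rho_summable\<close> through x^4 / 24 \<le> exp x, a single term
  of the exponential series.\<close>

lemma exp_rho_summable: "(\<lambda>k. exp (- rho k)) summable_on UNIV"
proof (rule summable_on_comparison_test)
  show "(\<lambda>k. 24 * (1 / (rho k) ^ 4)) summable_on UNIV" by (rule summable_on_cmult_right[OF rho_summable])
  fix k
  have r: "rho k > 0" using rho_ge1[of k] by linarith
  obtain C where C: "\<And>t::real. t \<ge> 0 \<Longrightarrow> t ^ 4 \<le> fact 4 / 1 ^ 4 * exp (1 * t)"
  proof -
    have "(\<Sum>i\<in>{4}. inverse (fact i) *\<^sub>R t ^ i) \<le> (\<Sum>i. inverse (fact i) *\<^sub>R t ^ i)" if "t \<ge> 0" for t :: real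
      using that by (intro sum_le_suminf summable_exp_generic) auto
    then have "t ^ 4 \<le> fact 4 / 1 ^ 4 * exp (1 * t)" if "t \<ge> 0" for t :: real
      using that by (simp add: exp_def field_simps)
    then show ?thesis by (rule that)
  qed
  have "(rho k) ^ 4 \<le> 24 * exp (rho k)" using C[of "rho k"] r by (simp add: fact_numeral)
  then show "exp (- rho k) \<le> 24 * (1 / (rho k) ^ 4)"
    using r by (simp add: exp_minus field_simps)
qed auto

lemma cell_integral:
  fixes f :: "real^3 \<Rightarrow> 'b::euclidean_space"
  assumes "continuous_on UNIV f"
  shows "(LINT x|cell L. f x) = vol *\<^sub>R mean f"
proof -
  have "average L f = mean f" by (rule average_eq_mean[OF assms])
  then show ?thesis using vol_pos unfolding average_def vol_def[symmetric]
    by (metis divide_inverse less_irrefl mult_1 right_inverse scaleR_one scaleR_scaleR)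
qed

lemma cell_integrable:
  fixes f :: "real^3 \<Rightarrow> 'b::euclidean_space"
  assumes "continuous_on UNIV f" shows "integrable (cell L) f"
  unfolding cell_def by (rule continuous_imp_integrable, rule continuous_on_subset[OF assms subset_UNIV])

lemma continuous_in_L2:
  assumes "continuous_on UNIV f" "periodic L f" shows "f \<in> L2 L"
  unfolding L2_def
proof (intro CollectI conjI assms)
  show "f \<in> borel_measurable lebesgue"
    by (intro measurable_completion) (simp add: borel_measurable_continuous_onI assms)
  show "integrable (cell L) (\<lambda>x. (norm (f x))\<^sup>2)"
    by (intro cell_integrable continuous_intros assms)
qed

lemma L2norm_le:
  assumes f: "continuous_on UNIV f" and B: "\<And>x. x \<in> cbox 0 L \<Longrightarrow> norm (f x) \<le> B" and "B \<ge> 0"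
  shows "L2norm L f \<le> sqrt vol * B"
proof -
  have "(LINT x|cell L. (norm (f x))\<^sup>2) = vol * mean (\<lambda>x. (norm (f x))\<^sup>2)"
    using cell_integral[of "\<lambda>x. (norm (f x))\<^sup>2"] f by (simp add: continuous_intros)
  also have "\<dots> \<le> vol * mean (\<lambda>x. B\<^sup>2)"
    using vol_pos B by (intro mult_left_mono mean_mono continuous_intros f power_mono) auto
  finally have "(LINT x|cell L. (norm (f x))\<^sup>2) \<le> vol * B\<^sup>2" by (simp add: mean_const)
  then have "L2norm L f \<le> sqrt (vol * B\<^sup>2)" unfolding L2norm_def by (rule real_sqrt_le_mono)
  then show ?thesis using \<open>B \<ge> 0\<close> by (simp add: real_sqrt_mult)
qed

lemma trig_sum_nth: "trig_sum L c F x $ j = (\<Sum>k\<in>F. c k $ j * ee k x)"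
  by (simp add: trig_sum_def ee_def mult.commute)

lemma trig_sum_cont: "continuous_on UNIV (trig_sum L c F)"
proof -
  have "continuous_on UNIV (\<lambda>x. \<chi> j. \<Sum>k\<in>F. c k $ j * ee k x)"
    by (intro continuous_on_vec_lambda continuous_intros ee_cont)
  moreover have "trig_sum L c F = (\<lambda>x. \<chi> j. \<Sum>k\<in>F. c k $ j * ee k x)"
    by (simp add: fun_eq_iff vec_eq_iff trig_sum_nth)
  ultimately show ?thesis by simp
qed

lemma norm_le_three: "(\<And>j. norm (z $ j) \<le> e) \<Longrightarrow> norm z \<le> 3 * e" for z :: "'a::real_normed_vector^3"
proof -
  assume "\<And>j. norm (z $ j) \<le> e"
  then have "(\<Sum>j\<in>UNIV. norm (z $ j)) \<le> (\<Sum>j\<in>(UNIV::3 set). e)" by (intro sum_mono)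
  moreover have "norm z \<le> (\<Sum>j\<in>UNIV. norm (z $ j))" unfolding norm_vec_def by (rule L2_set_le_sum) auto
  ultimately show ?thesis by simp
qed

lemma Xspace_iff: "z \<in> Xspace L k \<longleftrightarrow> cdot z (wave L k) = 0"
  by (simp add: Xspace_def cdot_def)

text \<open>The real part has the coefficients (a k + cnj (a (- k))) / 2 on the symmetric set G.
  They satisfy the reality condition for arbitrary Z, and remain divergence-free because the wave
  vector is odd in k.\<close>

lemma Vspace_real_part:
  assumes F: "finite F" "0 \<notin> F" and Z: "\<And>k. k \<in> F \<Longrightarrow> Z k \<in> Xspace L k"
  shows "(\<lambda>x. \<chi> j. Re (\<Sum>k\<in>F. ee k x * Z k $ j)) \<in> Vspace L"
proof -
  define a where "a k = (if k \<in> F then Z k else 0)" for k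
  define c where "c k = (\<chi> j. (a k $ j + cnj (a (- k) $ j)) / 2)" for k
  define G where "G = F \<union> uminus ` F"
  have G: "finite G" "uminus ` G = G" "0 \<notin> G" using F by (auto simp: G_def image_Un image_image)
  have c0: "c k = 0" if "k \<notin> G" for k
  proof -
    have "k \<notin> F" "- k \<notin> F" using that by (auto simp: G_def image_iff)
    then show ?thesis by (simp add: c_def a_def vec_eq_iff)
  qed
  have sub: "{k. k \<noteq> 0 \<and> c k \<noteq> 0} \<subseteq> G" using c0 by blast
  have aX: "cdot (a k) (wave L k) = 0" for k
    using Z[of k] by (auto simp: a_def Xspace_iff) (simp add: cdot_def)
  have "c k \<in> Xspace L k" for k
  proof -
    have "cdot (c k) (wave L k) = (cdot (a k) (wave L k) - cnj (cdot (a (- k)) (wave L (- k)))) / 2"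
      by (simp add: cdot_def c_def wave_minus sum_3 field_simps)
    then show ?thesis by (simp add: Xspace_iff aX)
  qed
  moreover have "c (- k) = (\<chi> j. cnj (c k $ j))" for k
    by (simp add: c_def vec_eq_iff add.commute)
  moreover have "complexify (\<chi> j. Re (\<Sum>k\<in>F. ee k x * Z k $ j)) = trig_sum L c {k. k \<noteq> 0 \<and> c k \<noteq> 0} x" for x
  proof -
    have "trig_sum L c {k. k \<noteq> 0 \<and> c k \<noteq> 0} x $ j = complexify (\<chi> j. Re (\<Sum>k\<in>F. ee k x * Z k $ j)) $ j" for j
    proof -
      define s where "s = (\<Sum>k\<in>F. ee k x * Z k $ j)"
      have s: "s = (\<Sum>k\<in>G. ee k x * a k $ j)"
        unfolding s_def using G(1) by (intro sum.mono_neutral_cong_left) (auto simp: G_def a_def)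
      have "trig_sum L c {k. k \<noteq> 0 \<and> c k \<noteq> 0} x $ j = (\<Sum>k\<in>G. c k $ j * ee k x)"
        unfolding trig_sum_nth using G sub by (intro sum.mono_neutral_left) auto
      also have "\<dots> = ((\<Sum>k\<in>G. ee k x * a k $ j) + (\<Sum>k\<in>G. cnj (ee (- k) x * a (- k) $ j))) / 2"
        by (simp add: c_def cnj_ee sum_divide_distrib algebra_simps add_divide_distrib flip: sum.distrib)
      also have "(\<Sum>k\<in>G. cnj (ee (- k) x * a (- k) $ j)) = (\<Sum>k\<in>uminus ` G. cnj (ee k x * a k $ j))"
        by (subst sum.reindex) (auto simp: inj_on_def)
      also have "\<dots> = cnj s" unfolding G(2) s by simp
      finally have A: "trig_sum L c {k. k \<noteq> 0 \<and> c k \<noteq> 0} x $ j = (s + cnj s) / 2" by (simp only: s[symmetric])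
      show ?thesis unfolding A complexify_def vec_lambda_beta s_def[symmetric] by (simp add: complex_add_cnj)
    qed
    then show ?thesis by (simp add: vec_eq_iff)
  qed
  ultimately show ?thesis
    unfolding Vspace_def using finite_subset[OF sub G(1)] by (intro CollectI exI[of _ c] conjI allI impI) auto
qed

text \<open>Makes the definite description in \<open>Gnorm\<close> meaningful.\<close>

lemma L2_sum_unique:
  assumes g: "has_L2_sum L c g" and g': "has_L2_sum L c g'"
  shows "L2norm L g = L2norm L g'"
proof -
  have gL: "g \<in> L2 L" "g' \<in> L2 L" using g g' by (auto simp: has_L2_sum_def)
  have meas: "f \<in> borel_measurable (cell L)" if "f \<in> borel_measurable lebesgue" for f :: "real^3 \<Rightarrow> complex^3"
    unfolding cell_def using that by (rule measurable_restrict_space1)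
  have gm: "g \<in> borel_measurable (cell L)" "g' \<in> borel_measurable (cell L)"
    using gL by (auto simp: L2_def intro: meas)
  have Tm: "trig_sum L c F \<in> borel_measurable (cell L)" for F
    by (rule borel_measurable_integrable[OF cell_integrable[OF trig_sum_cont]])
  have Ti: "integrable (cell L) (\<lambda>x. (norm (trig_sum L c F x))\<^sup>2)" for F
    by (intro cell_integrable continuous_intros trig_sum_cont)
  have sq: "(norm (x - y))\<^sup>2 \<le> 2 * (norm x)\<^sup>2 + 2 * (norm y)\<^sup>2" for x y :: "complex^3"
  proof -
    have "(norm (x - y))\<^sup>2 \<le> (norm x + norm y)\<^sup>2" by (intro power_mono norm_triangle_ineq4) auto
    also have "\<dots> \<le> 2 * (norm x)\<^sup>2 + 2 * (norm y)\<^sup>2"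
      using sum_squares_bound[of "norm x" "norm y"] by (simp add: power2_sum)
    finally show ?thesis .
  qed
  have int_diff: "integrable (cell L) (\<lambda>x. (norm (f x - h x))\<^sup>2)"
    if "f \<in> borel_measurable (cell L)" "h \<in> borel_measurable (cell L)"
        "integrable (cell L) (\<lambda>x. (norm (f x))\<^sup>2)" "integrable (cell L) (\<lambda>x. (norm (h x))\<^sup>2)"
    for f h :: "real^3 \<Rightarrow> complex^3"
  proof (rule Bochner_Integration.integrable_bound)
    show "integrable (cell L) (\<lambda>x. 2 * (norm (f x))\<^sup>2 + 2 * (norm (h x))\<^sup>2)"
      using that by (intro Bochner_Integration.integrable_add integrable_mult_right) auto
    show "(\<lambda>x. (norm (f x - h x))\<^sup>2) \<in> borel_measurable (cell L)"
      using that(1,2) by measurable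
    show "AE x in cell L. norm ((norm (f x - h x))\<^sup>2) \<le> norm (2 * (norm (f x))\<^sup>2 + 2 * (norm (h x))\<^sup>2)"
      using sq by (intro AE_I2) simp
  qed
  have gi: "integrable (cell L) (\<lambda>x. (norm (g x))\<^sup>2)" "integrable (cell L) (\<lambda>x. (norm (g' x))\<^sup>2)"
    using gL by (auto simp: L2_def)
  define A where "A = (LINT x|cell L. (norm (g x - g' x))\<^sup>2)"
  have ii: "integrable (cell L) (\<lambda>x. (norm (g x - g' x))\<^sup>2)" by (rule int_diff[OF gm gi])
  have L2sq: "(L2norm L f)\<^sup>2 = (LINT x|cell L. (norm (f x))\<^sup>2)" for f :: "real^3 \<Rightarrow> complex^3"
    unfolding L2norm_def by simp
  have "A \<le> 2 * (L2norm L (\<lambda>x. g x - trig_sum L c F x))\<^sup>2 + 2 * (L2norm L (\<lambda>x. g' x - trig_sum L c F x))\<^sup>2"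
      for F
  proof -
    note i1 = int_diff[OF gm(1) Tm gi(1) Ti, of F] and i2 = int_diff[OF gm(2) Tm gi(2) Ti, of F]
    have "A \<le> (LINT x|cell L. 2 * (norm (g x - trig_sum L c F x))\<^sup>2 + 2 * (norm (g' x - trig_sum L c F x))\<^sup>2)"
      unfolding A_def
    proof (rule integral_mono[OF ii])
      show "integrable (cell L) (\<lambda>x. 2 * (norm (g x - trig_sum L c F x))\<^sup>2
          + 2 * (norm (g' x - trig_sum L c F x))\<^sup>2)"
        using i1 i2 by (intro Bochner_Integration.integrable_add integrable_mult_right) auto
      show "(norm (g x - g' x))\<^sup>2 \<le> 2 * (norm (g x - trig_sum L c F x))\<^sup>2
          + 2 * (norm (g' x - trig_sum L c F x))\<^sup>2" for x
        using sq[of "g x - trig_sum L c F x" "g' x - trig_sum L c F x"] by simp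
    qed
    also have "\<dots> = 2 * (LINT x|cell L. (norm (g x - trig_sum L c F x))\<^sup>2)
        + 2 * (LINT x|cell L. (norm (g' x - trig_sum L c F x))\<^sup>2)"
      using i1 i2 by simp
    finally show ?thesis unfolding L2sq .
  qed
  moreover have "((\<lambda>F. 2 * (L2norm L (\<lambda>x. g x - trig_sum L c F x))\<^sup>2
      + 2 * (L2norm L (\<lambda>x. g' x - trig_sum L c F x))\<^sup>2) \<longlongrightarrow> 2 * 0\<^sup>2 + 2 * 0\<^sup>2) (finite_subsets_at_top (- {0}))"
    using g g' unfolding has_L2_sum_def by (intro tendsto_intros) auto
  ultimately have "A \<le> 0"
    by (intro tendsto_lowerbound[where f = "\<lambda>F. 2 * (L2norm L (\<lambda>x. g x - trig_sum L c F x))\<^sup>2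
        + 2 * (L2norm L (\<lambda>x. g' x - trig_sum L c F x))\<^sup>2"]) (auto intro: always_eventually)
  moreover have "A \<ge> 0" unfolding A_def by simp
  ultimately have "A = 0" by simp
  then have "AE x in cell L. (norm (g x - g' x))\<^sup>2 = 0"
    using integral_nonneg_eq_0_iff_AE[OF ii] by (simp add: A_def)
  then have "AE x in cell L. (norm (g x))\<^sup>2 = (norm (g' x))\<^sup>2" by (rule AE_mp) (intro AE_I2, simp)
  then have "(LINT x|cell L. (norm (g x))\<^sup>2) = (LINT x|cell L. (norm (g' x))\<^sup>2)"
    using gi by (intro integral_cong_AE) auto
  then show ?thesis by (simp add: L2norm_def)
qed

lemma series_partial_sum_close:
  assumes a: "\<And>j. (\<lambda>k. norm (a k $ j)) summable_on UNIV" and a0: "a 0 = (0::complex^3)" and e: "e > 0"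
  shows "\<forall>\<^sub>F F in finite_subsets_at_top (- {0}). \<forall>x. norm ((\<chi> j. \<Sum>\<^sub>\<infinity>k. a k $ j * ee k x) - trig_sum L a F x)
      \<le> 3 * e"
proof -
  have "\<forall>\<^sub>F F in finite_subsets_at_top (- {0}). \<forall>x\<in>UNIV. dist (\<Sum>k\<in>F. a k $ j * ee k x)
      (\<Sum>\<^sub>\<infinity>k\<in>-{0}. a k $ j * ee k x) < e" for j
  proof (rule uniform_limitD[OF Weierstrass_m_test_general e])
    show "(\<lambda>k. norm (a k $ j)) summable_on - {0}" by (rule summable_on_subset_banach[OF a]) simp
  qed (simp add: norm_mult)
  then have "\<forall>\<^sub>F F in finite_subsets_at_top (- {0}). \<forall>j\<in>(UNIV::3 set). \<forall>x\<in>UNIV. dist (\<Sum>k\<in>F. a k $ j * ee k x)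
      (\<Sum>\<^sub>\<infinity>k\<in>-{0}. a k $ j * ee k x) < e"
    by (intro eventually_ball_finite) auto
  then show ?thesis
  proof eventually_elim
    case (elim F)
    have "(\<Sum>\<^sub>\<infinity>k. a k $ j * ee k x) = (\<Sum>\<^sub>\<infinity>k\<in>-{0}. a k $ j * ee k x)" for j x
      by (rule infsum_cong_neutral) (auto simp: a0)
    then show ?case using elim
      by (intro allI norm_le_three) (auto simp: trig_sum_nth dist_norm norm_minus_commute less_imp_le)
  qed
qed

lemma fourier_series_cell:
  assumes h: "continuous_on UNIV h" "periodic L h"
      and s: "\<And>j. (\<lambda>k. norm (fourier_coeff L h k $ j)) summable_on UNIV"
    and x: "x \<in> cbox 0 L"
  shows "complexify (h x) = (\<chi> j. \<Sum>\<^sub>\<infinity>k. fourier_coeff L h k $ j * ee k x)"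
proof -
  have "complex_of_real (h x $ j) = (\<Sum>\<^sub>\<infinity>k. fourier_coeff L h k $ j * ee k x)" for j
    unfolding fourier_coeff_nth[OF h(1)]
  proof (rule fourier_series[OF _ _ _ x])
    show "continuous_on UNIV (\<lambda>x. complex_of_real (h x $ j))" using h(1) by (intro continuous_intros)
    show "periodic L (\<lambda>x. complex_of_real (h x $ j))" using h(2) by (simp add: periodic_def)
    show "(\<lambda>k. norm (fc (\<lambda>x. complex_of_real (h x $ j)) k)) summable_on UNIV"
      using s[of j] unfolding fourier_coeff_nth[OF h(1)] .
  qed
  then show ?thesis by (simp add: complexify_def vec_eq_iff)
qed

lemma Hspace_intro:
  assumes h: "continuous_on UNIV h" "periodic L h"
      and s: "\<And>j. (\<lambda>k. norm (fourier_coeff L h k $ j)) summable_on UNIV"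
    and h0: "fourier_coeff L h 0 = 0" and hX: "\<And>k. k \<noteq> 0 \<Longrightarrow> fourier_coeff L h k \<in> Xspace L k"
  shows "h \<in> Hspace L"
  unfolding Hspace_def
proof (intro CollectI conjI allI impI)
  show "h \<in> L2 L" by (rule continuous_in_L2[OF h])
  fix e :: real assume e: "e > 0"
  \<comment> \<open>The 9 stems from two passages from components to vectors, each costing a factor
    3.\<close>
  define d where "d = e / (2 * (sqrt vol * 9))"
  have d: "d > 0" using e vol_pos by (simp add: d_def)
  have "\<forall>\<^sub>F F in finite_subsets_at_top (- {0}). finite F \<and> F \<subseteq> - {0}
      \<and> (\<forall>x. norm ((\<chi> j. \<Sum>\<^sub>\<infinity>k. fourier_coeff L h k $ j * ee k x) - trig_sum L (fourier_coeff L h) F x) \<le> 3 * d)"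
    by (intro eventually_conj series_partial_sum_close s h0 d eventually_finite_subsets_at_top_weakI) auto
  note ev = eventually_happens'[OF finite_subsets_at_top_neq_bot this]
  obtain F where F': "finite F \<and> F \<subseteq> - {0} \<and>
      (\<forall>x. norm ((\<chi> j. \<Sum>\<^sub>\<infinity>k. fourier_coeff L h k $ j * ee k x) - trig_sum L (fourier_coeff L h) F x) \<le> 3 * d)"
    using ev by (rule exE)
  then have F: "finite F" "F \<subseteq> - {0}" by simp_all
  have le: "norm ((\<chi> j. \<Sum>\<^sub>\<infinity>k. fourier_coeff L h k $ j * ee k x) - trig_sum L (fourier_coeff L h) F x) \<le> 3 * d"
      for x
    by (rule F'[THEN conjunct2, THEN conjunct2, rule_format])
  \<comment> \<open>F need not be symmetric, so the partial sum may fail to be real. Its real part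
    lies in \<open>Vspace L\<close> and, as h is real, approximates h at least as well in each
    component.\<close>
  define v where "v = (\<lambda>x. \<chi> j. Re (\<Sum>k\<in>F. ee k x * fourier_coeff L h k $ j))"
  have vV: "v \<in> Vspace L" unfolding v_def by (intro Vspace_real_part F hX) (use F in auto)
  have vc: "continuous_on UNIV v" unfolding v_def by (intro continuous_on_vec_lambda continuous_intros ee_cont)
  have "norm (h x - v x) \<le> 3 * (3 * d)" if x: "x \<in> cbox 0 L" for x
  proof (rule norm_le_three)
    fix j
    have "norm ((complexify (h x) - trig_sum L (fourier_coeff L h) F x) $ j) \<le> 3 * d"
      using le[of x] unfolding fourier_series_cell[OF h s x, symmetric]
          by (rule order_trans[OF Finite_Cartesian_Product.norm_nth_le])
    moreover have "(h x - v x) $ j = Re ((complexify (h x) - trig_sum L (fourier_coeff L h) F x) $ j)"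
      by (simp add: v_def complexify_def trig_sum_nth mult.commute)
    ultimately show "norm ((h x - v x) $ j) \<le> 3 * d"
      using abs_Re_le_cmod[of "(complexify (h x) - trig_sum L (fourier_coeff L h) F x) $ j"]
          by (simp only: real_norm_def)
  qed
  then have "L2norm L (\<lambda>x. h x - v x) \<le> sqrt vol * (3 * (3 * d))"
    using d by (intro L2norm_le continuous_intros h vc) auto
  also have "\<dots> = e / 2" using vol_pos by (simp add: d_def)
  also have "\<dots> < e" using e by simp
  finally show "\<exists>v\<in>Vspace L. L2norm L (\<lambda>x. h x - v x) < e" using vV by blast
qed

text \<open>The logarithm of the length is at most rho, which turns the power into an exponential;
  thus one exponential weight dominates both factors.\<close>

lemma gevrey_weight_le:
  assumes "\<alpha> \<ge> 0" "\<sigma> \<ge> 0"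
  shows "norm (wave L k) powr (2 * \<alpha>) * exp (\<sigma> * norm (wave L k)) \<le> exp ((2 * \<alpha> + \<sigma>) * rho k)"
proof (cases "wave L k = 0")
  case False
  then have w: "norm (wave L k) > 0" by simp
  have wr: "norm (wave L k) \<le> rho k" by (simp add: rho_def)
  have "ln (norm (wave L k)) \<le> rho k" using ln_le_minus_one[OF w] wr by linarith
  then have "norm (wave L k) powr (2 * \<alpha>) \<le> exp (2 * \<alpha> * rho k)"
    using False assms by (simp add: powr_def mult_left_mono)
  moreover have "exp (\<sigma> * norm (wave L k)) \<le> exp (\<sigma> * rho k)" using wr assms by (simp add: mult_left_mono)
  ultimately have "norm (wave L k) powr (2 * \<alpha>) * exp (\<sigma> * norm (wave L k))
      \<le> exp (2 * \<alpha> * rho k) * exp (\<sigma> * rho k)"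
    by (intro mult_mono) auto
  then show ?thesis by (simp add: distrib_right exp_add)
qed simp

text \<open>The unit of decay beyond the Gevrey weight makes the weighted series converge absolutely
  and uniformly. Its supremum then bounds its L2 norm, which is \<open>Gnorm\<close>.\<close>

lemma Gspace_bound:
  assumes al: "\<alpha> > 0" "\<sigma> > 0"
    and h: "continuous_on UNIV h" "periodic L h" and h0: "fourier_coeff L h 0 = 0"
    and hX: "\<And>k. k \<noteq> 0 \<Longrightarrow> fourier_coeff L h k \<in> Xspace L k"
    and A: "\<And>k. norm (fourier_coeff L h k) \<le> A * exp (- (2 * \<alpha> + \<sigma> + 1) * rho k)"
  shows "h \<in> Gspace L \<alpha> \<sigma>" and "Gnorm L \<alpha> \<sigma> h \<le> sqrt vol * (3 * infsum (\<lambda>k. exp (- rho k)) UNIV) * A"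
    and "Gnorm L \<alpha> \<sigma> h \<ge> 0"
proof -
  have A0: "A \<ge> 0" by (rule norm_le_mult_exp_nonneg[OF A[of 0]])
  define E where "E = infsum (\<lambda>k. exp (- rho k)) UNIV"
  define a where "a = gevrey_coeff L \<alpha> \<sigma> h"
  have an: "norm (a k) \<le> A * exp (- rho k)" for k
  proof -
    have "norm (a k) = (norm (wave L k) powr (2 * \<alpha>) * exp (\<sigma> * norm (wave L k))) * norm (fourier_coeff L h k)"
      by (simp add: a_def gevrey_coeff_def)
    also have "\<dots> \<le> exp ((2 * \<alpha> + \<sigma>) * rho k) * (A * exp (- (2 * \<alpha> + \<sigma> + 1) * rho k))"
      by (intro mult_mono gevrey_weight_le A) (use al in auto)
    also have "\<dots> = A * exp (- rho k)" by (simp add: algebra_simps flip: exp_add)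
    finally show ?thesis .
  qed
  have anj: "norm (a k $ j) \<le> A * exp (- rho k)" for k j
    by (rule order_trans[OF Finite_Cartesian_Product.norm_nth_le an])
  have Es: "(\<lambda>k. A * exp (- rho k)) summable_on UNIV" by (rule summable_on_cmult_right[OF exp_rho_summable])
  have as: "(\<lambda>k. norm (a k $ j)) summable_on UNIV" for j
    by (rule Infinite_Sum.abs_summable_on_comparison_test'[OF Es anj])
  have hs: "(\<lambda>k. norm (fourier_coeff L h k $ j)) summable_on UNIV" for j
  proof (rule Infinite_Sum.abs_summable_on_comparison_test'[OF Es])
    fix k
    have "norm (fourier_coeff L h k $ j) \<le> A * exp (- (2 * \<alpha> + \<sigma> + 1) * rho k)"
      by (rule order_trans[OF Finite_Cartesian_Product.norm_nth_le A])
    also have "\<dots> \<le> A * exp (- rho k)"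
    proof (intro mult_left_mono A0)
      have "1 * rho k \<le> (2 * \<alpha> + \<sigma> + 1) * rho k" using al rho_ge1[of k] by (intro mult_right_mono) auto
      then show "exp (- (2 * \<alpha> + \<sigma> + 1) * rho k) \<le> exp (- rho k)"
          by (simp only: exp_le_cancel_iff mult_minus_left neg_le_iff_le mult_1_left)
    qed
    finally show "norm (fourier_coeff L h k $ j) \<le> A * exp (- rho k)" .
  qed
  have a0: "a 0 = 0" by (simp add: a_def gevrey_coeff_def h0)
  define g where "g x = (\<chi> j. \<Sum>\<^sub>\<infinity>k. a k $ j * ee k x)" for x
  have gc: "continuous_on UNIV g" unfolding g_def by (intro continuous_on_vec_lambda ee_series_cont as)
  have gp: "periodic L g" unfolding g_def using ee_series_periodic by (simp add: periodic_def)
  have gsum: "has_L2_sum L a g"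
    unfolding has_L2_sum_def
  proof (intro conjI continuous_in_L2[OF gc gp] tendstoI)
    fix e :: real assume e: "e > 0"
    define d where "d = e / (2 * (sqrt vol * 3))"
    have d: "d > 0" using e vol_pos by (simp add: d_def)
    show "\<forall>\<^sub>F F in finite_subsets_at_top (- {0}). dist (L2norm L (\<lambda>x. g x - trig_sum L a F x)) 0 < e"
      using series_partial_sum_close[OF as a0 d]
    proof eventually_elim
      case (elim F)
      have "L2norm L (\<lambda>x. g x - trig_sum L a F x) \<le> sqrt vol * (3 * d)"
        using elim d by (intro L2norm_le continuous_on_diff gc trig_sum_cont) (auto simp: g_def)
      also have "\<dots> = e / 2" using vol_pos by (simp add: d_def)
      also have "\<dots> < e" using e by simp
      moreover have "L2norm L (\<lambda>x. g x - trig_sum L a F x) \<ge> 0" by (simp add: L2norm_def)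
      ultimately show ?case by simp
    qed
  qed
  have "h \<in> Hspace L" by (rule Hspace_intro[OF h hs h0 hX])
  then show "h \<in> Gspace L \<alpha> \<sigma>" unfolding Gspace_def using gsum a_def by blast
  have G: "Gnorm L \<alpha> \<sigma> h = L2norm L g"
    unfolding Gnorm_def a_def[symmetric]
  proof (rule the_equality)
    show "\<exists>g'. has_L2_sum L a g' \<and> L2norm L g = L2norm L g'" using gsum by blast
    show "r = L2norm L g" if ex: "\<exists>g'. has_L2_sum L a g' \<and> r = L2norm L g'" for r
    proof -
      obtain g' where "has_L2_sum L a g'" "r = L2norm L g'" using ex by blast
      then show ?thesis using L2_sum_unique[OF _ gsum, of g'] by simp
    qed
  qed
  have "L2norm L g \<le> sqrt vol * (3 * (A * E))"
  proof (rule L2norm_le[OF gc])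
    fix x
    show "norm (g x) \<le> 3 * (A * E)"
    proof (rule norm_le_three)
      fix j
      have "norm (\<Sum>\<^sub>\<infinity>k. a k $ j * ee k x) \<le> A * E"
      proof (rule norm_infsum_le[OF has_sum_infsum])
        show "(\<lambda>k. a k $ j * ee k x) summable_on UNIV"
          by (rule abs_summable_summable) (use as[of j] in \<open>simp add: norm_mult\<close>)
        show "((\<lambda>k. A * exp (- rho k)) has_sum A * E) UNIV"
          unfolding E_def by (intro has_sum_cmult_right has_sum_infsum exp_rho_summable)
        show "norm (a k $ j * ee k x) \<le> A * exp (- rho k)" for k using anj by (simp add: norm_mult)
      qed
      then show "norm (g x $ j) \<le> A * E" by (simp add: g_def)
    qed
    show "0 \<le> 3 * (A * E)" using A0 unfolding E_def by (intro mult_nonneg_nonneg infsum_nonneg) auto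
  qed
  then show "Gnorm L \<alpha> \<sigma> h \<le> sqrt vol * (3 * infsum (\<lambda>k. exp (- rho k)) UNIV) * A"
    unfolding G E_def by (simp add: mult_ac)
  show "Gnorm L \<alpha> \<sigma> h \<ge> 0" unfolding G by (simp add: L2norm_def)
qed

end

section \<open>Expansion of the flow\<close>

lemma SS_zero: "SS_polynomial X (\<lambda>t x. 0)"
  unfolding SS_polynomial_def by (intro exI[of _ "0::nat"]) simp

lemma SS_single:
  assumes "Z \<in> X" "trig \<in> {cos, sin}"
  shows "SS_polynomial X (\<lambda>t x. (t ^ m * trig (a * cos (\<omega> * t) + b * sin (\<omega> * t) + c * t + d)) *\<^sub>R Z x)"
  unfolding SS_polynomial_def
  by (rule exI[of _ 1], rule exI[of _ "\<lambda>_. m"], rule exI[of _ "\<lambda>_. a"], rule exI[of _ "\<lambda>_. b"], rule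
      exI[of _ "\<lambda>_. c"],
      rule exI[of _ "\<lambda>_. d"], rule exI[of _ "\<lambda>_. \<omega>"], rule exI[of _ "\<lambda>_. trig"], rule exI[of _ "\<lambda>_. Z"])
     (use assms in simp)

lemma sum_lessThan_add: "(\<Sum>i<M + M'. g i) = (\<Sum>i<M. g i) + (\<Sum>i<M'. g (M + i))"
    for g :: "nat \<Rightarrow> 'a::comm_monoid_add"
  by (induction M') (simp_all add: add.assoc)

text \<open>Concatenation of the two lists of parameters.\<close>

lemma SS_add:
  assumes "SS_polynomial X P" "SS_polynomial X Q"
  shows "SS_polynomial X (\<lambda>t x. P t x + Q t x)"
proof -
  define R where "R P M m a b c d \<omega> trig Z \<longleftrightarrow> (\<forall>i<M. trig i \<in> {cos, sin} \<and> Z i \<in> X) \<and>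
    (\<forall>t x. P t x = (\<Sum>i<M. (t ^ m i * trig i (a i * cos (\<omega> i * t) + b i * sin (\<omega> i * t) + c i * t + d i)) *\<^sub>R Z
        i x))"
    for P and M :: nat and m :: "nat \<Rightarrow> nat" and a b c d \<omega> trig Z
  have "\<exists>M m a b c d \<omega> trig Z. R P M m a b c d \<omega> trig Z" "\<exists>M m a b c d \<omega> trig Z. R Q M m a b c d \<omega> trig Z"
    using assms unfolding SS_polynomial_def R_def .
  then obtain M m a b c d \<omega> trig Z M' m' a' b' c' d' \<omega>' trig' Z'
    where P': "R P M m a b c d \<omega> trig Z" and Q': "R Q M' m' a' b' c' d' \<omega>' trig' Z'"
    by (elim exE) (rule that)
  note P = P'[unfolded R_def, THEN conjunct1, rule_format] P'[unfolded R_def, THEN conjunct2, rule_format]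
    and Q = Q'[unfolded R_def, THEN conjunct1, rule_format] Q'[unfolded R_def, THEN conjunct2, rule_format]
  show ?thesis
    unfolding SS_polynomial_def
  proof (rule exI[of _ "M + M'"], rule exI[of _ "\<lambda>i. if i < M then m i else m' (i - M)"], rule
      exI[of _ "\<lambda>i. if i < M then a i else a' (i - M)"],
      rule exI[of _ "\<lambda>i. if i < M then b i else b' (i - M)"], rule
          exI[of _ "\<lambda>i. if i < M then c i else c' (i - M)"],
      rule exI[of _ "\<lambda>i. if i < M then d i else d' (i - M)"], rule
          exI[of _ "\<lambda>i. if i < M then \<omega> i else \<omega>' (i - M)"],
      rule exI[of _ "\<lambda>i. if i < M then trig i else trig' (i - M)"], rule
          exI[of _ "\<lambda>i. if i < M then Z i else Z' (i - M)"], intro conjI allI impI)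
    fix i assume i: "i < M + M'"
    have i': "i - M < M'" if "\<not> i < M" using i that by linarith
    show "(if i < M then trig i else trig' (i - M)) \<in> {cos, sin}"
      using P(1)[of i] Q(1)[of "i - M"] i' by (cases "i < M") simp_all
    show "(if i < M then Z i else Z' (i - M)) \<in> X"
      using P(1)[of i] Q(1)[of "i - M"] i' by (cases "i < M") simp_all
  next
    fix t x
    show "P t x + Q t x = (\<Sum>i<M + M'. (t ^ (if i < M then m i else m' (i - M)) *
        (if i < M then trig i else trig' (i - M))
       ((if i < M then a i else a' (i - M)) * cos ((if i < M then \<omega> i else \<omega>' (i - M)) * t)
           + (if i < M then b i else b' (i - M)) * sin ((if i < M then \<omega> i else \<omega>' (i - M)) * t)
        + (if i < M then c i else c' (i - M)) * t + (if i < M then d i else d' (i - M)))) *\<^sub>R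
            (if i < M then Z i else Z' (i - M)) x)"
      unfolding sum_lessThan_add P(2) Q(2) by (intro arg_cong2[where f = "(+)"] sum.cong refl) simp_all
  qed
qed

lemma SS_sum: "(\<And>k. k \<in> F \<Longrightarrow> SS_polynomial X (P k)) \<Longrightarrow> SS_polynomial X (\<lambda>t x. \<Sum>k\<in>F. P k t x)"
proof (induction F rule: infinite_finite_induct)
  case (insert k F)
  have "SS_polynomial X (\<lambda>t x. P k t x + (\<Sum>k\<in>F. P k t x))" by (rule SS_add) (use insert in auto)
  then show ?case using insert by simp
qed (simp_all add: SS_zero)

section \<open>Undoing the phase and the rotation\<close>

context rotating_expansion
begin

text \<open>The phase and the factor cis (\<eta> t) merge into cis (\<psi> t), where \<eta> t joins
  the linear term, so \<psi> has the admissible form. The real part of cis \<psi> times a mode is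
  cos \<psi> times the real part of the mode plus sin \<psi> times the real part of i times the
  mode, and both real parts lie in \<open>Vspace L\<close>.\<close>

lemma SS_exp_poly:
  assumes f: "f \<in> exp_poly" and k: "k \<noteq> 0" and Z: "Z \<in> Xspace L k"
  shows "SS_polynomial (Vspace L) (\<lambda>t x. \<chi> j. Re (ee k x * (cis (- \<theta> k t) * f t * Z $ j)))"
  using f
proof (induction rule: exp_poly.induct)
  case (exp_poly_base c m \<eta>)
  define a where "a = - ((wave L k $ 2 * mA - wave L k $ 1 * mB) / \<Omega>)"
  define b where "b = - ((wave L k $ 1 * mA + wave L k $ 2 * mB) / \<Omega>)"
  define c' where "c' = \<eta> - wave L k $ 3 * mC"
  define \<psi> where "\<psi> t = a * cos (\<Omega> * t) + b * sin (\<Omega> * t) + c' * t + 0" for t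
  have psi: "cis (- \<theta> k t) * cis (\<eta> * t) = cis (\<psi> t)" for t
    by (simp add: cis_mult \<psi>_def \<theta>_def a_def b_def c'_def algebra_simps)
  define V where "V z = (\<lambda>x. \<chi> j. Re (\<Sum>k\<in>{k}. ee k x * (z *s Z) $ j))" for z :: complex
  have V: "V z \<in> Vspace L" for z
    unfolding V_def
  proof (rule Vspace_real_part)
    fix k' assume "k' \<in> {k}"
    then show "z *s Z \<in> Xspace L k'" using Z by (simp add: Xspace_iff cdot_scale)
  qed (use k in auto)
  have "SS_polynomial (Vspace L) (\<lambda>t x. (t ^ m * cos (a * cos (\<Omega> * t) + b * sin (\<Omega> * t) + c' * t + 0)) *\<^sub>R V c x
      + (t ^ m * sin (a * cos (\<Omega> * t) + b * sin (\<Omega> * t) + c' * t + 0)) *\<^sub>R V (\<i> * c) x)"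
    by (intro SS_add SS_single V) auto
  moreover have "(\<chi> j. Re (ee k x * (cis (- \<theta> k t) * (c * of_real t ^ m * cis (\<eta> * t)) * Z $ j)))
    = (t ^ m * cos (\<psi> t)) *\<^sub>R V c x + (t ^ m * sin (\<psi> t)) *\<^sub>R V (\<i> * c) x" for t x
  proof -
    have "Re (ee k x * (cis (- \<theta> k t) * (c * of_real t ^ m * cis (\<eta> * t)) * Z $ j))
      = t ^ m * cos (\<psi> t) * Re (ee k x * (c * Z $ j)) + t ^ m * sin (\<psi> t) * Re (ee k x * (\<i> * c * Z $ j))" for j
    proof -
      have "ee k x * (cis (- \<theta> k t) * (c * of_real t ^ m * cis (\<eta> * t)) * Z $ j)
          = of_real (t ^ m) * (cis (\<psi> t) * (ee k x * (c * Z $ j)))"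
        unfolding psi[symmetric] by (simp add: mult_ac)
      also have "Re \<dots> = t ^ m * (cos (\<psi> t) * Re (ee k x * (c * Z $ j)) - sin (\<psi> t) * Im (ee k x * (c * Z $ j)))"
        by (simp only: Re_complex_of_real Im_complex_of_real times_complex.sel(1) cis.sel mult_zero_left
            diff_zero)
      also have "Im (ee k x * (c * Z $ j)) = - Re (ee k x * (\<i> * c * Z $ j))" by (simp add: algebra_simps)
      finally show ?thesis by (simp only:) (simp only: right_diff_distrib mult_minus_right diff_minus_eq_add
          mult.assoc distrib_left)
    qed
    then show ?thesis by (simp add: vec_eq_iff V_def distrib_left)
  qed
  ultimately show ?case by (simp only: \<psi>_def[symmetric])
next
  case (exp_poly_add f g)
  have "(\<chi> j. Re (ee k x * (cis (- \<theta> k t) * (f t + g t) * Z $ j))) =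
      (\<chi> j. Re (ee k x * (cis (- \<theta> k t) * f t * Z $ j)))
          + (\<chi> j. Re (ee k x * (cis (- \<theta> k t) * g t * Z $ j)))" for t x
    by (simp add: vec_eq_iff distrib_left distrib_right del: times_complex.sel)
  then show ?case using SS_add[OF exp_poly_add.IH] by simp
qed

text \<open>The Leray projection acts trivially on the coefficients of the flow; it forces the result into
  \<open>Xspace\<close> for every argument.\<close>

definition unrot :: "int^3 \<Rightarrow> real \<Rightarrow> complex^3 \<Rightarrow> complex^3" where
  "unrot k t z = (if k = 0 then 0 else cis (- \<theta> k t) *s leray (dir k) (rot (dir k) (- om k * t) z))"

lemma unrot_q: assumes t: "t > 0" and k: "k \<noteq> 0" shows "unrot k t (q t k) = v t k"
proof -
  have "leray (dir k) (rot (dir k) (- om k * t) (q t k)) = w t k"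
    unfolding w_eq_rot_q[OF t, symmetric] by (rule leray_id[OF w_cdot[OF t]])
  then have "unrot k t (q t k) = (cis (- \<theta> k t) * cis (\<theta> k t)) *s v t k"
    using k by (simp add: unrot_def w_def)
  then show ?thesis by (simp add: cis_mult)
qed

lemma unrot_linear: "linear (unrot k t)"
  unfolding unrot_def
  by (rule linearI) (simp_all add: linear_add[OF rot_linear] linear_add[OF leray_linear]
      linear_scale[OF rot_linear] linear_scale[OF leray_linear]
      vec_eq_iff scaleR_complex algebra_simps)

lemma unrot_smult: "unrot k t (c *s z) = c *s unrot k t z"
  by (simp add: unrot_def rot_scale leray_scale vec_eq_iff)

lemma norm_unrot_le: "norm (unrot k t z) \<le> 84 * norm z"
proof (cases "k = 0")
  case False
  have "norm (leray (dir k) (rot (dir k) (- om k * t) z)) \<le> 12 * (7 * norm z)"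
    by (rule order_trans[OF norm_leray_le[OF norm_dir_le]]) (intro mult_left_mono norm_rot_le norm_dir_le, simp)
  then show ?thesis using False by (simp add: unrot_def norm_smult_vec)
qed (simp add: unrot_def)

lemma unrot_Xspace: "unrot k t z \<in> Xspace L k"
proof (cases "k = 0")
  case True
  then show ?thesis by (simp add: Xspace_iff wave_0 cdot_def)
next
  case False
  have "cdot (leray (dir k) z') (wave L k) = of_real (norm (wave L k)) * cdot (leray (dir k) z') (dir k)" for z'
    using wave_eq_0_iff[of k] False by (simp add: cdot_dir)
  then show ?thesis using False by (simp add: unrot_def Xspace_iff cdot_scale cdot_leray norm_dir)
qed

text \<open>Writing the rotation with cos and sin separates fixed divergence-free vectors
  \<open>Z1\<close>, \<open>Z2\<close> from scalar exponential polynomials, and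
  \<open>SS_exp_poly\<close> applies to each product.\<close>

lemma SS_unrot:
  assumes z: "\<And>j. (\<lambda>t. z t $ j) \<in> exp_poly" and k: "k \<noteq> 0"
  shows "SS_polynomial (Vspace L) (\<lambda>t x. \<chi> j. Re (ee k x * unrot k t (z t) $ j))"
proof -
  define Z1 where "Z1 a = leray (dir k) (axis a 1)" for a
  define Z2 where "Z2 a = leray (dir k) (ccross (dir k) (axis a 1))" for a
  have ZX: "leray (dir k) y \<in> Xspace L k" for y
    using wave_eq_0_iff[of k] k cdot_leray[OF norm_dir[OF k], of y] by (simp add: Xspace_iff cdot_dir)
  have eq: "(\<chi> j. Re (ee k x * unrot k t (z t) $ j)) = (\<Sum>a\<in>UNIV.
      (\<chi> j. Re (ee k x * (cis (- \<theta> k t) * (of_real (cos (- om k * t)) * z t $ a) * Z1 a $ j)))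
    + (\<chi> j. Re (ee k x * (cis (- \<theta> k t) * (of_real (sin (- om k * t)) * z t $ a) * Z2 a $ j))))" for t x
  proof -
    have r: "rot (dir k) (- om k * t) (axis a 1) = of_real (cos (- om k * t)) *s axis a 1
        + of_real (sin (- om k * t)) *s ccross (dir k) (axis a 1)" for a
      by (simp add: rot_def vec_eq_iff scaleR_complex)
    have "unrot k t (z t) = (\<Sum>a\<in>UNIV. z t $ a *s unrot k t (axis a 1))"
      by (subst vec_expand_smult[of "z t"]) (simp add: linear_sum[OF unrot_linear] unrot_smult)
    also have "\<dots> = (\<Sum>a\<in>UNIV. z t $ a *s (cis (- \<theta> k t) *s
        (of_real (cos (- om k * t)) *s Z1 a + of_real (sin (- om k * t)) *s Z2 a)))"
      using k by (simp only: unrot_def if_False r linear_add[OF leray_linear] leray_scale Z1_def Z2_def)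
    finally have u: "unrot k t (z t) $ j = (\<Sum>a\<in>UNIV. z t $ a *
        (cis (- \<theta> k t) * (of_real (cos (- om k * t)) * Z1 a $ j + of_real (sin (- om k * t)) * Z2 a $ j)))"
        for j
      by (simp only: sum_component vector_smult_component vector_add_component)
    show ?thesis
      unfolding vec_eq_iff
    proof
      fix j
      have "ee k x * unrot k t (z t) $ j = (\<Sum>a\<in>UNIV. ee k x *
          (cis (- \<theta> k t) * (of_real (cos (- om k * t)) * z t $ a) * Z1 a $ j)
         + ee k x * (cis (- \<theta> k t) * (of_real (sin (- om k * t)) * z t $ a) * Z2 a $ j))"
        unfolding u sum_distrib_left by (intro sum.cong refl) (simp add: algebra_simps)
      then show "(\<chi> j. Re (ee k x * unrot k t (z t) $ j)) $ j = (\<Sum>a\<in>UNIV.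
        (\<chi> j. Re (ee k x * (cis (- \<theta> k t) * (of_real (cos (- om k * t)) * z t $ a) * Z1 a $ j)))
        + (\<chi> j. Re (ee k x * (cis (- \<theta> k t) * (of_real (sin (- om k * t)) * z t $ a) * Z2 a $ j)))) $ j"
        by (simp only: vec_lambda_beta sum_component vector_add_component Re_sum plus_complex.sel)
    qed
  qed
  have "SS_polynomial (Vspace L) (\<lambda>t x. \<Sum>a\<in>UNIV.
      (\<chi> j. Re (ee k x * (cis (- \<theta> k t) * (of_real (cos (- om k * t)) * z t $ a) * Z1 a $ j)))
    + (\<chi> j. Re (ee k x * (cis (- \<theta> k t) * (of_real (sin (- om k * t)) * z t $ a) * Z2 a $ j))))"
    by (intro SS_sum SS_add SS_exp_poly[OF _ k] exp_poly_mult exp_poly_cos exp_poly_sin z)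
        (simp_all add: Z1_def Z2_def ZX)
  then show ?thesis by (simp only: eq)
qed

lemma fourier_coeff_real_part:
  assumes F: "finite F"
  shows "fourier_coeff L (\<lambda>x. \<chi> j. Re (\<Sum>k\<in>F. ee k x * Z k $ j)) k $ j =
    ((if k \<in> F then Z k $ j else 0) + cnj (if - k \<in> F then Z (- k) $ j else 0)) / 2"
proof -
  have c: "continuous_on UNIV (\<lambda>x. \<chi> j. Re (\<Sum>k\<in>F. ee k x * Z k $ j))"
    by (intro continuous_on_vec_lambda continuous_intros ee_cont)
  have f1: "fc (\<lambda>x. ee m x * z) k = (if m = k then z else 0)" for m z
    using fc_cmult[OF ee_cont[of UNIV m], of z k] by (simp add: fc_ee mult.commute)
  have cz: "continuous_on UNIV (\<lambda>x. ee m x * z)" for m z by (intro continuous_intros ee_cont)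
  have "fourier_coeff L (\<lambda>x. \<chi> j. Re (\<Sum>k\<in>F. ee k x * Z k $ j)) k $ j
      = fc (\<lambda>x. of_real (Re (\<Sum>k\<in>F. ee k x * Z k $ j))) k"
    by (subst fourier_coeff_nth[OF c]) simp
  also have "\<dots> = fc (\<lambda>x. (1/2) * ((\<Sum>k\<in>F. ee k x * Z k $ j) + (\<Sum>k\<in>F. ee (- k) x * cnj (Z k $ j)))) k"
  proof (rule arg_cong[where f = "\<lambda>f. fc f k"], rule ext)
    fix x
    have "complex_of_real (Re (\<Sum>k\<in>F. ee k x * Z k $ j))
        = (1/2) * ((\<Sum>k\<in>F. ee k x * Z k $ j) + cnj (\<Sum>k\<in>F. ee k x * Z k $ j))"
      unfolding complex_add_cnj by simp
    then show "complex_of_real (Re (\<Sum>k\<in>F. ee k x * Z k $ j))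
        = (1/2) * ((\<Sum>k\<in>F. ee k x * Z k $ j) + (\<Sum>k\<in>F. ee (- k) x * cnj (Z k $ j)))"
      by (simp only: cnj_sum complex_cnj_mult cnj_ee)
  qed
  also have "\<dots> = (1/2) * (fc (\<lambda>x. \<Sum>k\<in>F. ee k x * Z k $ j) k + fc (\<lambda>x. \<Sum>k\<in>F. ee (- k) x * cnj (Z k $ j)) k)"
    by (subst fc_cmult fc_add; (intro continuous_intros ee_cont)?; subst fc_add;
        (intro continuous_intros ee_cont)?; rule refl)
  also have "fc (\<lambda>x. \<Sum>k\<in>F. ee k x * Z k $ j) k = (if k \<in> F then Z k $ j else 0)"
    using F by (subst fc_sum[OF F cz]) (simp add: f1)
  also have "fc (\<lambda>x. \<Sum>k\<in>F. ee (- k) x * cnj (Z k $ j)) k = cnj (if - k \<in> F then Z (- k) $ j else 0)"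
  proof -
    have "(- m = k) = (m = - k)" for m by auto
    then show ?thesis using F by (subst fc_sum[OF F cz]) (simp add: f1)
  qed
  finally show ?thesis by simp
qed

end

section \<open>The additive semigroup of exponents\<close>

lemma spectrum_sums_add:
  assumes "x \<in> spectrum_sums L" "y \<in> spectrum_sums L" shows "x + y \<in> spectrum_sums L"
proof -
  let ?S = "{(norm (wave L k))\<^sup>2 | k. k \<noteq> 0}"
  obtain n :: nat and a where a: "x = (\<Sum>j=1..n. a j)" "n \<ge> 1" "\<forall>j\<in>{1..n}. a j \<in> ?S"
    using assms(1) unfolding spectrum_sums_def mem_Collect_eq[of x] by (elim exE conjE) (rule that, assumption+)
  obtain m :: nat and b where b: "y = (\<Sum>j=1..m. b j)" "m \<ge> 1" "\<forall>j\<in>{1..m}. b j \<in> ?S"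
    using assms(2) unfolding spectrum_sums_def mem_Collect_eq[of y] by (elim exE conjE) (rule that, assumption+)
  define c where "c j = (if j \<le> n then a j else b (j - n))" for j :: nat
  have "(\<Sum>j=1..n+m. c j) = (\<Sum>j=1..n. c j) + (\<Sum>j=n+1..n+m. c j)"
    by (rule sum.ub_add_nat) simp
  also have "(\<Sum>j=1..n. c j) = x" unfolding a(1) by (intro sum.cong) (auto simp: c_def)
  also have "(\<Sum>j=n+1..n+m. c j) = (\<Sum>j=1..m. c (j + n))"
    using sum.shift_bounds_cl_nat_ivl[of c 1 n m] by (simp add: add.commute)
  also have "\<dots> = y" unfolding b(1) by (intro sum.cong) (auto simp: c_def)
  finally have e: "x + y = (\<Sum>j=1..n+m. c j)" by simp
  have cS: "c j \<in> ?S" if "j \<in> {1..n+m}" for j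
  proof (cases "j \<le> n")
    case True
    then show ?thesis using bspec[OF a(3), of j] that by (simp add: c_def)
  next
    case False
    then have "j - n \<in> {1..m}" using that by auto
    then show ?thesis using bspec[OF b(3), of "j - n"] False by (simp add: c_def)
  qed
  show ?thesis unfolding spectrum_sums_def
    by (intro CollectI exI[of _ "n + m"] exI[of _ c] conjI ballI cS e) (use a(2) in auto)
qed

lemma spectrum_sums_base: "k \<noteq> 0 \<Longrightarrow> (norm (wave L k))\<^sup>2 \<in> spectrum_sums L"
  unfolding spectrum_sums_def
  by (intro CollectI exI[of _ "1::nat"] exI[of _ "\<lambda>_. (norm (wave L k))\<^sup>2"] conjI ballI) auto

lemma spectrum_sums_ge:
  assumes w: "\<And>k. k \<noteq> 0 \<Longrightarrow> norm (wave L k) \<ge> 1" and x: "x \<in> spectrum_sums L" shows "x \<ge> 1"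
proof -
  obtain n :: nat and a where a: "x = (\<Sum>j=1..n. a j)" "n \<ge> 1"
      "\<forall>j\<in>{1..n}. a j \<in> {(norm (wave L k))\<^sup>2 | k. k \<noteq> 0}"
    using x unfolding spectrum_sums_def mem_Collect_eq[of x] by (elim exE conjE) (rule that, assumption+)
  have "1 \<le> a j" if "j \<in> {1..n}" for j using bspec[OF a(3) that] w by auto
  then have "(\<Sum>j=1..n. 1) \<le> (\<Sum>j=1..n. a j)" by (intro sum_mono)
  then show ?thesis using a(1,2) by simp
qed

section \<open>Decay of the coefficients and transfer of the expansion\<close>

context rotating_expansion
begin

lemma cN_pos: "cN > 0" by (simp add: cN_def)

text \<open>Cauchy-Schwarz bounds the critical norm by 7 times the square root of D times the sum of
  rho^(-4), and D becomes as small as desired. The zero mode does not contribute, as q vanishes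
  there.\<close>

lemma small_initial_time:
  "\<exists>t0\<ge>1. \<forall>F. finite F \<longrightarrow> (\<Sum>k\<in>F. norm (q t0 k) / rho k) \<le> 1 / (16 * cN)"
proof -
  define S4 where "S4 = (\<Sum>\<^sub>\<infinity>k. 1 / (rho k) ^ 4)"
  have S40: "S4 \<ge> 0" unfolding S4_def by (intro infsum_nonneg) simp
  \<comment> \<open>Chosen so that r (7 sqrt S4 + 1) is the smallness threshold of
    \<open>small_data\<close>; the summand 1 keeps the denominator positive.\<close>
  define r where "r = (1 / (16 * cN)) / (7 * sqrt S4 + 1)"
  have r: "r > 0" using cN_pos S40 by (simp add: r_def add_nonneg_pos)
  obtain t0 where t0: "t0 \<ge> 1" "D t0 < r\<^sup>2" using small_gradient[of "r\<^sup>2" 1] r by auto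
  then have tp: "t0 > 0" by simp
  show ?thesis
  proof (intro exI[of _ t0] conjI t0 allI impI)
    fix F :: "(int^3) set" assume F: "finite F"
    have rp: "rho k > 0" for k using rho_ge1[of k] by linarith
    have tm: "norm (q t0 k) / rho k \<le> 7 * ((norm (wave L k) * norm (v t0 k)) * (1 / (rho k)\<^sup>2))" for k
    proof (cases "k = 0")
      case False
      have "norm (q t0 k) / rho k \<le> 7 * norm (v t0 k) / rho k" using rp[of k]
          by (intro divide_right_mono norm_q_le) auto
      also have "\<dots> = 7 * ((norm (wave L k) * norm (v t0 k)) * (1 / (rho k)\<^sup>2))"
        using rp[of k] unfolding rho_eq[OF False, symmetric] by (simp add: power2_eq_square)
      finally show ?thesis .
    qed (simp add: q_0)
    have "(\<Sum>k\<in>F. norm (q t0 k) / rho k) \<le> (\<Sum>k\<in>F. 7 * ((norm (wave L k) * norm (v t0 k)) * (1 / (rho k)\<^sup>2)))"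
      by (intro sum_mono tm)
    also have "\<dots> = 7 * (\<Sum>k\<in>F. (norm (wave L k) * norm (v t0 k)) * (1 / (rho k)\<^sup>2))"
        by (simp add: sum_distrib_left)
    also have "(\<Sum>k\<in>F. (norm (wave L k) * norm (v t0 k)) * (1 / (rho k)\<^sup>2)) \<le> sqrt (r\<^sup>2 * S4)"
    proof (rule real_le_rsqrt)
      have "(\<Sum>k\<in>F. (norm (wave L k) * norm (v t0 k)) * (1 / (rho k)\<^sup>2))\<^sup>2
          \<le> (\<Sum>k\<in>F. (norm (wave L k) * norm (v t0 k))\<^sup>2) * (\<Sum>k\<in>F. (1 / (rho k)\<^sup>2)\<^sup>2)"
        by (rule Cauchy_Schwarz_ineq_sum)
      also have "\<dots> = (\<Sum>k\<in>F. (norm (wave L k))\<^sup>2 * (norm (v t0 k))\<^sup>2) * (\<Sum>k\<in>F. 1 / (rho k) ^ 4)"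
        by (simp add: power_mult_distrib power_divide flip: power_mult)
      also have "\<dots> \<le> r\<^sup>2 * S4"
        using bessel_grad[OF tp F] t0(2) F unfolding S4_def
        by (intro mult_mono finite_sum_le_infsum rho_summable sum_nonneg) auto
      finally show "(\<Sum>k\<in>F. (norm (wave L k) * norm (v t0 k)) * (1 / (rho k)\<^sup>2))\<^sup>2 \<le> r\<^sup>2 * S4" .
    qed
    also have "7 * sqrt (r\<^sup>2 * S4) = r * (7 * sqrt S4)" using r by (simp add: real_sqrt_mult)
    also have "\<dots> \<le> r * (7 * sqrt S4 + 1)" using r by simp
    also have "\<dots> = 1 / (16 * cN)"
    proof -
      have "7 * sqrt S4 + 1 \<noteq> 0" using S40 by (smt (verit) real_sqrt_ge_zero)
      then show ?thesis unfolding r_def by (rule nonzero_eq_divide_eq[THEN iffD1, OF _ refl])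
    qed
    finally show "(\<Sum>k\<in>F. norm (q t0 k) / rho k) \<le> 1 / (16 * cN)" by simp
  qed
qed

lemma q_analytic_decay:
  "\<exists>t0\<ge>1. \<forall>t\<ge>t0. \<forall>k. norm (q t k) \<le> rho k / (8 * cN) * exp (- (rho k) / 2 * (t - t0))"
proof -
  obtain t0 where t0: "t0 \<ge> 1" "\<And>F. finite F \<Longrightarrow> (\<Sum>k\<in>F. norm (q t0 k) / rho k) \<le> 1 / (16 * cN)"
    using small_initial_time by blast
  have tp: "t0 > 0" using t0 by simp
  interpret S: small_data rho q N cN t0 "1 / (16 * cN)"
  proof
    show "rho k \<ge> 1" for k by (rule rho_ge1)
    show "rho k \<le> rho m + rho (k - m)" for k m by (rule rho_add)
    show "(\<lambda>k. 1 / (rho k) ^ 4) summable_on UNIV" by (rule rho_summable)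
    show "((\<lambda>t. q t k) has_vector_derivative (- (rho k)\<^sup>2 *\<^sub>R q t k - N t k)) (at t)" if "t \<ge> t0" for t k
      by (rule q_derivative) (use that tp in simp)
    show "continuous_on {t0..} (\<lambda>t. N t k)" for k by (rule N_continuous[OF tp])
    show "norm (N t k) \<le> cN * rho k * (\<Sum>\<^sub>\<infinity>m. norm (q t m) * norm (q t (k - m)))" if "t \<ge> t0" for t k
      by (rule N_bound) (use that tp in simp)
    show "\<exists>C. \<forall>t\<in>{t0..T}. \<forall>F. finite F \<longrightarrow> (\<Sum>k\<in>F. (rho k)^4 * (norm (q t k))\<^sup>2) \<le> C" for T
    proof -
      obtain C where C: "\<And>t F. t \<in> {t0..T} \<Longrightarrow> finite F \<Longrightarrow> (\<Sum>k\<in>F. (rho k)^4 * (norm (v t k))\<^sup>2) \<le> C"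
        using local_bound[OF tp, of T] by blast
      show ?thesis
      proof (intro exI[of _ "49 * C"] ballI allI impI)
        fix t and F :: "(int^3) set" assume tF: "t \<in> {t0..T}" "finite F"
        have "(norm (q t k))\<^sup>2 \<le> 49 * (norm (v t k))\<^sup>2" for k
          using power_mono[OF norm_q_le[of t k], of 2] by (simp add: power_mult_distrib)
        then have "(\<Sum>k\<in>F. (rho k)^4 * (norm (q t k))\<^sup>2) \<le> (\<Sum>k\<in>F. (rho k)^4 * (49 * (norm (v t k))\<^sup>2))"
          by (intro sum_mono mult_left_mono) auto
        also have "\<dots> = 49 * (\<Sum>k\<in>F. (rho k)^4 * (norm (v t k))\<^sup>2)" by (simp add: sum_distrib_left mult_ac)
        also have "\<dots> \<le> 49 * C" using C[OF tF] by simp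
        finally show "(\<Sum>k\<in>F. (rho k)^4 * (norm (q t k))\<^sup>2) \<le> 49 * C" .
      qed
    qed
    show "16 * cN * (1 / (16 * cN)) \<le> 1" using cN_pos by simp
  qed (use cN_pos t0 in auto)
  show ?thesis using S.analytic_decay t0(1) by blast
qed

sublocale coeffs: expansion_coeffs "\<lambda>i. rho (fst i)" K "21 * 7 * 12 * 7"
proof
  show "rho (fst i) \<ge> 1" for i :: "(int^3) \<times> 3" by (rule rho_ge1)
  show "K i a b \<in> exp_poly" for i a b by (rule K_exp_poly)
  show "norm (K i a b t) \<le> 21 * 7 * 12 * 7 * rho (fst i)" for i a b t by (rule K_bound)
  show "K i a b t = 0" if "rho (fst a) + rho (fst b) < rho (fst i)" for i a b t by (rule K_zero[OF that])
  have "(\<lambda>p. exp (- rho (fst p)) * (\<lambda>_. 1) (snd p)) summable_on UNIV \<times> (UNIV :: 3 set)"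
    by (rule summable_on_product_nonneg(1)[OF exp_rho_summable]) auto
  then show "(\<lambda>i :: (int^3) \<times> 3. exp (- rho (fst i))) summable_on UNIV" by simp
qed

text \<open>The exponent rho (t - t0) / 2 is split into halves. One gives the weight as soon as (t -
  t0) / 4 \<ge> |s| + 1, where the unit absorbs the prefactor rho; the other gives the rate 1/4 in
  time because rho \<ge> 1.\<close>

lemma q_Oall: "coeffs.Oall (1/4) (\<lambda>t i. q t (fst i) $ snd i)"
proof -
  obtain t0 where t0: "\<And>t k. t \<ge> t0 \<Longrightarrow> norm (q t k) \<le> rho k / (8 * cN) * exp (- (rho k) / 2 * (t - t0))"
    using q_analytic_decay by blast
  show ?thesis
  proof (rule coeffs.Oall_I)
    fix s :: real
    show "\<exists>C T. \<forall>t\<ge>T. \<forall>i. norm (q t (fst i) $ snd i) \<le> (C * exp (- s * rho (fst i))) * exp (- (1/4) * t)"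
    proof (rule exI[of _ "exp (t0 / 4) / (8 * cN)"], rule exI[of _ "t0 + 4 * (\<bar>s\<bar> + 1)"], intro allI impI)
      fix t and i :: "(int^3) \<times> 3"
      assume t: "t \<ge> t0 + 4 * (\<bar>s\<bar> + 1)"
      let ?r = "rho (fst i)"
      have r: "?r \<ge> 1" by (rule rho_ge1)
      have "?r \<le> exp ?r" using exp_ge_add_one_self[of ?r] by linarith
      have tt: "t \<ge> t0" "(t - t0) / 4 \<ge> \<bar>s\<bar> + 1" using t by auto
      have "norm (q t (fst i) $ snd i) \<le> ?r / (8 * cN) * exp (- ?r / 2 * (t - t0))"
        by (rule order_trans[OF Finite_Cartesian_Product.norm_nth_le t0[OF tt(1)]])
      also have "\<dots> \<le> exp ?r / (8 * cN) * exp (- (\<bar>s\<bar> + 1) * ?r - (t - t0) / 4)"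
      proof (intro mult_mono divide_right_mono \<open>?r \<le> exp ?r\<close>)
        have "(\<bar>s\<bar> + 1) * ?r \<le> (t - t0) / 4 * ?r" using tt r by (intro mult_right_mono) auto
        moreover have "(t - t0) / 4 * 1 \<le> (t - t0) / 4 * ?r" using tt r by (intro mult_left_mono) auto
        moreover have "?r / 2 * (t - t0) = (t - t0) / 4 * ?r + (t - t0) / 4 * ?r" by simp
        ultimately have "(\<bar>s\<bar> + 1) * ?r + (t - t0) / 4 \<le> ?r / 2 * (t - t0)" by linarith
        then show "exp (- ?r / 2 * (t - t0)) \<le> exp (- (\<bar>s\<bar> + 1) * ?r - (t - t0) / 4)"
          by (simp only: exp_le_cancel_iff)
      qed (use cN_pos in auto)
      also have "\<dots> = exp (t0 / 4) / (8 * cN) * exp (- \<bar>s\<bar> * ?r) * exp (- (1/4) * t)"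
        by (simp add: algebra_simps diff_divide_distrib flip: exp_add)
      also have "\<dots> \<le> exp (t0 / 4) / (8 * cN) * exp (- s * ?r) * exp (- (1/4) * t)"
      proof (intro mult_right_mono mult_left_mono)
        have "s * ?r \<le> \<bar>s\<bar> * ?r" using r by (intro mult_right_mono) auto
        then show "exp (- \<bar>s\<bar> * ?r) \<le> exp (- s * ?r)" by simp
      qed (use cN_pos in auto)
      finally show "norm (q t (fst i) $ snd i) \<le> exp (t0 / 4) / (8 * cN) * exp (- s * ?r) * exp (- (1/4) * t)" .
    qed
  qed
qed

lemma q_expansion:
  assumes mu: "strict_enumeration \<mu> (spectrum_sums L)" and one: "1 \<in> spectrum_sums L"
  shows "\<exists>Q. (\<forall>n\<ge>1. coeffs.exp_poly_family (Q n)) \<and>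
     (\<forall>N\<ge>1. \<exists>\<epsilon>>0. coeffs.Oall (\<mu> N + \<epsilon>) (\<lambda>t i. q t (fst i) $ snd i - (\<Sum>n=1..N. exp (- \<mu> n * t) *\<^sub>R Q n t i)))"
proof -
  have im: "\<mu> ` {1..} = spectrum_sums L" and sm: "strict_mono_on {1..} \<mu>"
    using mu by (auto simp: strict_enumeration_def)
  interpret E: expansion_system "\<lambda>i. rho (fst i)" K "21 * 7 * 12 * 7" "\<lambda>t i. q t (fst i) $ snd i" 1 "1/4" \<mu>
  proof
    show "((\<lambda>t. q t (fst i) $ snd i) has_vector_derivative
      (- (rho (fst i))\<^sup>2 *\<^sub>R (q t (fst i) $ snd i) - coeffs.bil t (\<lambda>i. q t (fst i) $ snd i)
          (\<lambda>i. q t (fst i) $ snd i) i)) (at t)" if t: "t \<ge> 1" for t i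
    proof -
      have tp: "t > 0" using t by simp
      have "coeffs.bil t (\<lambda>i. q t (fst i) $ snd i) (\<lambda>i. q t (fst i) $ snd i) i = N t (fst i) $ snd i"
        unfolding coeffs.bil_def N_K[OF tp] by simp
      then show ?thesis
        using bounded_linear.has_vector_derivative[OF bounded_linear_vec_nth q_derivative[OF tp, of "fst i"],
            of "snd i"] by simp
    qed
    show "coeffs.Oall (1/4) (\<lambda>t i. q t (fst i) $ snd i)" by (rule q_Oall)
    show "strict_mono_on {1..} \<mu>" by (rule sm)
    show "(rho (fst i))\<^sup>2 \<in> \<mu> ` {1..}" for i :: "(int^3) \<times> 3"
    proof (cases "fst i = 0")
      \<comment> \<open>The zero wave vector carries no amplitude, but its value rho = 1 still has
        to be an exponent, which \<open>one\<close> guarantees.\<close>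
      case True
      then show ?thesis unfolding im using one by (simp add: rho_def wave_0)
    next
      case False
      then show ?thesis unfolding im rho_eq[OF False] by (rule spectrum_sums_base)
    qed
    show "x + y \<in> \<mu> ` {1..}" if "x \<in> \<mu> ` {1..}" "y \<in> \<mu> ` {1..}" for x y
      using that unfolding im by (rule spectrum_sums_add)
    show "\<mu> 1 = 1"
    proof -
      obtain m where m: "m \<ge> 1" "\<mu> m = 1" using one unfolding im[symmetric] by auto
      have "\<mu> 1 \<le> \<mu> m" using strict_mono_onD[OF sm, of 1 m] m(1) by (cases "m = 1") auto
      moreover have "\<mu> 1 \<ge> 1" by (rule spectrum_sums_ge[OF wave_ge1]) (auto simp flip: im)
      ultimately show ?thesis using m by simp
    qed
  qed simp
  show ?thesis by (rule E.expansion)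
qed

definition unrotated :: "real \<Rightarrow> ((int^3) \<times> 3 \<Rightarrow> complex) \<Rightarrow> int^3 \<Rightarrow> complex^3" where
  "unrotated t g k = unrot k t (\<chi> j. g (k, j))"

text \<open>The coefficients of the real part of a Fourier sum with coefficients \<open>z\<close>.\<close>

definition symmetrized :: "(int^3 \<Rightarrow> complex^3) \<Rightarrow> int^3 \<Rightarrow> complex^3" where
  "symmetrized z k = (\<chi> j. (z k $ j + cnj (z (- k) $ j)) / 2)"

lemma unrotated_diff_sum:
  "unrotated t (\<lambda>i. f i - (\<Sum>n\<in>A. c n *\<^sub>R g n i)) k = unrotated t f k - (\<Sum>n\<in>A. c n *\<^sub>R unrotated t (g n) k)"
proof -
  have "(\<chi> j. f (k, j) - (\<Sum>n\<in>A. c n *\<^sub>R g n (k, j))) = (\<chi> j. f (k, j)) - (\<Sum>n\<in>A. c n *\<^sub>R (\<chi> j. g n (k, j)))"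
    by (simp add: vec_eq_iff)
  then show ?thesis
    unfolding unrotated_def by (simp only: linear_diff[OF unrot_linear] linear_sum[OF unrot_linear]
        linear_scale[OF unrot_linear])
qed

lemma symmetrized_diff_sum:
  "symmetrized (\<lambda>k. y k - (\<Sum>n\<in>A. c n *\<^sub>R z n k)) k = symmetrized y k - (\<Sum>n\<in>A. c n *\<^sub>R symmetrized (z n) k)"
proof -
  have "(y k $ j - S + cnj (y (- k) $ j - S')) / 2 = (y k $ j + cnj (y (- k) $ j)) / 2 - (S + cnj S') / 2"
      for j S S'
    by (simp add: diff_divide_distrib add_divide_distrib)
  moreover have "((\<Sum>n\<in>A. c n *\<^sub>R z n k $ j) + cnj (\<Sum>n\<in>A. c n *\<^sub>R z n (- k) $ j)) / 2
    = (\<Sum>n\<in>A. c n *\<^sub>R ((z n k $ j + cnj (z n (- k) $ j)) / 2))" for j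
    unfolding cnj_sum sum.distrib[symmetric] sum_divide_distrib
    by (intro sum.cong refl) (simp add: scaleR_conv_of_real distrib_left)
  ultimately show ?thesis
    by (simp only: symmetrized_def vec_eq_iff vec_lambda_beta vector_minus_component sum_component
        vector_scaleR_component HOL.simp_thms)
qed

lemma unrotated_0: "unrotated t g 0 = 0"
  by (simp add: unrotated_def unrot_def)

lemma Gspace_symmetrized:
  assumes al: "\<alpha> > 0" "\<sigma> > 0" and h: "continuous_on UNIV h" "periodic L h"
    and c: "\<And>k. fourier_coeff L h k = symmetrized (unrotated t g) k"
    and g: "\<And>i. norm (g i) \<le> B * exp (- (2 * \<alpha> + \<sigma> + 1) * rho (fst i))"
  shows "h \<in> Gspace L \<alpha> \<sigma>" and "Gnorm L \<alpha> \<sigma> h \<le> sqrt vol * (3 * infsum (\<lambda>k. exp (- rho k)) UNIV) * (756 * B)"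
    and "Gnorm L \<alpha> \<sigma> h \<ge> 0"
proof -
  let ?e = "\<lambda>k. exp (- (2 * \<alpha> + \<sigma> + 1) * rho k)"
  \<comment> \<open>252 = 84 * 3: the bound for \<open>unrot\<close> times the passage from
    components to vectors. Symmetrization repeats that passage, whence 756.\<close>
  have nu: "norm (unrotated t g k) \<le> 252 * B * ?e k" for k
  proof -
    have "norm (\<chi> j. g (k, j)) \<le> 3 * (B * ?e k)"
      by (rule norm_le_three) (use g[of "(k, j)" for j] in simp)
    then have "84 * norm (\<chi> j. g (k, j)) \<le> 84 * (3 * (B * ?e k))" by (rule mult_left_mono) simp
    then show ?thesis using norm_unrot_le[of k t "\<chi> j. g (k, j)"] unfolding unrotated_def by linarith
  qed
  have A: "norm (fourier_coeff L h k) \<le> 756 * B * ?e k" for k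
  proof -
    have "norm (symmetrized (unrotated t g) k $ j) \<le> 252 * B * ?e k" for j
    proof -
      have "norm (unrotated t g k $ j) \<le> 252 * B * ?e k" "norm (unrotated t g (- k) $ j) \<le> 252 * B * ?e k"
        using order_trans[OF Finite_Cartesian_Product.norm_nth_le nu[of k]]
            order_trans[OF Finite_Cartesian_Product.norm_nth_le nu[of "- k"]]
        by (simp_all only: rho_minus)
      then show ?thesis
        using norm_triangle_ineq[of "unrotated t g k $ j" "cnj (unrotated t g (- k) $ j)"]
            by (simp add: symmetrized_def norm_divide)
    qed
    then have "norm (symmetrized (unrotated t g) k) \<le> 3 * (252 * B * ?e k)" by (rule norm_le_three)
    then show ?thesis unfolding c by simp
  qed
  have h0: "fourier_coeff L h 0 = 0" by (simp add: c symmetrized_def unrotated_0 vec_eq_iff)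
  have hX: "fourier_coeff L h k \<in> Xspace L k" for k
  proof -
    have u: "cdot (unrotated t g m) (wave L m) = 0" for m
      using unrot_Xspace[of m t] by (simp add: unrotated_def Xspace_iff)
    have e: "cdot (symmetrized z k) (wave L k)
        = (cdot (z k) (wave L k) - cnj (cdot (z (- k)) (wave L (- k)))) / 2" for z
      by (simp add: cdot_def symmetrized_def wave_minus sum_3 field_simps)
    show ?thesis unfolding Xspace_iff c e u by simp
  qed
  show "h \<in> Gspace L \<alpha> \<sigma>" "Gnorm L \<alpha> \<sigma> h \<le> sqrt vol * (3 * infsum (\<lambda>k. exp (- rho k)) UNIV) * (756 * B)"
      "Gnorm L \<alpha> \<sigma> h \<ge> 0"
    using Gspace_bound[OF al h h0 hX A] by simp_all
qed

lemma fourier_coeff_diff_sum: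
  assumes f: "continuous_on UNIV f" and A: "finite A" and g: "\<And>n. n \<in> A \<Longrightarrow> continuous_on UNIV (g n)"
  shows "fourier_coeff L (\<lambda>x. f x - (\<Sum>n\<in>A. c n *\<^sub>R g n x)) k
      = fourier_coeff L f k - (\<Sum>n\<in>A. c n *\<^sub>R fourier_coeff L (g n) k)"
proof -
  have cc: "continuous_on UNIV (\<lambda>x. f x - (\<Sum>n\<in>A. c n *\<^sub>R g n x))"
    by (intro continuous_intros f g)
  have cr: "continuous_on UNIV (\<lambda>x. complex_of_real (y x $ j))" if "continuous_on UNIV y"
      for y :: "real^3 \<Rightarrow> real^3" and j
    by (intro continuous_on_of_real continuous_on_component that)
  have "fourier_coeff L (\<lambda>x. f x - (\<Sum>n\<in>A. c n *\<^sub>R g n x)) k $ j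
      = (fourier_coeff L f k - (\<Sum>n\<in>A. c n *\<^sub>R fourier_coeff L (g n) k)) $ j" for j
  proof -
    have "fourier_coeff L (\<lambda>x. f x - (\<Sum>n\<in>A. c n *\<^sub>R g n x)) k $ j
      = fc (\<lambda>x. of_real (f x $ j) - (\<Sum>n\<in>A. of_real (c n) * of_real (g n x $ j))) k"
      by (subst fourier_coeff_nth[OF cc]) simp
    also have "\<dots> = fc (\<lambda>x. of_real (f x $ j)) k - (\<Sum>n\<in>A. of_real (c n) * fc (\<lambda>x. of_real (g n x $ j)) k)"
    proof -
      have "fc (\<lambda>x. \<Sum>n\<in>A. of_real (c n) * of_real (g n x $ j)) k
          = (\<Sum>n\<in>A. fc (\<lambda>x. of_real (c n) * of_real (g n x $ j)) k)"
        by (rule fc_sum[OF A]) (intro continuous_intros cr g)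
      also have "\<dots> = (\<Sum>n\<in>A. of_real (c n) * fc (\<lambda>x. of_real (g n x $ j)) k)"
        by (intro sum.cong refl fc_cmult cr g)
      finally show ?thesis
        by (subst fc_diff[OF cr[OF f]]) (intro continuous_intros cr g, simp_all)
    qed
    also have "\<dots> = (fourier_coeff L f k - (\<Sum>n\<in>A. c n *\<^sub>R fourier_coeff L (g n) k)) $ j"
      using f g by (simp add: fourier_coeff_nth) (simp add: scaleR_conv_of_real)
    finally show ?thesis .
  qed
  then show ?thesis by (simp add: vec_eq_iff)
qed

text \<open>Taking the real part symmetrizes the coefficients, which are not known to satisfy the
  reality condition. The sum runs over the support for all times jointly, so the set of modes does
  not vary with t.\<close>

definition synthesis :: "(real \<Rightarrow> (int^3) \<times> 3 \<Rightarrow> complex) \<Rightarrow> real \<Rightarrow> real^3 \<Rightarrow> real^3" where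
  "synthesis P t x = (\<chi> j. Re (\<Sum>k\<in>fst ` {i. \<exists>t. P t i \<noteq> 0} - {0}. ee k x * unrotated t (P t) k $ j))"

lemma synthesis_cont: "continuous_on UNIV (synthesis P t)"
  unfolding synthesis_def[abs_def] by (intro continuous_on_vec_lambda continuous_intros ee_cont)

lemma synthesis_periodic: "periodic L (synthesis P t)"
  using ee_periodic unfolding periodic_def synthesis_def by simp

lemma SS_synthesis:
  assumes "coeffs.exp_poly_family P" shows "SS_polynomial (Vspace L) (synthesis P)"
proof -
  let ?F = "fst ` {i. \<exists>t. P t i \<noteq> 0} - {0}"
  have "SS_polynomial (Vspace L) (\<lambda>t x. \<chi> j. Re (ee k x * unrotated t (P t) k $ j))" if k: "k \<in> ?F" for k
    unfolding unrotated_def by (rule SS_unrot) (use assms k in \<open>auto simp: coeffs.exp_poly_family_def\<close>)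
  then have "SS_polynomial (Vspace L) (\<lambda>t x. \<Sum>k\<in>?F. \<chi> j. Re (ee k x * unrotated t (P t) k $ j))"
      by (rule SS_sum)
  moreover have "synthesis P = (\<lambda>t x. \<Sum>k\<in>?F. \<chi> j. Re (ee k x * unrotated t (P t) k $ j))"
    by (intro ext) (simp only: synthesis_def vec_eq_iff vec_lambda_beta sum_component Re_sum HOL.simp_thms)
  ultimately show ?thesis by simp
qed

lemma fourier_coeff_synthesis:
  assumes P: "coeffs.exp_poly_family P"
  shows "fourier_coeff L (synthesis P t) k = symmetrized (unrotated t (P t)) k"
proof -
  let ?F = "fst ` {i. \<exists>t. P t i \<noteq> 0} - {0}"
  have F: "finite ?F" using P by (simp add: coeffs.exp_poly_family_def)
  have u: "(if k \<in> ?F then unrotated t (P t) k $ j else 0) = unrotated t (P t) k $ j" for k j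
  proof (cases "k \<in> ?F")
    case False
    have "unrotated t (P t) k = 0"
    proof (cases "k = 0")
      case k: False
      have "P t (k, j) = 0" for j
      proof (rule ccontr)
        assume "P t (k, j) \<noteq> 0"
        then have "(k, j) \<in> {i. \<exists>t. P t i \<noteq> 0}" by auto
        then have "fst (k, j) \<in> fst ` {i. \<exists>t. P t i \<noteq> 0}" by (rule imageI)
        then show False using k False by (simp only: fst_conv Diff_iff singleton_iff simp_thms)
      qed
      then have "(\<chi> j. P t (k, j)) = 0" by (simp add: vec_eq_iff)
      then show ?thesis by (simp add: unrotated_def linear_0[OF unrot_linear])
    qed (simp add: unrotated_0)
    then show ?thesis using False by simp
  qed simp
  have "fourier_coeff L (synthesis P t) k $ j = symmetrized (unrotated t (P t)) k $ j" for j
    unfolding synthesis_def[abs_def] fourier_coeff_real_part[OF F] u by (simp add: symmetrized_def)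
  then show ?thesis by (simp add: vec_eq_iff)
qed

text \<open>u is real, so symmetrization leaves its coefficients unchanged. Subtracting the mean
  removes the coefficient at 0, in accordance with \<open>unrot\<close>, which vanishes
  there.\<close>

lemma fourier_coeff_fluctuation:
  assumes t: "t > 0"
  shows "continuous_on UNIV (\<lambda>x. u t x - average L (u t))" "periodic L (\<lambda>x. u t x - average L (u t))"
    "fourier_coeff L (\<lambda>x. u t x - average L (u t)) k = symmetrized (unrotated t (\<lambda>i. q t (fst i) $ snd i)) k"
proof -
  note cu = cont(1)[OF t]
  show c: "continuous_on UNIV (\<lambda>x. u t x - average L (u t))" by (intro continuous_intros cu)
  show "periodic L (\<lambda>x. u t x - average L (u t))" using u_periodic[OF t] unfolding periodic_def by simp
  have cr: "continuous_on UNIV (\<lambda>x. complex_of_real (u t x $ j))" for j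
    by (intro continuous_on_of_real continuous_on_component cu)
  have un: "unrotated t (\<lambda>i. q t (fst i) $ snd i) k = (if k = 0 then 0 else v t k)" for k
    using unrot_q[OF t, of k] by (simp add: unrotated_def) (simp add: unrot_def)
  have one: "fc (\<lambda>x. a) k = (if k = 0 then a else 0)" for a k
  proof -
    have "fc (\<lambda>x. a * ee 0 x) k = a * fc (ee 0) k" by (rule fc_cmult[OF ee_cont])
    then show ?thesis by (simp add: fc_ee ee_0)
  qed
  have m: "complex_of_real (average L (u t) $ j) = v t 0 $ j" for j
  proof -
    have "average L (u t) $ j = mean (\<lambda>x. u t x $ j)"
      unfolding average_eq_mean[OF cu] by (rule mean_linear[OF bounded_linear_vec_nth cu, symmetric])
    also have "complex_of_real \<dots> = mean (\<lambda>x. of_real (u t x $ j))"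
      by (rule mean_linear[OF bounded_linear_of_real, symmetric]) (intro continuous_on_component cu)
    finally show ?thesis by (simp add: v_nth fc_def ee_0)
  qed
  have "fourier_coeff L (\<lambda>x. u t x - average L (u t)) k $ j
      = symmetrized (unrotated t (\<lambda>i. q t (fst i) $ snd i)) k $ j" for j
  proof -
    have "fourier_coeff L (\<lambda>x. u t x - average L (u t)) k $ j = fc (\<lambda>x. of_real (u t x $ j) - v t 0 $ j) k"
      by (subst fourier_coeff_nth[OF c]) (simp add: m)
    also have "\<dots> = (if k = 0 then 0 else v t k $ j)"
      by (subst fc_diff[OF cr continuous_on_const]) (simp add: one v_nth)
    also have "\<dots> = symmetrized (unrotated t (\<lambda>i. q t (fst i) $ snd i)) k $ j"
      using fc_uminus_real[of "\<lambda>x. u t x $ j" k] continuous_on_component[OF cu, of j]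
          by (simp add: symmetrized_def un v_nth)
    finally show ?thesis .
  qed
  then show "fourier_coeff L (\<lambda>x. u t x - average L (u t)) k
      = symmetrized (unrotated t (\<lambda>i. q t (fst i) $ snd i)) k"
    by (simp add: vec_eq_iff)
qed

lemma synthesis_Gspace:
  assumes al: "\<alpha> > 0" "\<sigma> > 0" and P: "coeffs.exp_poly_family P"
  shows "synthesis P t \<in> Gspace L \<alpha> \<sigma>"
proof -
  let ?S = "{i. \<exists>t. P t i \<noteq> 0}"
  define s where "s = 2 * \<alpha> + \<sigma> + 1"
  have S: "finite ?S" using P by (simp add: coeffs.exp_poly_family_def)
  have "norm (P t i) \<le> (\<Sum>i\<in>?S. norm (P t i) * exp (s * rho (fst i))) * exp (- s * rho (fst i))" for i
  proof (cases "i \<in> ?S")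
    case True
    have "norm (P t i) * exp (s * rho (fst i)) \<le> (\<Sum>i\<in>?S. norm (P t i) * exp (s * rho (fst i)))"
      by (rule member_le_sum[OF True]) (use S in auto)
    then have "norm (P t i) * exp (s * rho (fst i)) * exp (- s * rho (fst i))
        \<le> (\<Sum>i\<in>?S. norm (P t i) * exp (s * rho (fst i))) * exp (- s * rho (fst i))"
      by (rule mult_right_mono) simp
    then show ?thesis by (simp add: mult.assoc flip: exp_add)
  next
    case False
    then have "P t i = 0" by simp
    moreover have "0 \<le> (\<Sum>i\<in>?S. norm (P t i) * exp (s * rho (fst i)))" by (intro sum_nonneg) simp
    ultimately show ?thesis by simp
  qed
  then show ?thesis
    unfolding s_def by (rule Gspace_symmetrized(1)[OF al synthesis_cont synthesis_periodic
        fourier_coeff_synthesis[OF P]])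
qed

text \<open>Both undoing the transformations and symmetrizing are real-linear, hence commute with
  forming remainders. \<open>Oall\<close> at s = 2 \<alpha> + \<sigma> + 1 then bounds the Gevrey
  norm, so that one family serves all \<alpha> and \<sigma>.\<close>

theorem fluctuation_expansion:
  assumes mu: "strict_enumeration \<mu> (spectrum_sums L)" and one: "1 \<in> spectrum_sums L"
  shows "\<exists>Q. (\<forall>n\<ge>1. SS_polynomial (Vspace L) (Q n)) \<and>
    (\<forall>\<alpha>>0. \<forall>\<sigma>>0. asymptotic_expansion (Gspace L \<alpha> \<sigma>) (Gnorm L \<alpha> \<sigma>) \<mu> (\<lambda>t x. u t x - average L (u t)) Q)"
proof -
  obtain P where P: "\<And>n. n \<ge> 1 \<Longrightarrow> coeffs.exp_poly_family (P n)"
    and O: "\<And>N. N \<ge> 1 \<Longrightarrow> \<exists>\<epsilon>>0. coeffs.Oall (\<mu> N + \<epsilon>)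
        (\<lambda>t i. q t (fst i) $ snd i - (\<Sum>n=1..N. exp (- \<mu> n * t) *\<^sub>R P n t i))"
    using q_expansion[OF mu one] by blast
  let ?f = "\<lambda>t x. u t x - average L (u t)"
  have exp: "asymptotic_expansion (Gspace L \<alpha> \<sigma>) (Gnorm L \<alpha> \<sigma>) \<mu> ?f (\<lambda>n. synthesis (P n))"
    if al: "\<alpha> > 0" "\<sigma> > 0" for \<alpha> \<sigma>
    unfolding asymptotic_expansion_def
  proof (intro conjI allI impI)
    obtain C T where T: "T \<ge> 1" and
      C: "\<And>t i. t \<ge> T \<Longrightarrow> norm (q t (fst i) $ snd i)
          \<le> (C * exp (- (2 * \<alpha> + \<sigma> + 1) * rho (fst i))) * exp (- (1/4) * t)"
      using coeffs.eventually_atLeast_exp[OF q_Oall, of 1 "2 * \<alpha> + \<sigma> + 1"] by blast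
    have f: "?f t \<in> Gspace L \<alpha> \<sigma>" if t: "t \<ge> T" for t
    proof -
      have tp: "t > 0" using t T by simp
      have g: "norm (q t (fst i) $ snd i) \<le> C * exp (- (1/4) * t) * exp (- (2 * \<alpha> + \<sigma> + 1) * rho (fst i))" for i
        using C[OF t, of i] by (simp only: mult_ac)
      show ?thesis
        by (rule Gspace_symmetrized(1)[OF al fourier_coeff_fluctuation(1,2)[OF tp]
            fourier_coeff_fluctuation(3)[OF tp] g])
    qed
    show "\<exists>T\<ge>0. \<forall>t\<ge>T. ?f t \<in> Gspace L \<alpha> \<sigma> \<and> (\<forall>n\<ge>1. synthesis (P n) t \<in> Gspace L \<alpha> \<sigma>)"
      by (rule exI[of _ T]) (use T in \<open>auto intro: f synthesis_Gspace[OF al P]\<close>)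
  next
    fix N :: nat assume N: "N \<ge> 1"
    define r where "r t i = q t (fst i) $ snd i - (\<Sum>n=1..N. exp (- \<mu> n * t) *\<^sub>R P n t i)" for t i
    define h where "h t x = ?f t x - (\<Sum>n=1..N. exp (- \<mu> n * t) *\<^sub>R synthesis (P n) t x)" for t x
    obtain \<epsilon> where e: "\<epsilon> > 0" "coeffs.Oall (\<mu> N + \<epsilon>) r" using O[OF N] unfolding r_def by blast
    obtain C T where T: "T \<ge> 1" and
      C: "\<And>t i. t \<ge> T \<Longrightarrow> norm (r t i) \<le> (C * exp (- (2 * \<alpha> + \<sigma> + 1) * rho (fst i))) * exp (- (\<mu> N + \<epsilon>) * t)"
      using coeffs.eventually_atLeast_exp[OF e(2), of 1 "2 * \<alpha> + \<sigma> + 1"] by blast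
    define c where "c = sqrt vol * (3 * infsum (\<lambda>k. exp (- rho k)) UNIV) * (756 * C)"
    have b: "norm (Gnorm L \<alpha> \<sigma> (h t)) \<le> c * norm (exp (- (\<mu> N + \<epsilon>) * t))" if t: "t \<ge> T" for t
    proof -
      have tp: "t > 0" using t T by simp
      have hc: "continuous_on UNIV (h t)"
        unfolding h_def[abs_def] by (intro continuous_on_diff continuous_on_sum continuous_on_scaleR
            continuous_on_const
            synthesis_cont fourier_coeff_fluctuation(1)[OF tp, unfolded])
      have hp: "periodic L (h t)"
        using fourier_coeff_fluctuation(2)[OF tp] synthesis_periodic unfolding periodic_def h_def by simp
      have fch: "fourier_coeff L (h t) k = symmetrized (unrotated t (r t)) k" for k
      proof -
        have "fourier_coeff L (h t) k = fourier_coeff L (?f t) k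
            - (\<Sum>n=1..N. exp (- \<mu> n * t) *\<^sub>R fourier_coeff L (synthesis (P n) t) k)"
          unfolding h_def[abs_def] by (rule fourier_coeff_diff_sum[OF fourier_coeff_fluctuation(1)[OF tp] _
              synthesis_cont]) simp
        also have "\<dots> = symmetrized (unrotated t (\<lambda>i. q t (fst i) $ snd i)) k
            - (\<Sum>n=1..N. exp (- \<mu> n * t) *\<^sub>R symmetrized (unrotated t (P n t)) k)"
          unfolding fourier_coeff_fluctuation(3)[OF tp]
          by (intro arg_cong2[where f = "(-)"] sum.cong refl arg_cong2[where f = "(*\<^sub>R)"]
              fourier_coeff_synthesis P) simp
        also have "\<dots> = symmetrized (unrotated t (r t)) k"
          unfolding symmetrized_diff_sum[symmetric] unrotated_diff_sum[symmetric] r_def ..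
        finally show ?thesis .
      qed
      have g: "norm (r t i) \<le> C * exp (- (\<mu> N + \<epsilon>) * t) * exp (- (2 * \<alpha> + \<sigma> + 1) * rho (fst i))" for i
        using C[OF t, of i] by (simp only: mult_ac)
      show ?thesis
        using Gspace_symmetrized(2,3)[OF al hc hp fch g] by (simp add: c_def mult_ac)
    qed
    have "(\<lambda>t. Gnorm L \<alpha> \<sigma> (h t)) \<in> O[at_top](\<lambda>t. exp (- (\<mu> N + \<epsilon>) * t))"
      by (rule bigoI[of _ c]) (unfold eventually_at_top_linorder, intro exI[of _ T] allI impI b)
    then show "\<exists>\<epsilon>>0. (\<lambda>t. Gnorm L \<alpha> \<sigma> (\<lambda>x. ?f t x - (\<Sum>n=1..N. exp (- \<mu> n * t) *\<^sub>R synthesis (P n) t x)))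
        \<in> O[at_top](\<lambda>t. exp (- (\<mu> N + \<epsilon>) * t))"
      using e(1) unfolding h_def[abs_def] by blast
  qed
  show ?thesis
    by (rule exI[of _ "\<lambda>n. synthesis (P n)"]) (use SS_synthesis[OF P] exp in simp)
qed

end

theorem theorem4p2:
  fixes L :: "real^3" and \<mu> :: "nat \<Rightarrow> real" and \<Omega> :: real
    and u :: "real \<Rightarrow> real^3 \<Rightarrow> real^3" and p :: "real \<Rightarrow> real^3 \<Rightarrow> real"
  assumes "\<forall>j. L $ j > 0" and "Max {L $ 1, L $ 2, L $ 3} = 2 * pi"
    and "strict_enumeration \<mu> (spectrum_sums L)"
    and "\<Omega> \<noteq> 0"
    and "C21 u" and "continuous_on ({0..} \<times> UNIV) (\<lambda>(t, x). u t x)"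
    and "C1_x p"
    and "\<forall>t\<ge>0. periodic L (u t)" and "\<forall>t>0. periodic L (p t)"
    and "rotating_NSE \<Omega> u p"
  shows "\<exists>Q :: nat \<Rightarrow> real \<Rightarrow> real^3 \<Rightarrow> real^3.
           (\<forall>n\<ge>1. SS_polynomial (Vspace L) (Q n)) \<and>
           (\<forall>\<alpha>>0. \<forall>\<sigma>>0. asymptotic_expansion (Gspace L \<alpha> \<sigma>) (Gnorm L \<alpha> \<sigma>) \<mu>
              (\<lambda>t x. u t x - average L (u t)) Q)"
proof -
  have Lle: "L $ j \<le> 2 * pi" for j
    using assms(2) exhaust_3[of j] by (auto simp flip: assms(2))
  have "Max {L $ 1, L $ 2, L $ 3} \<in> {L $ 1, L $ 2, L $ 3}" by (rule Max_in) auto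
  \<comment> \<open>A longest side, of length 2 pi, carries a wave vector of length exactly 1.
    Together with the lower bound 1 for all nonzero wave vectors, this makes 1 the smallest
    exponent.\<close>
  then obtain j0 where j0: "L $ j0 = 2 * pi" unfolding assms(2) by auto
  interpret rotating_expansion L \<Omega> u p
  proof
    show "norm (wave L k) \<ge> 1" if "k \<noteq> 0" for k
    proof -
      obtain j where j: "k $ j \<noteq> 0" using \<open>k \<noteq> 0\<close> by (auto simp: vec_eq_iff)
      have Lj: "L $ j > 0" using assms(1) by blast
      have "1 \<le> 2 * pi / L $ j" using Lle[of j] Lj by simp
      also have "\<dots> = 2 * pi / L $ j * 1" by simp
      also have "\<dots> \<le> 2 * pi / L $ j * \<bar>of_int (k $ j)\<bar>"
      proof (rule mult_left_mono)
        have "1 \<le> \<bar>k $ j\<bar>" using j by simp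
        then show "1 \<le> \<bar>real_of_int (k $ j)\<bar>" by linarith
      qed (use Lj in simp)
      also have "\<dots> = \<bar>wave L k $ j\<bar>" using Lj by (simp add: wave_def abs_mult abs_divide)
      also have "\<dots> \<le> norm (wave L k)" by (rule component_le_norm_cart)
      finally show ?thesis .
    qed
  qed (use assms in auto)
  have "wave L (axis j0 1) = axis j0 1"
    using j0 by (simp add: wave_def vec_eq_iff axis_def)
  then have "1 \<in> spectrum_sums L"
    using spectrum_sums_base[of "axis j0 1" L] by (simp add: norm_axis_1)
  from fluctuation_expansion[OF assms(3) this] show ?thesis .
qed

end
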